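(* Let $M$ be a $C^{2,1}$ manifold of dimension $n$ endowed with a $C^{1,1}$ Riemannian metric $g$ and corresponding locally Lipschitz Levi-Civita connection, let $p\in M$, and let $x^\mu\colon U\to\mathbb{R}^n$ be a chart in a neighborhood of $p$ such that $g_{\alpha\beta}(p)=\delta_{\alpha\beta}$, $\Gamma^\mu_{\alpha\beta}(p)=0$. Let $C\subset U$ be a coordinate ball around $p$ of sufficiently small radius (in particular convex normal), and let $r:=D_p$ on $C$. Then the level sets $D_p^{-1}(r)$ (for $r>0$ sufficiently small) are $C^{1,1}$ hypersurfaces diffeomorphic to $S^{n-1}$ with an induced Lipschitz metric $h_r$. Locally on $C\setminus\{p\}$ one can always find $C^{2,1}$ functions $\theta_i$, $i=1,\dots,n-1$, such that in the $C^{1,1}$ chart $(r,\theta_1,\dots,\theta_{n-1})$ the metric takes the form $$g=dr^2+(h_r)_{ij}(d\theta_i-A_i\,dr)(d\theta_j-A_j\,dr),$$ where $h_r=(h_r)_{ij}\,d\theta_i\,d\theta_j$ and all the components $(h_r)_{ij}$, $A_i$, are Lipschitz in $(r,\theta)$. For any chosen sufficiently small radius $\bar r$ new Lipschitz coordinates $(r,\alpha_1,\dots,\alpha_{n-1})$ can be found such that $\{\alpha_i\}$ provide a $C^{1,1}$ chart on $D_p^{-1}(\bar r)$ and the metric takes the direct sum form $$g=dr^2+(h_r(\alpha))_{ij}\,d\alpha^i\,d\alpha^j,$$ where the components $(h_r(\alpha))_{ij}$ are defined almost everywhere and are bounded (this holds also for spherical normal coordinates), and for $r=\bar r$ they are defined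 everywhere and are Lipschitz in $\alpha$.
   Context: $C^{k,1}$ means $C^{k,1}_{loc}$. $M$ is paracompact and connected; charts are $C^{2,1}$. $\Gamma^\mu_{\alpha\beta}$ are the Christoffel symbols of the Levi-Civita connection. Geodesics are the non-stationary solutions of $\ddot x^\mu=-\Gamma^\mu_{\alpha\beta}(x)\dot x^\alpha\dot x^\beta$; $\gamma_v$ is the unique solution with initial velocity $v$, $\Omega_q\subset T_qM$ is the set of $v\in T_qM$ for which $\gamma_v$ is defined at least on $[0,1]$, and $\exp_qv:=\gamma_v(1)$. An open set $C$ is convex normal if for each $q\in C$ there is an open star-shaped ($v\in N_q$, $s\in[0,1]$ imply $sv\in N_q$) set $N_q\subset\Omega_q$ such that $\exp_q\colon N_q\to C$ is a homeomorphism, locally Lipschitz with locally Lipschitz inverse. On such $C$, $D^2_p(q):=g(\exp_p^{-1}(q),\exp_p^{-1}(q))$ and $D_p:=\sqrt{D_p^2}$. A coordinate ball around $p$ of radius $\delta$ is the set of points whose Euclidean coordinate distance from $p$ is less than $\delta$. Spherical normal coordinates are those obtained through $\exp_p$ from spherical coordinates on the Euclidean space $(T_pM,g_p)$. Repeated indices $i,j$ are summed from $1$ to $n-1$. *)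

theory Defs
  imports "HOL-Analysis.Analysis"
begin

section \<open>Functions of class \<open>C\<^sup>k\<^sup>,\<^sup>1\<close>\<close>

text \<open>Throughout, \<open>C\<^sup>k\<^sup>,\<^sup>1\<close> is a local condition: the partial derivatives of order \<open>k\<close> are
  locally Lipschitz. The set \<open>S\<close> is meant to be open.\<close>

definition locally_lipschitz_on :: "'a::metric_space set \<Rightarrow> ('a \<Rightarrow> 'b::metric_space) \<Rightarrow> bool" where
  "locally_lipschitz_on S f \<longleftrightarrow>
     (\<forall>x\<in>S. \<exists>\<epsilon>>0. \<exists>L. L-lipschitz_on (ball x \<epsilon> \<inter> S) f)"

primrec Ck1_on ::
  "nat \<Rightarrow> 'a::euclidean_space set \<Rightarrow> ('a \<Rightarrow> 'b::real_normed_vector) \<Rightarrow> bool" where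
  "Ck1_on 0 S f = locally_lipschitz_on S f"
| "Ck1_on (Suc k) S f =
     ((\<forall>x\<in>S. f differentiable (at x)) \<and>
      (\<forall>b\<in>Basis. Ck1_on k S (\<lambda>x. frechet_derivative f (at x) b)))"


section \<open>Charts and differentiable structures\<close>

text \<open>A chart is a pair of its domain and its coordinate map; the values of the map outside
  the domain are irrelevant.\<close>

type_synonym ('m, 'n) chart = "'m set \<times> ('m \<Rightarrow> real^'n)"

abbreviation chart_inv :: "('m, 'n) chart \<Rightarrow> real^'n \<Rightarrow> 'm" where
  "chart_inv c \<equiv> inv_into (fst c) (snd c)"

abbreviation chart_image :: "('m, 'n) chart \<Rightarrow> (real^'n) set" where
  "chart_image c \<equiv> snd c ` fst c"

definition is_chart :: "('m::topological_space, 'n::finite) chart \<Rightarrow> bool" where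
  "is_chart c \<longleftrightarrow> open (fst c) \<and> open (chart_image c) \<and>
     homeomorphism (fst c) (chart_image c) (snd c) (chart_inv c)"

definition Ck1_compatible ::
  "nat \<Rightarrow> ('m::topological_space, 'n::finite) chart \<Rightarrow> ('m, 'n) chart \<Rightarrow> bool" where
  "Ck1_compatible k c d \<longleftrightarrow>
     Ck1_on k (snd c ` (fst c \<inter> fst d)) (snd d \<circ> chart_inv c) \<and>
     Ck1_on k (snd d ` (fst c \<inter> fst d)) (snd c \<circ> chart_inv d)"

definition Ck1_chart ::
  "nat \<Rightarrow> ('m::topological_space, 'n::finite) chart set \<Rightarrow> ('m, 'n) chart \<Rightarrow> bool" where
  "Ck1_chart k \<A> c \<longleftrightarrow> is_chart c \<and> (\<forall>d\<in>\<A>. Ck1_compatible k c d)"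

text \<open>A \<open>C\<^sup>k\<^sup>,\<^sup>1\<close> structure is a maximal \<open>C\<^sup>k\<^sup>,\<^sup>1\<close> atlas.\<close>

definition Ck1_structure ::
  "nat \<Rightarrow> ('m::topological_space, 'n::finite) chart set \<Rightarrow> bool" where
  "Ck1_structure k \<A> \<longleftrightarrow> \<Union>(fst ` \<A>) = UNIV \<and> \<A> = {c. Ck1_chart k \<A> c}"

definition paracompact :: "'a topology \<Rightarrow> bool" where
  "paracompact X \<longleftrightarrow>
     (\<forall>\<U>. (\<forall>U\<in>\<U>. openin X U) \<and> \<Union>\<U> = topspace X \<longrightarrow>
        (\<exists>\<V>. (\<forall>V\<in>\<V>. openin X V \<and> (\<exists>U\<in>\<U>. V \<subseteq> U)) \<and> \<Union>\<V> = topspace X \<and>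
             locally_finite_in X \<V>))"

definition Ck1_manifold ::
  "nat \<Rightarrow> ('m::t2_space, 'n::finite) chart set \<Rightarrow> bool" where
  "Ck1_manifold k \<A> \<longleftrightarrow>
     paracompact (euclidean :: 'm topology) \<and> connected (UNIV :: 'm set) \<and> Ck1_structure k \<A>"

definition Ck1_fun_on ::
  "nat \<Rightarrow> ('m::topological_space, 'n::finite) chart set \<Rightarrow> 'm set \<Rightarrow>
     ('m \<Rightarrow> 'b::real_normed_vector) \<Rightarrow> bool" where
  "Ck1_fun_on k \<A> V f \<longleftrightarrow> (\<forall>c\<in>\<A>. Ck1_on k (snd c ` (fst c \<inter> V)) (f \<circ> chart_inv c))"


section \<open>Riemannian metrics, Levi-Civita connection and exponential map\<close>

text \<open>A metric is given by its matrix of components \<open>g c q\<close> at \<open>q\<close> in every chart \<open>c\<close> of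
  the manifold, subject to the transformation law of covariant 2-tensors.\<close>

type_synonym ('m, 'n) metric = "('m, 'n) chart \<Rightarrow> 'm \<Rightarrow> real^'n^'n"

definition C11_riemannian_metric ::
  "('m::topological_space, 'n::finite) chart set \<Rightarrow> ('m, 'n) metric \<Rightarrow> bool" where
  "C11_riemannian_metric \<A> g \<longleftrightarrow>
     (\<forall>c\<in>\<A>. Ck1_on 1 (chart_image c) (g c \<circ> chart_inv c) \<and>
        (\<forall>q\<in>fst c. transpose (g c q) = g c q \<and> (\<forall>v. v \<noteq> 0 \<longrightarrow> v \<bullet> (g c q *v v) > 0))) \<and>
     (\<forall>c\<in>\<A>. \<forall>d\<in>\<A>. \<forall>q\<in>fst c \<inter> fst d.
        (let J = matrix (frechet_derivative (snd d \<circ> chart_inv c) (at (snd c q)))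
         in g c q = transpose J ** g d q ** J))"

definition metric_partial ::
  "('m, 'n::finite) metric \<Rightarrow> ('m, 'n) chart \<Rightarrow> 'm \<Rightarrow> 'n \<Rightarrow> real^'n^'n" where
  "metric_partial g c q \<nu> = frechet_derivative (g c \<circ> chart_inv c) (at (snd c q)) (axis \<nu> 1)"

definition christoffel ::
  "('m, 'n::finite) metric \<Rightarrow> ('m, 'n) chart \<Rightarrow> 'm \<Rightarrow> 'n \<Rightarrow> 'n \<Rightarrow> 'n \<Rightarrow> real" where
  "christoffel g c q \<mu> \<alpha> \<beta> =
     (\<Sum>\<nu>\<in>UNIV. matrix_inv (g c q) $ \<mu> $ \<nu> *
        (metric_partial g c q \<alpha> $ \<nu> $ \<beta> + metric_partial g c q \<beta> $ \<nu> $ \<alpha>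
          - metric_partial g c q \<nu> $ \<alpha> $ \<beta>)) / 2"

text \<open>Solutions of the geodesic equation on an open interval \<open>I\<close>. Constant curves are
  included, so that the exponential map is defined at the zero vector.\<close>

definition geodesic_solution ::
  "('m::topological_space, 'n::finite) chart set \<Rightarrow> ('m, 'n) metric \<Rightarrow> real set \<Rightarrow>
     (real \<Rightarrow> 'm) \<Rightarrow> bool" where
  "geodesic_solution \<A> g I \<gamma> \<longleftrightarrow>
     open I \<and> is_interval I \<and> continuous_on I \<gamma> \<and>
     (\<forall>c\<in>\<A>. \<exists>u. \<forall>t\<in>I. \<gamma> t \<in> fst c \<longrightarrow>
        ((snd c \<circ> \<gamma>) has_vector_derivative u t) (at t) \<and>
        (u has_vector_derivative
           - (\<chi> \<mu>. \<Sum>\<alpha>\<in>UNIV. \<Sum>\<beta>\<in>UNIV. christoffel g c (\<gamma> t) \<mu> \<alpha> \<beta> * u t $ \<alpha> * u t $ \<beta>)) (at t))"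

text \<open>\<open>v\<close> is the vector of components of the initial velocity with respect to the
  coordinate frame of \<open>c\<close>. In this way \<open>T\<^sub>qM\<close>, for \<open>q\<close> in the domain of \<open>c\<close>, is identified
  with \<open>\<real>\<^sup>n\<close>; the notions below that are expressed in this frame (openness, star-shapedness,
  Lipschitz conditions) are invariant under linear isomorphisms.\<close>

definition geodesic_with_velocity ::
  "('m::topological_space, 'n::finite) chart set \<Rightarrow> ('m, 'n) metric \<Rightarrow> ('m, 'n) chart \<Rightarrow>
     'm \<Rightarrow> real^'n \<Rightarrow> real set \<Rightarrow> (real \<Rightarrow> 'm) \<Rightarrow> bool" where
  "geodesic_with_velocity \<A> g c q v I \<gamma> \<longleftrightarrow>
     geodesic_solution \<A> g I \<gamma> \<and> 0 \<in> I \<and> \<gamma> 0 = q \<and>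
     ((snd c \<circ> \<gamma>) has_vector_derivative v) (at 0)"

definition exp_domain ::
  "('m::topological_space, 'n::finite) chart set \<Rightarrow> ('m, 'n) metric \<Rightarrow> ('m, 'n) chart \<Rightarrow>
     'm \<Rightarrow> (real^'n) set" where
  "exp_domain \<A> g c q = {v. \<exists>I \<gamma>. {0..1} \<subseteq> I \<and> geodesic_with_velocity \<A> g c q v I \<gamma>}"

definition exp_map ::
  "('m::topological_space, 'n::finite) chart set \<Rightarrow> ('m, 'n) metric \<Rightarrow> ('m, 'n) chart \<Rightarrow>
     'm \<Rightarrow> real^'n \<Rightarrow> 'm" where
  "exp_map \<A> g c q v =
     (THE z. \<exists>I \<gamma>. {0..1} \<subseteq> I \<and> geodesic_with_velocity \<A> g c q v I \<gamma> \<and> \<gamma> 1 = z)"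

text \<open>In the following, \<open>C\<close> is a subset of the domain of \<open>c\<close>.\<close>

definition normal_domain ::
  "('m::topological_space, 'n::finite) chart set \<Rightarrow> ('m, 'n) metric \<Rightarrow> ('m, 'n) chart \<Rightarrow>
     'm set \<Rightarrow> 'm \<Rightarrow> (real^'n) set \<Rightarrow> bool" where
  "normal_domain \<A> g c C q N \<longleftrightarrow>
     open N \<and> (\<forall>v\<in>N. \<forall>s\<in>{0..1}. s *\<^sub>R v \<in> N) \<and> N \<subseteq> exp_domain \<A> g c q \<and>
     homeomorphism N C (exp_map \<A> g c q) (inv_into N (exp_map \<A> g c q)) \<and>
     locally_lipschitz_on N (snd c \<circ> exp_map \<A> g c q) \<and>
     locally_lipschitz_on (snd c ` C) (inv_into N (exp_map \<A> g c q) \<circ> chart_inv c)"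

definition convex_normal ::
  "('m::topological_space, 'n::finite) chart set \<Rightarrow> ('m, 'n) metric \<Rightarrow> ('m, 'n) chart \<Rightarrow>
     'm set \<Rightarrow> bool" where
  "convex_normal \<A> g c C \<longleftrightarrow> open C \<and> C \<subseteq> fst c \<and> (\<forall>q\<in>C. \<exists>N. normal_domain \<A> g c C q N)"

text \<open>The choice of \<open>N\<close> is harmless: star-shapedness makes the normal domain of \<open>q\<close> over \<open>C\<close>
  unique.\<close>

definition exp_inverse ::
  "('m::topological_space, 'n::finite) chart set \<Rightarrow> ('m, 'n) metric \<Rightarrow> ('m, 'n) chart \<Rightarrow>
     'm set \<Rightarrow> 'm \<Rightarrow> 'm \<Rightarrow> real^'n" where
  "exp_inverse \<A> g c C p =
     inv_into (SOME N. normal_domain \<A> g c C p N) (exp_map \<A> g c p)"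

definition geodesic_distance ::
  "('m::topological_space, 'n::finite) chart set \<Rightarrow> ('m, 'n) metric \<Rightarrow> ('m, 'n) chart \<Rightarrow>
     'm set \<Rightarrow> 'm \<Rightarrow> 'm \<Rightarrow> real" where
  "geodesic_distance \<A> g c C p q =
     sqrt (exp_inverse \<A> g c C p q \<bullet> (g c p *v exp_inverse \<A> g c C p q))"

definition coordinate_ball :: "('m, 'n::finite) chart \<Rightarrow> 'm \<Rightarrow> real \<Rightarrow> 'm set" where
  "coordinate_ball c p \<delta> = {q \<in> fst c. dist (snd c p) (snd c q) < \<delta>}"


section \<open>Hypersurfaces\<close>

text \<open>\<open>\<real>\<^sup>n\<^sup>-\<^sup>1\<close> is realised as the hyperplane \<open>{y. y $ k = 0}\<close> of \<open>\<real>\<^sup>n\<close>, so an index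
  \<open>i \<noteq> k\<close> plays the role of \<open>i = 1, \<dots>, n - 1\<close>. A function on a relatively open subset
  \<open>A\<close> of the hyperplane is \<open>C\<^sup>j\<^sup>,\<^sup>1\<close> iff its extension that is constant in the direction
  \<open>k\<close> is.\<close>

definition drop_coord :: "'n::finite \<Rightarrow> real^'n \<Rightarrow> real^'n" where
  "drop_coord k y = (\<chi> i. if i = k then 0 else y $ i)"

definition Ck1_on_slice ::
  "nat \<Rightarrow> 'n::finite \<Rightarrow> (real^'n) set \<Rightarrow> (real^'n \<Rightarrow> 'b::real_normed_vector) \<Rightarrow> bool" where
  "Ck1_on_slice j k A f \<longleftrightarrow> Ck1_on j {y. drop_coord k y \<in> A} (f \<circ> drop_coord k)"

definition slice_chart ::
  "('m::topological_space, 'n::finite) chart set \<Rightarrow> 'n \<Rightarrow> 'm set \<Rightarrow> ('m, 'n) chart \<Rightarrow> bool" where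
  "slice_chart \<A> k S \<psi> \<longleftrightarrow> Ck1_chart 1 \<A> \<psi> \<and> (\<forall>q\<in>fst \<psi>. q \<in> S \<longleftrightarrow> snd \<psi> q $ k = 0)"

definition C11_hypersurface ::
  "('m::topological_space, 'n::finite) chart set \<Rightarrow> 'n \<Rightarrow> 'm set \<Rightarrow> bool" where
  "C11_hypersurface \<A> k S \<longleftrightarrow> (\<forall>q\<in>S. \<exists>\<psi>. slice_chart \<A> k S \<psi> \<and> q \<in> fst \<psi>)"

definition C11_hypersurface_chart ::
  "('m::topological_space, 'n::finite) chart set \<Rightarrow> 'n \<Rightarrow> 'm set \<Rightarrow> ('m, 'n) chart \<Rightarrow> bool" where
  "C11_hypersurface_chart \<A> k S a \<longleftrightarrow>
     openin (top_of_set S) (fst a) \<and>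
     openin (top_of_set {y. y $ k = 0}) (chart_image a) \<and>
     homeomorphism (fst a) (chart_image a) (snd a) (chart_inv a) \<and>
     (\<forall>\<psi>. slice_chart \<A> k S \<psi> \<longrightarrow>
        Ck1_on_slice 1 k (snd \<psi> ` (fst a \<inter> fst \<psi>)) (snd a \<circ> chart_inv \<psi>) \<and>
        Ck1_on_slice 1 k (snd a ` (fst a \<inter> fst \<psi>)) (snd \<psi> \<circ> chart_inv a))"

definition C11_hypersurface_diffeomorphic ::
  "'n::finite \<Rightarrow> ('m::topological_space, 'n) chart set \<Rightarrow> 'm set \<Rightarrow>
     ('l::topological_space, 'n) chart set \<Rightarrow> 'l set \<Rightarrow> bool" where
  "C11_hypersurface_diffeomorphic k \<A> S \<B> T \<longleftrightarrow>
     (\<exists>F H. homeomorphism S T F H \<and>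
        (\<forall>\<psi> \<xi>. slice_chart \<A> k S \<psi> \<and> slice_chart \<B> k T \<xi> \<longrightarrow>
           Ck1_on_slice 1 k (snd \<psi> ` {q \<in> S \<inter> fst \<psi>. F q \<in> fst \<xi>}) (snd \<xi> \<circ> F \<circ> chart_inv \<psi>) \<and>
           Ck1_on_slice 1 k (snd \<xi> ` {z \<in> T \<inter> fst \<xi>. H z \<in> fst \<psi>}) (snd \<psi> \<circ> H \<circ> chart_inv \<xi>)))"

definition euclidean_atlas :: "(real^'n::finite, 'n) chart set" where
  "euclidean_atlas = {(UNIV, id)}"


section \<open>The metric in coordinates of lower regularity\<close>

text \<open>The value of \<open>g\<close> on vectors with components \<open>u\<close>, \<open>w\<close> in the chart \<open>\<psi>\<close>, at the point
  with coordinates \<open>y\<close>. Here \<open>\<psi>\<close> is a \<open>C\<^sup>1\<^sup>,\<^sup>1\<close> chart, or a Lipschitz chart provided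
  that \<open>snd c \<circ> chart_inv \<psi>\<close> is differentiable at \<open>y\<close>; the value does not depend on \<open>c\<close>.\<close>

definition metric_in ::
  "('m, 'n::finite) metric \<Rightarrow> ('m, 'n) chart \<Rightarrow> ('m, 'n) chart \<Rightarrow>
     real^'n \<Rightarrow> real^'n \<Rightarrow> real^'n \<Rightarrow> real" where
  "metric_in g c \<psi> y u w =
     (let L = frechet_derivative (snd c \<circ> chart_inv \<psi>) (at y)
      in L u \<bullet> (g c (chart_inv \<psi> y) *v L w))"

text \<open>For \<open>i, j \<noteq> k\<close> these are the components of the metric induced on the
  hypersurfaces on which the \<open>k\<close>-th coordinate of \<open>\<psi>\<close> is constant.\<close>

definition metric_component ::
  "('m, 'n::finite) metric \<Rightarrow> ('m, 'n) chart \<Rightarrow> ('m, 'n) chart \<Rightarrow>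
     'n \<Rightarrow> 'n \<Rightarrow> real^'n \<Rightarrow> real" where
  "metric_component g c \<psi> i j y = metric_in g c \<psi> y (axis i 1) (axis j 1)"

definition induces_lipschitz_metric ::
  "('m::topological_space, 'n::finite) chart set \<Rightarrow> ('m, 'n) metric \<Rightarrow> 'n \<Rightarrow> 'm set \<Rightarrow> bool" where
  "induces_lipschitz_metric \<A> g k S \<longleftrightarrow>
     (\<forall>c\<in>\<A>. \<forall>\<psi>. slice_chart \<A> k S \<psi> \<longrightarrow>
        (\<forall>i j. i \<noteq> k \<and> j \<noteq> k \<longrightarrow>
           Ck1_on_slice 0 k (snd \<psi> ` (S \<inter> fst \<psi> \<inter> fst c)) (metric_component g c \<psi> i j)))"

text \<open>The coordinates \<open>(r, \<theta>)\<close> on \<open>V\<close>: the slot \<open>k\<close> carries \<open>r\<close>, and the component \<open>k\<close> of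
  \<open>\<theta>\<close> is ignored.\<close>

definition radial_chart ::
  "'n::finite \<Rightarrow> 'm set \<Rightarrow> ('m \<Rightarrow> real) \<Rightarrow> ('m \<Rightarrow> real^'n) \<Rightarrow> ('m, 'n) chart" where
  "radial_chart k V r \<theta> = (V, \<lambda>q. \<chi> i. if i = k then r q else \<theta> q $ i)"

text \<open>\<open>g = dr\<^sup>2 + h\<^sub>i\<^sub>j d\<alpha>\<^sup>i d\<alpha>\<^sup>j\<close> in a Lipschitz chart \<open>\<psi> = (r, \<alpha>)\<close> with domain in the domain of
  \<open>c\<close>; the components are defined where the inverse of \<open>\<psi>\<close> is differentiable.\<close>

definition components_defined_at ::
  "('m, 'n::finite) chart \<Rightarrow> ('m, 'n) chart \<Rightarrow> real^'n \<Rightarrow> bool" where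
  "components_defined_at c \<psi> y \<longleftrightarrow> (snd c \<circ> chart_inv \<psi>) differentiable (at y)"

definition ae_direct_sum_form ::
  "('m, 'n::finite) metric \<Rightarrow> ('m, 'n) chart \<Rightarrow> 'n \<Rightarrow> ('m, 'n) chart \<Rightarrow> bool" where
  "ae_direct_sum_form g c k \<psi> \<longleftrightarrow>
     negligible {y \<in> chart_image \<psi>. \<not> components_defined_at c \<psi> y} \<and>
     (\<forall>y\<in>chart_image \<psi>. components_defined_at c \<psi> y \<longrightarrow>
        (\<forall>u w. metric_in g c \<psi> y u w =
           u $ k * w $ k +
           (\<Sum>i\<in>-{k}. \<Sum>j\<in>-{k}. metric_component g c \<psi> i j y * u $ i * w $ j))) \<and>
     (\<exists>B. \<forall>y\<in>chart_image \<psi>. components_defined_at c \<psi> y \<longrightarrow>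
        (\<forall>i j. i \<noteq> k \<and> j \<noteq> k \<longrightarrow> \<bar>metric_component g c \<psi> i j y\<bar> \<le> B))"


section \<open>Spherical normal coordinates\<close>

text \<open>Given an enumeration \<open>e 0, \<dots>, e (n - 1)\<close> of the indices, \<open>y $ e 0\<close> is the radius and
  \<open>\<phi>\<^sub>j = y $ e j\<close>, \<open>1 \<le> j < n\<close>, are the angles; the Cartesian coordinates are
  \<open>v\<^sub>1 = \<rho> cos \<phi>\<^sub>1\<close>, \<open>v\<^sub>2 = \<rho> sin \<phi>\<^sub>1 cos \<phi>\<^sub>2\<close>, \<open>\<dots>\<close>,
  \<open>v\<^sub>n = \<rho> sin \<phi>\<^sub>1 \<dots> sin \<phi>\<^sub>n\<^sub>-\<^sub>1\<close>.\<close>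

definition spherical_point :: "(nat \<Rightarrow> 'n::finite) \<Rightarrow> real^'n \<Rightarrow> real^'n" where
  "spherical_point e y =
     (\<Sum>j<CARD('n). (y $ e 0 * (\<Prod>l\<in>{1..j}. sin (y $ e l)) *
        (if Suc j < CARD('n) then cos (y $ e (Suc j)) else 1)) *\<^sub>R axis (e j) 1)"

definition spherical_range :: "(nat \<Rightarrow> 'n::finite) \<Rightarrow> (real^'n) set" where
  "spherical_range e =
     {y. 0 < y $ e 0 \<and>
         (\<forall>j. 1 \<le> j \<and> Suc j < CARD('n) \<longrightarrow> 0 < y $ e j \<and> y $ e j < pi) \<and>
         (2 \<le> CARD('n) \<longrightarrow> 0 < y $ e (CARD('n) - 1) \<and> y $ e (CARD('n) - 1) < 2 * pi)}"

text \<open>The columns of \<open>E\<close> are an orthonormal frame of \<open>(T\<^sub>pM, g\<^sub>p)\<close>.\<close>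

definition spherical_normal_chart ::
  "('m::topological_space, 'n::finite) chart set \<Rightarrow> ('m, 'n) metric \<Rightarrow> ('m, 'n) chart \<Rightarrow>
     'm set \<Rightarrow> 'm \<Rightarrow> (nat \<Rightarrow> 'n) \<Rightarrow> real^'n^'n \<Rightarrow> ('m, 'n) chart" where
  "spherical_normal_chart \<A> g c C p e E =
     (let f = (\<lambda>y. E *v spherical_point e y); Y = spherical_range e
      in ({q \<in> C. exp_inverse \<A> g c C p q \<in> f ` Y},
          \<lambda>q. inv_into Y f (exp_inverse \<A> g c C p q)))"

end

theory Submission imports Defs begin

text \<open>The exponential map is only bi-Lipschitz, and the proof differentiates it only along radial geodesics. In the given chart, geodesics
solve \<open>x'' = B(x)(x', x')\<close> with \<open>B\<close> locally Lipschitz and quadratic in the velocity (locale \<open>spray\<close>). For small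
velocities the flow is close, in the Lipschitz sense, to \<open>(q, v) \<mapsto> q + t v\<close>; so \<open>exp\<^sub>q\<close> is a bi-Lipschitz
homeomorphism onto a coordinate ball, and a convexity argument shows that a short geodesic with endpoints in the ball
stays in it. This is \<open>normal_balls\<close>.

The decisive gain of regularity comes from the first variation formula. Let \<open>E = r\<^sup>2 / 2\<close> be the energy of the radial
geodesic ending at a point \<open>x\<close>, and \<open>Z(x)\<close> its final velocity. Comparison of two radial geodesics gives
\<open>E(y) - E(x) = g(Z(x), y - x) + O(|y - x|\<^sup>2)\<close> (\<open>gauss_estimate\<close>). Hence \<open>E\<close> is differentiable with gradient \<open>Z\<close>,
and \<open>Z\<close> is Lipschitz: away from the centre \<open>r\<close> is \<open>C\<^sup>1\<^sup>,\<^sup>1\<close> with unit gradient \<open>nrm = Z / r\<close>, one degree more regular than \<open>exp\<close>.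
This is the Gauss lemma, and everything that the remainder needs about geodesics is collected in the locale
\<open>radial_ball\<close>.

The rest is calculus of \<open>r\<close>. Since \<open>dr \<noteq> 0\<close>, replacing one of the coordinates \<open>x\<^sup>\<mu>\<close> by \<open>r\<close> gives a \<open>C\<^sup>1\<^sup>,\<^sup>1\<close> chart; the other
coordinates are the functions \<open>\<theta>\<^sub>i\<close>, and the orthogonality of the gradient to the level sets is the stated block form
(\<open>radial_charts\<close>). A level set is a graph over the sphere because \<open>r\<close> increases along the straight rays of the chart
(\<open>level_diffeomorphic_sphere\<close>). Extending the coordinates of one level set so as to be constant along the radial geodesics
removes the terms \<open>A\<^sub>i\<close> at the price of coordinates that are only Lipschitz (\<open>tube_charts\<close>); spherical normal
coordinates are of the same kind (\<open>spherical_chart\<close>). For such coordinates the components of the metric exist almost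
everywhere by Rademacher's theorem and are bounded by the Lipschitz constant of the inverse chart
(\<open>ae_direct_sum_formI\<close>).\<close>

section \<open>Rademacher's theorem\<close>

text \<open>Adding a multiple of the identity makes \<open>f\<close> an increasing homeomorphism \<open>F\<close> with Lipschitz constant \<open>2 L + 1\<close>. It maps null
sets to null sets, so the measure \<open>F b - F a\<close> of \<open>[a, b]\<close> has a density by the Radon--Nikodym theorem, and \<open>F\<close> is
differentiable at the points where the averages of the density converge. One-sided averages are enough when they are
also applied to the reflected density.\<close>

lemma lipschitz_real_differentiable_ae:
 fixes f :: "real => real" assumes L: "L-lipschitz_on UNIV f" shows "negligible {x. \<not> f differentiable (at x)}"
proof -
 define F where "F x = f x + (L + 1) * x" for x
 have L0: "L \<ge> 0" using L lipschitz_on_nonneg by blast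
 have fL: "\<bar>f x - f y\<bar> \<le> L * \<bar>x - y\<bar>" for x y using lipschitz_onD[OF L, of x y] by (simp add: dist_real_def)
 have F_low: "y - x \<le> F y - F x" if "x \<le> y" for x y using fL[of x y] that unfolding F_def by (simp add: algebra_simps abs_le_iff)
 have F_up: "\<bar>F y - F x\<bar> \<le> (2 * L + 1) * \<bar>y - x\<bar>" for x y
 proof -
  have "\<bar>F y - F x\<bar> \<le> \<bar>f y - f x\<bar> + \<bar>(L + 1) * (y - x)\<bar>" unfolding F_def by (simp add: algebra_simps)
  also have "\<bar>(L + 1) * (y - x)\<bar> = (L + 1) * \<bar>y - x\<bar>" using L0 by (simp add: abs_mult)
  finally show ?thesis using fL[of y x] by (simp add: algebra_simps)
 qed
 have F_mono: "F x < F y" if "x < y" for x y using F_low[of x y] that by simp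
 have F_inj: "inj F" by (metis F_mono injI linorder_less_linear order_less_irrefl)
 have F_cont: "continuous_on UNIV F" unfolding F_def using lipschitz_on_continuous_on[OF L] by (intro continuous_intros)
 have F_surj: "surj F"
 proof -
  have "\<exists>x. F x = y" for y
  proof -
   define b where "b = \<bar>y - F 0\<bar>"
   have "F (- b) \<le> y" "y \<le> F b" using F_low[of "-b" 0] F_low[of 0 b] unfolding b_def by auto
   moreover have "-b \<le> b" unfolding b_def by simp
   ultimately show ?thesis using IVT'[of F "-b" y b] continuous_on_subset[OF F_cont] by auto
  qed
  thus ?thesis by (metis surj_def)
 qed
 define H where "H = inv F"
 have HF: "H (F x) = x" and FH: "F (H y) = y" for x y unfolding H_def using F_inj F_surj by (simp_all add: surj_f_inv_f)
 have H_le: "H y \<le> x \<longleftrightarrow> y \<le> F x" for x y by (metis FH F_mono linorder_not_le nless_le)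
 have H_meas: "H \<in> borel_measurable borel" unfolding borel_measurable_iff_le by (auto simp: H_le)
 define \<mu> where "\<mu> = distr lborel borel H"
 have mu_Icc: "emeasure \<mu> {a..b} = ennreal (F b - F a)" if "a \<le> b" for a b
 proof -
  have "H -` {a..b} = {F a..F b}" by (auto simp: H_le) (metis FH F_mono linorder_not_le nless_le)+
  moreover have "F a \<le> F b" using F_low[OF that] that by linarith
  ultimately show ?thesis unfolding \<mu>_def using H_meas by (simp add: emeasure_distr)
 qed
 have ac: "absolutely_continuous lborel \<mu>" unfolding absolutely_continuous_def
 proof
  fix A :: "real set" assume A: "A \<in> null_sets lborel"
  have vim: "H -` A = F ` A" using HF FH by (auto simp: image_iff) metis
  have "A \<in> sets borel" using A by auto
  have "negligible A" using A negligible_iff_null_sets null_sets_completionI by blast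
  hence "negligible (F ` A)" using F_up by (intro negligible_locally_Lipschitz_image) auto
  hence "F ` A \<in> null_sets lebesgue" using negligible_iff_null_sets by blast
  moreover have "F ` A \<in> sets borel" using measurable_sets[OF H_meas \<open>A \<in> sets borel\<close>] vim by simp
  ultimately have "F ` A \<in> null_sets lborel" by (simp add: null_sets_completion_iff)
  thus "A \<in> null_sets \<mu>" unfolding \<mu>_def using H_meas \<open>A \<in> sets borel\<close> vim by (simp add: null_sets_distr_iff)
 qed
 obtain \<phi> where phi: "\<phi> \<in> borel_measurable lborel" and dens: "density lborel \<phi> = \<mu>"
  using sigma_finite_measure.Radon_Nikodym[OF sigma_finite_lborel ac] by (auto simp: \<mu>_def)
 have phi_Icc: "(\<integral>\<^sup>+x. \<phi> x * indicator {a..b} x \<partial>lborel) = ennreal (F b - F a)" if "a \<le> b" for a b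
  using mu_Icc[OF that] phi unfolding dens[symmetric] by (simp add: emeasure_density)
 have fin: "AE x in lborel. \<phi> x \<noteq> \<infinity>"
 proof -
  have "AE x in lborel. \<forall>n::nat. \<phi> x * indicator {-real n..real n} x \<noteq> \<infinity>" unfolding AE_all_countable
   using phi phi_Icc by (intro allI nn_integral_PInf_AE) auto
  thus ?thesis
  proof (eventually_elim)
   fix x assume *: "\<forall>n::nat. \<phi> x * indicator {-real n..real n} x \<noteq> \<infinity>"
   obtain n :: nat where "\<bar>x\<bar> \<le> real n" using real_arch_simple by blast
   thus "\<phi> x \<noteq> \<infinity>" using *[rule_format, of n] by (auto simp: abs_le_iff indicator_def)
  qed
 qed
 define h where "h x = enn2real (\<phi> x)" for x
 have hint: "(h has_integral (F b - F a)) {a..b}" if "a \<le> b" for a b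
 proof -
  have "((\<lambda>x. h x * indicator {a..b} x) has_integral (F b - F a)) UNIV"
  proof (rule nn_integral_has_integral)
   show "(\<lambda>x. h x * indicat_real {a..b} x) \<in> borel_measurable borel" unfolding h_def using phi by measurable
   have "(\<integral>\<^sup>+x. ennreal (h x * indicator {a..b} x) \<partial>lborel)
    = (\<integral>\<^sup>+x. \<phi> x * indicator {a..b} x \<partial>lborel)" by (rule nn_integral_cong_AE, rule AE_mp[OF fin])
    (auto simp: h_def indicator_def top.not_eq_extremum)
   thus "(\<integral>\<^sup>+x. ennreal (h x * indicator {a..b} x) \<partial>lborel) = ennreal (F b - F a)" using phi_Icc[OF that] by simp
   show "0 \<le> F b - F a" using F_low[OF that] that by linarith
  qed (auto simp: h_def indicator_def)
  moreover have "(\<lambda>x. h x * indicator {a..b} x) = (\<lambda>x. if x \<in> {a..b} then h x else 0)" by (auto simp: indicator_def)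
  ultimately show ?thesis by (simp only: has_integral_restrict_UNIV)
 qed
 have hint': "((\<lambda>x. h (- x)) has_integral (F (- a) - F (- b))) {a..b}" if "a \<le> b" for a b
  using hint[of "-b" "-a"] that has_integral_reflect_real[of h "F (-a) - F (-b)" "-a" "-b"] by simp
 have "h integrable_on cbox a b" for a b by (cases "a \<le> b") (use hint in \<open>auto simp: integrable_on_def\<close>)
 from integrable_ccontinuous_explicit[OF this] obtain N1 where N1: "negligible N1"
  "\<And>x e. \<lbrakk>x \<notin> N1; 0 < e\<rbrakk> \<Longrightarrow> \<exists>d>0. \<forall>t. 0 < t \<and> t < d \<longrightarrow>
   norm (integral (cbox x (x + t *\<^sub>R One)) h /\<^sub>R t ^ DIM(real) - h x) < e" by metis
 have "(\<lambda>x. h (- x)) integrable_on cbox a b" for a b by (cases "a \<le> b") (use hint' in \<open>auto simp: integrable_on_def\<close>)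
 from integrable_ccontinuous_explicit[OF this] obtain N2 where N2: "negligible N2"
  "\<And>x e. \<lbrakk>x \<notin> N2; 0 < e\<rbrakk> \<Longrightarrow> \<exists>d>0. \<forall>t. 0 < t \<and> t < d \<longrightarrow>
   norm (integral (cbox x (x + t *\<^sub>R One)) (\<lambda>x. h (- x)) /\<^sub>R t ^ DIM(real) - h (- x)) < e" by metis
 have diff: "f differentiable (at x)" if x: "x \<notin> N1 \<union> uminus ` N2" for x
 proof -
  have "-x \<notin> N2" using x by (metis UnCI add.inverse_inverse image_eqI)
  have "(\<lambda>t. (F (x + t) - F x) / t) \<midarrow>0\<rightarrow> h x"
  proof (rule LIM_I)
   fix e :: real assume e: "e > 0"
   from N1(2)[OF _ e, of x] x obtain d1 where d1: "d1 > 0"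
    "\<And>t. 0 < t ==> t < d1 ==> norm (integral {x..x + t} h /\<^sub>R t - h x) < e" by auto
   from N2(2)[OF \<open>-x \<notin> N2\<close> e] obtain d2 where d2: "d2 > 0"
    "\<And>t. 0 < t ==> t < d2 ==> norm (integral {-x..- x + t} (\<lambda>x. h (- x)) /\<^sub>R t - h x) < e" by auto
   have "norm ((F (x + t) - F x) / t - h x) < e" if t: "t \<noteq> 0" "norm (t - 0) < min d1 d2" for t
   proof (cases "t > 0")
    case True
    have "integral {x..x + t} h = F (x + t) - F x" using hint[of x "x + t"] True by (simp add: integral_unique)
    with d1(2)[OF True] t True show ?thesis by (simp add: divide_inverse mult.commute)
   next
    case False
    hence t': "- t > 0" using t by simp
    have "integral {-x..- x + (- t)} (\<lambda>x. h (- x)) = F x - F (x + t)"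
    using hint'[of "-x" "-x + (-t)"] t' by (simp add: integral_unique add.commute)
    moreover have "(F x - F (x + t)) /\<^sub>R (- t) = (F (x + t) - F x) / t" by (simp add: divide_inverse algebra_simps)
    ultimately show ?thesis using d2(2)[OF t'] t t' by simp
   qed
   thus "\<exists>s>0. \<forall>t. t \<noteq> 0 \<and> norm (t - 0) < s \<longrightarrow> norm ((F (x + t) - F x) / t - h x) < e"
    using d1(1) d2(1) by (intro exI[of _ "min d1 d2"]) auto
  qed
  hence "DERIV F x :> h x" by (simp add: DERIV_def)
  hence "DERIV (\<lambda>x. F x - (L + 1) * x) x :> h x - (L + 1)" by (auto intro!: derivative_eq_intros)
  thus ?thesis unfolding F_def by (auto simp: real_differentiable_def)
 qed
 have "negligible (uminus ` N2)" using N2(1) by (intro negligible_locally_Lipschitz_image) (auto intro!: exI[of _ UNIV] exI[of _ "1::real"])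
 hence "negligible (N1 \<union> uminus ` N2)" using N1(1) by simp
 moreover have "{x. \<not> f differentiable (at x)} \<subseteq> N1 \<union> uminus ` N2"
 proof
  fix x assume "x \<in> {x. \<not> f differentiable (at x)}"
  thus "x \<in> N1 \<union> uminus ` N2" using diff[of x] by (cases "x \<in> N1 \<union> uminus ` N2") simp_all
 qed
 ultimately show ?thesis by (rule negligible_subset)
qed

lemma borel_nondifferentiable_direction:
 fixes f :: "'a::euclidean_space => real" assumes f: "continuous_on UNIV f"
 shows "{x. (\<lambda>t. f (x + t *\<^sub>R b)) differentiable (at 0)} \<in> sets borel"
proof -
 define q where "q x t = (f (x + t *\<^sub>R b) - f x) / t" for x t
 define P where "P k m = {x. \<forall>s t. s \<noteq> 0 \<and> \<bar>s\<bar> < inverse (real (Suc m)) \<and> t \<noteq> 0 \<and>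
  \<bar>t\<bar> < inverse (real (Suc m)) \<longrightarrow> \<bar>q x s - q x t\<bar> \<le> inverse (real (Suc k))}" for k m
 have q_cont: "continuous_on UNIV (\<lambda>x. q x t)" for t unfolding q_def by (cases "t = 0")
   (auto intro!: continuous_intros continuous_on_compose2[OF f])
 have "closed (P k m)" for k m unfolding P_def by (intro closed_Collect_all closed_Collect_imp open_Collect_const closed_Collect_le
    continuous_intros q_cont)
 hence "(\<Inter>k. \<Union>m. P k m) \<in> sets borel" by (intro sets.countable_INT' sets.countable_UN') (auto intro: borel_closed)
 moreover have "{x. (\<lambda>t. f (x + t *\<^sub>R b)) differentiable (at 0)} = (\<Inter>k. \<Union>m. P k m)"
 proof (intro set_eqI iffI)
  fix x assume "x \<in> {x. (\<lambda>t. f (x + t *\<^sub>R b)) differentiable (at 0)}"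
  then obtain D where "DERIV (\<lambda>t. f (x + t *\<^sub>R b)) 0 :> D" by (auto simp: real_differentiable_def)
  hence lim: "(q x) \<midarrow>0\<rightarrow> D" by (simp add: DERIV_def q_def[abs_def])
  have "\<exists>m. x \<in> P k m" for k
  proof -
   define e where "e = inverse (real (Suc k)) / 2"
   have "e > 0" unfolding e_def by simp
   then obtain d where d: "d > 0" "\<And>t. t \<noteq> 0 ==> \<bar>t\<bar> < d ==> \<bar>q x t - D\<bar> < e" using LIM_D[OF lim] by force
   obtain m where m: "inverse (real (Suc m)) < d" using reals_Archimedean[OF d(1)] by blast
   have "\<bar>q x s - q x t\<bar> \<le> inverse (real (Suc k))"
    if "s \<noteq> 0" "\<bar>s\<bar> < inverse (real (Suc m))" "t \<noteq> 0" "\<bar>t\<bar> < inverse (real (Suc m))" for s t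
   proof -
    have "\<bar>q x s - D\<bar> < e" "\<bar>q x t - D\<bar> < e" using d(2) that m by force+
    hence "\<bar>q x s - q x t\<bar> \<le> 2 * e" by linarith
    thus ?thesis unfolding e_def by simp
   qed
   hence "x \<in> P k m" unfolding P_def by blast
   thus ?thesis ..
  qed
  thus "x \<in> (\<Inter>k. \<Union>m. P k m)" by auto
 next
  fix x assume x: "x \<in> (\<Inter>k. \<Union>m. P k m)"
  have P: "\<exists>m. \<forall>s t. s \<noteq> 0 \<and> \<bar>s\<bar> < inverse (real (Suc m)) \<and> t \<noteq> 0 \<and>
   \<bar>t\<bar> < inverse (real (Suc m)) \<longrightarrow> \<bar>q x s - q x t\<bar> \<le> inverse (real (Suc k))" for k
   using x unfolding P_def by blast
  have inv_lt: "\<bar>inverse (real (Suc n))\<bar> < inverse (real (Suc m))" if "m < n" for m n using that by (simp add: field_simps)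
  define y where "y n = q x (inverse (real (Suc n)))" for n
  have "Cauchy y"
  proof (rule metric_CauchyI)
   fix e :: real assume "e > 0"
   then obtain k where k: "inverse (real (Suc k)) < e" using reals_Archimedean by blast
   from P[of k] obtain m where m: "\<And>s t. s \<noteq> 0 \<and> \<bar>s\<bar> < inverse (real (Suc m)) \<and> t \<noteq> 0 \<and>
   \<bar>t\<bar> < inverse (real (Suc m)) ==> \<bar>q x s - q x t\<bar> \<le> inverse (real (Suc k))" by blast
   have "dist (y n1) (y n2) < e" if "n1 \<ge> Suc m" "n2 \<ge> Suc m" for n1 n2
   proof -
    have "\<bar>y n1 - y n2\<bar> \<le> inverse (real (Suc k))" unfolding y_def using that by (intro m) (auto simp: inv_lt)
    thus ?thesis using k by (simp add: dist_real_def)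
   qed
   thus "\<exists>M. \<forall>m\<ge>M. \<forall>n\<ge>M. dist (y m) (y n) < e" by blast
  qed
  then obtain D where D: "y \<longlonglongrightarrow> D" using real_Cauchy_convergent convergent_def by blast
  have "(q x) \<midarrow>0\<rightarrow> D"
  proof (rule LIM_I)
   fix e :: real assume "e > 0"
   then obtain k where k: "inverse (real (Suc k)) < e" using reals_Archimedean by blast
   from P[of k] obtain m where m: "\<And>s t. s \<noteq> 0 \<and> \<bar>s\<bar> < inverse (real (Suc m)) \<and> t \<noteq> 0 \<and>
   \<bar>t\<bar> < inverse (real (Suc m)) ==> \<bar>q x s - q x t\<bar> \<le> inverse (real (Suc k))" by blast
   have "norm (q x t - D) < e" if t: "t \<noteq> 0" "norm (t - 0) < inverse (real (Suc m))" for t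
   proof -
    have "(\<lambda>n. \<bar>q x t - y n\<bar>) \<longlonglongrightarrow> \<bar>q x t - D\<bar>" using D by (intro tendsto_intros)
    moreover have "\<forall>\<^sub>F n in sequentially. \<bar>q x t - y n\<bar> \<le> inverse (real (Suc k))"
    unfolding eventually_sequentially y_def using t by (intro exI[of _ "Suc m"] allI impI m) (auto simp: inv_lt)
    ultimately have "\<bar>q x t - D\<bar> \<le> inverse (real (Suc k))" using tendsto_upperbound by fastforce
    thus ?thesis using k by simp
   qed
   thus "\<exists>s>0. \<forall>t. t \<noteq> 0 \<and> norm (t - 0) < s \<longrightarrow> norm (q x t - D) < e"
    by (intro exI[of _ "inverse (real (Suc m))"]) auto
  qed
  hence "DERIV (\<lambda>t. f (x + t *\<^sub>R b)) 0 :> D" by (simp add: DERIV_def q_def[abs_def])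
  thus "x \<in> {x. (\<lambda>t. f (x + t *\<^sub>R b)) differentiable (at 0)}" by (auto simp: real_differentiable_def)
 qed
 ultimately show ?thesis by simp
qed

text \<open>Fubini's theorem along the lines in direction \<open>b\<close>.\<close>

lemma lipschitz_directional_derivative_ae:
 fixes f :: "'a::euclidean_space => real" assumes L: "L-lipschitz_on UNIV f"
 shows "negligible {x. \<not> (\<lambda>t. f (x + t *\<^sub>R b)) differentiable (at 0)}"
proof -
 define D where "D = {x. (\<lambda>t. f (x + t *\<^sub>R b)) differentiable (at 0)}"
 have D_borel: "D \<in> sets borel" unfolding D_def by (rule borel_nondifferentiable_direction[OF lipschitz_on_continuous_on[OF L]])
 have P: "pair_sigma_finite (lborel :: 'a measure) (lborel :: real measure)" ..
 have meas: "{z \<in> space (lborel \<Otimes>\<^sub>M lborel). fst z + snd z *\<^sub>R b \<in> D} \<in> sets (lborel \<Otimes>\<^sub>M lborel)"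
 proof -
  have "(\<lambda>z. fst z + snd z *\<^sub>R b) \<in> borel_measurable (lborel \<Otimes>\<^sub>M lborel)" by measurable
  from measurable_sets[OF this D_borel] show ?thesis by (simp add: vimage_def Int_def conj_commute)
 qed
 have "AE t in lborel. x + t *\<^sub>R b \<in> D" for x
 proof -
  define g where "g t = f (x + t *\<^sub>R b)" for t
  have "(L * norm b)-lipschitz_on UNIV g"
  proof (rule lipschitz_onI)
   fix s t :: real
   have "dist (g s) (g t) \<le> L * dist (x + s *\<^sub>R b) (x + t *\<^sub>R b)" unfolding g_def by (rule lipschitz_onD[OF L]) auto
   also have "dist (x + s *\<^sub>R b) (x + t *\<^sub>R b) = norm b * dist s t" by (simp add: dist_norm flip: scaleR_diff_left)
   finally show "dist (g s) (g t) \<le> L * norm b * dist s t" by simp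
  qed (use lipschitz_on_nonneg[OF L] in auto)
  hence neg: "negligible {t. \<not> g differentiable (at t)}" by (rule lipschitz_real_differentiable_ae)
  have "{t. \<not> (x + t *\<^sub>R b \<in> D)} \<subseteq> {t. \<not> g differentiable (at t)}"
  proof clarify
   fix t assume "x + t *\<^sub>R b \<notin> D" "g differentiable (at t)"
   then obtain d where "(g has_real_derivative d) (at (0 + t))" by (auto simp: real_differentiable_def)
   hence "((\<lambda>s. g (s + t)) has_real_derivative d) (at 0)" by (simp only: DERIV_shift)
   moreover have "(\<lambda>s. g (s + t)) = (\<lambda>s. f ((x + t *\<^sub>R b) + s *\<^sub>R b))" unfolding g_def by (simp add: algebra_simps)
   ultimately have "x + t *\<^sub>R b \<in> D" unfolding D_def by (auto simp: real_differentiable_def)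
   thus False using \<open>x + t *\<^sub>R b \<notin> D\<close> by simp
  qed
  hence "negligible {t. \<not> (x + t *\<^sub>R b \<in> D)}" using neg negligible_subset by blast
  hence "AE t in lebesgue. x + t *\<^sub>R b \<in> D" by (simp add: eventually_ae_filter_negligible) blast
  thus ?thesis by (simp add: AE_completion_iff)
 qed
 hence "AE x in lborel. AE t in lborel. x + t *\<^sub>R b \<in> D" by simp
 hence "AE t in lborel. AE x in lborel. x + t *\<^sub>R b \<in> D"
  using pair_sigma_finite.AE_commute[OF P, of "\<lambda>x t. x + t *\<^sub>R b \<in> D"] meas by blast
 then obtain t :: real where "AE x in lborel. x + t *\<^sub>R b \<in> D" using eventually_happens'[of "ae_filter (lborel :: real measure)"]
  by (auto simp: ae_filter_eq_bot_iff)
 hence "AE x in lebesgue. x + t *\<^sub>R b \<in> D" using AE_completion by blast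
 then obtain N where N: "negligible N" "{x. x + t *\<^sub>R b \<notin> D} \<subseteq> N" by (auto simp: eventually_ae_filter_negligible)
 have "- D \<subseteq> (+) (t *\<^sub>R b) ` N"
 proof
  fix x assume "x \<in> - D"
  hence "x - t *\<^sub>R b \<in> N" using N(2) by auto
  thus "x \<in> (+) (t *\<^sub>R b) ` N" by (intro image_eqI[of _ _ "x - t *\<^sub>R b"]) auto
 qed
 hence "negligible (- D)" using negligible_translation[OF N(1)] negligible_subset by blast
 thus ?thesis unfolding D_def by (simp add: Collect_neg_eq)
qed

text \<open>In the disjoint balls of a Vitali covering, the holes take away a fixed proportion of the measure. So the outer measure
of a bounded part of \<open>S\<close> is at most \<open>1 - c\<close> times itself.\<close>

lemma negligible_porous:
 fixes S :: "'a::euclidean_space set" assumes \<delta>: "0 < \<delta>" "\<delta> \<le> 1" and por: "\<And>x e. x \<in> S ==> e > 0 ==>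
   \<exists>y d. 0 < d \<and> d < e \<and> dist x y \<le> d \<and> ball y (\<delta> * d) \<inter> S = {}" shows "negligible S"
proof -
 have bounded_case: "negligible T" if "T \<subseteq> S" "bounded T" for T
 proof -
  have porT: "\<exists>y d. 0 < d \<and> d < e \<and> dist x y \<le> d \<and> ball y (\<delta> * d) \<inter> T = {}"
   if "x \<in> T" "e > 0" for x e using por[of x e] \<open>T \<subseteq> S\<close> that by blast
  define c where "c = (\<delta> / 2) ^ DIM('a)"
  have c: "0 < c" "c \<le> 1" unfolding c_def using \<delta> by (auto intro!: power_le_one)
  have step: "\<exists>W. T \<subseteq> W \<and> W \<in> lmeasurable \<and> measure lebesgue W \<le> (1 - c) * measure lebesgue U"
   if U: "open U" "T \<subseteq> U" "U \<in> lmeasurable" for U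
  proof -
   define K where "K = {(x, y, d). x \<in> T \<and> 0 < d \<and> ball x (2 * d) \<subseteq> U \<and> dist x y \<le> d \<and>
    ball y (\<delta> * d) \<inter> T = {}}"
   define a :: "'a \<times> 'a \<times> real => 'a" where "a = fst"
   define r :: "'a \<times> 'a \<times> real => real" where "r i = 2 * snd (snd i)" for i
   define B where "B i = ball (a i) (r i)" for i
   define H where "H i = ball (fst (snd i)) (\<delta> * snd (snd i))" for i :: "'a \<times> 'a \<times> real"
   have cov: "\<exists>i. i \<in> K \<and> x \<in> ball (a i) (r i) \<and> r i < d" if "x \<in> T" "0 < d" for x d
   proof -
    obtain e where e: "e > 0" "ball x e \<subseteq> U" using U(1,2) \<open>x \<in> T\<close> openE by blast
    obtain y t where "0 < t" "t < min (d / 2) (e / 2)" "dist x y \<le> t" "ball y (\<delta> * t) \<inter> T = {}"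
    using porT[of x "min (d / 2) (e / 2)"] \<open>x \<in> T\<close> \<open>0 < d\<close> e(1) by auto
    thus ?thesis using \<open>x \<in> T\<close> e(2) unfolding K_def a_def r_def by (intro exI[of _ "(x, y, t)"]) (auto simp: subset_iff)
   qed
   obtain C where C: "countable C" "C \<subseteq> K"
    "pairwise (\<lambda>i j. disjnt (ball (a i) (r i)) (ball (a j) (r j))) C"
    "negligible (T - (\<Union>i\<in>C. ball (a i) (r i)))" using Vitali_covering_theorem_balls[OF cov] by blast
   have HB: "H i \<subseteq> B i" if "i \<in> C" for i
   proof -
    obtain x y d where i: "i = (x, y, d)" by (cases i)
    with that C(2) have "0 < d" "dist x y \<le> d" unfolding K_def by auto
    moreover have "\<delta> * d \<le> d" using \<delta> \<open>0 < d\<close> by simp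
    ultimately show ?thesis unfolding H_def B_def a_def r_def i
    by (auto simp: subset_iff) (smt (verit) dist_triangle \<open>\<delta> * d \<le> d\<close>)
   qed
   have disj: "disjoint_family_on B C" using C(3) unfolding disjoint_family_on_def pairwise_def disjnt_def B_def by blast
   have disj': "disjoint_family_on (\<lambda>i. B i - H i) C" using disj unfolding disjoint_family_on_def by blast
   have em: "emeasure lborel (B i - H i) = ennreal (1 - c) * emeasure lborel (B i)" if "i \<in> C" for i
   proof -
    have d: "0 < snd (snd i)" using C(2) that unfolding K_def by auto
    let ?V = "unit_ball_vol (real DIM('a))" and ?d = "snd (snd i)"
    have "emeasure lborel (B i - H i) = emeasure lborel (B i) - emeasure lborel (H i)"
    using HB[OF that] d \<delta> unfolding B_def H_def r_def by (subst emeasure_Diff) (auto simp: emeasure_ball)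
    also have "\<dots> = ennreal (?V * (2 * ?d) ^ DIM('a) - ?V * (\<delta> * ?d) ^ DIM('a))"
    unfolding B_def H_def r_def using d \<delta> by (simp add: emeasure_ball ennreal_minus)
    also have "?V * (2 * ?d) ^ DIM('a) - ?V * (\<delta> * ?d) ^ DIM('a) = (1 - c) * (?V * (2 * ?d) ^ DIM('a))"
    unfolding c_def by (simp add: power_mult_distrib power_divide field_simps)
    also have "ennreal \<dots> = ennreal (1 - c) * ennreal (?V * (2 * ?d) ^ DIM('a))" using c by (simp add: ennreal_mult')
    finally show ?thesis unfolding B_def r_def using d by (simp add: emeasure_ball)
   qed
   have sets_B: "B i \<in> sets lborel" "B i - H i \<in> sets lborel" for i unfolding B_def H_def by auto
   have "emeasure lborel (\<Union>i\<in>C. B i - H i) = (\<integral>\<^sup>+i. emeasure lborel (B i - H i) \<partial>count_space C)"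
    using sets_B C(1) disj' by (intro emeasure_UN_countable) auto
   also have "\<dots> = (\<integral>\<^sup>+i. ennreal (1 - c) * emeasure lborel (B i) \<partial>count_space C)"
    by (intro nn_integral_cong) (simp add: em)
   also have "\<dots> = ennreal (1 - c) * (\<integral>\<^sup>+i. emeasure lborel (B i) \<partial>count_space C)"
    by (simp add: nn_integral_cmult)
   also have "(\<integral>\<^sup>+i. emeasure lborel (B i) \<partial>count_space C) = emeasure lborel (\<Union>i\<in>C. B i)"
    using sets_B C(1) disj by (intro emeasure_UN_countable[symmetric]) auto
   also have "\<dots> \<le> emeasure lborel U"
   proof (rule emeasure_mono)
    show "(\<Union>i\<in>C. B i) \<subseteq> U" using C(2) unfolding B_def a_def r_def K_def by fastforce
   qed (use U(1) in auto)
   also have "emeasure lborel U = ennreal (measure lebesgue U)" using emeasure_eq_measure2[OF U(3)] U(1) by simp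
   finally have le: "emeasure lborel (\<Union>i\<in>C. B i - H i) \<le> ennreal ((1 - c) * measure lebesgue U)"
    using c by (simp add: ennreal_mult' mult_left_mono)
   have UB: "(\<Union>i\<in>C. B i - H i) \<in> sets lborel" using sets_B C(1) by (intro sets.countable_UN') auto
   define Z where "Z = (\<Union>i\<in>C. B i - H i)"
   have "emeasure lebesgue Z \<le> ennreal ((1 - c) * measure lebesgue U)" using le UB unfolding Z_def by simp
   hence Z: "Z \<in> lmeasurable" "measure lebesgue Z \<le> (1 - c) * measure lebesgue U" using UB c unfolding Z_def
    by (auto intro!: fmeasurableI le_less_trans[OF _ ennreal_less_top] enn2real_leI simp: measure_def)
   define N where "N = T - (\<Union>i\<in>C. B i)"
   have N: "negligible N" using C(4) unfolding N_def B_def .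
   have "T \<subseteq> Z \<union> N" unfolding Z_def N_def using C(2) unfolding K_def H_def by fastforce
   moreover have "Z \<union> N \<in> lmeasurable" using Z(1) N negligible_imp_measurable by auto
   moreover have "measure lebesgue (Z \<union> N) = measure lebesgue Z"
    using N Z(1) by (intro measure_negligible_symdiff) (auto intro: negligible_subset)
   ultimately show ?thesis using Z(2) by (intro exI[of _ "Z \<union> N"]) auto
  qed
  define M where "M = {measure lebesgue U | U. open U \<and> T \<subseteq> U \<and> U \<in> lmeasurable}"
  obtain R where R: "T \<subseteq> ball 0 R" using bounded_subset_ballD[OF \<open>bounded T\<close>, of 0] by blast
  hence M_ne: "M \<noteq> {}" unfolding M_def by (auto intro!: exI[of _ "ball 0 R"])
  have M_bdd: "bdd_below M" unfolding M_def by (intro bdd_belowI[of _ 0]) auto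
  have "Inf M \<ge> 0" using M_ne unfolding M_def by (intro cInf_greatest) auto
  have inf_eps: "Inf M \<le> (1 - c) * u + e" if "u \<in> M" "e > 0" for u e
  proof -
   from \<open>u \<in> M\<close> obtain U where U: "u = measure lebesgue U" "open U" "T \<subseteq> U" "U \<in> lmeasurable"
    unfolding M_def by blast
   obtain W where W: "T \<subseteq> W" "W \<in> lmeasurable" "measure lebesgue W \<le> (1 - c) * u" using step[OF U(2-4)] U(1) by blast
   obtain V where V: "open V" "W \<subseteq> V" "V - W \<in> lmeasurable" "emeasure lebesgue (V - W) < ennreal e"
    using sets_lebesgue_outer_open[OF fmeasurableD[OF W(2)] \<open>e > 0\<close>] by blast
   have VW: "V = W \<union> (V - W)" using V(2) by blast
   have "measure lebesgue (V - W) \<le> e" using V(3,4) \<open>e > 0\<close> by (simp add: emeasure_eq_measure2 ennreal_less_iff)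
   moreover have "measure lebesgue V \<le> measure lebesgue W + measure lebesgue (V - W)" by (subst VW, rule measure_Un_le) (use W V in auto)
   moreover have "V \<in> lmeasurable" by (subst VW) (intro fmeasurable.Un W V)
   ultimately have "measure lebesgue V \<le> (1 - c) * u + e" using W(3) by linarith
   moreover have "measure lebesgue V \<in> M" using W(1) V(1,2) \<open>V \<in> lmeasurable\<close> unfolding M_def mem_Collect_eq by blast
   ultimately show ?thesis using cInf_lower[OF _ M_bdd] by (meson order_trans)
  qed
  have inf_le: "Inf M \<le> (1 - c) * u" if "u \<in> M" for u by (rule field_le_epsilon) (rule inf_eps[OF that])
  have "c * Inf M \<le> 0"
  proof (cases "c = 1")
   case False
   hence "1 - c > 0" using c by simp
   have "Inf M / (1 - c) \<le> u" if "u \<in> M" for u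
    using inf_le[OF that] \<open>1 - c > 0\<close> by (simp add: pos_divide_le_eq mult.commute)
   hence "Inf M / (1 - c) \<le> Inf M" using M_ne by (intro cInf_greatest)
   thus ?thesis using \<open>1 - c > 0\<close> by (simp add: field_simps)
  qed (use M_ne inf_le in fastforce)
  hence "Inf M \<le> 0" using c by (simp add: mult_le_0_iff)
  show "negligible T" unfolding negligible_outer
  proof (intro allI impI)
   fix e :: real assume "e > 0"
   then obtain u where "u \<in> M" "u < e" using \<open>Inf M \<le> 0\<close> cInf_lessD[OF M_ne, of e] by force
   thus "\<exists>U. T \<subseteq> U \<and> U \<in> lmeasurable \<and> measure lebesgue U < e" unfolding M_def by blast
  qed
 qed
 show ?thesis unfolding negligible_on_intervals[of S] by (intro allI bounded_case) (auto intro: bounded_subset[OF bounded_cbox])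
qed

text \<open>Let the partial derivatives of \<open>f\<close> at \<open>x\<close> form the vector \<open>G\<close>. The set of points at which \<open>f\<close> is, up to \<open>1 / (k + 1)\<close> and
on the scale \<open>1 / (m + 1)\<close>, partially differentiable with gradient \<open>a\<close> is porous at the points that have near them
balls free of it. Those form a null set, and off it every small displacement can be moved, coordinate by coordinate,
through points of the set; there the increments of \<open>f\<close> add up to \<open>a \<bullet> h\<close> with a small error.\<close>

lemma lipschitz_differentiable_ae_real:
 fixes f :: "'a::euclidean_space => real" assumes L: "L-lipschitz_on UNIV f" shows "negligible {x. \<not> f differentiable (at x)}"
proof -
 obtain Q :: "'a set" where Q: "countable Q" "\<And>U. open U ==> U \<noteq> {} ==> \<exists>q\<in>Q. q \<in> U"
  using countable_dense_exists by blast
 have L0: "L \<ge> 0" using L lipschitz_on_nonneg by blast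
 have fL: "\<bar>f x - f y\<bar> \<le> L * dist x y" for x y using lipschitz_onD[OF L, of x y] by (simp add: dist_real_def)
 define A where "A k m a = {x. \<forall>b\<in>Basis. \<forall>t. \<bar>t\<bar> < inverse (real (Suc m)) \<longrightarrow>
   \<bar>f (x + t *\<^sub>R b) - f x - t * (a \<bullet> b)\<bar> \<le> \<bar>t\<bar> / real (Suc k)}" for k m and a :: 'a
 define P where "P k m a = {x \<in> A k m a. \<forall>e>0. \<exists>y d. 0 < d \<and> d < e \<and> dist x y \<le> d \<and>
   ball y (inverse (real (Suc k)) * d) \<inter> A k m a = {}}" for k m a
 have P_neg: "negligible (P k m a)" for k m a
 proof (rule negligible_porous[of "inverse (real (Suc k))"])
  fix x and e :: real assume "x \<in> P k m a" "e > 0"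
  thus "\<exists>y d. 0 < d \<and> d < e \<and> dist x y \<le> d \<and> ball y (inverse (real (Suc k)) * d) \<inter> P k m a = {}"
   unfolding P_def by blast
 qed (auto simp: field_simps)
 define N where "N = (\<Union>b\<in>Basis. {x. \<not> (\<lambda>t. f (x + t *\<^sub>R b)) differentiable (at 0)})
   \<union> (\<Union>k. \<Union>m. \<Union>a\<in>Q. P k m a)"
 have "negligible (\<Union>a\<in>Q. P k m a)" for k m using P_neg Q(1) by (intro negligible_countable_Union) auto
 hence "negligible (\<Union>m. \<Union>a\<in>Q. P k m a)" for k by (intro negligible_countable_Union) auto
 hence "negligible (\<Union>k. \<Union>m. \<Union>a\<in>Q. P k m a)" by (intro negligible_countable_Union) auto
 moreover have "negligible (\<Union>b\<in>Basis. {x. \<not> (\<lambda>t. f (x + t *\<^sub>R b)) differentiable (at 0)})"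
  using lipschitz_directional_derivative_ae[OF L] by (intro negligible_Union) auto
 ultimately have "negligible N" unfolding N_def by simp
 have diff: "f differentiable (at x)" if "x \<notin> N" for x
 proof -
  have "\<exists>D. DERIV (\<lambda>t. f (x + t *\<^sub>R b)) 0 :> D" if "b \<in> Basis" for b
   using \<open>x \<notin> N\<close> that unfolding N_def real_differentiable_def by auto
  then obtain D where D: "\<And>b. b \<in> Basis ==> DERIV (\<lambda>t. f (x + t *\<^sub>R b)) 0 :> D b" by metis
  define G where "G = (\<Sum>b\<in>Basis. D b *\<^sub>R b)"
  have Gb: "G \<bullet> b = D b" if "b \<in> Basis" for b
   unfolding G_def using that by (simp add: inner_sum_left inner_Basis if_distrib sum.delta' cong: if_cong)
  define n where "n = real DIM('a)"
  have n: "n \<ge> 1" unfolding n_def by (simp add: Suc_le_eq)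
  have est: "\<exists>d>0. \<forall>h. norm h < d \<longrightarrow> \<bar>f (x + h) - f x - G \<bullet> h\<bar> \<le> e * norm h" if "e > 0" for e
  proof -
   define C where "C = n * (2 * L * n + 1) + 1"
   have C: "C > 0" unfolding C_def using n L0 by (intro add_nonneg_pos mult_nonneg_nonneg) auto
   obtain k where k: "inverse (real (Suc k)) < e / C" using reals_Archimedean[of "e / C"] \<open>e > 0\<close> C by auto
   define \<epsilon> where "\<epsilon> = inverse (real (Suc k))"
   have \<epsilon>: "\<epsilon> > 0" "C * \<epsilon> \<le> e" unfolding \<epsilon>_def using k C by (auto simp: field_simps)
   obtain a where a: "a \<in> Q" "dist G a < \<epsilon> / 2" using Q(2)[of "ball G (\<epsilon> / 2)"] \<epsilon>(1) by auto
   have "\<exists>d>0. \<forall>t. \<bar>t\<bar> < d \<longrightarrow> \<bar>f (x + t *\<^sub>R b) - f x - t * (G \<bullet> b)\<bar> \<le> \<epsilon> / 2 * \<bar>t\<bar>" if "b \<in> Basis" for b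
   proof -
    have "(\<lambda>t. (f (x + t *\<^sub>R b) - f x) / t) \<midarrow>0\<rightarrow> D b" using D[OF that] by (simp add: DERIV_def)
    then obtain d where d: "d > 0" "\<And>t. t \<noteq> 0 ==> \<bar>t\<bar> < d ==> \<bar>(f (x + t *\<^sub>R b) - f x) / t - D b\<bar> < \<epsilon> / 2"
    using LIM_D[of _ "D b" 0 "\<epsilon> / 2"] \<epsilon>(1) by force
    have "\<bar>f (x + t *\<^sub>R b) - f x - t * (G \<bullet> b)\<bar> \<le> \<epsilon> / 2 * \<bar>t\<bar>" if "\<bar>t\<bar> < d" for t
    proof (cases "t = 0")
    case False
    have "f (x + t *\<^sub>R b) - f x - t * (G \<bullet> b) = ((f (x + t *\<^sub>R b) - f x) / t - D b) * t"
    using False Gb[OF \<open>b \<in> Basis\<close>] by (simp add: field_simps)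
    hence "\<bar>f (x + t *\<^sub>R b) - f x - t * (G \<bullet> b)\<bar> = \<bar>(f (x + t *\<^sub>R b) - f x) / t - D b\<bar> * \<bar>t\<bar>"
    by (simp add: abs_mult)
    also have "\<dots> \<le> \<epsilon> / 2 * \<bar>t\<bar>" using d(2)[OF False that] by (intro mult_right_mono) auto
    finally show ?thesis .
    qed simp
    thus ?thesis using d(1) by blast
   qed
   then obtain d where d: "\<And>b. b \<in> Basis ==> d b > 0"
    "\<And>b t. b \<in> Basis ==> \<bar>t\<bar> < d b ==> \<bar>f (x + t *\<^sub>R b) - f x - t * (G \<bullet> b)\<bar> \<le> \<epsilon> / 2 * \<bar>t\<bar>"
    by metis
   define d0 where "d0 = Min (d ` Basis)"
   have "d0 > 0" unfolding d0_def using d(1) by (subst Min_gr_iff) auto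
   have d0: "d0 \<le> d b" if "b \<in> Basis" for b unfolding d0_def using that by simp
   obtain m where m: "inverse (real (Suc m)) < d0" using reals_Archimedean[OF \<open>d0 > 0\<close>] by blast
   have xA: "x \<in> A k m a" unfolding A_def
   proof (intro CollectI ballI allI impI)
    fix b :: 'a and t :: real assume b: "b \<in> Basis" and t: "\<bar>t\<bar> < inverse (real (Suc m))"
    have "\<bar>(G - a) \<bullet> b\<bar> \<le> norm (G - a) * norm b" by (rule Cauchy_Schwarz_ineq2)
    hence 1: "\<bar>(G - a) \<bullet> b\<bar> \<le> \<epsilon> / 2" using a(2) b by (simp add: dist_norm)
    have "\<bar>f (x + t *\<^sub>R b) - f x - t * (G \<bullet> b)\<bar> \<le> \<epsilon> / 2 * \<bar>t\<bar>" using d(2)[OF b] d0[OF b] t m by simp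
    moreover have "\<bar>t * ((G - a) \<bullet> b)\<bar> \<le> \<bar>t\<bar> * (\<epsilon> / 2)"
    using 1 unfolding abs_mult by (intro mult_left_mono) auto
    moreover have "f (x + t *\<^sub>R b) - f x - t * (a \<bullet> b)
    = (f (x + t *\<^sub>R b) - f x - t * (G \<bullet> b)) + t * ((G - a) \<bullet> b)" by (simp add: inner_diff_left algebra_simps)
    ultimately have "\<bar>f (x + t *\<^sub>R b) - f x - t * (a \<bullet> b)\<bar> \<le> \<epsilon> / 2 * \<bar>t\<bar> + \<bar>t\<bar> * (\<epsilon> / 2)"
    by linarith
    also have "\<dots> = \<bar>t\<bar> * \<epsilon>" by simp
    also have "\<dots> = \<bar>t\<bar> / real (Suc k)" unfolding \<epsilon>_def divide_inverse ..
    finally show "\<bar>f (x + t *\<^sub>R b) - f x - t * (a \<bullet> b)\<bar> \<le> \<bar>t\<bar> / real (Suc k)" .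
   qed
   have "P k m a \<subseteq> N" using a(1) by (auto simp: N_def)
   hence "x \<notin> P k m a" using \<open>x \<notin> N\<close> by (rule contra_subsetD)
   hence "\<not> (\<forall>e>0. \<exists>y d. 0 < d \<and> d < e \<and> dist x y \<le> d \<and> ball y (\<epsilon> * d) \<inter> A k m a = {})"
    using xA unfolding P_def \<epsilon>_def by simp
   then obtain e0 where e0: "e0 > 0"
    "\<And>y d. 0 < d ==> d < e0 ==> dist x y \<le> d ==> ball y (\<epsilon> * d) \<inter> A k m a \<noteq> {}" by auto
   define d1 where "d1 = min (e0 / n) (inverse (real (Suc m)))"
   have "d1 > 0" unfolding d1_def using e0(1) n by simp
   have "\<bar>f (x + h) - f x - G \<bullet> h\<bar> \<le> e * norm h" if h: "norm h < d1" for h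
   proof (cases "h = 0")
    case False
    define s where "s J = (\<Sum>b\<in>J. (h \<bullet> b) *\<^sub>R b)" for J
    define \<Delta> where "\<Delta> = n * norm h"
    have hb: "\<bar>h \<bullet> b\<bar> \<le> norm h" if "b \<in> Basis" for b using Basis_le_norm[OF that] .
    have norm_s: "norm (s J) \<le> \<Delta>" if "J \<subseteq> Basis" for J
    proof -
    have "norm (s J) \<le> (\<Sum>b\<in>J. norm ((h \<bullet> b) *\<^sub>R b))" unfolding s_def by (rule norm_sum)
    also have "\<dots> \<le> (\<Sum>b\<in>J. norm h)" using that hb by (intro sum_mono) auto
    also have "\<dots> \<le> n * norm h" using card_mono[OF finite_Basis that] unfolding n_def by (simp add: mult_right_mono)
    finally show ?thesis unfolding \<Delta>_def .
    qed
    have \<Delta>: "0 < \<Delta>" "\<Delta> < e0" unfolding \<Delta>_def using False n h unfolding d1_def by (auto simp: field_simps)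
    have "\<bar>f (x + s J) - f x - (\<Sum>b\<in>J. (h \<bullet> b) * (a \<bullet> b))\<bar>
    \<le> real (card J) * ((2 * L * n + 1) * \<epsilon> * norm h)" if "J \<subseteq> Basis" for J
    using finite_subset[OF that finite_Basis] that
    proof (induction J rule: finite_induct)
    case empty thus ?case by (simp add: s_def)
    next
    case (insert b J)
    define y where "y = x + s J"
    have b: "b \<in> Basis" using insert.prems by simp
    have "dist x y \<le> \<Delta>" unfolding y_def using norm_s[of J] insert.prems by (simp add: dist_norm)
    then obtain z where z: "z \<in> A k m a" "dist y z < \<epsilon> * \<Delta>" using e0(2)[OF \<Delta>] by fastforce
    have "\<bar>h \<bullet> b\<bar> < inverse (real (Suc m))" using hb[OF b] h unfolding d1_def by simp
    hence 1: "\<bar>f (z + (h \<bullet> b) *\<^sub>R b) - f z - (h \<bullet> b) * (a \<bullet> b)\<bar> \<le> \<epsilon> * norm h"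
    proof -
    assume "\<bar>h \<bullet> b\<bar> < inverse (real (Suc m))"
    hence "\<bar>f (z + (h \<bullet> b) *\<^sub>R b) - f z - (h \<bullet> b) * (a \<bullet> b)\<bar> \<le> \<bar>h \<bullet> b\<bar> / real (Suc k)"
    using z(1) b unfolding A_def by blast
    also have "\<dots> \<le> norm h / real (Suc k)" using hb[OF b] by (intro divide_right_mono) auto
    finally show ?thesis unfolding \<epsilon>_def by (simp add: divide_inverse mult.commute)
    qed
    have "L * dist y z \<le> L * (\<epsilon> * \<Delta>)" using z(2) L0 by (simp add: mult_left_mono)
    hence 2: "\<bar>f y - f z\<bar> \<le> L * (\<epsilon> * \<Delta>)"
    and 3: "\<bar>f (y + (h \<bullet> b) *\<^sub>R b) - f (z + (h \<bullet> b) *\<^sub>R b)\<bar> \<le> L * (\<epsilon> * \<Delta>)"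
    using fL[of y z] fL[of "y + (h \<bullet> b) *\<^sub>R b" "z + (h \<bullet> b) *\<^sub>R b"] by (auto simp: dist_norm)
    have 4: "\<bar>f y - f x - (\<Sum>b\<in>J. (h \<bullet> b) * (a \<bullet> b))\<bar> \<le> real (card J) * ((2 * L * n + 1) * \<epsilon> * norm h)"
    using insert.IH insert.prems unfolding y_def by simp
    have s_ins: "x + s (insert b J) = y + (h \<bullet> b) *\<^sub>R b" unfolding s_def y_def using insert.hyps by (simp add: algebra_simps)
    have "\<bar>f (x + s (insert b J)) - f x - (\<Sum>b\<in>insert b J. (h \<bullet> b) * (a \<bullet> b))\<bar>
    \<le> real (card J) * ((2 * L * n + 1) * \<epsilon> * norm h) + (2 * (L * (\<epsilon> * \<Delta>)) + \<epsilon> * norm h)"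
    unfolding s_ins using 1 2 3 4 insert.hyps by simp
    also have "2 * (L * (\<epsilon> * \<Delta>)) + \<epsilon> * norm h = (2 * L * n + 1) * \<epsilon> * norm h"
    unfolding \<Delta>_def by (simp add: algebra_simps)
    finally show ?case using insert.hyps by (simp add: algebra_simps)
    qed
    from this[of Basis] have *: "\<bar>f (x + h) - f x - a \<bullet> h\<bar> \<le> n * ((2 * L * n + 1) * \<epsilon> * norm h)"
    unfolding s_def n_def by (simp add: euclidean_representation euclidean_inner[of a h] mult.commute)
    have "\<bar>(G - a) \<bullet> h\<bar> \<le> norm (G - a) * norm h" by (rule Cauchy_Schwarz_ineq2)
    also have "\<dots> \<le> \<epsilon> * norm h" using a(2) \<epsilon>(1) by (intro mult_right_mono) (auto simp: dist_norm)
    finally have "\<bar>f (x + h) - f x - G \<bullet> h\<bar> \<le> n * ((2 * L * n + 1) * \<epsilon> * norm h) + \<epsilon> * norm h"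
    using * by (simp add: inner_diff_left)
    also have "\<dots> = (C * \<epsilon>) * norm h" unfolding C_def by (simp add: algebra_simps)
    also have "\<dots> \<le> e * norm h" using \<epsilon>(2) by (simp add: mult_right_mono)
    finally show ?thesis .
   qed simp
   thus ?thesis using \<open>d1 > 0\<close> by blast
  qed
  have "(f has_derivative (\<lambda>h. G \<bullet> h)) (at x)" unfolding has_derivative_at_alt
  proof (intro conjI allI impI)
   show "bounded_linear ((\<bullet>) G)" by (rule bounded_linear_inner_right)
   fix e :: real assume "e > 0"
   from est[OF this] obtain d where d: "d > 0" "\<And>h. norm h < d ==> \<bar>f (x + h) - f x - G \<bullet> h\<bar> \<le> e * norm h" by blast
   show "\<exists>d>0. \<forall>y. norm (y - x) < d \<longrightarrow> norm (f y - f x - G \<bullet> (y - x)) \<le> e * norm (y - x)"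
    using d(1) d(2)[of "_ - x"] by (intro exI[of _ d]) auto
  qed
  thus ?thesis unfolding differentiable_def by blast
 qed
 have "{x. \<not> f differentiable (at x)} \<subseteq> N"
 proof
  fix x assume "x \<in> {x. \<not> f differentiable (at x)}"
  thus "x \<in> N" using diff[of x] by (cases "x \<in> N") simp_all
 qed
 thus ?thesis by (rule negligible_subset[OF \<open>negligible N\<close>])
qed

text \<open>Rademacher's theorem. Locally, each component extends to a Lipschitz function on the whole space.\<close>

theorem locally_lipschitz_differentiable_ae:
 fixes f :: "'a::euclidean_space => 'b::euclidean_space" assumes S: "open S" and f: "locally_lipschitz_on S f"
 shows "negligible {x \<in> S. \<not> f differentiable (at x)}"
proof (subst locally_negligible_alt, rule ballI)
 fix x assume "x \<in> {x \<in> S. \<not> f differentiable (at x)}"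
 hence "x \<in> S" by simp
 obtain e1 where e1: "e1 > 0" "ball x e1 \<subseteq> S" using S \<open>x \<in> S\<close> openE by blast
 obtain e2 L where e2: "e2 > 0" "L-lipschitz_on (ball x e2 \<inter> S) f"
  using f \<open>x \<in> S\<close> unfolding locally_lipschitz_on_def by blast
 define e where "e = min e1 e2 / 2"
 have e: "e > 0" "cball x e \<subseteq> ball x e2 \<inter> S" using e1 e2 unfolding e_def by (auto simp: subset_iff)
 define F where "F = f \<circ> closest_point (cball x e)"
 have cp: "closest_point (cball x e) y \<in> cball x e" for y using e(1) by (intro closest_point_in_set) auto
 have F_L: "L-lipschitz_on UNIV F"
 proof (rule lipschitz_onI)
  fix y z :: 'a
  have "dist (F y) (F z) \<le> L * dist (closest_point (cball x e) y) (closest_point (cball x e) z)"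
   unfolding F_def comp_def using subsetD[OF e(2) cp] by (intro lipschitz_onD[OF e2(2)])
  also have "\<dots> \<le> L * dist y z" using e(1) lipschitz_on_nonneg[OF e2(2)] by (intro mult_left_mono closest_point_lipschitz) auto
  finally show "dist (F y) (F z) \<le> L * dist y z" .
 qed (rule lipschitz_on_nonneg[OF e2(2)])
 have Fi_L: "L-lipschitz_on UNIV (\<lambda>y. F y \<bullet> i)" if "i \<in> Basis" for i
 proof (rule lipschitz_onI)
  fix y z :: 'a
  have "dist (F y \<bullet> i) (F z \<bullet> i) \<le> dist (F y) (F z)"
   using Basis_le_norm[OF that, of "F y - F z"] by (simp add: dist_norm inner_diff_left)
  also have "\<dots> \<le> L * dist y z" by (rule lipschitz_onD[OF F_L]) auto
  finally show "dist (F y \<bullet> i) (F z \<bullet> i) \<le> L * dist y z" .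
 qed (rule lipschitz_on_nonneg[OF e2(2)])
 define N where "N = (\<Union>i\<in>Basis. {y. \<not> (\<lambda>y. F y \<bullet> i) differentiable (at y)})"
 have "negligible N" unfolding N_def using lipschitz_differentiable_ae_real[OF Fi_L] by (intro negligible_Union) auto
 have "f differentiable (at y)" if "y \<in> ball x e" "y \<notin> N" for y
 proof -
  have "F differentiable (at y)" using that(2) unfolding N_def by (subst differentiable_componentwise_within) auto
  then obtain F' where "(F has_derivative F') (at y)" unfolding differentiable_def by blast
  moreover have "F z = f z" if "z \<in> ball x e" for z using that unfolding F_def by (simp add: closest_point_self)
  ultimately have "(f has_derivative F') (at y)" by (intro has_derivative_transform_within_open[of F F' y UNIV "ball x e" f]) (use that in auto)
  thus ?thesis unfolding differentiable_def by blast
 qed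
 hence "{x \<in> S. \<not> f differentiable (at x)} \<inter> ball x e \<subseteq> N" by blast
 hence "negligible ({x \<in> S. \<not> f differentiable (at x)} \<inter> ball x e)" by (rule negligible_subset[OF \<open>negligible N\<close>])
 thus "\<exists>U. openin (top_of_set {x \<in> S. \<not> f differentiable (at x)}) U \<and> x \<in> U \<and> negligible U"
  using \<open>x \<in> {x \<in> S. \<not> f differentiable (at x)}\<close> e(1) by (intro exI[of _ "{x \<in> S. \<not> f differentiable (at x)} \<inter> ball x e"]) auto
qed

section \<open>Calculus of locally Lipschitz functions\<close>

lemma loclip_subset:
 "locally_lipschitz_on S f ==> T \<subseteq> S ==> locally_lipschitz_on T f" unfolding locally_lipschitz_on_def
 by (metis Int_mono lipschitz_on_subset order_refl subset_eq)

lemma loclip_cong: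
 "(\<And>x. x \<in> S ==> f x = g x) ==> locally_lipschitz_on S f \<longleftrightarrow> locally_lipschitz_on S g"
 unfolding locally_lipschitz_on_def lipschitz_on_def by (metis Int_iff)

lemma lipschitz_on_imp_locally:
 "L-lipschitz_on S f ==> locally_lipschitz_on S f" unfolding locally_lipschitz_on_def by (meson inf_le2 lipschitz_on_subset zero_less_one)

lemma loclip_continuous: "locally_lipschitz_on S f ==> continuous_on S f" unfolding continuous_on_eq_continuous_within
proof
 fix x assume "locally_lipschitz_on S f" "x \<in> S"
 then obtain e L where e: "e > 0" "L-lipschitz_on (ball x e \<inter> S) f" unfolding locally_lipschitz_on_def by blast
 have "continuous (at x within (S \<inter> ball x e)) f"
  using lipschitz_on_continuous_within[OF e(2), of x] \<open>x \<in> S\<close> e(1) by (simp add: Int_commute)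
 thus "continuous (at x within S) f" using at_within_nhd[of x "ball x e" "S \<inter> ball x e" S] e(1) by (simp add: continuous_within Int_assoc)
qed

lemma loclip_const: "locally_lipschitz_on S (\<lambda>x. c)" by (rule lipschitz_on_imp_locally[OF lipschitz_on_constant])

lemma loclip_id: "locally_lipschitz_on S (\<lambda>x. x)" by (rule lipschitz_on_imp_locally[OF lipschitz_on_id])

lemma loclip_compose: assumes f: "locally_lipschitz_on S f" and g: "locally_lipschitz_on T g" and "f ` S \<subseteq> T"
 shows "locally_lipschitz_on S (\<lambda>x. g (f x))" unfolding locally_lipschitz_on_def
proof
 fix x assume x: "x \<in> S"
 then obtain e L where e: "e > 0" "L-lipschitz_on (ball x e \<inter> S) f" using f unfolding locally_lipschitz_on_def by blast
 have "f x \<in> T" using assms(3) x by blast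
 then obtain d M where d: "d > 0" "M-lipschitz_on (ball (f x) d \<inter> T) g" using g unfolding locally_lipschitz_on_def by blast
 have L: "L \<ge> 0" using e(2) lipschitz_on_nonneg by blast
 define r where "r = min e (d / (L + 1))"
 have r: "r > 0" unfolding r_def using e d L by simp
 have sub: "f ` (ball x r \<inter> S) \<subseteq> ball (f x) d \<inter> T"
 proof
  fix z assume "z \<in> f ` (ball x r \<inter> S)"
  then obtain y where y: "z = f y" "y \<in> S" "dist x y < r" by auto
  have "dist (f x) (f y) \<le> L * dist x y" using y x e(1) unfolding r_def by (intro lipschitz_onD[OF e(2)]) auto
  also have "\<dots> \<le> (L + 1) * dist x y" by (intro mult_right_mono) auto
  also have "\<dots> < (L + 1) * r" using y L by (intro mult_strict_left_mono) auto
  also have "\<dots> \<le> (L + 1) * (d / (L + 1))" using L unfolding r_def by (intro mult_left_mono) auto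
  also have "\<dots> = d" using L by simp
  finally show "z \<in> ball (f x) d \<inter> T" using y assms(3) by auto
 qed
 have "(M * L)-lipschitz_on (ball x r \<inter> S) (\<lambda>x. g (f x))"
  by (rule lipschitz_on_compose2[OF lipschitz_on_subset[OF e(2)] lipschitz_on_subset[OF d(2) sub]])
   (auto simp: r_def)
 thus "\<exists>\<epsilon>>0. \<exists>L. L-lipschitz_on (ball x \<epsilon> \<inter> S) (\<lambda>x. g (f x))" using r by blast
qed

lemma loclip_add:
 fixes f g :: "'a::metric_space => 'b::real_normed_vector" assumes "locally_lipschitz_on S f" "locally_lipschitz_on S g"
 shows "locally_lipschitz_on S (\<lambda>x. f x + g x)" unfolding locally_lipschitz_on_def
proof
 fix x assume "x \<in> S"
 then obtain e L d M where "e > 0" "L-lipschitz_on (ball x e \<inter> S) f" "d > 0" "M-lipschitz_on (ball x d \<inter> S) g"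
  using assms unfolding locally_lipschitz_on_def by meson
 hence "(L + M)-lipschitz_on (ball x (min e d) \<inter> S) (\<lambda>x. f x + g x)" by (intro lipschitz_on_add; elim lipschitz_on_subset) auto
 thus "\<exists>\<epsilon>>0. \<exists>L. L-lipschitz_on (ball x \<epsilon> \<inter> S) (\<lambda>x. f x + g x)"
  using \<open>e > 0\<close> \<open>d > 0\<close> by (intro exI[of _ "min e d"]) auto
qed

lemma loclip_bounded_linear: assumes "bounded_linear h" "locally_lipschitz_on S f" shows "locally_lipschitz_on S (\<lambda>x. h (f x))"
proof -
 obtain B where "B-lipschitz_on UNIV h" using bounded_linear.lipschitz_boundE[OF assms(1)] by metis
 thus ?thesis by (intro loclip_compose[OF assms(2) lipschitz_on_imp_locally]) auto
qed

lemma loclip_minus: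
 fixes f :: "'a::metric_space => 'b::real_normed_vector" shows "locally_lipschitz_on S f ==> locally_lipschitz_on S (\<lambda>x. - f x)"
 using loclip_bounded_linear[OF bounded_linear_minus[OF bounded_linear_ident]] .

lemma loclip_diff:
 fixes f g :: "'a::metric_space => 'b::real_normed_vector" assumes "locally_lipschitz_on S f" "locally_lipschitz_on S g"
 shows "locally_lipschitz_on S (\<lambda>x. f x - g x)" using loclip_add[OF assms(1) loclip_minus[OF assms(2)]] by simp

lemma loclip_sum:
 fixes f :: "'i => 'a::metric_space => 'b::real_normed_vector" assumes "\<And>i. i \<in> I ==> locally_lipschitz_on S (f i)"
 shows "locally_lipschitz_on S (\<lambda>x. \<Sum>i\<in>I. f i x)" using assms by (induction I rule: infinite_finite_induct)
  (auto intro: loclip_add loclip_const)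

lemma loclip_bilinear: assumes h: "bounded_bilinear h" and "locally_lipschitz_on S f" "locally_lipschitz_on S g"
 shows "locally_lipschitz_on S (\<lambda>x. h (f x) (g x))" unfolding locally_lipschitz_on_def
proof
 interpret bounded_bilinear h by fact
 fix x assume x: "x \<in> S"
 then obtain e L d M where e: "e > 0" "L-lipschitz_on (ball x e \<inter> S) f" "d > 0" "M-lipschitz_on (ball x d \<inter> S) g"
  using assms unfolding locally_lipschitz_on_def by meson
 obtain K where K: "K > 0" "\<And>a b. norm (h a b) \<le> norm a * norm b * K" using pos_bounded by blast
 define r where "r = min 1 (min e d)"
 have r: "r > 0" unfolding r_def using e by simp
 have LM: "L \<ge> 0" "M \<ge> 0" using e lipschitz_on_nonneg by blast+
 have fb: "norm (f y) \<le> norm (f x) + L" if "y \<in> ball x r \<inter> S" for y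
 proof -
  have "dist (f y) (f x) \<le> L * dist y x" using that x r unfolding r_def by (intro lipschitz_onD[OF e(2)]) auto
  also have "\<dots> \<le> L * 1" using that LM unfolding r_def by (intro mult_left_mono) (auto simp: dist_commute)
  finally show ?thesis using norm_triangle_ineq2[of "f y" "f x"] by (simp add: dist_norm)
 qed
 have gb: "norm (g y) \<le> norm (g x) + M" if "y \<in> ball x r \<inter> S" for y
 proof -
  have "dist (g y) (g x) \<le> M * dist y x" using that x r unfolding r_def by (intro lipschitz_onD[OF e(4)]) auto
  also have "\<dots> \<le> M * 1" using that LM unfolding r_def by (intro mult_left_mono) (auto simp: dist_commute)
  finally show ?thesis using norm_triangle_ineq2[of "g y" "g x"] by (simp add: dist_norm)
 qed
 define C where "C = (norm (f x) + L) * M * K + L * (norm (g x) + M) * K"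
 have "C-lipschitz_on (ball x r \<inter> S) (\<lambda>x. h (f x) (g x))"
 proof (rule lipschitz_onI)
  fix y z assume y: "y \<in> ball x r \<inter> S" and z: "z \<in> ball x r \<inter> S"
  have df: "norm (f y - f z) \<le> L * dist y z" using y z unfolding r_def dist_norm[symmetric] by (intro lipschitz_onD[OF e(2)]) auto
  have dg: "norm (g y - g z) \<le> M * dist y z" using y z unfolding r_def dist_norm[symmetric] by (intro lipschitz_onD[OF e(4)]) auto
  have "h (f y) (g y) - h (f z) (g z) = h (f y) (g y - g z) + h (f y - f z) (g z)" by (simp add: diff_left diff_right)
  hence "dist (h (f y) (g y)) (h (f z) (g z)) \<le> norm (h (f y) (g y - g z)) + norm (h (f y - f z) (g z))"
   by (simp add: dist_norm norm_triangle_ineq)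
  also have "\<dots> \<le> norm (f y) * norm (g y - g z) * K + norm (f y - f z) * norm (g z) * K" by (intro add_mono K)
  also have "\<dots> \<le> (norm (f x) + L) * (M * dist y z) * K + (L * dist y z) * (norm (g x) + M) * K"
   using K(1) LM df dg fb[OF y] gb[OF z] by (intro add_mono mult_mono) auto
  also have "\<dots> = C * dist y z" unfolding C_def by (simp add: algebra_simps)
  finally show "dist (h (f y) (g y)) (h (f z) (g z)) \<le> C * dist y z" .
 qed (use K LM in \<open>auto simp: C_def\<close>)
 thus "\<exists>\<epsilon>>0. \<exists>L. L-lipschitz_on (ball x \<epsilon> \<inter> S) (\<lambda>x. h (f x) (g x))" using r by blast
qed

lemmas loclip_scaleR = loclip_bilinear[OF bounded_bilinear_scaleR]
lemmas loclip_mult = loclip_bilinear[OF bounded_bilinear_mult]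
lemmas loclip_inner = loclip_bilinear[OF bounded_bilinear_inner]

lemma loclip_componentwise:
 fixes f :: "'a::metric_space => 'b::euclidean_space" assumes "\<And>b. b \<in> Basis ==> locally_lipschitz_on S (\<lambda>x. f x \<bullet> b)"
 shows "locally_lipschitz_on S f"
proof -
 have "locally_lipschitz_on S (\<lambda>x. \<Sum>b\<in>Basis. (f x \<bullet> b) *\<^sub>R b)"
  by (intro loclip_sum loclip_scaleR loclip_const assms)
 thus ?thesis by (simp add: euclidean_representation)
qed

lemma loclip_vec:
 fixes f :: "'a::metric_space => real^'n" assumes "\<And>i. locally_lipschitz_on S (\<lambda>x. f x $ i)" shows "locally_lipschitz_on S f"
 by (rule loclip_componentwise) (auto simp: Basis_vec_def inner_axis assms)

lemma loclip_nth:
 fixes f :: "'a::metric_space => 'b::real_normed_vector^'n" shows "locally_lipschitz_on S f ==> locally_lipschitz_on S (\<lambda>x. f x $ i)"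
 by (rule loclip_bounded_linear[OF bounded_linear_vec_nth])

lemma linear_norm_le_sum_Basis:
 fixes f :: "'a::euclidean_space => 'b::real_normed_vector" assumes "linear f" shows "norm (f x) \<le> (\<Sum>b\<in>Basis. norm (f b)) * norm x"
proof -
 have "f x = f (\<Sum>b\<in>Basis. (x \<bullet> b) *\<^sub>R b)" by (simp add: euclidean_representation)
 also have "\<dots> = (\<Sum>b\<in>Basis. (x \<bullet> b) *\<^sub>R f b)" using assms by (simp add: linear_sum linear_scale)
 finally have "norm (f x) \<le> (\<Sum>b\<in>Basis. \<bar>x \<bullet> b\<bar> * norm (f b))"
  by (metis (no_types, lifting) norm_scaleR norm_sum sum.cong)
 also have "\<dots> \<le> (\<Sum>b\<in>Basis. norm (f b) * norm x)"
  by (intro sum_mono, subst mult.commute) (simp add: Basis_le_norm mult_left_mono)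
 finally show ?thesis by (simp add: sum_distrib_right)
qed

lemma C1_imp_locally_lipschitz_on:
 fixes f :: "'a::euclidean_space => 'b::real_normed_vector" assumes S: "open S" and d: "\<And>x. x \<in> S ==> (f has_derivative f' x) (at x)"
  and c: "\<And>b. b \<in> Basis ==> continuous_on S (\<lambda>x. f' x b)" shows "locally_lipschitz_on S f" unfolding locally_lipschitz_on_def
proof
 fix x assume x: "x \<in> S"
 have "\<exists>e>0. \<forall>y\<in>ball x e. norm (f' y b) < norm (f' x b) + 1" if "b \<in> Basis" for b
 proof -
  have "isCont (\<lambda>x. f' x b) x" using c[OF that] S x continuous_on_eq_continuous_at by blast
  then obtain e where "e > 0" "\<And>y. dist y x < e ==> dist (f' y b) (f' x b) < 1" unfolding continuous_at_eps_delta by (meson zero_less_one)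
  thus ?thesis by (intro exI[of _ e]) (auto simp: dist_commute dist_norm, smt (verit) norm_triangle_ineq2)
 qed
 then obtain e where e: "\<And>b. b \<in> Basis ==> e b > 0"
  "\<And>b y. b \<in> Basis ==> y \<in> ball x (e b) ==> norm (f' y b) < norm (f' x b) + 1" by metis
 obtain e0 where e0: "e0 > 0" "ball x e0 \<subseteq> S" using S x openE by blast
 define r where "r = min e0 (Min (e ` Basis))"
 have r: "r > 0" unfolding r_def using e0 e(1) by (auto simp: Min_gr_iff)
 have sub: "ball x r \<subseteq> S" using e0 unfolding r_def by auto
 have rb: "ball x r \<subseteq> ball x (e b)" if "b \<in> Basis" for b
  using that unfolding r_def by (auto intro!: subset_ball simp: min.coboundedI2)
 define C where "C = (\<Sum>b\<in>Basis. norm (f' x b) + 1)"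
 have "C-lipschitz_on (ball x r) f"
 proof (rule bounded_derivative_imp_lipschitz)
  show "(f has_derivative f' y) (at y within ball x r)" if "y \<in> ball x r" for y
   using d sub that by (meson has_derivative_at_withinI subsetD)
  fix y assume y: "y \<in> ball x r"
  hence lin: "linear (f' y)" using d sub has_derivative_linear by blast
  show "onorm (f' y) \<le> C"
  proof (rule onorm_le)
   fix w
   have "norm (f' y w) \<le> (\<Sum>b\<in>Basis. norm (f' y b)) * norm w" by (rule linear_norm_le_sum_Basis[OF lin])
   also have "\<dots> \<le> C * norm w" unfolding C_def using subsetD[OF rb y] by (intro mult_right_mono sum_mono less_imp_le[OF e(2)]) auto
   finally show "norm (f' y w) \<le> C * norm w" .
  qed
 qed (auto simp: C_def intro: sum_nonneg)
 moreover have "ball x r \<inter> S = ball x r" using sub by blast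
 ultimately show "\<exists>\<epsilon>>0. \<exists>L. L-lipschitz_on (ball x \<epsilon> \<inter> S) f" using r by metis
qed

lemma real_C1_imp_locally_lipschitz_on:
 fixes f :: "real => real" assumes "open S" "\<And>x. x \<in> S ==> (f has_real_derivative f' x) (at x)" "continuous_on S f'"
 shows "locally_lipschitz_on S f" using assms by (intro C1_imp_locally_lipschitz_on[where f' = "\<lambda>x. (*) (f' x)"])
  (auto simp: has_field_derivative_def)

lemma loclip_inverse_real: "locally_lipschitz_on (- {0}) (inverse :: real => real)"
 by (rule real_C1_imp_locally_lipschitz_on[where f' = "\<lambda>x. - (inverse x ^ 2)"])
  (auto intro!: derivative_eq_intros continuous_intros simp: power2_eq_square)

lemma loclip_sqrt: "locally_lipschitz_on {0<..} sqrt" by (rule real_C1_imp_locally_lipschitz_on[where f' = "\<lambda>x. inverse (sqrt x) / 2"])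
  (auto intro!: derivative_eq_intros continuous_intros simp: field_simps)

lemma loclip_arctan: "locally_lipschitz_on UNIV arctan"
 by (rule real_C1_imp_locally_lipschitz_on[where f' = "\<lambda>x. inverse (1 + x\<^sup>2)"])
  (auto intro!: derivative_eq_intros continuous_intros simp: add_nonneg_eq_0_iff)

lemma loclip_divide:
 fixes f g :: "'a::metric_space => real" assumes "locally_lipschitz_on S f" "locally_lipschitz_on S g" "\<And>x. x \<in> S ==> g x \<noteq> 0"
 shows "locally_lipschitz_on S (\<lambda>x. f x / g x)" unfolding divide_inverse using assms
 by (intro loclip_mult loclip_compose[OF _ loclip_inverse_real]) auto

section \<open>Calculus of functions of class \<open>C\<^sup>k\<^sup>,\<^sup>1\<close>\<close>

lemma Ck1_on_subset: "Ck1_on k S f ==> T \<subseteq> S ==> Ck1_on k T f"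
proof (induction k arbitrary: f)
 case 0
 thus ?case using loclip_subset by simp blast
next
 case (Suc k)
 thus ?case by (simp add: subset_iff)
qed

lemma differentiable_transform_open: assumes "open S" "x \<in> S" "\<And>y. y \<in> S ==> f y = g y" "f differentiable (at x)"
 shows "g differentiable (at x)"
proof -
 obtain f' where "(f has_derivative f') (at x)" using assms(4) unfolding differentiable_def by blast
 hence "(g has_derivative f') (at x)" by (rule has_derivative_transform_within_open[OF _ assms(1,2)]) (rule assms(3))
 thus ?thesis unfolding differentiable_def by blast
qed

lemma Ck1_on_cong: assumes S: "open S" and eq: "\<And>x. x \<in> S ==> f x = g x" and f: "Ck1_on k S f" shows "Ck1_on k S g" using eq f
proof (induction k arbitrary: f g)
 case 0
 thus ?case using loclip_cong[of S f g] by simp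
next
 case (Suc k)
 show ?case unfolding Ck1_on.simps
 proof (intro conjI ballI)
  fix x assume "x \<in> S"
  thus "g differentiable (at x)" using Suc.prems differentiable_transform_open[OF S, of x f g] by simp
 next
  fix b :: 'a assume b: "b \<in> Basis"
  show "Ck1_on k S (\<lambda>x. frechet_derivative g (at x) b)"
  proof (rule Suc.IH)
   show "Ck1_on k S (\<lambda>x. frechet_derivative f (at x) b)" using Suc.prems b by simp
   fix x assume "x \<in> S"
   hence "frechet_derivative f (at x) = frechet_derivative g (at x)"
    using Suc.prems frechet_derivative_transform_within_open[of f x S g] S by simp
   thus "frechet_derivative f (at x) b = frechet_derivative g (at x) b" by simp
  qed
 qed
qed

lemma Ck1_on_1_iff:
 "Ck1_on 1 S f \<longleftrightarrow> (\<forall>x\<in>S. f differentiable (at x)) \<and>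
  (\<forall>b\<in>Basis. locally_lipschitz_on S (\<lambda>x. frechet_derivative f (at x) b))" unfolding One_nat_def by simp

lemma Ck1_on_1I: assumes "\<And>x. x \<in> S ==> (f has_derivative f' x) (at x)"
  and "\<And>b. b \<in> Basis ==> locally_lipschitz_on S (\<lambda>x. f' x b)" shows "Ck1_on 1 S f"
proof -
 have "frechet_derivative f (at x) = f' x" if "x \<in> S" for x using frechet_derivative_at[OF assms(1)[OF that]] by simp
 hence "locally_lipschitz_on S (\<lambda>x. frechet_derivative f (at x) b)" if "b \<in> Basis" for b
  using assms(2)[OF that] loclip_cong[of S "\<lambda>x. frechet_derivative f (at x) b" "\<lambda>x. f' x b"] by auto
 thus ?thesis unfolding Ck1_on_1_iff using assms(1) differentiable_def by blast
qed

lemma Ck1_on_1_has_derivative: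
 "Ck1_on 1 S f ==> x \<in> S ==> (f has_derivative frechet_derivative f (at x)) (at x)"
 unfolding Ck1_on_1_iff using frechet_derivative_works by blast

lemma linear_apply_locally_lipschitz_on:
 fixes F :: "'a::metric_space => 'c::euclidean_space => 'b::real_normed_vector" assumes lin: "\<And>x. x \<in> S ==> linear (F x)"
  and F: "\<And>b. b \<in> Basis ==> locally_lipschitz_on S (\<lambda>x. F x b)" and w: "locally_lipschitz_on S w"
 shows "locally_lipschitz_on S (\<lambda>x. F x (w x))"
proof -
 have "locally_lipschitz_on S (\<lambda>x. \<Sum>b\<in>Basis. (w x \<bullet> b) *\<^sub>R F x b)" by (intro loclip_sum loclip_scaleR loclip_inner
    loclip_const w F)
 moreover have "(\<Sum>b\<in>Basis. (w x \<bullet> b) *\<^sub>R F x b) = F x (w x)" if "x \<in> S" for x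
 proof -
  have "F x (w x) = F x (\<Sum>b\<in>Basis. (w x \<bullet> b) *\<^sub>R b)" by (simp add: euclidean_representation)
  thus ?thesis using lin[OF that] by (simp add: linear_sum linear_scale)
 qed
 ultimately show ?thesis
  using loclip_cong[of S "\<lambda>x. \<Sum>b\<in>Basis. (w x \<bullet> b) *\<^sub>R F x b" "\<lambda>x. F x (w x)"] by auto
qed

lemma Ck1_on_1_derivative_lipschitz: assumes f: "Ck1_on 1 S f" and w: "locally_lipschitz_on S w"
 shows "locally_lipschitz_on S (\<lambda>x. frechet_derivative f (at x) (w x))"
proof (rule linear_apply_locally_lipschitz_on[OF _ _ w])
 show "linear (frechet_derivative f (at x))" if "x \<in> S" for x using f that unfolding Ck1_on_1_iff by (intro linear_frechet_derivative) blast
qed (use f in \<open>auto simp: Ck1_on_1_iff\<close>)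

lemma Ck1_on_1_imp_0: assumes "open S" "Ck1_on 1 S f" shows "locally_lipschitz_on S f" using assms Ck1_on_1_has_derivative[OF assms(2)]
 by (intro C1_imp_locally_lipschitz_on[of S f "\<lambda>x. frechet_derivative f (at x)"])
  (auto simp: Ck1_on_1_iff loclip_continuous)

lemma Ck1_on_Suc_imp: assumes "open S" "Ck1_on (Suc k) S f" shows "Ck1_on k S f" using assms(2)
proof (induction k arbitrary: f)
 case 0
 thus ?case using Ck1_on_1_imp_0[OF assms(1)] by simp
next
 case (Suc k)
 thus ?case unfolding Ck1_on.simps(2)[of "Suc k"] by (simp del: Ck1_on.simps(2) add: Ck1_on.simps(2)[of k])
qed

lemma Ck1_on_1_compose:
 fixes f :: "'a::euclidean_space => 'b::euclidean_space"
 assumes S: "open S" and f: "Ck1_on 1 S f" and g: "Ck1_on 1 T g" and fS: "f ` S \<subseteq> T" shows "Ck1_on 1 S (\<lambda>x. g (f x))"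
proof (rule Ck1_on_1I)
 fix x assume "x \<in> S"
 thus "((\<lambda>x. g (f x)) has_derivative (\<lambda>w. frechet_derivative g (at (f x)) (frechet_derivative f (at x) w))) (at x)"
  using Ck1_on_1_has_derivative[OF f] Ck1_on_1_has_derivative[OF g] fS by (intro has_derivative_compose[of f _ x UNIV g]) auto
next
 fix b :: 'a assume "b \<in> Basis"
 have ll: "locally_lipschitz_on S f" using Ck1_on_1_imp_0[OF S f] .
 show "locally_lipschitz_on S (\<lambda>x. frechet_derivative g (at (f x)) (frechet_derivative f (at x) b))"
 proof (rule linear_apply_locally_lipschitz_on)
  show "linear (frechet_derivative g (at (f x)))" if "x \<in> S" for x
   using g fS that unfolding Ck1_on_1_iff by (intro linear_frechet_derivative) auto
  show "locally_lipschitz_on S (\<lambda>x. frechet_derivative g (at (f x)) c)" if "c \<in> Basis" for c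
   using g fS that unfolding Ck1_on_1_iff by (intro loclip_compose[OF ll]) auto
  show "locally_lipschitz_on S (\<lambda>x. frechet_derivative f (at x) b)" using f \<open>b \<in> Basis\<close> unfolding Ck1_on_1_iff by blast
 qed
qed

lemma Ck1_on_const: "Ck1_on k S (\<lambda>x. c)" by (induction k arbitrary: c) (auto intro: loclip_const)

lemma Ck1_on_bounded_linear_compose: assumes "open S" "bounded_linear h" "Ck1_on k S f" shows "Ck1_on k S (\<lambda>x. h (f x))" using assms(3)
proof (induction k arbitrary: f)
 case 0
 thus ?case using loclip_bounded_linear[OF assms(2)] by simp
next
 case (Suc k)
 have d: "((\<lambda>x. h (f x)) has_derivative (\<lambda>w. h (frechet_derivative f (at x) w))) (at x)" if "x \<in> S" for x
  using Suc.prems that by (intro bounded_linear.has_derivative[OF assms(2)]) (auto simp: frechet_derivative_works[symmetric])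
 have "Ck1_on k S (\<lambda>x. h (frechet_derivative f (at x) b))" if "b \<in> Basis" for b using Suc.prems that by (intro Suc.IH) auto
 moreover have "h (frechet_derivative f (at x) b) = frechet_derivative (\<lambda>x. h (f x)) (at x) b"
  if "x \<in> S" for x b using fun_cong[OF frechet_derivative_at[OF d[OF that]], of b] .
 ultimately have "Ck1_on k S (\<lambda>x. frechet_derivative (\<lambda>x. h (f x)) (at x) b)" if "b \<in> Basis" for b
  using that Ck1_on_cong[OF assms(1), of "\<lambda>x. h (frechet_derivative f (at x) b)"
    "\<lambda>x. frechet_derivative (\<lambda>x. h (f x)) (at x) b" k] by blast
 moreover have "\<forall>x\<in>S. (\<lambda>x. h (f x)) differentiable (at x)" using d differentiable_def by blast
 ultimately show ?case by simp
qed

lemma Ck1_on_bounded_linear: assumes "bounded_linear h" shows "Ck1_on (Suc k) S h"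
proof -
 have "frechet_derivative h (at x) = h" for x using frechet_derivative_at[OF bounded_linear_imp_has_derivative[OF assms]] by metis
 thus ?thesis using bounded_linear_imp_differentiable[OF assms] by (auto intro: Ck1_on_const)
qed

lemma Ck1_on_1_add: assumes "Ck1_on 1 S f" "Ck1_on 1 S g" shows "Ck1_on 1 S (\<lambda>x. f x + g x)" using assms
 by (intro Ck1_on_1I[where f' = "\<lambda>x w. frechet_derivative f (at x) w + frechet_derivative g (at x) w"])
  (auto intro!: has_derivative_add Ck1_on_1_has_derivative loclip_add simp: Ck1_on_1_iff)

lemma Ck1_on_1_bilinear: assumes S: "open S" and h: "bounded_bilinear h" and f: "Ck1_on 1 S f" and g: "Ck1_on 1 S g"
 shows "Ck1_on 1 S (\<lambda>x. h (f x) (g x))"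
proof (rule Ck1_on_1I)
 fix x assume "x \<in> S"
 thus "((\<lambda>x. h (f x) (g x)) has_derivative
  (\<lambda>w. h (f x) (frechet_derivative g (at x) w) + h (frechet_derivative f (at x) w) (g x))) (at x)"
  using Ck1_on_1_has_derivative[OF f] Ck1_on_1_has_derivative[OF g] by (intro bounded_bilinear.FDERIV[OF h]) auto
next
 fix b :: 'a assume "b \<in> Basis"
 thus "locally_lipschitz_on S (\<lambda>x. h (f x) (frechet_derivative g (at x) b) + h (frechet_derivative f (at x) b) (g x))"
  using f g Ck1_on_1_imp_0[OF S f] Ck1_on_1_imp_0[OF S g] unfolding Ck1_on_1_iff by (intro loclip_add loclip_bilinear[OF h]) simp_all
qed

lemma Ck1_on_1_real:
 fixes f :: "real => real" assumes "\<And>x. x \<in> S ==> (f has_real_derivative f' x) (at x)" "locally_lipschitz_on S f'" shows "Ck1_on 1 S f"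
 using assms by (intro Ck1_on_1I[where f' = "\<lambda>x. (*) (f' x)"]) (auto simp: has_field_derivative_def)

lemma Ck1_on_1_inverse_real: "Ck1_on 1 (- {0}) (inverse :: real => real)"
 by (rule Ck1_on_1_real[where f' = "\<lambda>x. - (inverse x * inverse x)"])
  (auto intro!: derivative_eq_intros loclip_minus loclip_mult
   loclip_inverse_real)

lemma Ck1_on_1_sqrt: "Ck1_on 1 {0<..} sqrt" by (rule Ck1_on_1_real[where f' = "\<lambda>x. (1 / sqrt x) * (1 / 2)"])
  (auto intro!: derivative_eq_intros loclip_mult loclip_divide
   loclip_const loclip_sqrt simp: field_simps)

text \<open>The identity \<open>M y - M x = M y (L x - L y) M x\<close>, once \<open>M y\<close> is known to be bounded for \<open>y\<close> near \<open>x\<close>.\<close>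

lemma linear_inverse_locally_lipschitz_on:
 fixes L M :: "'a::euclidean_space => 'b::euclidean_space => 'b"
 assumes lin: "\<And>x. x \<in> S ==> linear (L x)" and linM: "\<And>x. x \<in> S ==> linear (M x)"
  and L: "\<And>b. b \<in> Basis ==> locally_lipschitz_on S (\<lambda>x. L x b)"
  and leftinv: "\<And>x w. x \<in> S ==> M x (L x w) = w" and rightinv: "\<And>x w. x \<in> S ==> L x (M x w) = w"
 shows "locally_lipschitz_on S (\<lambda>x. M x w)" unfolding locally_lipschitz_on_def
proof
 fix x assume x: "x \<in> S"
 define n where "n = (\<Sum>b\<in>(Basis::'b set). norm (M x b)) + 1"
 have n: "n > 0" unfolding n_def by (intro add_nonneg_pos sum_nonneg) auto
 have "\<exists>e>0. \<exists>K\<ge>0. K-lipschitz_on (ball x e \<inter> S) (\<lambda>x. L x b)" if "b \<in> Basis" for b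
  using L[OF that] x lipschitz_on_nonneg unfolding locally_lipschitz_on_def by meson
 then obtain e K where e: "\<And>b. b \<in> Basis ==> e b > 0" "\<And>b. b \<in> Basis ==> K b \<ge> 0"
  "\<And>b. b \<in> Basis ==> (K b)-lipschitz_on (ball x (e b) \<inter> S) (\<lambda>x. L x b)" by metis
 define k where "k = (\<Sum>b\<in>Basis. K b)"
 have k: "k \<ge> 0" unfolding k_def using e(2) by (intro sum_nonneg) auto
 define r0 where "r0 = Min (e ` Basis)"
 have r0: "r0 > 0" unfolding r0_def using e(1) by (auto simp: Min_gr_iff)
 have r0_le: "r0 \<le> e b" if "b \<in> Basis" for b unfolding r0_def using that by simp
 have Ldiff: "norm (L y v - L z v) \<le> k * dist y z * norm v"
  if y: "y \<in> ball x r0 \<inter> S" and z: "z \<in> ball x r0 \<inter> S" for y z v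
 proof -
  have "linear (\<lambda>v. L y v - L z v)" using lin y z by (intro linear_compose_sub) auto
  hence "norm (L y v - L z v) \<le> (\<Sum>b\<in>Basis. norm (L y b - L z b)) * norm v" by (rule linear_norm_le_sum_Basis)
  also have "\<dots> \<le> (\<Sum>b\<in>Basis. K b * dist y z) * norm v"
  proof (intro mult_right_mono sum_mono norm_ge_zero)
   fix b :: 'b assume b: "b \<in> Basis"
   show "norm (L y b - L z b) \<le> K b * dist y z" unfolding dist_norm[of "L y b", symmetric]
    using y z r0_le[OF b] by (intro lipschitz_onD[OF e(3)[OF b]]) auto
  qed
  finally show ?thesis unfolding k_def by (simp add: sum_distrib_right)
 qed
 define r where "r = min r0 (1 / (2 * n * (k + 1)))"
 have r: "r > 0" unfolding r_def using r0 n k by simp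
 \<comment> \<open>near \<open>x\<close> the inverses are bounded by twice the bound at \<open>x\<close>\<close>
 have Mbound: "norm (M y v) \<le> 2 * n * norm v" if y: "y \<in> ball x r \<inter> S" for y v
 proof -
  define u where "u = M y v"
  have "norm (M x (L x u)) \<le> (n - 1) * norm (L x u)" unfolding n_def using linear_norm_le_sum_Basis[OF linM[OF x], of "L x u"] by simp
  also have "\<dots> \<le> n * norm (L x u)" by (intro mult_right_mono) auto
  finally have 1: "norm u \<le> n * norm (L x u)" using leftinv x by simp
  have 2: "norm (L x u) \<le> norm (L y u) + norm (L x u - L y u)" using norm_triangle_sub[of "L x u" "L y u"] by simp
  have 3: "norm (L x u - L y u) \<le> k * dist x y * norm u" using x y r0 unfolding r_def by (intro Ldiff) auto
  have "k * dist x y \<le> (k + 1) * (1 / (2 * n * (k + 1)))" using y k unfolding r_def by (intro mult_mono) auto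
  also have "\<dots> = 1 / (2 * n)" using k by simp
  finally have "k * dist x y * norm u \<le> 1 / (2 * n) * norm u" by (rule mult_right_mono) simp
  hence "norm (L x u) \<le> norm (L y u) + 1 / (2 * n) * norm u" using 2 3 by linarith
  hence "n * norm (L x u) \<le> n * (norm (L y u) + 1 / (2 * n) * norm u)" using n by (intro mult_left_mono) auto
  hence "norm u \<le> n * (norm (L y u) + 1 / (2 * n) * norm u)" using 1 by linarith
  hence "norm u \<le> 2 * n * norm (L y u)" using n by (simp add: algebra_simps)
  thus ?thesis unfolding u_def using rightinv y by simp
 qed
 define C where "C = 2 * n * k * (2 * n * norm w)"
 have "C-lipschitz_on (ball x r \<inter> S) (\<lambda>x. M x w)"
 proof (rule lipschitz_onI)
  fix y z assume y: "y \<in> ball x r \<inter> S" and z: "z \<in> ball x r \<inter> S"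
  have "M y w - M z w = M y (L z (M z w) - L y (M z w))" using y z rightinv leftinv linM by (simp add: linear_diff)
  hence "dist (M y w) (M z w) \<le> 2 * n * norm (L z (M z w) - L y (M z w))" unfolding dist_norm using Mbound[OF y] by simp
  also have "\<dots> \<le> 2 * n * (k * dist z y * (2 * n * norm w))"
  proof (rule mult_left_mono)
   have "norm (L z (M z w) - L y (M z w)) \<le> k * dist z y * norm (M z w)" using y z unfolding r_def by (intro Ldiff) auto
   also have "\<dots> \<le> k * dist z y * (2 * n * norm w)" using Mbound[OF z] k by (intro mult_left_mono) auto
   finally show "norm (L z (M z w) - L y (M z w)) \<le> k * dist z y * (2 * n * norm w)" .
  qed (use n in auto)
  also have "\<dots> = C * dist y z" unfolding C_def by (simp add: dist_commute)
  finally show "dist (M y w) (M z w) \<le> C * dist y z" .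
 qed (use n k in \<open>auto simp: C_def\<close>)
 thus "\<exists>\<epsilon>>0. \<exists>L. L-lipschitz_on (ball x \<epsilon> \<inter> S) (\<lambda>x. M x w)" using r by blast
qed

text \<open>The derivative of the inverse is the inverse of the derivative, hence again locally Lipschitz.\<close>

theorem Ck1_on_1_inverse:
 fixes f :: "'a::euclidean_space => 'a" assumes S: "open S" and T: "open T" and hom: "homeomorphism S T f g" and f: "Ck1_on 1 S f"
  and inj: "\<And>x w. x \<in> S ==> frechet_derivative f (at x) w = 0 ==> w = 0" shows "Ck1_on 1 T g"
proof -
 define L where "L x = frechet_derivative f (at x)" for x
 define M where "M x = inv (L x)" for x
 have lin: "linear (L x)" if "x \<in> S" for x unfolding L_def using f that unfolding Ck1_on_1_iff by (intro linear_frechet_derivative) auto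
 have bijL: "bij (L x)" if "x \<in> S" for x
 proof -
  have "inj (L x)" using linear_injective_0[OF lin[OF that]] inj[OF that] unfolding L_def by auto
  thus ?thesis using linear_injective_imp_surjective[OF lin[OF that]] unfolding bij_def by simp
 qed
 have leftinv: "M x (L x w) = w" and rightinv: "L x (M x w) = w" if "x \<in> S" for x w
  unfolding M_def using bijL[OF that] by (simp_all add: bij_is_inj bij_is_surj surj_f_inv_f)
 have linM: "linear (M x)" if "x \<in> S" for x
 proof (rule linearI)
  fix a b :: 'a and c :: real
  show "M x (a + b) = M x a + M x b" using leftinv[OF that, of "M x a + M x b"] by (simp add: rightinv[OF that] linear_add[OF lin[OF that]])
  show "M x (c *\<^sub>R b) = c *\<^sub>R M x b"
   using leftinv[OF that, of "c *\<^sub>R M x b"] by (simp add: rightinv[OF that] linear_scale[OF lin[OF that]])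
 qed
 have Lb: "locally_lipschitz_on S (\<lambda>x. L x b)" if "b \<in> Basis" for b using f that unfolding L_def Ck1_on_1_iff by blast
 have M_lip: "locally_lipschitz_on S (\<lambda>x. M x w)" for w
  by (rule linear_inverse_locally_lipschitz_on[of S L M, OF lin linM Lb leftinv rightinv])
 have gT: "g y \<in> S" "f (g y) = y" if "y \<in> T" for y using hom that unfolding homeomorphism_def by auto
 have g_cont: "continuous_on T g" using hom unfolding homeomorphism_def by auto
 have dg: "(g has_derivative M (g y)) (at y)" if "y \<in> T" for y
 proof (rule has_derivative_inverse_basic[where f = f and T = T])
  show "(f has_derivative L (g y)) (at (g y))" unfolding L_def using Ck1_on_1_has_derivative[OF f] gT that by blast
  show "bounded_linear (M (g y))" using linM gT that linear_conv_bounded_linear by blast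
  show "M (g y) \<circ> L (g y) = id" using leftinv gT that by auto
  show "isCont g y" using g_cont T that continuous_on_eq_continuous_at by blast
 qed (use that T gT in auto)
 have "continuous_on T (\<lambda>y. M (g y) b)" for b using gT by (intro continuous_on_compose2[OF loclip_continuous[OF M_lip] g_cont]) auto
 hence g_lip: "locally_lipschitz_on T g" using C1_imp_locally_lipschitz_on[of T g "\<lambda>y. M (g y)"] dg T by blast
 show ?thesis by (intro Ck1_on_1I[OF dg] loclip_compose[OF g_lip M_lip]) (auto simp: gT)
qed

theorem Ck1_on_1_local_inverse:
 fixes f :: "'a::euclidean_space => 'a" assumes S: "open S" and f: "Ck1_on 1 S f" and x0: "x0 \<in> S"
  and inj: "\<And>w. frechet_derivative f (at x0) w = 0 ==> w = 0"
 obtains U V g where "open U" "U \<subseteq> S" "x0 \<in> U" "open V" "homeomorphism U V f g" "Ck1_on 1 V g"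
proof -
 define f' where "f' x = Blinfun (frechet_derivative f (at x))" for x
 have bl: "bounded_linear (frechet_derivative f (at x))" if "x \<in> S" for x
  using Ck1_on_1_has_derivative[OF f that] has_derivative_bounded_linear by blast
 have app: "blinfun_apply (f' x) = frechet_derivative f (at x)" if "x \<in> S" for x
  unfolding f'_def using bl[OF that] by (simp add: bounded_linear_Blinfun_apply)
 have cont: "continuous_on S f'" unfolding continuous_on_eq_continuous_within
 proof
  fix x assume "x \<in> S"
  have "continuous (at x within S) (\<lambda>x. f' x b)" if "b \<in> Basis" for b
  proof -
   have "continuous_on S (\<lambda>x. frechet_derivative f (at x) b)" using f that unfolding Ck1_on_1_iff by (simp add: loclip_continuous)
   hence "continuous_on S (\<lambda>x. f' x b)" by (rule continuous_on_eq) (simp add: app)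
   thus ?thesis using \<open>x \<in> S\<close> continuous_on_eq_continuous_within by blast
  qed
  thus "continuous (at x within S) f'" by (rule continuous_blinfun_componentwiseI1)
 qed
 have "linear (f' x0)" by (simp add: bounded_linear.linear blinfun.bounded_linear_right)
 moreover have "inj (f' x0)" using linear_injective_0[OF \<open>linear (f' x0)\<close>] inj app[OF x0] by auto
 ultimately obtain h where h: "linear h" "h \<circ> f' x0 = id" using linear_injective_left_inverse by blast
 have "Blinfun h o\<^sub>L f' x0 = id_blinfun" using h by (intro blinfun_eqI)
   (simp add: bounded_linear_Blinfun_apply linear_conv_bounded_linear pointfree_idE)
 from inverse_function_theorem[OF S _ cont x0 this] obtain U V g g'
  where UV: "open U" "U \<subseteq> S" "x0 \<in> U" "open V" "homeomorphism U V f g"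
   "\<And>y. y \<in> V ==> bij (blinfun_apply (f' (g y)))" using Ck1_on_1_has_derivative[OF f] app by metis
 have "Ck1_on 1 V g"
 proof (rule Ck1_on_1_inverse[OF UV(1,4,5)])
  show "Ck1_on 1 U f" using Ck1_on_subset[OF f UV(2)] .
  fix x w assume x: "x \<in> U" and w: "frechet_derivative f (at x) w = 0"
  have "f x \<in> V" "g (f x) = x" using UV(5) x unfolding homeomorphism_def by auto
  hence "inj (blinfun_apply (f' x))" using UV(6)[of "f x"] by (simp add: bij_is_inj)
  moreover have "blinfun_apply (f' x) w = blinfun_apply (f' x) 0" using w app UV(2) x by auto
  ultimately show "w = 0" by (rule injD)
 qed
 thus ?thesis using that UV by blast
qed

section \<open>Ordinary differential equations with Lipschitz right-hand side\<close>

lemma vector_derivative_bound: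
 fixes w :: "real => 'a::real_normed_vector" assumes "convex S" "\<And>r. r \<in> S ==> (w has_vector_derivative w' r) (at r within S)"
  and "\<And>r. r \<in> S ==> norm (w' r) \<le> B" and "s \<in> S" "t \<in> S" shows "norm (w t - w s) \<le> B * \<bar>t - s\<bar>"
proof -
 have "onorm (\<lambda>h. h *\<^sub>R w' r) \<le> B" if "r \<in> S" for r using assms(3)[OF that]
  by (intro onorm_le) (metis norm_scaleR mult.commute mult_right_mono norm_ge_zero real_norm_def)
 hence "norm (w t - w s) \<le> B * norm (t - s)" using assms(2) unfolding has_vector_derivative_def
  by (intro differentiable_bound[OF assms(1) _ _ assms(5,4)]) auto
 thus ?thesis by simp
qed

text \<open>The function \<open>exp (- 2 K t) |w(t)|\<^sup>2\<close> does not increase, by the Cauchy--Schwarz inequality.\<close>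

lemma gronwall_forward:
 fixes w :: "real => 'a::real_inner" assumes "s \<le> t" and d: "\<And>r. s \<le> r ==> r \<le> t ==> (w has_vector_derivative w' r) (at r)"
  and b: "\<And>r. s \<le> r ==> r \<le> t ==> norm (w' r) \<le> K * norm (w r)" shows "norm (w t) \<le> exp (K * (t - s)) * norm (w s)"
proof -
 define \<phi> where "\<phi> r = exp (- 2 * K * (r - s)) * (w r \<bullet> w r)" for r
 have "\<phi> t \<le> \<phi> s"
 proof (rule DERIV_nonpos_imp_nonincreasing[OF assms(1)])
  fix r assume r: "s \<le> r" "r \<le> t"
  have "((\<lambda>r. w r \<bullet> w r) has_vector_derivative (w r \<bullet> w' r + w' r \<bullet> w r)) (at r)"
   by (rule bounded_bilinear.has_vector_derivative[OF bounded_bilinear_inner d[OF r] d[OF r]])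
  hence 1: "((\<lambda>r. w r \<bullet> w r) has_real_derivative 2 * (w r \<bullet> w' r)) (at r)"
   by (simp add: has_real_derivative_iff_has_vector_derivative inner_commute)
  have 2: "((\<lambda>r. exp (- 2 * K * (r - s))) has_real_derivative (- 2 * K) * exp (- 2 * K * (r - s))) (at r)"
   by (auto intro!: derivative_eq_intros)
  have "(\<phi> has_real_derivative ((- 2 * K) * exp (- 2 * K * (r - s)) * (w r \<bullet> w r)
    + (2 * (w r \<bullet> w' r)) * exp (- 2 * K * (r - s)))) (at r)" unfolding \<phi>_def by (rule DERIV_mult[OF 2 1])
  moreover have "(- 2 * K) * exp (- 2 * K * (r - s)) * (w r \<bullet> w r) + (2 * (w r \<bullet> w' r)) * exp (- 2 * K * (r - s)) \<le> 0"
  proof -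
   have "w r \<bullet> w' r \<le> norm (w r) * norm (w' r)" by (rule norm_cauchy_schwarz)
   also have "\<dots> \<le> norm (w r) * (K * norm (w r))" using b[OF r] by (intro mult_left_mono) auto
   also have "\<dots> = K * (w r \<bullet> w r)" by (simp add: power2_norm_eq_inner[symmetric] power2_eq_square)
   finally have "2 * exp (- 2 * K * (r - s)) * (w r \<bullet> w' r - K * (w r \<bullet> w r)) \<le> 0" by (intro mult_nonneg_nonpos) auto
   thus ?thesis by (simp add: algebra_simps)
  qed
  ultimately show "\<exists>y. DERIV \<phi> r :> y \<and> y \<le> 0" by blast
 qed
 hence "exp (- 2 * K * (t - s)) * (norm (w t))\<^sup>2 \<le> (norm (w s))\<^sup>2" unfolding \<phi>_def by (simp add: power2_norm_eq_inner)
 hence "exp (2 * K * (t - s)) * (exp (- 2 * K * (t - s)) * (norm (w t))\<^sup>2) \<le> exp (2 * K * (t - s)) * (norm (w s))\<^sup>2"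
  by (intro mult_left_mono) auto
 also have "exp (2 * K * (t - s)) * (exp (- 2 * K * (t - s)) * (norm (w t))\<^sup>2) = (norm (w t))\<^sup>2"
  by (simp add: mult.assoc[symmetric] exp_add[symmetric])
 also have "exp (2 * K * (t - s)) * (norm (w s))\<^sup>2 = (exp (K * (t - s)) * norm (w s))\<^sup>2"
  by (simp add: power_mult_distrib exp_double[symmetric] mult.assoc)
 finally show ?thesis by (rule power2_le_imp_le) simp
qed

lemma gronwall:
 fixes w :: "real => 'a::real_inner" assumes d: "\<And>r. r \<in> closed_segment s t ==> (w has_vector_derivative w' r) (at r)"
  and b: "\<And>r. r \<in> closed_segment s t ==> norm (w' r) \<le> K * norm (w r)"
 shows "norm (w t) \<le> exp (K * \<bar>t - s\<bar>) * norm (w s)"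
proof (cases "s \<le> t")
 case True
 thus ?thesis using gronwall_forward[of s t w w' K] d b by (simp add: closed_segment_eq_real_ivl)
next
 case False
 have "norm ((w \<circ> uminus) (- t)) \<le> exp (K * (- t - - s)) * norm ((w \<circ> uminus) (- s))"
 proof (rule gronwall_forward[where w' = "\<lambda>r. - w' (- r)"])
  fix r assume r: "- s \<le> r" "r \<le> - t"
  hence r': "- r \<in> closed_segment s t" using False by (auto simp: closed_segment_eq_real_ivl)
  show "(w \<circ> uminus has_vector_derivative - w' (- r)) (at r)"
  proof -
   have "((uminus :: real => real) has_vector_derivative (- 1)) (at r)" by (auto intro!: derivative_eq_intros)
   from vector_diff_chain_at[OF this d[OF r']] show ?thesis by simp
  qed
  show "norm (- w' (- r)) \<le> K * norm ((w \<circ> uminus) r)" using b[OF r'] by simp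
 qed (use False in auto)
 thus ?thesis using False by simp
qed

text \<open>Picard iteration is a contraction of the bounded continuous curves. Composition with the retraction of the line to
\<open>[-T, T]\<close> keeps the iteration in the complete space of bounded continuous functions on the whole line.\<close>

theorem picard_lindeloef_global:
 fixes F :: "'a::euclidean_space => 'a" assumes F: "K-lipschitz_on UNIV F" and T: "T > 0" and KT: "K * T < 1"
 obtains z where "z 0 = z0" "\<And>t. \<bar>t\<bar> < T ==> (z has_vector_derivative F (z t)) (at t)"
proof -
 have K: "K \<ge> 0" using F lipschitz_on_nonneg by blast
 have F_cont: "continuous_on UNIV F" using lipschitz_on_continuous_on[OF F] .
 define cl where "cl t = max (- T) (min t T)" for t
 have cl: "cl t \<in> {- T..T}" "\<bar>cl t\<bar> \<le> T" for t using T unfolding cl_def by auto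
 have cl_id: "cl t = t" if "\<bar>t\<bar> \<le> T" for t using that unfolding cl_def by auto
 define I where "I \<zeta> t = integral {- T..t} (\<lambda>s. F (apply_bcontfun \<zeta> s))
   - integral {- T..0} (\<lambda>s. F (apply_bcontfun \<zeta> s))" for \<zeta> t
 have cont: "continuous_on S (\<lambda>s. F (apply_bcontfun \<zeta> s))" for \<zeta> and S :: "real set"
  by (rule continuous_on_compose2[OF F_cont]) auto
 have I_deriv: "(I \<zeta> has_vector_derivative F (apply_bcontfun \<zeta> t)) (at t within {- T..T})"
  if "t \<in> {- T..T}" for \<zeta> t unfolding I_def
  using has_vector_derivative_diff[OF integral_has_vector_derivative[OF cont that] has_vector_derivative_const] by simp
 have I_cont: "continuous_on {- T..T} (I \<zeta>)" for \<zeta>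
  using I_deriv has_vector_derivative_continuous continuous_on_eq_continuous_within by blast
 define \<Phi> where "\<Phi> \<zeta> t = z0 + I \<zeta> (cl t)" for \<zeta> t
 have \<Phi>_bc: "\<Phi> \<zeta> \<in> bcontfun" for \<zeta>
 proof -
  have "continuous_on UNIV (\<lambda>t. I \<zeta> (cl t))"
   by (rule continuous_on_compose2[OF I_cont]) (use cl in \<open>auto simp: cl_def intro!: continuous_intros\<close>)
  hence c: "continuous_on UNIV (\<Phi> \<zeta>)" unfolding \<Phi>_def by (intro continuous_intros)
  have "bounded (I \<zeta> ` {- T..T})" using compact_continuous_image[OF I_cont] compact_imp_bounded by blast
  then obtain b where b: "\<And>t. t \<in> {- T..T} ==> norm (I \<zeta> t) \<le> b" unfolding bounded_iff by blast
  have "norm (\<Phi> \<zeta> t) \<le> norm z0 + b" for t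
   unfolding \<Phi>_def using norm_triangle_ineq[of z0 "I \<zeta> (cl t)"] b[OF cl(1)[of t]] by linarith
  thus ?thesis by (rule bcontfun_normI[OF c])
 qed
 define P where "P \<zeta> = Bcontfun (\<Phi> \<zeta>)" for \<zeta>
 have P_app: "apply_bcontfun (P \<zeta>) = \<Phi> \<zeta>" for \<zeta> unfolding P_def by (rule Bcontfun_inverse[OF \<Phi>_bc])
 have "dist (P \<zeta>) (P \<xi>) \<le> (K * T) * dist \<zeta> \<xi>" for \<zeta> \<xi>
 proof (rule dist_bound)
  fix t
  define D where "D t = I \<zeta> t - I \<xi> t" for t
  have "norm (D (cl t) - D 0) \<le> (K * dist \<zeta> \<xi>) * \<bar>cl t - 0\<bar>"
  proof (rule vector_derivative_bound[where S = "{- T..T}"])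
   fix r assume r: "r \<in> {- T..T}"
   show "(D has_vector_derivative (F (apply_bcontfun \<zeta> r) - F (apply_bcontfun \<xi> r))) (at r within {- T..T})"
    unfolding D_def using I_deriv[OF r] by (intro has_vector_derivative_diff) auto
   have "norm (F (apply_bcontfun \<zeta> r) - F (apply_bcontfun \<xi> r)) \<le> K * dist (apply_bcontfun \<zeta> r) (apply_bcontfun \<xi> r)"
    using lipschitz_onD[OF F] by (simp add: dist_norm)
   also have "\<dots> \<le> K * dist \<zeta> \<xi>" using dist_bounded K by (intro mult_left_mono) auto
   finally show "norm (F (apply_bcontfun \<zeta> r) - F (apply_bcontfun \<xi> r)) \<le> K * dist \<zeta> \<xi>" .
  qed (use cl T in auto)
  moreover have "D 0 = 0" unfolding D_def I_def by simp
  ultimately have "norm (D (cl t)) \<le> (K * dist \<zeta> \<xi>) * \<bar>cl t\<bar>" by simp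
  also have "\<dots> \<le> (K * dist \<zeta> \<xi>) * T" using cl K by (intro mult_left_mono) auto
  finally show "dist (apply_bcontfun (P \<zeta>) t) (apply_bcontfun (P \<xi>) t) \<le> (K * T) * dist \<zeta> \<xi>"
   unfolding P_app \<Phi>_def D_def by (simp add: dist_norm mult_ac)
 qed
 hence "\<exists>!\<zeta>\<in>UNIV. P \<zeta> = \<zeta>" using K T KT by (intro Banach_fix[where c = "K * T"]) auto
 then obtain \<zeta> where "P \<zeta> = \<zeta>" by blast
 hence z: "apply_bcontfun \<zeta> = \<Phi> \<zeta>" using P_app by metis
 have "\<Phi> \<zeta> 0 = z0" unfolding \<Phi>_def I_def using cl_id[of 0] T by simp
 moreover have "(\<Phi> \<zeta> has_vector_derivative F (\<Phi> \<zeta> t)) (at t)" if t: "\<bar>t\<bar> < T" for t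
 proof -
  have t': "t \<in> {- T<..<T}" using t by auto
  have "(I \<zeta> has_vector_derivative F (apply_bcontfun \<zeta> t)) (at t within {- T..T})" using t by (intro I_deriv) auto
  hence "(I \<zeta> has_vector_derivative F (apply_bcontfun \<zeta> t)) (at t)"
   using at_within_interior[of t "{- T..T}"] t' by (simp add: interior_atLeastAtMost_real)
  hence "((\<lambda>t. z0 + I \<zeta> t) has_vector_derivative F (\<Phi> \<zeta> t)) (at t)" unfolding z by (auto intro!: derivative_eq_intros)
  thus ?thesis by (rule has_vector_derivative_transform_within_open[where S = "{- T<..<T}"])
    (use t' in \<open>auto simp: \<Phi>_def cl_id abs_le_iff\<close>)
 qed
 ultimately show thesis using that by blast
qed

text \<open>A fixed point of the contraction \<open>v \<mapsto> y - (h v - v)\<close>. This replaces the inverse function theorem for \<open>exp\<close>, which is not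
known to be differentiable.\<close>

lemma lipschitz_perturbation_of_identity:
 fixes h :: "'a::euclidean_space => 'a"
 assumes h: "\<And>v w. norm v \<le> R ==> norm w \<le> R ==> norm (h v - h w - (v - w)) \<le> norm (v - w) / 4"
  and y: "norm (y - h 0) \<le> R / 2" and R: "0 \<le> R"
 obtains v where "norm v \<le> 4 / 3 * norm (y - h 0)" "norm v \<le> R" "h v = y"
proof -
 define \<rho> where "\<rho> = 4 / 3 * norm (y - h 0)"
 have \<rho>: "0 \<le> \<rho>" "\<rho> \<le> R" using y R unfolding \<rho>_def by auto
 define P where "P v = y - (h v - v)" for v
 have "\<exists>!v\<in>cball 0 \<rho>. P v = v"
 proof (rule Banach_fix[where c = "1/4"])
  show "complete (cball 0 \<rho> :: 'a set)" using complete_eq_closed closed_cball by blast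
  show "cball 0 \<rho> \<noteq> ({} :: 'a set)" using \<rho> by simp
  show "dist (P v) (P w) \<le> 1 / 4 * dist v w" if "v \<in> cball 0 \<rho>" "w \<in> cball 0 \<rho>" for v w
  proof -
   have "P v - P w = - (h v - h w - (v - w))" unfolding P_def by simp
   hence "norm (P v - P w) = norm (h v - h w - (v - w))" by (simp only: norm_minus_cancel)
   thus ?thesis using h[of v w] that \<rho> unfolding dist_norm by simp
  qed
  show "P ` cball 0 \<rho> \<subseteq> cball 0 \<rho>"
  proof clarify
   fix v :: 'a assume v: "v \<in> cball 0 \<rho>"
   have "P v = (y - h 0) - (h v - h 0 - (v - 0))" unfolding P_def by simp
   hence "norm (P v) \<le> norm (y - h 0) + norm (h v - h 0 - (v - 0))" by (metis norm_triangle_ineq4)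
   also have "\<dots> \<le> norm (y - h 0) + \<rho> / 4" using h[of v 0] v \<rho> R by simp
   finally show "P v \<in> cball 0 \<rho>" unfolding \<rho>_def by simp
  qed
 qed auto
 then obtain v where "norm v \<le> \<rho>" "P v = v" by auto
 hence "h v = y" unfolding P_def by (simp add: diff_eq_eq)
 thus thesis using that[of v] \<open>norm v \<le> \<rho>\<close> \<rho>(2) unfolding \<rho>_def by simp
qed

section \<open>Short geodesics in coordinates\<close>

text \<open>The geodesic equation in coordinates, \<open>B x u w\<close> standing for \<open>- \<Gamma>(x)(u, w)\<close>, on a ball so small that \<open>a K \<le> 1 / 2\<close>. The
quadratic dependence on the velocity is what gives the estimates below for all short velocities at once.\<close>

locale spray =
 fixes B :: "'a::euclidean_space => 'a => 'a => 'a" and x0 :: 'a and a K :: real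
 assumes a: "0 < a" and K: "0 \<le> K" and aK: "a * K \<le> 1 / 2" and bil: "\<And>x. x \<in> cball x0 a ==> bounded_bilinear (B x)"
  and bound: "\<And>x u w. x \<in> cball x0 a ==> norm (B x u w) \<le> K * norm u * norm w"
  and lip: "\<And>x y u w. x \<in> cball x0 a ==> y \<in> cball x0 a ==>
   norm (B x u w - B y u w) \<le> K * norm (x - y) * norm u * norm w"
begin

definition spray_curve :: "real set => (real => 'a) => (real => 'a) => bool" where
 "spray_curve I x u \<longleftrightarrow> (\<forall>t\<in>I. (x has_vector_derivative u t) (at t) \<and>
  (u has_vector_derivative B (x t) (u t) (u t)) (at t) \<and> x t \<in> cball x0 a)"

lemma spray_curveD: assumes "spray_curve I x u" "t \<in> I" shows "(x has_vector_derivative u t) (at t)"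
  and "(u has_vector_derivative B (x t) (u t) (u t)) (at t)" and "x t \<in> cball x0 a" using assms unfolding spray_curve_def by auto

lemma spray_diff_bound: assumes x: "x \<in> cball x0 a" and y: "y \<in> cball x0 a" and u: "norm u \<le> R" and w: "norm w \<le> R"
 shows "norm (B x u u - B y w w) \<le> 2 * K * R * norm (u - w) + K * R\<^sup>2 * norm (x - y)"
proof -
 interpret Bx: bounded_bilinear "B x" using bil[OF x] .
 have R: "0 \<le> R" using u norm_ge_zero order_trans by blast
 have "B x u u - B y w w = B x (u - w) u + B x w (u - w) + (B x w w - B y w w)" by (simp add: Bx.diff_left Bx.diff_right)
 hence "norm (B x u u - B y w w) \<le> norm (B x (u - w) u) + norm (B x w (u - w)) + norm (B x w w - B y w w)"
  by (metis norm_triangle_ineq norm_triangle_mono order_refl)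
 also have "\<dots> \<le> K * norm (u - w) * norm u + K * norm w * norm (u - w) + K * norm (x - y) * norm w * norm w"
  by (intro add_mono bound lip x y)
 also have "\<dots> \<le> K * norm (u - w) * R + K * R * norm (u - w) + K * norm (x - y) * R * R"
  using K u w R by (intro add_mono mult_mono mult_nonneg_nonneg) auto
 finally show ?thesis by (simp add: algebra_simps power2_eq_square)
qed

lemma spray_curve_unique: assumes x: "spray_curve I x u" and y: "spray_curve I y w" and I: "is_interval I"
  and s: "s \<in> I" "x s = y s" "u s = w s" and t: "t \<in> I" shows "x t = y t \<and> u t = w t"
proof -
 have sub: "closed_segment s t \<subseteq> I" using I s(1) t is_interval_convex convex_contains_segment by blast
 have cont: "continuous_on (closed_segment s t) u" "continuous_on (closed_segment s t) w" using spray_curveD(2)[OF x] spray_curveD(2)[OF y] sub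
  by (meson continuous_at_imp_continuous_on has_vector_derivative_continuous subsetD)+
 have "bounded (u ` closed_segment s t \<union> w ` closed_segment s t)"
  using compact_continuous_image[OF cont(1)] compact_continuous_image[OF cont(2)] by (simp add: compact_imp_bounded)
 then obtain R where R: "\<And>r. r \<in> closed_segment s t ==> norm (u r) \<le> R"
  "\<And>r. r \<in> closed_segment s t ==> norm (w r) \<le> R" unfolding bounded_iff by auto
 have R0: "R \<ge> 0" using R(1)[of s] norm_ge_zero order_trans by blast
 define z where "z r = (x r - y r, u r - w r)" for r
 have "norm (z t) \<le> exp ((1 + 2 * K * R + K * R\<^sup>2) * \<bar>t - s\<bar>) * norm (z s)"
 proof (rule gronwall)
  fix r assume r: "r \<in> closed_segment s t"
  hence "r \<in> I" using sub by blast
  note dx = spray_curveD[OF x this] and dy = spray_curveD[OF y this]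
  show "(z has_vector_derivative (u r - w r, B (x r) (u r) (u r) - B (y r) (w r) (w r))) (at r)" unfolding z_def using dx dy
   by (intro has_vector_derivative_Pair has_vector_derivative_diff) auto
  have "norm (u r - w r, B (x r) (u r) (u r) - B (y r) (w r) (w r))
    \<le> norm (u r - w r) + norm (B (x r) (u r) (u r) - B (y r) (w r) (w r))" by (rule norm_Pair_le)
  also have "\<dots> \<le> norm (z r) + (2 * K * R * norm (z r) + K * R\<^sup>2 * norm (z r))"
  proof (intro add_mono order_trans[OF spray_diff_bound[OF dx(3) dy(3) R(1)[OF r] R(2)[OF r]]])
   have 1: "norm (u r - w r) \<le> norm (z r)" and 2: "norm (x r - y r) \<le> norm (z r)"
    unfolding z_def by (rule norm_snd_le, rule norm_fst_le)
   show "norm (u r - w r) \<le> norm (z r)" by fact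
   show "2 * K * R * norm (u r - w r) \<le> 2 * K * R * norm (z r)" "K * R\<^sup>2 * norm (x r - y r) \<le> K * R\<^sup>2 * norm (z r)"
    using 1 2 K R0 by (intro mult_left_mono; simp)+
  qed
  finally show "norm (u r - w r, B (x r) (u r) (u r) - B (y r) (w r) (w r))
    \<le> (1 + 2 * K * R + K * R\<^sup>2) * norm (z r)" by (simp add: algebra_simps)
 qed
 moreover have "z s = 0" unfolding z_def using s by (simp add: zero_prod_def)
 ultimately have "z t = 0" by simp
 thus ?thesis unfolding z_def by (simp add: zero_prod_def)
qed

text \<open>Bound on the velocities for which geodesics are constructed.\<close>

definition speed :: real where "speed = min (a / 4) (1 / (100 * (1 + K)))"

lemma speed: "0 < speed" "4 * speed \<le> a" "100 * speed \<le> 1" "100 * (K * speed) \<le> 1"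
proof -
 show "0 < speed" "4 * speed \<le> a" unfolding speed_def using a K by auto
 have s: "speed \<le> 1 / (100 * (1 + K))" unfolding speed_def by simp
 hence *: "100 * speed + 100 * (K * speed) \<le> 1" using K by (simp add: field_simps)
 moreover have "0 \<le> K * speed" using K \<open>0 < speed\<close> by simp
 ultimately show "100 * speed \<le> 1" "100 * (K * speed) \<le> 1" using \<open>0 < speed\<close> by linarith+
qed

text \<open>Composition with the metric projections onto the unit ball of velocities and onto the ball of positions makes the vector
field globally Lipschitz without changing it where the solution lives.\<close>

lemma spray_curve_exists: assumes q: "q \<in> cball x0 (a / 2)" and v: "norm v \<le> speed / 2"
 shows "\<exists>x u. x 0 = q \<and> u 0 = v \<and> spray_curve {-2<..<2} x u \<and> (\<forall>t\<in>{-2<..<2}. norm (u t) \<le> speed)"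
proof -
 define \<eta> where "\<eta> = speed"
 have \<eta>: "0 < \<eta>" "4 * \<eta> \<le> a" "100 * \<eta> \<le> 1" "100 * (K * \<eta>) \<le> 1" unfolding \<eta>_def by (rule speed)+
 define P where "P w = closest_point (cball 0 1) w" for w :: 'a
 define Q where "Q x = closest_point (cball x0 a) x" for x :: 'a
 have P: "norm (P w) \<le> 1" for w using closest_point_in_set[of "cball 0 1" w] unfolding P_def by simp
 have Q: "Q x \<in> cball x0 a" for x using closest_point_in_set[of "cball x0 a" x] a unfolding Q_def by simp
 have P_lip: "norm (P w - P w') \<le> norm (w - w')" for w w'
  using closest_point_lipschitz[of "cball 0 1" w w'] unfolding P_def by (simp add: dist_norm)
 have Q_lip: "norm (Q x - Q x') \<le> norm (x - x')" for x x'
  using closest_point_lipschitz[of "cball x0 a" x x'] a unfolding Q_def by (simp add: dist_norm)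
 define F where "F z = (\<eta> *\<^sub>R P (snd z), \<eta> *\<^sub>R B (Q (fst z)) (P (snd z)) (P (snd z)))" for z :: "'a \<times> 'a"
 have F_lip: "(\<eta> * (1 + 3 * K))-lipschitz_on UNIV F"
 proof (rule lipschitz_onI)
  fix y z :: "'a \<times> 'a"
  have f: "norm (fst y - fst z) \<le> norm (y - z)" "norm (snd y - snd z) \<le> norm (y - z)"
   by (metis fst_diff norm_fst_le prod.collapse, metis snd_diff norm_snd_le prod.collapse)
  let ?py = "P (snd y)" and ?pz = "P (snd z)"
  have 1: "norm (?py - ?pz) \<le> norm (y - z)" using P_lip f(2) order_trans by blast
  have 2: "norm (Q (fst y) - Q (fst z)) \<le> norm (y - z)" using Q_lip f(1) order_trans by blast
  have "norm (B (Q (fst y)) ?py ?py - B (Q (fst z)) ?pz ?pz)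
    \<le> 2 * K * 1 * norm (?py - ?pz) + K * 1\<^sup>2 * norm (Q (fst y) - Q (fst z))" by (intro spray_diff_bound Q P)
  also have "\<dots> \<le> 2 * K * norm (y - z) + K * norm (y - z)" using 1 2 K by (intro add_mono) (auto intro!: mult_left_mono)
  finally have 3: "norm (B (Q (fst y)) ?py ?py - B (Q (fst z)) ?pz ?pz) \<le> 3 * K * norm (y - z)" by simp
  have "F y - F z = \<eta> *\<^sub>R (?py - ?pz, B (Q (fst y)) ?py ?py - B (Q (fst z)) ?pz ?pz)"
   unfolding F_def by (simp add: scaleR_diff_right)
  hence "norm (F y - F z) = \<eta> * norm (?py - ?pz, B (Q (fst y)) ?py ?py - B (Q (fst z)) ?pz ?pz)"
   by (simp only: norm_scaleR abs_of_pos[OF \<eta>(1)])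
  also have "\<dots> \<le> \<eta> * (norm (y - z) + 3 * K * norm (y - z))"
   using \<eta>(1) 1 3 by (intro mult_left_mono order_trans[OF norm_Pair_le] add_mono) auto
  finally show "dist (F y) (F z) \<le> \<eta> * (1 + 3 * K) * dist y z" by (simp add: dist_norm algebra_simps)
 qed (use \<eta> K in auto)
 have "\<eta> * (1 + 3 * K) * 2 = 2 * \<eta> + 6 * (K * \<eta>)" by (simp add: algebra_simps)
 hence "\<eta> * (1 + 3 * K) * 2 < 1" using \<eta> by linarith
 from picard_lindeloef_global[OF F_lip _ this, of "(q, (1 / \<eta>) *\<^sub>R v)"] obtain z where
  z0: "z 0 = (q, (1 / \<eta>) *\<^sub>R v)" and z: "\<And>t. \<bar>t\<bar> < 2 ==> (z has_vector_derivative F (z t)) (at t)" by auto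
 define x where "x t = fst (z t)" for t
 define w where "w t = snd (z t)" for t
 have dx: "(x has_vector_derivative \<eta> *\<^sub>R P (w t)) (at t)" if "\<bar>t\<bar> < 2" for t
  using bounded_linear.has_vector_derivative[OF bounded_linear_fst z[OF that]] unfolding x_def w_def F_def by simp
 have dw: "(w has_vector_derivative \<eta> *\<^sub>R B (Q (x t)) (P (w t)) (P (w t))) (at t)" if "\<bar>t\<bar> < 2" for t
  using bounded_linear.has_vector_derivative[OF bounded_linear_snd z[OF that]] unfolding x_def w_def F_def by simp
 have x_bound: "x t \<in> cball x0 a" if t: "\<bar>t\<bar> < 2" for t
 proof -
  have "norm (x t - x 0) \<le> \<eta> * \<bar>t - 0\<bar>"
  proof (rule vector_derivative_bound[where S = "{-2<..<2}"])
   show "(x has_vector_derivative \<eta> *\<^sub>R P (w r)) (at r within {-2<..<2})" if "r \<in> {-2<..<2}" for r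
    using that by (auto intro: has_vector_derivative_at_within[OF dx])
   show "norm (\<eta> *\<^sub>R P (w r)) \<le> \<eta>" for r using P[of "w r"] \<eta>(1) by simp
  qed (use t in auto)
  also have "\<dots> \<le> \<eta> * 2" using t \<eta>(1) by (intro mult_left_mono) auto
  finally have "norm (x t - q) \<le> a / 2" using \<eta>(2) z0 unfolding x_def by simp
  moreover have "norm (q - x0) \<le> a / 2" using q by (simp add: dist_norm norm_minus_commute)
  ultimately have "norm (x t - x0) \<le> a" using norm_triangle_ineq[of "x t - q" "q - x0"] by simp
  thus ?thesis by (simp add: dist_norm norm_minus_commute)
 qed
 have w_bound: "norm (w t) \<le> 1" if t: "\<bar>t\<bar> < 2" for t
 proof -
  have "norm (w t - w 0) \<le> (\<eta> * K) * \<bar>t - 0\<bar>"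
  proof (rule vector_derivative_bound[where S = "{-2<..<2}"])
   show "(w has_vector_derivative \<eta> *\<^sub>R B (Q (x r)) (P (w r)) (P (w r))) (at r within {-2<..<2})"
    if "r \<in> {-2<..<2}" for r using that by (auto intro: has_vector_derivative_at_within[OF dw])
   fix r
   have "norm (B (Q (x r)) (P (w r)) (P (w r))) \<le> K * norm (P (w r)) * norm (P (w r))" by (rule bound[OF Q])
   also have "\<dots> \<le> K * 1 * 1" using P[of "w r"] K by (intro mult_mono) auto
   finally show "norm (\<eta> *\<^sub>R B (Q (x r)) (P (w r)) (P (w r))) \<le> \<eta> * K" using \<eta>(1) by simp
  qed (use t in auto)
  also have "\<dots> \<le> (\<eta> * K) * 2" using t \<eta>(1) K by (intro mult_left_mono) auto
  also have "\<dots> \<le> 1 / 2" using \<eta>(4) by (simp add: mult.commute)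
  finally have 1: "norm (w t - w 0) \<le> 1 / 2" .
  have "norm (w 0) = norm v / \<eta>" unfolding w_def z0 using \<eta>(1) by simp
  also have "\<dots> \<le> (\<eta> / 2) / \<eta>" using v \<eta>(1) unfolding \<eta>_def by (intro divide_right_mono) auto
  also have "\<dots> = 1 / 2" using \<eta>(1) by simp
  finally have "norm (w 0) \<le> 1 / 2" .
  thus ?thesis using 1 norm_triangle_ineq[of "w t - w 0" "w 0"] by simp
 qed
 have Pw: "P (w t) = w t" and Qx: "Q (x t) = x t" if "\<bar>t\<bar> < 2" for t
  unfolding P_def Q_def using w_bound[OF that] x_bound[OF that] by (auto intro!: closest_point_self)
 define u where "u t = \<eta> *\<^sub>R w t" for t
 have "spray_curve {-2<..<2} x u" unfolding spray_curve_def
 proof (intro ballI conjI)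
  fix t :: real assume "t \<in> {-2<..<2}"
  hence t: "\<bar>t\<bar> < 2" by auto
  interpret Bx: bounded_bilinear "B (x t)" using bil[OF x_bound[OF t]] .
  show "(x has_vector_derivative u t) (at t)" using dx[OF t] Pw[OF t] unfolding u_def by simp
  have "(u has_vector_derivative \<eta> *\<^sub>R (\<eta> *\<^sub>R B (x t) (w t) (w t))) (at t)"
   using bounded_linear.has_vector_derivative[OF bounded_linear_scaleR_right dw[OF t], of \<eta>] Pw[OF t] Qx[OF t] unfolding u_def by simp
  thus "(u has_vector_derivative B (x t) (u t) (u t)) (at t)" unfolding u_def by (simp add: Bx.scaleR_left Bx.scaleR_right)
  show "x t \<in> cball x0 a" using x_bound[OF t] .
 qed
 moreover have "norm (u t) \<le> speed" if "t \<in> {-2<..<2}" for t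
  using w_bound[of t] that \<eta>(1) unfolding u_def \<eta>_def by (auto intro: mult_left_le)
 moreover have "x 0 = q" "u 0 = v" unfolding x_def u_def w_def z0 using \<eta>(1) by auto
 ultimately show ?thesis by blast
qed

definition geod :: "'a => 'a => (real => 'a) \<times> (real => 'a)" where
 "geod q v = (SOME c. fst c 0 = q \<and> snd c 0 = v \<and> spray_curve {-2<..<2} (fst c) (snd c) \<and>
  (\<forall>t\<in>{-2<..<2}. norm (snd c t) \<le> speed))"

definition pos :: "'a => 'a => real => 'a" where "pos q v = fst (geod q v)"
definition vel :: "'a => 'a => real => 'a" where "vel q v = snd (geod q v)"

lemma geod: assumes "q \<in> cball x0 (a / 2)" "norm v \<le> speed / 2"
 shows "pos q v 0 = q" "vel q v 0 = v" "spray_curve {-2<..<2} (pos q v) (vel q v)"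
  "\<And>t. t \<in> {-2<..<2} ==> norm (vel q v t) \<le> speed"
proof -
 let ?P = "\<lambda>c. fst c 0 = q \<and> snd c 0 = v \<and> spray_curve {-2<..<2} (fst c) (snd c) \<and>
  (\<forall>t\<in>{-2<..<2}. norm (snd c t) \<le> speed)"
 have "\<exists>c. ?P c" using spray_curve_exists[OF assms] by force
 hence "?P (geod q v)" unfolding geod_def by (rule someI_ex)
 thus "pos q v 0 = q" "vel q v 0 = v" "spray_curve {-2<..<2} (pos q v) (vel q v)"
  "\<And>t. t \<in> {-2<..<2} ==> norm (vel q v t) \<le> speed" unfolding pos_def vel_def by auto
qed

lemma geod_unique: assumes q: "q \<in> cball x0 (a / 2)" and v: "norm v \<le> speed / 2"
  and c: "spray_curve J x u" "x 0 = q" "u 0 = v" and J: "is_interval J" "J \<subseteq> {-2<..<2}" "0 \<in> J" and t: "t \<in> J"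
 shows "x t = pos q v t" "u t = vel q v t"
proof -
 have "spray_curve J (pos q v) (vel q v)" using geod(3)[OF q v] J(2) unfolding spray_curve_def by blast
 from spray_curve_unique[OF c(1) this J(1,3) _ _ t]
 show "x t = pos q v t" "u t = vel q v t" using c(2,3) geod(1,2)[OF q v] by auto
qed

text \<open>Affine reparametrisations of geodesics are geodesics.\<close>

lemma geod_scale: assumes q: "q \<in> cball x0 (a / 2)" and v: "norm v \<le> speed / 2" and s: "\<bar>s\<bar> \<le> 1" and t: "\<bar>t\<bar> < 2"
 shows "pos q (s *\<^sub>R v) t = pos q v (s * t)" "vel q (s *\<^sub>R v) t = s *\<^sub>R vel q v (s * t)"
proof -
 define x where "x r = pos q v (s * r)" for r
 define u where "u r = s *\<^sub>R vel q v (s * r)" for r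
 have c: "spray_curve {-2<..<2} x u" unfolding spray_curve_def
 proof (intro ballI conjI)
  fix r :: real assume r: "r \<in> {-2<..<2}"
  have "\<bar>s * r\<bar> \<le> \<bar>r\<bar>" using s by (simp add: abs_mult mult_left_le_one_le)
  hence sr: "s * r \<in> {-2<..<2}" using r by auto
  note d = spray_curveD[OF geod(3)[OF q v] sr]
  interpret Bx: bounded_bilinear "B (pos q v (s * r))" using bil[OF d(3)] .
  have lin: "((*) s has_vector_derivative s) (at r)" by (auto intro!: derivative_eq_intros)
  show "(x has_vector_derivative u r) (at r)" using vector_diff_chain_at[OF lin d(1)] unfolding x_def u_def comp_def by simp
  have "((\<lambda>r. vel q v (s * r)) has_vector_derivative s *\<^sub>R B (x r) (vel q v (s * r)) (vel q v (s * r))) (at r)"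
   using vector_diff_chain_at[OF lin d(2)] unfolding x_def comp_def by simp
  hence "(u has_vector_derivative s *\<^sub>R (s *\<^sub>R B (x r) (vel q v (s * r)) (vel q v (s * r)))) (at r)"
   unfolding u_def by (rule bounded_linear.has_vector_derivative[OF bounded_linear_scaleR_right])
  thus "(u has_vector_derivative B (x r) (u r) (u r)) (at r)" unfolding u_def x_def by (simp add: Bx.scaleR_left Bx.scaleR_right)
  show "x r \<in> cball x0 a" using d(3) unfolding x_def .
 qed
 have "norm (s *\<^sub>R v) \<le> norm v" using s by (simp add: mult_left_le_one_le)
 hence sv: "norm (s *\<^sub>R v) \<le> speed / 2" using v by linarith
 have "x 0 = q" "u 0 = s *\<^sub>R v" unfolding x_def u_def using geod(1,2)[OF q v] by auto
 from geod_unique[OF q sv c this _ order_refl] t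
 show "pos q (s *\<^sub>R v) t = pos q v (s * t)" "vel q (s *\<^sub>R v) t = s *\<^sub>R vel q v (s * t)"
  unfolding x_def u_def by (auto simp: is_interval_oo abs_less_iff)
qed

lemma geod_zero: assumes q: "q \<in> cball x0 (a / 2)" and t: "\<bar>t\<bar> < 2" shows "pos q 0 t = q" "vel q 0 t = 0"
 using geod_scale[OF q, of 0 0 t] geod(1)[OF q, of 0] speed(1) t by auto

text \<open>Two geodesics from the same point differ from two straight lines by an integral of \<open>B\<close>, which is quadratic in the small
velocities. The factor \<open>1 / 4\<close> in the last two estimates makes \<open>exp\<close> a Lipschitz perturbation of a translation.\<close>

lemma geod_lipschitz: assumes q: "q \<in> cball x0 (a / 2)" and v: "norm v \<le> speed / 2" and w: "norm w \<le> speed / 2"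
  and t: "\<bar>t\<bar> < 2" shows "norm (vel q v t - vel q w t) \<le> 3 * norm (v - w)"
  and "norm (pos q v t - pos q w t) \<le> 6 * norm (v - w)" and "norm (vel q v t - vel q w t - (v - w)) \<le> norm (v - w) / 4"
  and "\<bar>t\<bar> \<le> 1 ==> norm (pos q v t - pos q w t - t *\<^sub>R (v - w)) \<le> norm (v - w) / 4"
proof -
 note \<eta> = speed
 let ?I = "{-2<..<2} :: real set"
 note cv = spray_curveD[OF geod(3)[OF q v]] and cw = spray_curveD[OF geod(3)[OF q w]]
 note bv = geod(4)[OF q v] and bw = geod(4)[OF q w]
 define X where "X r = pos q v r - pos q w r" for r
 define U where "U r = vel q v r - vel q w r" for r
 define U' where "U' r = B (pos q v r) (vel q v r) (vel q v r) - B (pos q w r) (vel q w r) (vel q w r)" for r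
 have dX: "(X has_vector_derivative U r) (at r)" and dU: "(U has_vector_derivative U' r) (at r)" if "r \<in> ?I" for r
  unfolding X_def U_def U'_def using cv[OF that] cw[OF that] by (auto intro: has_vector_derivative_diff)
 have X0: "X 0 = 0" and U0: "U 0 = v - w" unfolding X_def U_def using geod(1,2)[OF q v] geod(1,2)[OF q w] by auto
 have U'_le: "norm (U' r) \<le> 2 * K * speed * norm (U r) + K * speed\<^sup>2 * norm (X r)" if "r \<in> ?I" for r
  unfolding U'_def U_def X_def using cv[OF that] cw[OF that] bv[OF that] bw[OF that] by (intro spray_diff_bound)
 \<comment> \<open>with velocities measured in units of \<open>speed\<close> the system has a small Lipschitz constant\<close>
 define Z where "Z r = (X r, (1 / speed) *\<^sub>R U r)" for r
 have Z_le: "norm (Z r) \<le> exp (1 / 2 * \<bar>r - 0\<bar>) * norm (Z 0)" if "r \<in> ?I" for r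
 proof (rule gronwall)
  fix s assume s: "s \<in> closed_segment 0 r"
  hence s: "s \<in> ?I" using that by (auto simp: closed_segment_eq_real_ivl split: if_splits)
  show "(Z has_vector_derivative (U s, (1 / speed) *\<^sub>R U' s)) (at s)" unfolding Z_def
   by (intro has_vector_derivative_Pair dX[OF s] bounded_linear.has_vector_derivative[OF bounded_linear_scaleR_right] dU[OF s])
  have 1: "norm (X s) \<le> norm (Z s)" "norm ((1 / speed) *\<^sub>R U s) \<le> norm (Z s)"
   unfolding Z_def by (rule norm_fst_le, rule norm_snd_le)
  have 2: "norm (U s) \<le> speed * norm (Z s)" using 1(2) \<eta>(1) by (simp add: field_simps)
  have 3: "norm (U' s) \<le> 2 * K * speed * (speed * norm (Z s)) + K * speed\<^sup>2 * norm (Z s)" using U'_le[OF s] 1(1) 2 K \<eta>(1)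
   by (elim order_trans) (intro add_mono mult_left_mono, auto)
  also have "\<dots> = speed * (3 * (K * speed) * norm (Z s))" by (simp add: power2_eq_square algebra_simps)
  finally have 4: "norm ((1 / speed) *\<^sub>R U' s) \<le> 3 * (K * speed) * norm (Z s)" using \<eta>(1) by (simp add: field_simps)
  have "norm (U s, (1 / speed) *\<^sub>R U' s) \<le> norm (U s) + norm ((1 / speed) *\<^sub>R U' s)" by (rule norm_Pair_le)
  also have "\<dots> \<le> (speed + 3 * (K * speed)) * norm (Z s)" using 2 4 by (simp add: algebra_simps)
  also have "\<dots> \<le> 1 / 2 * norm (Z s)" using \<eta>(3,4) by (intro mult_right_mono) auto
  finally show "norm (U s, (1 / speed) *\<^sub>R U' s) \<le> 1 / 2 * norm (Z s)" .
 qed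
 have U_le: "norm (U r) \<le> 3 * norm (v - w)" if "r \<in> ?I" for r
 proof -
  have "exp (1 / 2 * \<bar>r - 0\<bar>) \<le> exp 1" using that by auto
  hence "exp (1 / 2 * \<bar>r - 0\<bar>) \<le> 3" using exp_le by linarith
  hence "norm (Z r) \<le> 3 * norm (Z 0)" using Z_le[OF that] by (meson mult_right_mono norm_ge_zero order_trans)
  moreover have "norm ((1 / speed) *\<^sub>R U r) \<le> norm (Z r)" unfolding Z_def by (rule norm_snd_le)
  moreover have "norm (Z 0) = norm (v - w) / speed" unfolding Z_def X0 U0 norm_Pair norm_scaleR using \<eta>(1) by simp
  ultimately have "norm (U r) / speed \<le> 3 * (norm (v - w) / speed)" using \<eta>(1) by simp
  thus ?thesis using \<eta>(1) by (simp add: field_simps)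
 qed
 have X_le: "norm (X r) \<le> 6 * norm (v - w)" if "r \<in> ?I" for r
 proof -
  have "norm (X r - X 0) \<le> (3 * norm (v - w)) * \<bar>r - 0\<bar>" by (rule vector_derivative_bound[where S = ?I and w' = U])
    (use that U_le in \<open>auto intro: has_vector_derivative_at_within[OF dX]\<close>)
  also have "\<dots> \<le> (3 * norm (v - w)) * 2" using that by (intro mult_left_mono) auto
  finally show ?thesis using X0 by simp
 qed
 have U'_small: "norm (U' r) \<le> norm (v - w) / 8" if "r \<in> ?I" for r
 proof -
  have "norm (U' r) \<le> 2 * K * speed * (3 * norm (v - w)) + K * speed\<^sup>2 * (6 * norm (v - w))"
   using U'_le[OF that] U_le[OF that] X_le[OF that] K \<eta>(1) by (elim order_trans) (intro add_mono mult_left_mono, auto)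
  also have "\<dots> = (6 * (K * speed) + 6 * (K * speed) * speed) * norm (v - w)" by (simp add: power2_eq_square algebra_simps)
  also have "\<dots> \<le> 1 / 8 * norm (v - w)"
  proof (rule mult_right_mono)
   have "(K * speed) * speed \<le> (K * speed) * 1" using \<eta> K by (intro mult_left_mono) auto
   thus "6 * (K * speed) + 6 * (K * speed) * speed \<le> 1 / 8" using \<eta>(4) by simp
  qed simp
  finally show ?thesis by simp
 qed
 have U_small: "norm (U r - (v - w)) \<le> norm (v - w) / 4" if "r \<in> ?I" for r
 proof -
  have "norm (U r - U 0) \<le> (norm (v - w) / 8) * \<bar>r - 0\<bar>" by (rule vector_derivative_bound[where S = ?I and w' = U'])
    (use that U'_small in \<open>auto intro: has_vector_derivative_at_within[OF dU]\<close>)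
  also have "\<dots> \<le> (norm (v - w) / 8) * 2" using that by (intro mult_left_mono) auto
  finally show ?thesis using U0 by simp
 qed
 have tI: "t \<in> ?I" using t by auto
 show "norm (vel q v t - vel q w t) \<le> 3 * norm (v - w)"
  "norm (pos q v t - pos q w t) \<le> 6 * norm (v - w)"
  "norm (vel q v t - vel q w t - (v - w)) \<le> norm (v - w) / 4" using U_le[OF tI] X_le[OF tI] U_small[OF tI] unfolding U_def X_def by auto
 show "norm (pos q v t - pos q w t - t *\<^sub>R (v - w)) \<le> norm (v - w) / 4" if "\<bar>t\<bar> \<le> 1"
 proof -
  define Y where "Y r = X r - r *\<^sub>R (v - w)" for r
  have "norm (Y t - Y 0) \<le> (norm (v - w) / 4) * \<bar>t - 0\<bar>"
  proof (rule vector_derivative_bound[where S = ?I and w' = "\<lambda>r. U r - (v - w)"])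
   fix r :: real assume r: "r \<in> ?I"
   show "(Y has_vector_derivative U r - (v - w)) (at r within ?I)" unfolding Y_def
    by (rule has_vector_derivative_at_within) (auto intro!: derivative_eq_intros dX[OF r])
  qed (use tI U_small in auto)
  also have "\<dots> \<le> (norm (v - w) / 4) * 1" using that by (intro mult_left_mono) auto
  finally show ?thesis unfolding Y_def X0 by (simp add: X_def)
 qed
qed
end

context spray
begin

definition expo :: "'a => 'a => 'a" where "expo q v = pos q v 1"

lemma expo_near_translation: assumes "q \<in> cball x0 (a / 2)" "norm v \<le> speed / 2" "norm w \<le> speed / 2"
 shows "norm (expo q v - expo q w - (v - w)) \<le> norm (v - w) / 4" using geod_lipschitz(4)[OF assms, of 1] unfolding expo_def by simp

lemma expo_zero: "q \<in> cball x0 (a / 2) ==> expo q 0 = q" unfolding expo_def by (simp add: geod_zero)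

lemma expo_bilipschitz: assumes "q \<in> cball x0 (a / 2)" "norm v \<le> speed / 2" "norm w \<le> speed / 2"
 shows "norm (expo q v - expo q w) \<le> 5 / 4 * norm (v - w)" and "norm (v - w) \<le> 4 / 3 * norm (expo q v - expo q w)"
proof -
 let ?d = "expo q v - expo q w"
 have *: "norm (?d - (v - w)) \<le> norm (v - w) / 4" by (rule expo_near_translation[OF assms])
 have "norm ?d \<le> norm (v - w) + norm (?d - (v - w))" by (rule norm_triangle_sub)
 thus "norm ?d \<le> 5 / 4 * norm (v - w)" using * by simp
 have "norm (v - w) \<le> norm ?d + norm (v - w - ?d)" by (rule norm_triangle_sub)
 thus "norm (v - w) \<le> 4 / 3 * norm ?d" using * by (simp add: norm_minus_commute)
qed

text \<open>The squared Euclidean distance from the centre is a convex function of time: in its second derivative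
\<open>2 |u|\<^sup>2 + 2 (x - x0) \<bullet> B(x)(u, u)\<close> the condition \<open>a K \<le> 1 / 2\<close> makes the first term dominate.\<close>

lemma spray_curve_in_ball_convex: assumes c: "spray_curve {-2<..<2} x u" and \<delta>: "dist x0 (x 0) < \<delta>" "dist x0 (x 1) < \<delta>"
  and s: "s \<in> {0..1}" shows "dist x0 (x s) < \<delta>"
proof -
 define f where "f t = (x t - x0) \<bullet> (x t - x0)" for t
 have d: "(x has_vector_derivative u t) (at t)" "(u has_vector_derivative B (x t) (u t) (u t)) (at t)"
  "x t \<in> cball x0 a" if "t \<in> {0..1}" for t using spray_curveD[OF c, of t] that by auto
 have "convex_on {0..1} f"
 proof (rule f''_ge0_imp_convex)
  fix t :: real assume t: "t \<in> {0..1}"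
  have dx: "((\<lambda>t. x t - x0) has_vector_derivative u t) (at t)" using d(1)[OF t] by (auto intro!: derivative_eq_intros)
  have "(f has_vector_derivative ((x t - x0) \<bullet> u t + u t \<bullet> (x t - x0))) (at t)"
   unfolding f_def by (rule bounded_bilinear.has_vector_derivative[OF bounded_bilinear_inner dx dx])
  thus "(f has_real_derivative (2 * ((x t - x0) \<bullet> u t))) (at t)"
   by (simp add: has_real_derivative_iff_has_vector_derivative inner_commute)
  have "((\<lambda>t. (x t - x0) \<bullet> u t) has_vector_derivative ((x t - x0) \<bullet> B (x t) (u t) (u t) + u t \<bullet> u t)) (at t)"
   by (rule bounded_bilinear.has_vector_derivative[OF bounded_bilinear_inner dx d(2)[OF t]])
  hence "((\<lambda>t. (x t - x0) \<bullet> u t) has_real_derivative ((x t - x0) \<bullet> B (x t) (u t) (u t) + u t \<bullet> u t)) (at t)"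
   by (simp add: has_real_derivative_iff_has_vector_derivative)
  thus "((\<lambda>t. 2 * ((x t - x0) \<bullet> u t)) has_real_derivative (2 * ((x t - x0) \<bullet> B (x t) (u t) (u t) + u t \<bullet> u t))) (at t)"
   by (rule DERIV_cmult)
  have "\<bar>(x t - x0) \<bullet> B (x t) (u t) (u t)\<bar> \<le> norm (x t - x0) * norm (B (x t) (u t) (u t))" by (rule Cauchy_Schwarz_ineq2)
  also have "\<dots> \<le> a * (K * norm (u t) * norm (u t))"
   using d(3)[OF t] a by (intro mult_mono bound) (auto simp: dist_norm norm_minus_commute)
  also have "\<dots> = (a * K) * (u t \<bullet> u t)" by (simp add: power2_norm_eq_inner[symmetric] power2_eq_square)
  also have "\<dots> \<le> 1 / 2 * (u t \<bullet> u t)" using aK by (intro mult_right_mono) auto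
  finally have "- ((x t - x0) \<bullet> B (x t) (u t) (u t)) \<le> 1 / 2 * (u t \<bullet> u t)" by (rule abs_le_D2)
  moreover have "0 \<le> u t \<bullet> u t" by (rule inner_ge_zero)
  ultimately have "0 \<le> (x t - x0) \<bullet> B (x t) (u t) (u t) + u t \<bullet> u t" by argo
  thus "2 * ((x t - x0) \<bullet> B (x t) (u t) (u t) + u t \<bullet> u t) \<ge> 0" by (rule mult_nonneg_nonneg[rotated]) simp
 qed simp
 hence "f ((1 - s) *\<^sub>R 0 + s *\<^sub>R 1) \<le> (1 - s) * f 0 + s * f 1" using s by (intro convex_onD) auto
 moreover have fd: "f t = (dist x0 (x t))\<^sup>2" for t unfolding f_def dist_norm norm_minus_commute[of x0] power2_norm_eq_inner ..
 moreover have "(1 - s) * (dist x0 (x 0))\<^sup>2 + s * (dist x0 (x 1))\<^sup>2 < \<delta>\<^sup>2"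
 proof -
  have lt: "(dist x0 (x 0))\<^sup>2 < \<delta>\<^sup>2" "(dist x0 (x 1))\<^sup>2 < \<delta>\<^sup>2"
   using \<delta> by (auto intro!: power_strict_mono)
  define m where "m = max ((dist x0 (x 0))\<^sup>2) ((dist x0 (x 1))\<^sup>2)"
  have "(1 - s) * (dist x0 (x 0))\<^sup>2 + s * (dist x0 (x 1))\<^sup>2 \<le> (1 - s) * m + s * m"
   unfolding m_def using s by (intro add_mono mult_left_mono) auto
  also have "\<dots> = m" by (simp add: algebra_simps)
  finally show ?thesis using lt unfolding m_def by (simp add: max_def split: if_splits)
 qed
 ultimately have "(dist x0 (x s))\<^sup>2 < \<delta>\<^sup>2" by simp
 moreover have "0 \<le> \<delta>" using \<delta>(1) zero_le_dist[of x0 "x 0"] by linarith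
 ultimately show ?thesis by (rule power2_less_imp_less)
qed

definition expo_dom :: "real => 'a => 'a set" where
 "expo_dom \<delta> q = {v \<in> ball 0 (speed / 2). expo q v \<in> ball x0 \<delta>}"

definition expo_inv :: "real => 'a => 'a => 'a" where
 "expo_inv \<delta> q = inv_into (expo_dom \<delta> q) (expo q)"

context
 fixes \<delta> :: real and q :: 'a assumes \<delta>: "16 * \<delta> \<le> speed" and q: "q \<in> ball x0 \<delta>"
begin

lemma q_in_half_ball: "q \<in> cball x0 (a / 2)" using q \<delta> speed by (auto simp: dist_norm)

lemma expo_domD:
 "v \<in> expo_dom \<delta> q ==> norm v \<le> speed / 2" "v \<in> expo_dom \<delta> q ==> expo q v \<in> ball x0 \<delta>"
 unfolding expo_dom_def by auto

lemma expo_inj: "inj_on (expo q) (expo_dom \<delta> q)" using expo_bilipschitz(2)[OF q_in_half_ball] expo_domD by (fastforce intro!: inj_onI)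

text \<open>The perturbation of the identity is inverted in the ball of velocities, where it covers the small coordinate ball.\<close>

lemma expo_surj: "expo q ` expo_dom \<delta> q = ball x0 \<delta>"
proof (intro equalityI subsetI)
 fix x assume x: "x \<in> ball x0 \<delta>"
 have "norm (x - expo q 0) \<le> norm (x - x0) + norm (x0 - q)"
  using norm_triangle_ineq[of "x - x0" "x0 - q"] by (simp add: expo_zero[OF q_in_half_ball])
 also have "\<dots> < 2 * \<delta>" using x q by (simp add: dist_norm norm_minus_commute)
 finally have *: "norm (x - expo q 0) < 2 * \<delta>" .
 obtain v where v: "norm v \<le> 4 / 3 * norm (x - expo q 0)" "expo q v = x" using lipschitz_perturbation_of_identity[of "speed / 4" "expo q" x]
   expo_near_translation[OF q_in_half_ball] * \<delta> speed(1) by auto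
 have "norm v < speed / 2" using v(1) * \<delta> speed(1) by linarith
 hence "v \<in> expo_dom \<delta> q" unfolding expo_dom_def using v(2) x by simp
 thus "x \<in> expo q ` expo_dom \<delta> q" using v(2) by blast
qed (use expo_domD in auto)

lemma expo_continuous: "continuous_on (ball 0 (speed / 2)) (expo q)"
proof -
 have "(5 / 4)-lipschitz_on (ball 0 (speed / 2)) (expo q)"
  using expo_bilipschitz(1)[OF q_in_half_ball] by (intro lipschitz_onI) (auto simp: dist_norm)
 thus ?thesis by (rule lipschitz_on_continuous_on)
qed

lemma expo_dom_open: "open (expo_dom \<delta> q)"
proof -
 have "expo_dom \<delta> q = ball 0 (speed / 2) \<inter> expo q -` ball x0 \<delta>" unfolding expo_dom_def by auto
 thus ?thesis using continuous_on_open_vimage[of "ball 0 (speed / 2)" "expo q"] expo_continuous by (auto simp: Int_commute)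
qed

lemma expo_dom_star: "v \<in> expo_dom \<delta> q ==> s \<in> {0..1} ==> s *\<^sub>R v \<in> expo_dom \<delta> q"
proof -
 assume v: "v \<in> expo_dom \<delta> q" and s: "s \<in> {0..1::real}"
 note v' = expo_domD[OF v]
 have "dist x0 (pos q v s) < \<delta>"
 proof (rule spray_curve_in_ball_convex[OF geod(3)[OF q_in_half_ball v'(1)]])
  show "dist x0 (pos q v 0) < \<delta>" using geod(1)[OF q_in_half_ball v'(1)] q by simp
  show "dist x0 (pos q v 1) < \<delta>" using v'(2) unfolding expo_def by simp
 qed (use s in auto)
 moreover have "expo q (s *\<^sub>R v) = pos q v s" unfolding expo_def using geod_scale(1)[OF q_in_half_ball v'(1), of s 1] s by simp
 moreover have "norm (s *\<^sub>R v) < speed / 2"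
 proof -
  have "norm (s *\<^sub>R v) \<le> norm v" using s by (simp add: mult_left_le_one_le)
  thus ?thesis using v unfolding expo_dom_def by simp
 qed
 ultimately show ?thesis unfolding expo_dom_def by simp
qed

lemma expo_inv:
 "x \<in> ball x0 \<delta> ==> expo_inv \<delta> q x \<in> expo_dom \<delta> q"
 "x \<in> ball x0 \<delta> ==> expo q (expo_inv \<delta> q x) = x"
 "v \<in> expo_dom \<delta> q ==> expo_inv \<delta> q (expo q v) = v"
 unfolding expo_inv_def using expo_surj inv_into_into[of x "expo q"] f_inv_into_f[of x "expo q"]
  inv_into_f_f[OF expo_inj] by auto

lemma expo_lipschitz: "(5 / 4)-lipschitz_on (expo_dom \<delta> q) (expo q)"
 using expo_bilipschitz(1)[OF q_in_half_ball] expo_domD by (intro lipschitz_onI) (auto simp: dist_norm)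

lemma expo_inv_lipschitz: "(4 / 3)-lipschitz_on (ball x0 \<delta>) (expo_inv \<delta> q)"
proof (rule lipschitz_onI)
 fix x y assume xy: "x \<in> ball x0 \<delta>" "y \<in> ball x0 \<delta>"
 show "dist (expo_inv \<delta> q x) (expo_inv \<delta> q y) \<le> 4 / 3 * dist x y"
  using expo_bilipschitz(2)[OF q_in_half_ball expo_domD(1)[OF expo_inv(1)[OF xy(1)]] expo_domD(1)[OF expo_inv(1)[OF xy(2)]]]
   expo_inv(2)[OF xy(1)] expo_inv(2)[OF xy(2)] by (simp add: dist_norm)
qed simp

lemma expo_homeomorphism: "homeomorphism (expo_dom \<delta> q) (ball x0 \<delta>) (expo q) (expo_inv \<delta> q)"
 using lipschitz_on_continuous_on[OF expo_lipschitz] lipschitz_on_continuous_on[OF expo_inv_lipschitz]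
  expo_surj expo_inv expo_domD(2) by (intro homeomorphismI) auto

end
end

section \<open>The Gauss lemma\<close>

lemma bounded_bilinear_matrix_vector_mult: "bounded_bilinear ((*v) :: real^'n^'m => real^'n => real^'m)"
 unfolding bilinear_conv_bounded_bilinear[symmetric] bilinear_def
 by (auto intro!: linearI simp: algebra_simps matrix_vector_mult_def vec_eq_iff sum.distrib
   scaleR_sum_right sum_distrib_left)

text \<open>A spray that is the geodesic spray of a metric \<open>M\<close> with Lipschitz derivative. The equation is used in its weak form,
tested against a vector \<open>w\<close>; it involves only \<open>M\<close> and its first derivative.\<close>

locale metric_spray = spray B x0 a K for B :: "real^'n => real^'n => real^'n => real^'n" and x0 a K +
 fixes M :: "real^'n => real^'n^'n" and DM :: "real^'n => real^'n => real^'n^'n" and L :: real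
 assumes M_deriv: "\<And>x. x \<in> cball x0 a ==> (M has_derivative DM x) (at x)"
  and M_sym: "\<And>x. x \<in> cball x0 a ==> transpose (M x) = M x" and L: "0 \<le> L"
  and M_bound: "\<And>x. x \<in> cball x0 a ==> norm (M x) \<le> L"
  and DM_bound: "\<And>x h. x \<in> cball x0 a ==> norm (DM x h) \<le> L * norm h"
  and DM_lip: "\<And>x y h. x \<in> cball x0 a ==> y \<in> cball x0 a ==>
   norm (DM x h - DM y h) \<le> L * norm (x - y) * norm h" and geodesic: "\<And>x u w. x \<in> cball x0 a ==>
   B x u u \<bullet> (M x *v w) = - (u \<bullet> (DM x u *v w)) + (u \<bullet> (DM x w *v u)) / 2" and M_center: "M x0 = mat 1"
  and M_near: "\<And>x u w. x \<in> cball x0 a ==> \<bar>u \<bullet> (M x *v w) - u \<bullet> w\<bar> \<le> norm u * norm w / 10"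
begin

lemma M_symmetric: "x \<in> cball x0 a ==> u \<bullet> (M x *v w) = w \<bullet> (M x *v u)"
 by (metis M_sym dot_lmul_matrix inner_commute transpose_matrix_vector)

lemma M_taylor: assumes "x \<in> cball x0 a" "y \<in> cball x0 a" shows "norm (M y - M x - DM x (y - x)) \<le> L * (norm (y - x))\<^sup>2"
proof -
 have seg: "x + t *\<^sub>R (y - x) \<in> cball x0 a" if "t \<in> {0..1}" for t
 proof -
  have "(1 - t) *\<^sub>R x + t *\<^sub>R y \<in> cball x0 a" using that assms convexD_alt[OF convex_cball] by auto
  thus ?thesis by (simp add: algebra_simps)
 qed
 define \<phi> where "\<phi> t = M (x + t *\<^sub>R (y - x)) - t *\<^sub>R DM x (y - x)" for t :: real
 have "norm (\<phi> 1 - \<phi> 0) \<le> (L * (norm (y - x))\<^sup>2) * \<bar>1 - 0\<bar>"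
 proof (rule vector_derivative_bound[where S = "{0..1}"])
  fix t :: real assume t: "t \<in> {0..1}"
  have "((\<lambda>t. M (x + t *\<^sub>R (y - x))) has_derivative (\<lambda>s. DM (x + t *\<^sub>R (y - x)) (s *\<^sub>R (y - x)))) (at t)"
   by (rule has_derivative_compose[of "\<lambda>t. x + t *\<^sub>R (y - x)" "\<lambda>s. s *\<^sub>R (y - x)" t UNIV M])
    (auto intro!: derivative_eq_intros M_deriv[OF seg[OF t]])
  moreover have "DM (x + t *\<^sub>R (y - x)) (s *\<^sub>R (y - x)) = s *\<^sub>R DM (x + t *\<^sub>R (y - x)) (y - x)" for s
   using has_derivative_linear[OF M_deriv[OF seg[OF t]]] by (simp add: linear_scale)
  ultimately have "((\<lambda>t. M (x + t *\<^sub>R (y - x))) has_vector_derivative DM (x + t *\<^sub>R (y - x)) (y - x)) (at t)"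
   unfolding has_vector_derivative_def by simp
  hence "(\<phi> has_vector_derivative DM (x + t *\<^sub>R (y - x)) (y - x) - DM x (y - x)) (at t)"
   unfolding \<phi>_def by (auto intro!: derivative_eq_intros)
  thus "(\<phi> has_vector_derivative DM (x + t *\<^sub>R (y - x)) (y - x) - DM x (y - x)) (at t within {0..1})"
   by (rule has_vector_derivative_at_within)
  have "norm (DM (x + t *\<^sub>R (y - x)) (y - x) - DM x (y - x)) \<le> L * norm (t *\<^sub>R (y - x)) * norm (y - x)"
   using DM_lip[OF seg[OF t] assms(1), of "y - x"] by simp
  also have "\<dots> \<le> L * norm (y - x) * norm (y - x)" using t L by (intro mult_right_mono mult_left_mono) (auto simp: mult_left_le_one_le)
  finally show "norm (DM (x + t *\<^sub>R (y - x)) (y - x) - DM x (y - x)) \<le> L * (norm (y - x))\<^sup>2" by (simp add: power2_eq_square)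
 qed auto
 thus ?thesis unfolding \<phi>_def by (simp add: algebra_simps)
qed

text \<open>The Euler--Lagrange equation: \<open>d/dt M(u, y) = DM(y)(u, u) / 2 + M(u, y')\<close> for every field \<open>y\<close> along the curve.\<close>

lemma metric_along_curve: assumes c: "spray_curve I x u" and t: "t \<in> I" and y: "(y has_vector_derivative y') (at t)"
 shows "((\<lambda>t. u t \<bullet> (M (x t) *v y t)) has_real_derivative
  (u t \<bullet> (DM (x t) (y t) *v u t)) / 2 + u t \<bullet> (M (x t) *v y')) (at t)"
proof -
 note d = spray_curveD[OF c t]
 have dMx: "((\<lambda>t. M (x t)) has_vector_derivative DM (x t) (u t)) (at t)"
 proof -
  have "((\<lambda>t. M (x t)) has_derivative (\<lambda>s. DM (x t) (s *\<^sub>R u t))) (at t)"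
   using d(1) M_deriv[OF d(3)] unfolding has_vector_derivative_def
   by (rule has_derivative_compose[of x "\<lambda>s. s *\<^sub>R u t" t UNIV M])
  thus ?thesis unfolding has_vector_derivative_def using has_derivative_linear[OF M_deriv[OF d(3)]] by (simp add: linear_scale)
 qed
 have 1: "((\<lambda>t. M (x t) *v y t) has_vector_derivative (M (x t) *v y' + DM (x t) (u t) *v y t)) (at t)"
  by (rule bounded_bilinear.has_vector_derivative[OF bounded_bilinear_matrix_vector_mult dMx y])
 have "((\<lambda>t. u t \<bullet> (M (x t) *v y t)) has_vector_derivative
  (u t \<bullet> (M (x t) *v y' + DM (x t) (u t) *v y t) + B (x t) (u t) (u t) \<bullet> (M (x t) *v y t))) (at t)"
  by (rule bounded_bilinear.has_vector_derivative[OF bounded_bilinear_inner d(2) 1])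
 thus ?thesis unfolding has_real_derivative_iff_has_vector_derivative geodesic[OF d(3)] by (simp add: inner_add_right add.commute)
qed

lemma speed_constant: assumes c: "spray_curve {-2<..<2} x u" and t: "t \<in> {-2<..<2}"
 shows "u t \<bullet> (M (x t) *v u t) = u 0 \<bullet> (M (x 0) *v u 0)"
proof -
 define f where "f t = u t \<bullet> (M (x t) *v u t)" for t
 have "(f has_real_derivative 0) (at s within {-2<..<2})" if s: "s \<in> {-2<..<2}" for s
 proof -
  note d = spray_curveD[OF c s]
  have "(f has_real_derivative (u s \<bullet> (DM (x s) (u s) *v u s)) / 2 + u s \<bullet> (M (x s) *v B (x s) (u s) (u s))) (at s)"
   unfolding f_def by (rule metric_along_curve[OF c s d(2)])
  moreover have "u s \<bullet> (M (x s) *v B (x s) (u s) (u s)) = - (u s \<bullet> (DM (x s) (u s) *v u s)) / 2"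
   using geodesic[OF d(3), of "u s" "u s"] M_symmetric[OF d(3), of "u s"] by simp
  ultimately show ?thesis by (auto intro: has_field_derivative_at_within)
 qed
 then obtain k where "\<And>s. s \<in> {-2<..<2} ==> f s = k" using has_field_derivative_zero_constant[of "{-2<..<2}" f] by auto
 thus ?thesis using t unfolding f_def by auto
qed

text \<open>First variation of the energy. The energy density of a geodesic is constant, so no
 integration is needed: the difference \<open>f\<close> of the two energies is compared with the derivative
 of the boundary term \<open>h\<close>.\<close>

lemma gauss_estimate:
 obtains C where "0 \<le> C" "\<And>v w. norm v \<le> speed / 2 ==> norm w \<le> speed / 2 ==>
  \<bar>(w \<bullet> w) / 2 - (v \<bullet> v) / 2 - vel x0 v 1 \<bullet> (M (expo x0 v) *v (expo x0 w - expo x0 v))\<bar> \<le> C * (norm (w - v))\<^sup>2"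
proof -
 obtain k where k: "k > 0" "\<And>A w :: _. norm ((A :: real^'n^'n) *v w) \<le> norm A * norm w * k"
  using bounded_bilinear.pos_bounded[OF bounded_bilinear_matrix_vector_mult] by blast
 have form: "\<bar>u \<bullet> (A *v w)\<bar> \<le> k * norm A * norm u * norm w" for u w :: "real^'n" and A
 proof -
  have "\<bar>u \<bullet> (A *v w)\<bar> \<le> norm u * norm (A *v w)" by (rule Cauchy_Schwarz_ineq2)
  also have "\<dots> \<le> norm u * (norm A * norm w * k)" by (intro mult_left_mono k) auto
  finally show ?thesis by (simp add: mult_ac)
 qed
 have x0: "x0 \<in> cball x0 (a / 2)" using a by simp
 define C where "C = k * L * (36 * speed\<^sup>2 / 2 + 18 * speed + 9 / 2)"
 have C0: "0 \<le> C" unfolding C_def using k L speed(1) by simp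
 have "\<bar>(w \<bullet> w) / 2 - (v \<bullet> v) / 2 - vel x0 v 1 \<bullet> (M (expo x0 v) *v (expo x0 w - expo x0 v))\<bar> \<le> C * (norm (w - v))\<^sup>2"
  if v: "norm v \<le> speed / 2" and w: "norm w \<le> speed / 2" for v w
 proof -
  let ?I = "{-2<..<2} :: real set"
  note cv = geod(3)[OF x0 v] and cw = geod(3)[OF x0 w]
  define X where "X = pos x0 v"
  define U where "U = vel x0 v"
  define Y where "Y t = pos x0 w t - X t" for t
  define W where "W t = vel x0 w t - U t" for t
  define d where "d = norm (w - v)"
  have X: "X t \<in> cball x0 a" "X t + Y t \<in> cball x0 a" if "t \<in> ?I" for t
   using spray_curveD(3)[OF cv that] spray_curveD(3)[OF cw that] unfolding X_def Y_def by auto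
  have dY: "(Y has_vector_derivative W t) (at t)" if "t \<in> ?I" for t unfolding Y_def W_def X_def U_def
   using spray_curveD(1)[OF cv that] spray_curveD(1)[OF cw that] by (intro has_vector_derivative_diff)
  have Yb: "norm (Y t) \<le> 6 * d" and Wb: "norm (W t) \<le> 3 * d"
   and Ub: "norm (U t) \<le> speed" and UWb: "norm (U t + W t) \<le> speed" if "t \<in> ?I" for t
   using geod_lipschitz(1,2)[OF x0 w v, of t] geod(4)[OF x0 v that] geod(4)[OF x0 w that] that unfolding Y_def W_def X_def U_def d_def by auto
  define f where "f = (w \<bullet> w) / 2 - (v \<bullet> v) / 2"
  have f: "f = (U t + W t) \<bullet> (M (X t + Y t) *v (U t + W t)) / 2 - U t \<bullet> (M (X t) *v U t) / 2" if "t \<in> ?I" for t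
   using speed_constant[OF cv that] speed_constant[OF cw that] geod(1,2)[OF x0 v] geod(1,2)[OF x0 w]
   unfolding f_def Y_def W_def X_def U_def by (simp add: M_center)
  define h where "h t = U t \<bullet> (M (X t) *v Y t)" for t
  define h' where "h' t = (U t \<bullet> (DM (X t) (Y t) *v U t)) / 2 + U t \<bullet> (M (X t) *v W t)" for t
  have dh: "(h has_real_derivative h' t) (at t)" if "t \<in> ?I" for t
   unfolding h_def h'_def X_def U_def by (rule metric_along_curve[OF cv that dY[OF that]])
  have est: "\<bar>h' t - f\<bar> \<le> C * d\<^sup>2" if t: "t \<in> ?I" for t
  proof -
   define R where "R = M (X t + Y t) - M (X t) - DM (X t) (Y t)"
   have R: "norm R \<le> L * (6 * d)\<^sup>2"
   proof -
    have "norm R \<le> L * (norm (Y t))\<^sup>2" using M_taylor[OF X[OF t]] unfolding R_def by simp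
    also have "\<dots> \<le> L * (6 * d)\<^sup>2" using Yb[OF t] L by (intro mult_left_mono power_mono) auto
    finally show ?thesis .
   qed
   have Msplit: "M (X t + Y t) = R + M (X t) + DM (X t) (Y t)" unfolding R_def by simp
   have sym: "W t \<bullet> (M (X t) *v U t) = U t \<bullet> (M (X t) *v W t)" by (rule M_symmetric[OF X(1)[OF t]])
   have "f - h' t = ((U t + W t) \<bullet> (R *v (U t + W t)) + W t \<bullet> (DM (X t) (Y t) *v (U t + W t))
    + U t \<bullet> (DM (X t) (Y t) *v W t) + W t \<bullet> (M (X t) *v W t)) / 2" unfolding f[OF t] h'_def Msplit
    by (simp only: matrix_vector_mult_add_rdistrib matrix_vector_right_distrib inner_add_left inner_add_right sym) argo
   hence "\<bar>f - h' t\<bar> = \<bar>((U t + W t) \<bullet> (R *v (U t + W t)) + W t \<bullet> (DM (X t) (Y t) *v (U t + W t))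
    + U t \<bullet> (DM (X t) (Y t) *v W t) + W t \<bullet> (M (X t) *v W t)) / 2\<bar>" by (rule arg_cong)
   also have "\<dots> \<le> (\<bar>(U t + W t) \<bullet> (R *v (U t + W t))\<bar> + \<bar>W t \<bullet> (DM (X t) (Y t) *v (U t + W t))\<bar>
    + \<bar>U t \<bullet> (DM (X t) (Y t) *v W t)\<bar> + \<bar>W t \<bullet> (M (X t) *v W t)\<bar>) / 2"
   proof -
    have "\<bar>(b1 + b2 + b3 + b4) / 2\<bar> \<le> (\<bar>b1\<bar> + \<bar>b2\<bar> + \<bar>b3\<bar> + \<bar>b4\<bar>) / 2" for b1 b2 b3 b4 :: real
    unfolding abs_divide abs_numeral
    by (rule divide_right_mono[OF order_trans[OF abs_triangle_ineq add_mono[OF order_trans[OF abs_triangle_ineq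
    add_mono[OF abs_triangle_ineq order_refl]] order_refl]]]) simp
    thus ?thesis .
   qed
   also have "\<dots> \<le> (k * (L * (6 * d)\<^sup>2) * speed * speed + k * (L * (6 * d)) * (3 * d) * speed
    + k * (L * (6 * d)) * speed * (3 * d) + k * L * (3 * d) * (3 * d)) / 2"
   proof -
    have DM: "norm (DM (X t) (Y t)) \<le> L * (6 * d)" by (rule order_trans[OF DM_bound[OF X(1)[OF t]] mult_left_mono[OF Yb[OF t] L]])
    have d0: "0 \<le> d" unfolding d_def by simp
    have "k * norm R * norm (U t + W t) * norm (U t + W t) \<le> k * (L * (6 * d)\<^sup>2) * speed * speed"
    using R UWb[OF t] k(1) L d0 speed(1) by (intro mult_mono mult_nonneg_nonneg) auto
    hence 1: "\<bar>(U t + W t) \<bullet> (R *v (U t + W t))\<bar> \<le> k * (L * (6 * d)\<^sup>2) * speed * speed"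
    by (rule order_trans[OF form])
    have "k * norm (DM (X t) (Y t)) * norm (W t) * norm (U t + W t) \<le> k * (L * (6 * d)) * (3 * d) * speed"
    using DM UWb[OF t] Wb[OF t] k(1) L d0 speed(1) by (intro mult_mono mult_nonneg_nonneg) auto
    hence 2: "\<bar>W t \<bullet> (DM (X t) (Y t) *v (U t + W t))\<bar> \<le> k * (L * (6 * d)) * (3 * d) * speed"
    by (rule order_trans[OF form])
    have "k * norm (DM (X t) (Y t)) * norm (U t) * norm (W t) \<le> k * (L * (6 * d)) * speed * (3 * d)"
    using DM Ub[OF t] Wb[OF t] k(1) L d0 speed(1) by (intro mult_mono mult_nonneg_nonneg) auto
    hence 3: "\<bar>U t \<bullet> (DM (X t) (Y t) *v W t)\<bar> \<le> k * (L * (6 * d)) * speed * (3 * d)" by (rule order_trans[OF form])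
    have "k * norm (M (X t)) * norm (W t) * norm (W t) \<le> k * L * (3 * d) * (3 * d)"
    using M_bound[OF X(1)[OF t]] Wb[OF t] k(1) L d0 by (intro mult_mono mult_nonneg_nonneg) auto
    hence 4: "\<bar>W t \<bullet> (M (X t) *v W t)\<bar> \<le> k * L * (3 * d) * (3 * d)" by (rule order_trans[OF form])
    show ?thesis by (rule divide_right_mono[OF add_mono[OF add_mono[OF add_mono[OF 1 2] 3] 4]]) simp
   qed
   also have "\<dots> = C * d\<^sup>2" unfolding C_def by (simp add: power2_eq_square algebra_simps)
   finally show ?thesis by (simp add: abs_minus_commute)
  qed
  define \<phi> where "\<phi> t = h t - t * f" for t
  have "norm (\<phi> 1 - \<phi> 0) \<le> (C * d\<^sup>2) * \<bar>1 - 0\<bar>"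
  proof (rule vector_derivative_bound[where S = ?I])
   fix t :: real assume t: "t \<in> ?I"
   have "(\<phi> has_real_derivative h' t - f) (at t)" unfolding \<phi>_def using dh[OF t] by (auto intro!: derivative_eq_intros)
   thus "(\<phi> has_vector_derivative h' t - f) (at t within ?I)"
    unfolding has_real_derivative_iff_has_vector_derivative by (rule has_vector_derivative_at_within)
   show "norm (h' t - f) \<le> C * d\<^sup>2" using est[OF t] by simp
  qed auto
  moreover have "Y 0 = 0" unfolding Y_def X_def using geod(1)[OF x0 v] geod(1)[OF x0 w] by simp
  hence "\<phi> 0 = 0" unfolding \<phi>_def h_def by simp
  moreover have "\<phi> 1 = vel x0 v 1 \<bullet> (M (expo x0 v) *v (expo x0 w - expo x0 v)) - f"
   unfolding \<phi>_def h_def Y_def X_def U_def expo_def by simp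
  ultimately show ?thesis unfolding f_def d_def by (simp add: abs_minus_commute)
 qed
 thus thesis using that C0 by blast
qed
end

text \<open>What the rest of the argument needs of normal coordinates: \<open>ex\<close> and \<open>lg\<close> are the exponential map and its inverse, read
in the chart, \<open>Z\<close> is the final velocity of the radial geodesic of unit duration and \<open>M\<close> is the metric. The norm in \<open>N\<close>
is Euclidean since the chart is orthonormal at the centre. The axiom \<open>energy_deriv\<close> is the Gauss lemma, and \<open>Z_outward\<close> says that radial
geodesics leave the coordinate balls outwards.\<close>

locale radial_ball =
 fixes x0 :: "real^'n" and \<delta> :: real and N :: "(real^'n) set"
  and ex lg Z :: "real^'n => real^'n" and M :: "real^'n => real^'n^'n" and Le :: real
 assumes \<delta>: "0 < \<delta>" and N_open: "open N" and N_star: "\<And>v s. v \<in> N ==> s \<in> {0..1} ==> s *\<^sub>R v \<in> N"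
  and N_bounded: "N \<subseteq> ball 0 1" and hom: "homeomorphism N (ball x0 \<delta>) ex lg" and ex_lip: "Le-lipschitz_on N ex"
  and lg_lip: "locally_lipschitz_on (ball x0 \<delta>) lg" and ex_0: "ex 0 = x0" and Z_lip: "locally_lipschitz_on (ball x0 \<delta>) Z"
  and M_lip: "locally_lipschitz_on (ball x0 \<delta>) M"
  and M_sym: "\<And>x u w. x \<in> ball x0 \<delta> ==> u \<bullet> (M x *v w) = w \<bullet> (M x *v u)"
  and M_pos: "\<And>x u. x \<in> ball x0 \<delta> ==> u \<noteq> 0 ==> 0 < u \<bullet> (M x *v u)"
  and M_bdd: "\<And>x u w. x \<in> ball x0 \<delta> ==> \<bar>u \<bullet> (M x *v w)\<bar> \<le> 2 * norm u * norm w"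
  and energy_deriv: "\<And>x. x \<in> ball x0 \<delta> ==>
   ((\<lambda>x. (lg x \<bullet> lg x) / 2) has_derivative (\<lambda>w. Z x \<bullet> (M x *v w))) (at x)"
  and Z_norm: "\<And>x. x \<in> ball x0 \<delta> ==> Z x \<bullet> (M x *v Z x) = lg x \<bullet> lg x"
  and Z_outward: "\<And>x. x \<in> ball x0 \<delta> ==> x \<noteq> x0 ==> 0 < Z x \<bullet> (M x *v (x - x0))"
  and ex_radial: "\<And>v. v \<in> N ==> ((\<lambda>s. ex (s *\<^sub>R v)) has_vector_derivative Z (ex v)) (at 1)"

text \<open>Differentiability obtained from comparison of values only; in this way derivatives of functions of \<open>exp\<close> are found although \<open>exp\<close> is
merely Lipschitz.\<close>

lemma quadratic_remainder_imp_has_derivative: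
 fixes f :: "'a::euclidean_space => 'b::real_normed_vector" assumes lin: "bounded_linear f'" and U: "open U" "x \<in> U"
  and est: "\<And>y. y \<in> U ==> norm (f y - f x - f' (y - x)) \<le> C * (norm (y - x))\<^sup>2" shows "(f has_derivative f') (at x)"
 unfolding has_derivative_at_alt
proof (intro conjI allI impI lin)
 fix e :: real assume e: "e > 0"
 obtain r where r: "r > 0" "ball x r \<subseteq> U" using U openE by blast
 define d where "d = min r (e / (\<bar>C\<bar> + 1))"
 have d: "d > 0" unfolding d_def using r e by simp
 have "norm (f y - f x - f' (y - x)) \<le> e * norm (y - x)" if y: "norm (y - x) < d" for y
 proof -
  have "y \<in> U" using y r(2) unfolding d_def by (auto simp: dist_norm norm_minus_commute)
  hence "norm (f y - f x - f' (y - x)) \<le> C * (norm (y - x))\<^sup>2" by (rule est)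
  also have "\<dots> \<le> (\<bar>C\<bar> + 1) * (norm (y - x))\<^sup>2" by (intro mult_right_mono) auto
  also have "\<dots> = ((\<bar>C\<bar> + 1) * norm (y - x)) * norm (y - x)" by (simp add: power2_eq_square)
  also have "\<dots> \<le> e * norm (y - x)"
  proof (rule mult_right_mono)
   have "norm (y - x) \<le> e / (\<bar>C\<bar> + 1)" using y unfolding d_def by simp
   thus "(\<bar>C\<bar> + 1) * norm (y - x) \<le> e" by (simp add: pos_le_divide_eq mult.commute)
  qed simp
  finally show ?thesis .
 qed
 thus "\<exists>d>0. \<forall>y. norm (y - x) < d \<longrightarrow> norm (f y - f x - f' (y - x)) \<le> e * norm (y - x)" using d by blast
qed

context spray
begin

lemma geod_extend: assumes q: "q \<in> cball x0 (a / 2)" and v: "norm v \<le> speed / 2" and s: "0 < s" "s < 2"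
  and sv: "norm (s *\<^sub>R v) \<le> speed / 2" shows "pos q (s *\<^sub>R v) 1 = pos q v s"
proof (cases "s \<le> 1")
 case True
 thus ?thesis using geod_scale(1)[OF q v, of s 1] s by simp
next
 case False
 have "pos q ((1 / s) *\<^sub>R (s *\<^sub>R v)) s = pos q (s *\<^sub>R v) (1 / s * s)" using False s by (intro geod_scale(1)[OF q sv]) auto
 thus ?thesis using s by simp
qed

end

context metric_spray
begin

definition endvel :: "real => real^'n => real^'n" where
 "endvel \<delta> x = vel x0 (expo_inv \<delta> x0 x) 1"

text \<open>The differentiability of the energy is \<open>gauss_estimate\<close>, transported to the ball by the Lipschitz inverse of \<open>exp\<close>. Outward
direction holds since \<open>Z\<close> and \<open>x - x0\<close> both differ from \<open>lg x\<close> by at most a quarter of its length.\<close>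

lemma radial_ballI: assumes \<delta>: "0 < \<delta>" "16 * \<delta> \<le> speed"
 shows "radial_ball x0 \<delta> (expo_dom \<delta> x0) (expo x0) (expo_inv \<delta> x0) (endvel \<delta>) M (5 / 4)"
proof -
 let ?lg = "expo_inv \<delta> x0" and ?N = "expo_dom \<delta> x0" and ?ex = "expo x0" and ?Z = "endvel \<delta>"
 have x0: "x0 \<in> ball x0 \<delta>" "x0 \<in> cball x0 (a / 2)" using \<delta>(1) a by auto
 have sub: "ball x0 \<delta> \<subseteq> cball x0 a" using \<delta> speed by (auto simp: subset_iff)
 note N = expo_domD[OF \<delta>(2) x0(1)]
 note inv = expo_inv[OF \<delta>(2) x0(1)]
 have lgN: "norm (?lg x) \<le> speed / 2" if "x \<in> ball x0 \<delta>" for x using N(1)[OF inv(1)[OF that]] .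
 have lg_dist: "norm (?lg x - ?lg y) \<le> 4 / 3 * norm (x - y)" if "x \<in> ball x0 \<delta>" "y \<in> ball x0 \<delta>" for x y
  using lipschitz_onD[OF expo_inv_lipschitz[OF \<delta>(2) x0(1)] that] by (simp add: dist_norm)
 have Z_lip: "4-lipschitz_on (ball x0 \<delta>) ?Z"
 proof (rule lipschitz_onI)
  fix x y assume xy: "x \<in> ball x0 \<delta>" "y \<in> ball x0 \<delta>"
  have "norm (?Z x - ?Z y) \<le> 3 * norm (?lg x - ?lg y)"
   unfolding endvel_def by (rule geod_lipschitz(1)[OF x0(2) lgN[OF xy(1)] lgN[OF xy(2)]]) simp
  thus "dist (?Z x) (?Z y) \<le> 4 * dist x y" using lg_dist[OF xy] by (simp add: dist_norm)
 qed simp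
 have energy: "((\<lambda>x. (?lg x \<bullet> ?lg x) / 2) has_derivative (\<lambda>w. ?Z x \<bullet> (M x *v w))) (at x)"
  if x: "x \<in> ball x0 \<delta>" for x
 proof -
  obtain C where C: "0 \<le> C" "\<And>v w. norm v \<le> speed / 2 ==> norm w \<le> speed / 2 ==>
   \<bar>(w \<bullet> w) / 2 - (v \<bullet> v) / 2 - vel x0 v 1 \<bullet> (M (expo x0 v) *v (expo x0 w - expo x0 v))\<bar> \<le> C * (norm (w - v))\<^sup>2"
   using gauss_estimate by blast
  show ?thesis
  proof (rule quadratic_remainder_imp_has_derivative)
   show "bounded_linear (\<lambda>w. ?Z x \<bullet> (M x *v w))"
    by (rule bounded_linear_compose[OF bounded_linear_inner_right matrix_vector_mul_bounded_linear])
   fix y assume y: "y \<in> ball x0 \<delta>"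
   have "norm ((?lg y \<bullet> ?lg y) / 2 - (?lg x \<bullet> ?lg x) / 2 - ?Z x \<bullet> (M x *v (y - x))) \<le> C * (norm (?lg y - ?lg x))\<^sup>2"
    using C(2)[OF lgN[OF x] lgN[OF y]] inv(2)[OF x] inv(2)[OF y] unfolding endvel_def by simp
   also have "\<dots> \<le> C * (4 / 3 * norm (y - x))\<^sup>2" using lg_dist[OF y x] C(1) by (intro mult_left_mono power_mono) auto
   also have "\<dots> = (C * (4 / 3)\<^sup>2) * (norm (y - x))\<^sup>2" by (simp add: power_mult_distrib power_divide)
   finally show "norm ((?lg y \<bullet> ?lg y) / 2 - (?lg x \<bullet> ?lg x) / 2 - ?Z x \<bullet> (M x *v (y - x)))
    \<le> (C * (4 / 3)\<^sup>2) * (norm (y - x))\<^sup>2" .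
  qed (use x in auto)
 qed
 have Z_near: "norm (?Z x - ?lg x) \<le> norm (?lg x) / 4" "norm (x - x0 - ?lg x) \<le> norm (?lg x) / 4"
  if x: "x \<in> ball x0 \<delta>" for x
 proof -
  have z: "norm (0 :: real^'n) \<le> speed / 2" using speed(1) by simp
  show "norm (?Z x - ?lg x) \<le> norm (?lg x) / 4"
   using geod_lipschitz(3)[OF x0(2) lgN[OF x] z, of 1] geod_zero[OF x0(2), of 1] unfolding endvel_def by simp
  show "norm (x - x0 - ?lg x) \<le> norm (?lg x) / 4" using expo_near_translation[OF x0(2) lgN[OF x] z] expo_zero[OF x0(2)] inv(2)[OF x] by simp
 qed
 have outward: "0 < ?Z x \<bullet> (M x *v (x - x0))" if x: "x \<in> ball x0 \<delta>" "x \<noteq> x0" for x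
 proof -
  define v where "v = ?lg x"
  have "v \<noteq> 0" using inv(2)[OF x(1)] expo_zero[OF x0(2)] x(2) unfolding v_def by auto
  hence v: "0 < norm v" by simp
  define e where "e = ?Z x - v"
  define f where "f = x - x0 - v"
  have ef: "norm e \<le> norm v / 4" "norm f \<le> norm v / 4" using Z_near[OF x(1)] unfolding e_def f_def v_def by auto
  have Zx: "?Z x = v + e" "x - x0 = v + f" unfolding e_def f_def by simp_all
  have "norm (v + e) \<le> 5 / 4 * norm v" "norm (v + f) \<le> 5 / 4 * norm v"
   using norm_triangle_ineq[of v e] norm_triangle_ineq[of v f] ef by auto
  hence "norm (v + e) * norm (v + f) \<le> (5 / 4 * norm v) * (5 / 4 * norm v)" by (intro mult_mono) auto
  hence 1: "\<bar>?Z x \<bullet> (M x *v (x - x0)) - (v + e) \<bullet> (v + f)\<bar> \<le> (5 / 4 * norm v) * (5 / 4 * norm v) / 10"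
   using M_near[of x "v + e" "v + f"] subsetD[OF sub x(1)] unfolding Zx by linarith
  have "\<bar>v \<bullet> f\<bar> \<le> norm v * (norm v / 4)" "\<bar>e \<bullet> v\<bar> \<le> norm v / 4 * norm v" "\<bar>e \<bullet> f\<bar> \<le> norm v / 4 * (norm v / 4)"
   by (rule order_trans[OF Cauchy_Schwarz_ineq2]; intro mult_mono ef; simp)+
  moreover have "(v + e) \<bullet> (v + f) = (norm v)\<^sup>2 + v \<bullet> f + e \<bullet> v + e \<bullet> f"
   by (simp add: inner_add_left inner_add_right power2_norm_eq_inner)
  ultimately have "(v + e) \<bullet> (v + f) \<ge> (norm v)\<^sup>2 - norm v * (norm v / 4) - norm v / 4 * norm v - norm v / 4 * (norm v / 4)"
   by (simp only: abs_le_iff) linarith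
  hence "(v + e) \<bullet> (v + f) \<ge> 7 / 16 * (norm v)\<^sup>2" by (simp add: power2_eq_square)
  moreover have "(5 / 4 * norm v) * (5 / 4 * norm v) / 10 = 25 / 160 * (norm v)\<^sup>2" by (simp add: power2_eq_square)
  moreover have "0 < (norm v)\<^sup>2" using v by simp
  ultimately show ?thesis using 1 by (simp only: abs_le_iff) linarith
 qed
 have radial: "((\<lambda>s. ?ex (s *\<^sub>R v)) has_vector_derivative ?Z (?ex v)) (at 1)" if v: "v \<in> ?N" for v
 proof -
  have "(pos x0 v has_vector_derivative vel x0 v 1) (at 1)" using spray_curveD(1)[OF geod(3)[OF x0(2) N(1)[OF v]], of 1] by simp
  hence dv: "(pos x0 v has_vector_derivative ?Z (?ex v)) (at 1)" unfolding endvel_def using inv(3)[OF v] by simp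
  have "\<exists>T. open T \<and> 1 \<in> T \<and> (\<forall>s\<in>T. pos x0 v s = ?ex (s *\<^sub>R v))"
  proof -
   define T where "T = {s. norm (s *\<^sub>R v) < speed / 2} \<inter> {0<..<2}"
   have "open T" unfolding T_def by (intro open_Int open_Collect_less continuous_intros) auto
   moreover have "1 \<in> T" using v unfolding T_def expo_dom_def by auto
   moreover have "pos x0 v s = ?ex (s *\<^sub>R v)" if "s \<in> T" for s unfolding expo_def using that unfolding T_def
    by (intro geod_extend[OF x0(2) N(1)[OF v], symmetric]) auto
   ultimately show ?thesis by blast
  qed
  then obtain T where "open T" "1 \<in> T" "\<And>s. s \<in> T ==> pos x0 v s = ?ex (s *\<^sub>R v)" by blast
  thus ?thesis by (rule has_vector_derivative_transform_within_open[OF dv])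
 qed
 show ?thesis
 proof (unfold_locales)
  show "expo_dom \<delta> x0 \<subseteq> ball 0 1" unfolding expo_dom_def using speed by auto
  show "locally_lipschitz_on (ball x0 \<delta>) M"
  proof (rule C1_imp_locally_lipschitz_on[OF open_ball])
   show "(M has_derivative DM x) (at x)" if "x \<in> ball x0 \<delta>" for x using M_deriv sub that by blast
   fix b :: "real^'n"
   have "(L * norm b)-lipschitz_on (ball x0 \<delta>) (\<lambda>x. DM x b)"
   proof (rule lipschitz_onI)
    fix x y assume "x \<in> ball x0 \<delta>" "y \<in> ball x0 \<delta>"
    hence "norm (DM x b - DM y b) \<le> L * norm (x - y) * norm b" using DM_lip sub by blast
    thus "dist (DM x b) (DM y b) \<le> L * norm b * dist x y" by (simp add: dist_norm mult_ac)
   qed (use L in auto)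
   thus "continuous_on (ball x0 \<delta>) (\<lambda>x. DM x b)" by (rule lipschitz_on_continuous_on)
  qed
  show "u \<bullet> (M x *v w) = w \<bullet> (M x *v u)" if "x \<in> ball x0 \<delta>" for x u w using M_symmetric sub that by blast
  show "0 < u \<bullet> (M x *v u)" if "x \<in> ball x0 \<delta>" "u \<noteq> 0" for x u
  proof -
   have "\<bar>u \<bullet> (M x *v u) - u \<bullet> u\<bar> \<le> norm u * norm u / 10" using M_near sub that by blast
   moreover have "u \<bullet> u = norm u * norm u" by (simp add: power2_norm_eq_inner[symmetric] power2_eq_square)
   moreover have "0 < norm u * norm u" using that(2) by simp
   ultimately show ?thesis by (simp only: abs_le_iff) linarith
  qed
  show "\<bar>u \<bullet> (M x *v w)\<bar> \<le> 2 * norm u * norm w" if "x \<in> ball x0 \<delta>" for x u w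
  proof -
   have "\<bar>u \<bullet> (M x *v w) - u \<bullet> w\<bar> \<le> norm u * norm w / 10" using M_near sub that by blast
   moreover have "\<bar>u \<bullet> w\<bar> \<le> norm u * norm w" by (rule Cauchy_Schwarz_ineq2)
   moreover have "0 \<le> norm u * norm w" by simp
   ultimately have "\<bar>u \<bullet> (M x *v w)\<bar> \<le> 2 * (norm u * norm w)" by linarith
   thus ?thesis by (simp only: mult.assoc)
  qed
  show "endvel \<delta> x \<bullet> (M x *v endvel \<delta> x) = expo_inv \<delta> x0 x \<bullet> expo_inv \<delta> x0 x" if x: "x \<in> ball x0 \<delta>" for x
   using speed_constant[OF geod(3)[OF x0(2) lgN[OF x]], of 1] geod(1,2)[OF x0(2) lgN[OF x]] inv(2)[OF x]
   unfolding endvel_def expo_def by (simp add: M_center)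
 qed (fact \<delta>(1) expo_dom_open[OF \<delta>(2) x0(1)] expo_dom_star[OF \<delta>(2) x0(1)] expo_homeomorphism[OF \<delta>(2) x0(1)]
   expo_lipschitz[OF \<delta>(2) x0(1)] lipschitz_on_imp_locally[OF expo_inv_lipschitz[OF \<delta>(2) x0(1)]]
   expo_zero[OF x0(2)] lipschitz_on_imp_locally[OF Z_lip] energy outward radial)+
qed
end

section \<open>Charts and the geodesic equation\<close>

lemma second_difference_estimate:
 fixes f :: "'a::real_normed_vector => 'b::real_normed_vector" assumes S: "open S" "x \<in> S"
  and f: "\<And>y. y \<in> S ==> (f has_derivative f' y) (at y)" and f2: "((\<lambda>y. f' y b) has_derivative D) (at x)" and e: "e > 0"
 shows "\<exists>d>0. \<forall>s. 0 < s \<and> s < d \<longrightarrow>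
  norm (f (x + s *\<^sub>R h + s *\<^sub>R b) - f (x + s *\<^sub>R h) - f (x + s *\<^sub>R b) + f x - s\<^sup>2 *\<^sub>R D h) \<le> e * s\<^sup>2"
proof -
 interpret D: bounded_linear D using f2 has_derivative_bounded_linear by blast
 define n where "n = norm h + norm b + 1"
 have n: "n > 0" unfolding n_def by (simp add: add_nonneg_pos)
 obtain r where r: "r > 0" "ball x r \<subseteq> S" using S openE by blast
 have "e / (2 * n) > 0" using e n by simp
 then obtain d1 where d1: "d1 > 0" "\<And>z. norm (z - x) < d1 ==> norm (f' z b - f' x b - D (z - x)) \<le> e / (2 * n) * norm (z - x)"
  using f2[unfolded has_derivative_at_alt] by blast
 define d where "d = min r d1 / n"
 have d: "d > 0" unfolding d_def using r d1 n by simp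
 have "norm (f (x + s *\<^sub>R h + s *\<^sub>R b) - f (x + s *\<^sub>R h) - f (x + s *\<^sub>R b) + f x - s\<^sup>2 *\<^sub>R D h) \<le> e * s\<^sup>2"
  if s: "0 < s" "s < d" for s
 proof -
  have sn: "s * n < r" "s * n < d1" using s n unfolding d_def by (auto simp: pos_less_divide_eq)
  have small: "norm (c1 *\<^sub>R s *\<^sub>R h + (t * s) *\<^sub>R b) \<le> s * n" if "c1 \<in> {0, 1}" "t \<in> {0..1}" for c1 t :: real
  proof -
   have "norm (c1 *\<^sub>R s *\<^sub>R h + (t * s) *\<^sub>R b) \<le> norm (c1 *\<^sub>R s *\<^sub>R h) + norm ((t * s) *\<^sub>R b)" by (rule norm_triangle_ineq)
   also have "\<dots> \<le> s * norm h + s * norm b" using that s by (intro add_mono) (auto simp: mult_left_le_one_le mult.assoc)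
   also have "\<dots> \<le> s * n" unfolding n_def using s by (simp add: algebra_simps)
   finally show ?thesis .
  qed
  have inS: "x + c1 *\<^sub>R s *\<^sub>R h + (t * s) *\<^sub>R b \<in> S" if "c1 \<in> {0, 1}" "t \<in> {0..1}" for c1 t :: real
  proof -
   have "dist x (x + c1 *\<^sub>R s *\<^sub>R h + (t * s) *\<^sub>R b) = norm (c1 *\<^sub>R s *\<^sub>R h + (t * s) *\<^sub>R b)"
    unfolding dist_norm by (subst norm_minus_commute) (simp add: add.assoc)
   thus ?thesis using small[OF that] sn r(2) by auto
  qed
  have est: "norm (f' (x + c1 *\<^sub>R s *\<^sub>R h + (t * s) *\<^sub>R b) b - f' x b - D (c1 *\<^sub>R s *\<^sub>R h + (t * s) *\<^sub>R b)) \<le> e / 2 * s"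
   if "c1 \<in> {0, 1}" "t \<in> {0..1}" for c1 t :: real
  proof -
   let ?z = "c1 *\<^sub>R s *\<^sub>R h + (t * s) *\<^sub>R b"
   have "norm (f' (x + ?z) b - f' x b - D (x + ?z - x)) \<le> e / (2 * n) * norm (x + ?z - x)" using small[OF that] sn by (intro d1(2)) simp
   also have "\<dots> \<le> e / (2 * n) * (s * n)" using small[OF that] e n by (intro mult_left_mono) auto
   also have "\<dots> = e / 2 * s" using n by simp
   finally show ?thesis by (simp add: add.assoc)
  qed
  define \<xi> where "\<xi> t = f (x + 1 *\<^sub>R s *\<^sub>R h + (t * s) *\<^sub>R b) - f (x + 0 *\<^sub>R s *\<^sub>R h + (t * s) *\<^sub>R b) - t *\<^sub>R s\<^sup>2 *\<^sub>R D h" for t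
  define \<xi>' where "\<xi>' t = s *\<^sub>R f' (x + 1 *\<^sub>R s *\<^sub>R h + (t * s) *\<^sub>R b) b - s *\<^sub>R f' (x + 0 *\<^sub>R s *\<^sub>R h + (t * s) *\<^sub>R b) b - s\<^sup>2 *\<^sub>R D h" for t
  have "norm (\<xi> 1 - \<xi> 0) \<le> (e * s\<^sup>2) * \<bar>1 - 0\<bar>"
  proof (rule vector_derivative_bound[where S = "{0..1}" and w' = \<xi>'])
   fix t :: real assume t: "t \<in> {0..1}"
   have d: "((\<lambda>t. f (x + c1 *\<^sub>R s *\<^sub>R h + (t * s) *\<^sub>R b)) has_vector_derivative
    s *\<^sub>R f' (x + c1 *\<^sub>R s *\<^sub>R h + (t * s) *\<^sub>R b) b) (at t)" if "c1 \<in> {0, 1}" for c1 :: real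
   proof -
    have 1: "((\<lambda>t. x + c1 *\<^sub>R s *\<^sub>R h + (t * s) *\<^sub>R b) has_derivative (\<lambda>r. (r * s) *\<^sub>R b)) (at t)"
    by (auto intro!: derivative_eq_intros)
    have 2: "(f has_derivative f' (x + c1 *\<^sub>R s *\<^sub>R h + (t * s) *\<^sub>R b)) (at (x + c1 *\<^sub>R s *\<^sub>R h + (t * s) *\<^sub>R b))"
    by (rule f[OF inS[OF that t]])
    have "f' (x + c1 *\<^sub>R s *\<^sub>R h + (t * s) *\<^sub>R b) ((r * s) *\<^sub>R b) = r *\<^sub>R s *\<^sub>R f' (x + c1 *\<^sub>R s *\<^sub>R h + (t * s) *\<^sub>R b) b" for r
    using has_derivative_linear[OF 2] by (simp add: linear_scale)
    thus ?thesis using has_derivative_compose[OF 1 2] unfolding has_vector_derivative_def by simp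
   qed
   have "(\<xi> has_vector_derivative \<xi>' t) (at t)" unfolding \<xi>_def \<xi>'_def
    by (intro has_vector_derivative_diff d) (auto intro!: derivative_eq_intros)
   thus "(\<xi> has_vector_derivative \<xi>' t) (at t within {0..1})" by (rule has_vector_derivative_at_within)
   let ?E = "\<lambda>c1::real. f' (x + c1 *\<^sub>R s *\<^sub>R h + (t * s) *\<^sub>R b) b - f' x b - D (c1 *\<^sub>R s *\<^sub>R h + (t * s) *\<^sub>R b)"
   have "\<xi>' t = s *\<^sub>R (?E 1 - ?E 0)" unfolding \<xi>'_def by (simp add: D.add D.scaleR algebra_simps power2_eq_square)
   hence "norm (\<xi>' t) = s * norm (?E 1 - ?E 0)" using s by simp
   also have "\<dots> \<le> s * (e / 2 * s + e / 2 * s)"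
   proof (rule mult_left_mono[OF order_trans[OF norm_triangle_ineq4 add_mono]])
    show "norm (?E 1) \<le> e / 2 * s" by (rule est[OF _ t]) simp
    show "norm (?E 0) \<le> e / 2 * s" by (rule est[OF _ t]) simp
   qed (use s in simp)
   finally show "norm (\<xi>' t) \<le> e * s\<^sup>2" by (simp add: power2_eq_square algebra_simps)
  qed auto
  thus ?thesis unfolding \<xi>_def by (simp add: algebra_simps)
 qed
 thus ?thesis using d by blast
qed

text \<open>The second difference quotient is symmetric in the two directions, and it converges to both of the iterated derivatives.\<close>

theorem second_derivative_symmetric:
 fixes f :: "'a::real_normed_vector => 'b::real_normed_vector" assumes S: "open S" "x \<in> S"
  and f: "\<And>y. y \<in> S ==> (f has_derivative f' y) (at y)"
  and Db: "((\<lambda>y. f' y b) has_derivative Db) (at x)" and Dh: "((\<lambda>y. f' y h) has_derivative Dh) (at x)" shows "Db h = Dh b"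
proof -
 have "norm (Db h - Dh b) \<le> e" if "e > 0" for e
 proof -
  obtain d1 where d1: "d1 > 0" "\<And>s. 0 < s ==> s < d1 ==>
   norm (f (x + s *\<^sub>R h + s *\<^sub>R b) - f (x + s *\<^sub>R h) - f (x + s *\<^sub>R b) + f x - s\<^sup>2 *\<^sub>R Db h) \<le> e / 2 * s\<^sup>2"
   using second_difference_estimate[OF S f Db, of "e / 2" h] \<open>e > 0\<close> by auto
  obtain d2 where d2: "d2 > 0" "\<And>s. 0 < s ==> s < d2 ==>
   norm (f (x + s *\<^sub>R b + s *\<^sub>R h) - f (x + s *\<^sub>R b) - f (x + s *\<^sub>R h) + f x - s\<^sup>2 *\<^sub>R Dh b) \<le> e / 2 * s\<^sup>2"
   using second_difference_estimate[OF S f Dh, of "e / 2" b] \<open>e > 0\<close> by auto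
  define s where "s = min d1 d2 / 2"
  have s: "0 < s" "s < d1" "s < d2" unfolding s_def using d1(1) d2(1) by auto
  define \<Delta> where "\<Delta> = f (x + s *\<^sub>R h + s *\<^sub>R b) - f (x + s *\<^sub>R h) - f (x + s *\<^sub>R b) + f x"
  have 1: "norm (\<Delta> - s\<^sup>2 *\<^sub>R Db h) \<le> e / 2 * s\<^sup>2" using d1(2)[OF s(1,2)] unfolding \<Delta>_def .
  have "\<Delta> = f (x + s *\<^sub>R b + s *\<^sub>R h) - f (x + s *\<^sub>R b) - f (x + s *\<^sub>R h) + f x"
   unfolding \<Delta>_def by (simp add: add.assoc add.commute[of "s *\<^sub>R h"])
  hence 2: "norm (\<Delta> - s\<^sup>2 *\<^sub>R Dh b) \<le> e / 2 * s\<^sup>2" using d2(2)[OF s(1,3)] by simp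
  have "s\<^sup>2 *\<^sub>R (Db h - Dh b) = (\<Delta> - s\<^sup>2 *\<^sub>R Dh b) - (\<Delta> - s\<^sup>2 *\<^sub>R Db h)" by (simp add: algebra_simps)
  hence "norm (s\<^sup>2 *\<^sub>R (Db h - Dh b)) \<le> e / 2 * s\<^sup>2 + e / 2 * s\<^sup>2"
   by (simp only: order_trans[OF norm_triangle_ineq4 add_mono[OF 2 1]])
  hence "s\<^sup>2 * norm (Db h - Dh b) \<le> s\<^sup>2 * e" unfolding norm_scaleR by (simp add: mult.commute)
  thus ?thesis using s(1) by simp
 qed
 hence "norm (Db h - Dh b) \<le> 0" by (rule field_le_epsilon[of _ 0, simplified])
 thus ?thesis by simp
qed

lemma chart_invs: assumes "is_chart c" shows chart_inv_left: "q \<in> fst c ==> chart_inv c (snd c q) = q"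
  and chart_inv_right: "y \<in> chart_image c ==> snd c (chart_inv c y) = y"
  and chart_inv_in: "y \<in> chart_image c ==> chart_inv c y \<in> fst c"
 using assms unfolding is_chart_def homeomorphism_def by (auto simp: inv_into_into)

lemma chart_continuous: assumes "is_chart c" shows "continuous_on (fst c) (snd c)" "continuous_on (chart_image c) (chart_inv c)"
  "open (fst c)" "open (chart_image c)" using assms unfolding is_chart_def homeomorphism_def by auto

lemma chart_preimage: assumes "is_chart c" shows "snd c ` (fst c \<inter> V) = {y \<in> chart_image c. chart_inv c y \<in> V}"
 using chart_invs[OF assms] by force

lemma chart_open: assumes "is_chart c" "open V" shows "open (snd c ` (fst c \<inter> V))"
proof -
 have "snd c ` (fst c \<inter> V) = chart_inv c -` V \<inter> chart_image c" unfolding chart_preimage[OF assms(1)] by auto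
 thus ?thesis using chart_continuous[OF assms(1)] assms(2) continuous_on_open_vimage by metis
qed

locale riemannian_manifold =
 fixes \<A> :: "('m::t2_space, 'n::finite) chart set" and g :: "('m, 'n) metric"
 assumes manifold: "Ck1_manifold 2 \<A>" and metric: "C11_riemannian_metric \<A> g"
begin

lemma atlas_Ck1_chart: "c \<in> \<A> ==> Ck1_chart 2 \<A> c" using manifold unfolding Ck1_manifold_def Ck1_structure_def by blast

lemma atlas_chart: "c \<in> \<A> ==> is_chart c" using atlas_Ck1_chart unfolding Ck1_chart_def by blast

lemma atlas_covers: "\<exists>d\<in>\<A>. q \<in> fst d" using manifold unfolding Ck1_manifold_def Ck1_structure_def by (metis UNIV_I UN_iff)

lemma transition_C21:
 "c \<in> \<A> ==> d \<in> \<A> ==> Ck1_on 2 (snd c ` (fst c \<inter> fst d)) (snd d \<circ> chart_inv c)"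
 using atlas_Ck1_chart unfolding Ck1_chart_def Ck1_compatible_def by blast

definition gmat :: "('m, 'n) chart => real^'n => real^'n^'n" where
 "gmat d = g d \<circ> chart_inv d"

definition dgmat :: "('m, 'n) chart => real^'n => real^'n => real^'n^'n" where
 "dgmat d y = frechet_derivative (gmat d) (at y)"

lemma gmat_C11: "d \<in> \<A> ==> Ck1_on 1 (chart_image d) (gmat d)" using metric unfolding C11_riemannian_metric_def gmat_def by blast

lemma gmat_deriv: "d \<in> \<A> ==> y \<in> chart_image d ==> (gmat d has_derivative dgmat d y) (at y)"
 unfolding dgmat_def by (rule Ck1_on_1_has_derivative[OF gmat_C11])

lemma gmat_transpose: "d \<in> \<A> ==> y \<in> chart_image d ==> transpose (gmat d y) = gmat d y"
 using metric chart_inv_in[OF atlas_chart] unfolding C11_riemannian_metric_def gmat_def by simp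

lemma gmat_sym: "d \<in> \<A> ==> y \<in> chart_image d ==> u \<bullet> (gmat d y *v w) = w \<bullet> (gmat d y *v u)"
 by (metis gmat_transpose dot_lmul_matrix inner_commute transpose_matrix_vector)

lemma gmat_pos: "d \<in> \<A> ==> y \<in> chart_image d ==> v \<noteq> 0 ==> v \<bullet> (gmat d y *v v) > 0"
 using metric chart_inv_in[OF atlas_chart] unfolding C11_riemannian_metric_def gmat_def by simp

lemma gmat_nondegenerate: assumes "d \<in> \<A>" "y \<in> chart_image d" "\<And>w. v \<bullet> (gmat d y *v w) = 0" shows "v = 0"
 using gmat_pos[OF assms(1,2), of v] assms(3)[of v] by fastforce

lemma gmat_invertible: "d \<in> \<A> ==> y \<in> chart_image d ==> invertible (gmat d y)"
proof -
 assume d: "d \<in> \<A>" "y \<in> chart_image d"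
 have "v = 0" if "gmat d y *v v = 0" for v using gmat_pos[OF d, of v] that by fastforce
 thus ?thesis by (simp add: invertible_left_inverse matrix_left_invertible_ker)
qed

lemma gmat_inv: assumes "d \<in> \<A>" "y \<in> chart_image d"
 shows "gmat d y ** matrix_inv (gmat d y) = mat 1" "matrix_inv (gmat d y) ** gmat d y = mat 1"
 using someI_ex[OF gmat_invertible[OF assms, unfolded invertible_def]] unfolding matrix_inv_def by auto

lemma dgmat_linear: "d \<in> \<A> ==> y \<in> chart_image d ==> linear (dgmat d y)" using gmat_deriv has_derivative_linear by blast

lemma dgmat_sym: assumes d: "d \<in> \<A>" "y \<in> chart_image d" shows "u \<bullet> (dgmat d y h *v w) = w \<bullet> (dgmat d y h *v u)"
proof -
 have bl: "bounded_linear (\<lambda>A :: real^'n^'n. u \<bullet> (A *v w))" for u w by (rule bounded_linear_compose[OF bounded_linear_inner_right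
    bounded_bilinear.bounded_linear_left[OF bounded_bilinear_matrix_vector_mult]])
 have 1: "((\<lambda>z. u \<bullet> (gmat d z *v w)) has_derivative (\<lambda>h. u \<bullet> (dgmat d y h *v w))) (at y)" for u w
  by (rule bounded_linear.has_derivative[OF bl gmat_deriv[OF d]])
 have "((\<lambda>z. u \<bullet> (gmat d z *v w)) has_derivative (\<lambda>h. w \<bullet> (dgmat d y h *v u))) (at y)"
  by (rule has_derivative_transform_within_open[OF 1[of w u] chart_continuous(4)[OF atlas_chart[OF d(1)]] d(2)])
   (rule gmat_sym[OF d(1)])
 from has_derivative_unique[OF 1 this] show ?thesis by meson
qed

definition geo_rhs :: "('m, 'n) chart => real^'n => real^'n => real^'n => real^'n" where
 "geo_rhs d y u w = - (\<chi> \<mu>. \<Sum>\<alpha>\<in>UNIV. \<Sum>\<beta>\<in>UNIV. christoffel g d (chart_inv d y) \<mu> \<alpha> \<beta> * u $ \<alpha> * w $ \<beta>)"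

text \<open>The geodesic equation in the Euler--Lagrange form, in which its invariance is visible.\<close>

lemma geo_rhs_inner: assumes d: "d \<in> \<A>" "y \<in> chart_image d"
 shows "geo_rhs d y u u \<bullet> (gmat d y *v w) = - (u \<bullet> (dgmat d y u *v w)) + (u \<bullet> (dgmat d y w *v u)) / 2"
proof -
 let ?q = "chart_inv d y"
 have y: "snd d ?q = y" using chart_inv_right[OF atlas_chart[OF d(1)] d(2)] .
 have G: "g d ?q = gmat d y" unfolding gmat_def by simp
 have P: "metric_partial g d ?q \<nu> = dgmat d y (axis \<nu> 1)" for \<nu> unfolding metric_partial_def dgmat_def gmat_def y ..
 have dg: "dgmat d y h = (\<Sum>\<nu>\<in>UNIV. h $ \<nu> *\<^sub>R dgmat d y (axis \<nu> 1))" for h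
 proof -
  have "dgmat d y h = dgmat d y (\<Sum>\<nu>\<in>UNIV. h $ \<nu> *\<^sub>R axis \<nu> 1)"
   using basis_expansion[of h] by (simp add: scalar_mult_eq_scaleR)
  thus ?thesis using dgmat_linear[OF d] by (simp add: linear_sum linear_scale)
 qed
 define cv where "cv = (\<chi> \<nu>. \<Sum>\<alpha>\<in>UNIV. \<Sum>\<beta>\<in>UNIV. (metric_partial g d ?q \<alpha> $ \<nu> $ \<beta>
  + metric_partial g d ?q \<beta> $ \<nu> $ \<alpha> - metric_partial g d ?q \<nu> $ \<alpha> $ \<beta>) * u $ \<alpha> * u $ \<beta>)"
 have cv_nth: "cv $ \<nu> = 2 * (dgmat d y u *v u) $ \<nu> - u \<bullet> (dgmat d y (axis \<nu> 1) *v u)" for \<nu>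
 proof -
  have e1: "(\<Sum>\<alpha>\<in>UNIV. \<Sum>\<beta>\<in>UNIV. metric_partial g d ?q \<alpha> $ \<nu> $ \<beta> * u $ \<alpha> * u $ \<beta>) = (dgmat d y u *v u) $ \<nu>"
  proof -
   have "(dgmat d y u *v u) $ \<nu> = (\<Sum>\<beta>\<in>UNIV. (\<Sum>\<alpha>\<in>UNIV. u $ \<alpha> * dgmat d y (axis \<alpha> 1) $ \<nu> $ \<beta>) * u $ \<beta>)"
    unfolding matrix_vector_mult_def by (subst dg) (simp add: mult.commute)
   also have "\<dots> = (\<Sum>\<beta>\<in>UNIV. \<Sum>\<alpha>\<in>UNIV. metric_partial g d ?q \<alpha> $ \<nu> $ \<beta> * u $ \<alpha> * u $ \<beta>)"
    unfolding P sum_distrib_right by (simp add: mult_ac)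
   finally show ?thesis by (subst sum.swap) simp
  qed
  have e2: "(\<Sum>\<alpha>\<in>UNIV. \<Sum>\<beta>\<in>UNIV. metric_partial g d ?q \<beta> $ \<nu> $ \<alpha> * u $ \<alpha> * u $ \<beta>) = (dgmat d y u *v u) $ \<nu>"
   unfolding e1[symmetric] by (subst sum.swap) (simp add: mult_ac)
  have e3: "(\<Sum>\<alpha>\<in>UNIV. \<Sum>\<beta>\<in>UNIV. metric_partial g d ?q \<nu> $ \<alpha> $ \<beta> * u $ \<alpha> * u $ \<beta>) = u \<bullet> (dgmat d y (axis \<nu> 1) *v u)"
   unfolding P matrix_vector_mult_def inner_vec_def by (simp add: sum_distrib_left mult_ac)
  have "cv $ \<nu> = (\<Sum>\<alpha>\<in>UNIV. \<Sum>\<beta>\<in>UNIV. metric_partial g d ?q \<alpha> $ \<nu> $ \<beta> * u $ \<alpha> * u $ \<beta>)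
    + (\<Sum>\<alpha>\<in>UNIV. \<Sum>\<beta>\<in>UNIV. metric_partial g d ?q \<beta> $ \<nu> $ \<alpha> * u $ \<alpha> * u $ \<beta>)
    - (\<Sum>\<alpha>\<in>UNIV. \<Sum>\<beta>\<in>UNIV. metric_partial g d ?q \<nu> $ \<alpha> $ \<beta> * u $ \<alpha> * u $ \<beta>)"
   unfolding cv_def by (simp add: algebra_simps sum.distrib sum_subtractf)
  note this[unfolded e1 e2 e3]
  thus ?thesis by simp
 qed
 have rhs: "geo_rhs d y u u = - (1 / 2) *\<^sub>R (matrix_inv (gmat d y) *v cv)"
 proof -
  have "(\<Sum>\<alpha>\<in>UNIV. \<Sum>\<beta>\<in>UNIV. christoffel g d ?q \<mu> \<alpha> \<beta> * u $ \<alpha> * u $ \<beta>)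
    = (\<Sum>\<nu>\<in>UNIV. matrix_inv (gmat d y) $ \<mu> $ \<nu> * cv $ \<nu>) / 2" for \<mu>
  proof -
   define T where "T \<alpha> \<beta> \<nu> = matrix_inv (gmat d y) $ \<mu> $ \<nu> * ((metric_partial g d ?q \<alpha> $ \<nu> $ \<beta>
    + metric_partial g d ?q \<beta> $ \<nu> $ \<alpha> - metric_partial g d ?q \<nu> $ \<alpha> $ \<beta>) * u $ \<alpha> * u $ \<beta>)" for \<alpha> \<beta> \<nu>
   have "(\<Sum>\<alpha>\<in>UNIV. \<Sum>\<beta>\<in>UNIV. christoffel g d ?q \<mu> \<alpha> \<beta> * u $ \<alpha> * u $ \<beta>)
    = (\<Sum>\<alpha>\<in>UNIV. \<Sum>\<beta>\<in>UNIV. \<Sum>\<nu>\<in>UNIV. T \<alpha> \<beta> \<nu>) / 2"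
    unfolding christoffel_def G T_def by (simp add: sum_divide_distrib sum_distrib_right sum_distrib_left mult_ac)
   also have "(\<Sum>\<alpha>\<in>UNIV. \<Sum>\<beta>\<in>UNIV. \<Sum>\<nu>\<in>UNIV. T \<alpha> \<beta> \<nu>) = (\<Sum>\<alpha>\<in>UNIV. \<Sum>\<nu>\<in>UNIV. \<Sum>\<beta>\<in>UNIV. T \<alpha> \<beta> \<nu>)"
    by (intro sum.cong refl sum.swap)
   also have "\<dots> = (\<Sum>\<nu>\<in>UNIV. \<Sum>\<alpha>\<in>UNIV. \<Sum>\<beta>\<in>UNIV. T \<alpha> \<beta> \<nu>)" by (rule sum.swap)
   also have "\<dots> = (\<Sum>\<nu>\<in>UNIV. matrix_inv (gmat d y) $ \<mu> $ \<nu> * cv $ \<nu>)"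
    unfolding T_def cv_def by (simp add: sum_distrib_left)
   finally show ?thesis .
  qed
  thus ?thesis unfolding geo_rhs_def by (simp add: vec_eq_iff matrix_vector_mult_def)
 qed
 have "gmat d y *v geo_rhs d y u u = - (1 / 2) *\<^sub>R cv" unfolding rhs
  by (simp only: matrix_vector_mult_scaleR matrix_vector_mul_assoc gmat_inv[OF d] matrix_vector_mul_lid)
 hence "geo_rhs d y u u \<bullet> (gmat d y *v w) = - (1 / 2) * (w \<bullet> cv)" using gmat_sym[OF d, of "geo_rhs d y u u" w] by simp
 also have "w \<bullet> cv = 2 * (w \<bullet> (dgmat d y u *v u)) - u \<bullet> (dgmat d y w *v u)"
 proof -
  have "u \<bullet> (dgmat d y w *v u) = (\<Sum>\<nu>\<in>UNIV. w $ \<nu> * (u \<bullet> (dgmat d y (axis \<nu> 1) *v u)))"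
  proof -
   have "linear (\<lambda>h. u \<bullet> (dgmat d y h *v u))" using dgmat_linear[OF d] by (auto intro!: linearI simp: linear_add linear_scale
    matrix_vector_mult_add_rdistrib inner_add_right scaleR_matrix_vector_assoc[symmetric])
   hence "u \<bullet> (dgmat d y (\<Sum>\<nu>\<in>UNIV. w $ \<nu> *\<^sub>R axis \<nu> 1) *v u)
    = (\<Sum>\<nu>\<in>UNIV. w $ \<nu> *\<^sub>R (u \<bullet> (dgmat d y (axis \<nu> 1) *v u)))"
    by (simp add: linear_sum[of "\<lambda>h. u \<bullet> (dgmat d y h *v u)"] linear_scale[of "\<lambda>h. u \<bullet> (dgmat d y h *v u)"])
   thus ?thesis using basis_expansion[of w] by (simp add: scalar_mult_eq_scaleR)
  qed
  thus ?thesis unfolding inner_vec_def[of w cv] inner_vec_def[of w "dgmat d y u *v u"] cv_nth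
   by (simp add: algebra_simps sum_subtractf sum_distrib_left)
 qed
 finally show ?thesis using dgmat_sym[OF d, of w u u] by (simp add: field_simps)
qed

lemma geo_rhsI: assumes d: "d \<in> \<A>" "y \<in> chart_image d"
  and v: "\<And>w. v \<bullet> (gmat d y *v w) = - (u \<bullet> (dgmat d y u *v w)) + (u \<bullet> (dgmat d y w *v u)) / 2"
 shows "v = geo_rhs d y u u"
proof -
 have "(v - geo_rhs d y u u) \<bullet> (gmat d y *v w) = 0" for w using v geo_rhs_inner[OF d] by (simp add: inner_diff_left)
 thus ?thesis using gmat_nondegenerate[OF d, of "v - geo_rhs d y u u"] by simp
qed
end

lemma loclip_vec_general:
 fixes f :: "'a::metric_space => 'b::euclidean_space^'n" assumes "\<And>i. locally_lipschitz_on S (\<lambda>x. f x $ i)"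
 shows "locally_lipschitz_on S f"
proof (rule loclip_componentwise)
 fix b :: "'b^'n" assume "b \<in> Basis"
 then obtain i u where "b = axis i u" unfolding Basis_vec_def by auto
 thus "locally_lipschitz_on S (\<lambda>x. f x \<bullet> b)" by (simp add: inner_axis loclip_inner[OF assms loclip_const])
qed

lemma locally_lipschitz_onE:
 fixes f :: "'a::real_normed_vector => 'b::real_normed_vector" assumes S: "open S" "y0 \<in> S" and f: "locally_lipschitz_on S f"
 obtains r C where "r > 0" "C \<ge> 0" "cball y0 r \<subseteq> S" "\<And>x. x \<in> cball y0 r ==> norm (f x) \<le> C"
  "\<And>x y. x \<in> cball y0 r ==> y \<in> cball y0 r ==> norm (f x - f y) \<le> C * norm (x - y)"
proof -
 obtain e L where e: "e > 0" "L-lipschitz_on (ball y0 e \<inter> S) f" using f S(2) unfolding locally_lipschitz_on_def by blast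
 obtain e' where e': "e' > 0" "ball y0 e' \<subseteq> S" using S openE by blast
 define r where "r = min 1 (min e e' / 2)"
 have r: "r > 0" "r \<le> 1" "cball y0 r \<subseteq> ball y0 e \<inter> S" using e e' unfolding r_def by (auto simp: subset_iff)
 have L: "L \<ge> 0" using e(2) lipschitz_on_nonneg by blast
 define C where "C = norm (f y0) + L"
 have lip: "norm (f x - f y) \<le> L * norm (x - y)" if "x \<in> cball y0 r" "y \<in> cball y0 r" for x y
  using lipschitz_onD[OF e(2) subsetD[OF r(3) that(1)] subsetD[OF r(3) that(2)]] by (simp add: dist_norm)
 show thesis
 proof
  fix x assume x: "x \<in> cball y0 r"
  have "norm (f x - f y0) \<le> L * norm (x - y0)" using x r(1) by (intro lip) auto
  also have "\<dots> \<le> L * 1" using x r(2) L by (intro mult_left_mono) (auto simp: dist_norm norm_minus_commute)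
  finally show "norm (f x) \<le> C" unfolding C_def using norm_triangle_ineq2[of "f x" "f y0"] by linarith
 next
  fix x y assume "x \<in> cball y0 r" "y \<in> cball y0 r"
  hence "norm (f x - f y) \<le> L * norm (x - y)" by (rule lip)
  also have "\<dots> \<le> C * norm (x - y)" unfolding C_def by (intro mult_right_mono) auto
  finally show "norm (f x - f y) \<le> C * norm (x - y)" .
 qed (use r L in \<open>auto simp: C_def\<close>)
qed

definition contract3 :: "real^'n^'n^'n => real^'n => real^'n => real^'n" where
 "contract3 T u w = - (\<chi> \<mu>. \<Sum>\<alpha>\<in>UNIV. \<Sum>\<beta>\<in>UNIV. T $ \<mu> $ \<alpha> $ \<beta> * u $ \<alpha> * w $ \<beta>)"

lemma contract3_bound: "norm (contract3 (T :: real^'n^'n^'n) u w) \<le> real CARD('n) ^ 3 * norm T * norm u * norm w"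
proof -
 have "norm (contract3 T u w) \<le> (\<Sum>\<mu>\<in>UNIV. \<bar>contract3 T u w $ \<mu>\<bar>)" by (rule norm_le_l1_cart)
 also have "\<dots> \<le> (\<Sum>(\<mu>::'n)\<in>UNIV. \<Sum>(\<alpha>::'n)\<in>UNIV. \<Sum>(\<beta>::'n)\<in>UNIV. norm T * norm u * norm w)"
 proof (rule sum_mono)
  fix \<mu> :: 'n
  have "\<bar>contract3 T u w $ \<mu>\<bar> \<le> (\<Sum>\<alpha>\<in>UNIV. \<Sum>\<beta>\<in>UNIV. \<bar>T $ \<mu> $ \<alpha> $ \<beta> * u $ \<alpha> * w $ \<beta>\<bar>)"
   unfolding contract3_def by (simp, intro order_trans[OF sum_abs] sum_mono sum_abs)
  also have "\<dots> \<le> (\<Sum>(\<alpha>::'n)\<in>UNIV. \<Sum>(\<beta>::'n)\<in>UNIV. norm T * norm u * norm w)"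
  proof (intro sum_mono)
   fix \<alpha> \<beta> :: 'n
   have "\<bar>T $ \<mu> $ \<alpha> $ \<beta>\<bar> \<le> norm T"
    using Finite_Cartesian_Product.norm_nth_le[where x = T and i = \<mu>] Finite_Cartesian_Product.norm_nth_le[where x = "T $ \<mu>" and i = \<alpha>] component_le_norm_cart[of "T $ \<mu> $ \<alpha>" \<beta>] by linarith
   thus "\<bar>T $ \<mu> $ \<alpha> $ \<beta> * u $ \<alpha> * w $ \<beta>\<bar> \<le> norm T * norm u * norm w"
    unfolding abs_mult by (intro mult_mono component_le_norm_cart) auto
  qed
  finally show "\<bar>contract3 T u w $ \<mu>\<bar> \<le> (\<Sum>(\<alpha>::'n)\<in>UNIV. \<Sum>(\<beta>::'n)\<in>UNIV. norm T * norm u * norm w)" .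
 qed
 also have "\<dots> = real CARD('n) ^ 3 * norm T * norm u * norm w" by (simp add: power3_eq_cube mult_ac)
 finally show ?thesis .
qed

lemma contract3_diff: "contract3 S u w - contract3 T u w = contract3 (S - T) u w"
 by (simp add: contract3_def vec_eq_iff sum_subtractf left_diff_distrib)

lemma contract3_bilinear: "bounded_bilinear (contract3 (T :: real^'n^'n^'n))" unfolding bilinear_conv_bounded_bilinear[symmetric] bilinear_def
 by (auto intro!: linearI simp: contract3_def vec_eq_iff algebra_simps sum.distrib sum_distrib_left)

context riemannian_manifold
begin

lemma matrix_inv_locally_lipschitz: assumes d: "d \<in> \<A>"
 shows "locally_lipschitz_on (chart_image d) (\<lambda>y. matrix_inv (gmat d y) $ \<mu> $ \<nu>)"
proof -
 have G: "locally_lipschitz_on (chart_image d) (gmat d)" using Ck1_on_1_imp_0[OF chart_continuous(4)[OF atlas_chart[OF d]] gmat_C11[OF d]] .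
 have "locally_lipschitz_on (chart_image d) (\<lambda>y. matrix_inv (gmat d y) *v axis \<nu> 1)"
 proof (rule linear_inverse_locally_lipschitz_on[where L = "\<lambda>y. (*v) (gmat d y)" and M = "\<lambda>y. (*v) (matrix_inv (gmat d y))"])
  show "locally_lipschitz_on (chart_image d) (\<lambda>y. gmat d y *v b)" for b
   by (rule loclip_bilinear[OF bounded_bilinear_matrix_vector_mult G loclip_const])
 qed (simp_all only: matrix_vector_mul_assoc gmat_inv[OF d] matrix_vector_mul_lid matrix_vector_mul_linear)
 hence "locally_lipschitz_on (chart_image d) (\<lambda>y. (matrix_inv (gmat d y) *v axis \<nu> 1) $ \<mu>)" by (rule loclip_nth)
 moreover have "(A *v axis \<nu> 1) $ \<mu> = A $ \<mu> $ \<nu>" for A :: "real^'n^'n" by (simp add: matrix_vector_mult_basis column_def)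
 ultimately show ?thesis by simp
qed

definition chr :: "('m, 'n) chart => real^'n => real^'n^'n^'n" where
 "chr d y = (\<chi> \<mu> \<alpha> \<beta>. christoffel g d (chart_inv d y) \<mu> \<alpha> \<beta>)"

lemma geo_rhs_contract3: "geo_rhs d y = contract3 (chr d y)" by (intro ext) (simp add: geo_rhs_def contract3_def chr_def)

lemma dgmat_locally_lipschitz: assumes d: "d \<in> \<A>" shows "locally_lipschitz_on (chart_image d) (\<lambda>y. dgmat d y h)"
 unfolding dgmat_def using Ck1_on_1_derivative_lipschitz[OF gmat_C11[OF d] loclip_const] .

lemma chr_locally_lipschitz: assumes d: "d \<in> \<A>" shows "locally_lipschitz_on (chart_image d) (chr d)"
proof -
 let ?S = "chart_image d"
 have D: "locally_lipschitz_on ?S (\<lambda>y. dgmat d y (axis \<nu> 1) $ i $ j)" for \<nu> i j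
  by (intro loclip_nth dgmat_locally_lipschitz[OF d])
 define f where "f \<mu> \<alpha> \<beta> y = (\<Sum>\<nu>\<in>UNIV. matrix_inv (gmat d y) $ \<mu> $ \<nu> *
    (dgmat d y (axis \<alpha> 1) $ \<nu> $ \<beta> + dgmat d y (axis \<beta> 1) $ \<nu> $ \<alpha> - dgmat d y (axis \<nu> 1) $ \<alpha> $ \<beta>)) / 2" for \<mu> \<alpha> \<beta> y
 have f: "locally_lipschitz_on ?S (f \<mu> \<alpha> \<beta>)" for \<mu> \<alpha> \<beta> unfolding f_def
  by (intro loclip_divide loclip_sum loclip_mult
    loclip_add loclip_diff D matrix_inv_locally_lipschitz[OF d]
    loclip_const) simp
 have eq: "f \<mu> \<alpha> \<beta> y = chr d y $ \<mu> $ \<alpha> $ \<beta>" if "y \<in> ?S" for \<mu> \<alpha> \<beta> y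
  unfolding chr_def f_def christoffel_def metric_partial_def dgmat_def gmat_def using chart_inv_right[OF atlas_chart[OF d] that] by simp
 have "locally_lipschitz_on ?S (\<lambda>y. chr d y $ \<mu> $ \<alpha> $ \<beta>)" for \<mu> \<alpha> \<beta>
  using f[of \<mu> \<alpha> \<beta>] loclip_cong[of ?S "f \<mu> \<alpha> \<beta>" "\<lambda>y. chr d y $ \<mu> $ \<alpha> $ \<beta>"] eq by blast
 thus ?thesis by (intro loclip_vec_general loclip_vec)
qed

lemma local_spray: assumes d: "d \<in> \<A>" and y0: "y0 \<in> chart_image d"
 obtains K where "K \<ge> 0" "\<exists>r>0. cball y0 r \<subseteq> chart_image d \<and> (\<forall>a. 0 < a \<and> a \<le> r \<longrightarrow> spray (geo_rhs d) y0 a K)"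
proof -
 obtain r C where r: "r > 0" "C \<ge> 0" "cball y0 r \<subseteq> chart_image d"
  "\<And>x. x \<in> cball y0 r ==> norm (chr d x) \<le> C"
  "\<And>x y. x \<in> cball y0 r ==> y \<in> cball y0 r ==> norm (chr d x - chr d y) \<le> C * norm (x - y)"
  using locally_lipschitz_onE[OF chart_continuous(4)[OF atlas_chart[OF d]] y0 chr_locally_lipschitz[OF d]] by metis
 define K where "K = real CARD('n) ^ 3 * C"
 have K: "K \<ge> 0" unfolding K_def using r(2) by simp
 define r' where "r' = min r (1 / (2 * (K + 1)))"
 have r': "r' > 0" "r' \<le> r" unfolding r'_def using r(1) K by auto
 have "spray (geo_rhs d) y0 a K" if a: "0 < a" "a \<le> r'" for a
 proof (rule spray.intro)
  have sub: "cball y0 a \<subseteq> cball y0 r" using a r'(2) by (intro subset_cball) simp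
  show "0 < a" "0 \<le> K" by fact+
  have "a * K \<le> 1 / (2 * (K + 1)) * (K + 1)" using a K unfolding r'_def by (intro mult_mono) auto
  also have "1 / (2 * (K + 1)) * (K + 1) = 1 / 2" using K by (simp add: field_simps)
  finally show "a * K \<le> 1 / 2" .
  fix x assume "x \<in> cball y0 a"
  hence x: "x \<in> cball y0 r" using sub by blast
  show "bounded_bilinear (geo_rhs d x)" unfolding geo_rhs_contract3 by (rule contract3_bilinear)
  fix u w
  show "norm (geo_rhs d x u w) \<le> K * norm u * norm w" unfolding geo_rhs_contract3 K_def
   using r(4)[OF x] by (intro order_trans[OF contract3_bound] mult_right_mono mult_left_mono) auto
  fix y assume "y \<in> cball y0 a"
  hence y: "y \<in> cball y0 r" using sub by blast
  have "norm (geo_rhs d x u w - geo_rhs d y u w) \<le> real CARD('n) ^ 3 * norm (chr d x - chr d y) * norm u * norm w"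
   unfolding geo_rhs_contract3 contract3_diff by (rule contract3_bound)
  also have "\<dots> \<le> real CARD('n) ^ 3 * (C * norm (x - y)) * norm u * norm w"
   using r(5)[OF x y] by (intro mult_right_mono mult_left_mono) auto
  finally show "norm (geo_rhs d x u w - geo_rhs d y u w) \<le> K * norm (x - y) * norm u * norm w" unfolding K_def by (simp add: mult_ac)
 qed
 moreover have "cball y0 r' \<subseteq> chart_image d" using r(3) r'(2) subset_cball[of r' r y0] by simp
 ultimately have "\<exists>r>0. cball y0 r \<subseteq> chart_image d \<and> (\<forall>a. 0 < a \<and> a \<le> r \<longrightarrow> spray (geo_rhs d) y0 a K)"
  using r'(1) by (intro exI[of _ r']) blast
 thus thesis by (rule that[OF K])
qed

lemma local_metric_spray: assumes d: "d \<in> \<A>" and y0: "y0 \<in> chart_image d" and center: "gmat d y0 = mat 1"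
 obtains a K L where "metric_spray (geo_rhs d) y0 a K (gmat d) (dgmat d) L" "cball y0 a \<subseteq> chart_image d"
proof -
 note op = chart_continuous(4)[OF atlas_chart[OF d]]
 obtain K r0 where K: "K \<ge> 0" and r0: "r0 > 0" "cball y0 r0 \<subseteq> chart_image d"
  "\<And>a. 0 < a ==> a \<le> r0 ==> spray (geo_rhs d) y0 a K" using local_spray[OF d y0] by metis
 define D where "D y = (\<chi> \<nu>. dgmat d y (axis \<nu> 1))" for y
 have "locally_lipschitz_on (chart_image d) D" unfolding D_def by (rule loclip_vec_general) (simp add: dgmat_locally_lipschitz[OF d])
 then obtain r1 C1 where r1: "r1 > 0" "C1 \<ge> 0" "cball y0 r1 \<subseteq> chart_image d"
  "\<And>x. x \<in> cball y0 r1 ==> norm (D x) \<le> C1"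
  "\<And>x y. x \<in> cball y0 r1 ==> y \<in> cball y0 r1 ==> norm (D x - D y) \<le> C1 * norm (x - y)"
  using locally_lipschitz_onE[OF op y0] by metis
 obtain r2 C2 where r2: "r2 > 0" "C2 \<ge> 0" "cball y0 r2 \<subseteq> chart_image d"
  "\<And>x. x \<in> cball y0 r2 ==> norm (gmat d x) \<le> C2"
  "\<And>x y. x \<in> cball y0 r2 ==> y \<in> cball y0 r2 ==> norm (gmat d x - gmat d y) \<le> C2 * norm (x - y)"
  using locally_lipschitz_onE[OF op y0 Ck1_on_1_imp_0[OF op gmat_C11[OF d]]] by metis
 obtain k where k: "k > 0" "\<And>A w. norm ((A :: real^'n^'n) *v w) \<le> norm A * norm w * k"
  using bounded_bilinear.pos_bounded[OF bounded_bilinear_matrix_vector_mult] by blast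
 define a where "a = min (min r0 r1) (min r2 (1 / (10 * k * (C2 + 1))))"
 have ab: "0 < a" "a \<le> r0" "a \<le> r1" "a \<le> r2" "a \<le> 1 / (10 * k * (C2 + 1))" unfolding a_def using r0(1) r1(1) r2(1,2) k(1) by auto
 have sub: "cball y0 a \<subseteq> cball y0 r1" "cball y0 a \<subseteq> cball y0 r2" "cball y0 a \<subseteq> chart_image d"
  using ab r0(2) subset_cball[of a r0 y0] subset_cball[of a r1 y0] subset_cball[of a r2 y0] by auto
 define n where "n = real CARD('n)"
 define L where "L = n * C1 + C2"
 have nC: "0 \<le> n * C1" unfolding n_def using r1(2) by simp
 have sum_bound: "norm (\<Sum>\<nu>\<in>UNIV. h $ \<nu> *\<^sub>R X $ \<nu>) \<le> n * norm X * norm h" for h :: "real^'n" and X :: "(real^'n^'n)^'n"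
 proof -
  have "norm (\<Sum>\<nu>\<in>UNIV. h $ \<nu> *\<^sub>R X $ \<nu>) \<le> (\<Sum>(\<nu>::'n)\<in>UNIV. norm h * norm X)"
  proof (rule order_trans[OF norm_sum sum_mono])
   fix \<nu> :: 'n
   show "norm (h $ \<nu> *\<^sub>R X $ \<nu>) \<le> norm h * norm X"
    unfolding norm_scaleR by (intro mult_mono component_le_norm_cart Finite_Cartesian_Product.norm_nth_le) auto
  qed
  thus ?thesis unfolding n_def by (simp add: mult_ac)
 qed
 have dg: "dgmat d y h = (\<Sum>\<nu>\<in>UNIV. h $ \<nu> *\<^sub>R D y $ \<nu>)" if "y \<in> chart_image d" for y h
 proof -
  have "dgmat d y h = dgmat d y (\<Sum>\<nu>\<in>UNIV. h $ \<nu> *\<^sub>R axis \<nu> 1)"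
   using basis_expansion[of h] by (simp add: scalar_mult_eq_scaleR)
  thus ?thesis using dgmat_linear[OF d that] unfolding D_def by (simp add: linear_sum linear_scale)
 qed
 interpret spray "geo_rhs d" y0 a K using r0(3)[OF ab(1,2)] .
 have "metric_spray (geo_rhs d) y0 a K (gmat d) (dgmat d) L"
 proof (unfold_locales)
  show "0 \<le> L" unfolding L_def using nC r2(2) by simp
  show "gmat d y0 = mat 1" by fact
  fix x assume x: "x \<in> cball y0 a"
  hence xi: "x \<in> chart_image d" using sub by blast
  show "(gmat d has_derivative dgmat d x) (at x)" using gmat_deriv[OF d xi] .
  show "transpose (gmat d x) = gmat d x" using gmat_transpose[OF d xi] .
  show "norm (gmat d x) \<le> L" unfolding L_def using r2(4)[of x] x sub(2) nC by force
  fix h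
  have "norm (dgmat d x h) \<le> n * norm (D x) * norm h" unfolding dg[OF xi] by (rule sum_bound)
  also have "\<dots> \<le> L * norm h"
  proof (rule mult_right_mono)
   have "n * norm (D x) \<le> n * C1" using r1(4)[of x] x sub(1) unfolding n_def by (intro mult_left_mono) auto
   thus "n * norm (D x) \<le> L" unfolding L_def using r2(2) by simp
  qed simp
  finally show "norm (dgmat d x h) \<le> L * norm h" .
  show "geo_rhs d x h h \<bullet> (gmat d x *v w) = - (h \<bullet> (dgmat d x h *v w)) + (h \<bullet> (dgmat d x w *v h)) / 2" for w
   by (rule geo_rhs_inner[OF d xi])
  show "\<bar>h \<bullet> (gmat d x *v w) - h \<bullet> w\<bar> \<le> norm h * norm w / 10" for w
  proof -
   have "h \<bullet> (gmat d x *v w) - h \<bullet> w = h \<bullet> ((gmat d x - gmat d y0) *v w)"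
    by (simp add: center matrix_vector_mult_diff_rdistrib inner_diff_right)
   hence "\<bar>h \<bullet> (gmat d x *v w) - h \<bullet> w\<bar> \<le> norm h * norm ((gmat d x - gmat d y0) *v w)"
    by (metis Cauchy_Schwarz_ineq2)
   also have "\<dots> \<le> norm h * (norm (gmat d x - gmat d y0) * norm w * k)" by (intro mult_left_mono k) auto
   also have "\<dots> \<le> norm h * ((1 / (10 * k)) * norm w * k)"
   proof (intro mult_left_mono mult_right_mono)
    have "norm (gmat d x - gmat d y0) \<le> C2 * norm (x - y0)" using x sub(2) r2(1) by (intro r2(5)) auto
    also have "\<dots> \<le> (C2 + 1) * (1 / (10 * k * (C2 + 1)))"
    using x ab(5) r2(2) by (intro mult_mono) (auto simp: dist_norm norm_minus_commute)
    also have "\<dots> = 1 / (10 * k)" using r2(2) by simp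
    finally show "norm (gmat d x - gmat d y0) \<le> 1 / (10 * k)" .
   qed (use k in auto)
   also have "\<dots> = norm h * norm w / 10" using k(1) by simp
   finally show ?thesis .
  qed
  fix y assume y: "y \<in> cball y0 a"
  hence yi: "y \<in> chart_image d" using sub by blast
  have "dgmat d x h - dgmat d y h = (\<Sum>\<nu>\<in>UNIV. h $ \<nu> *\<^sub>R (D x - D y) $ \<nu>)"
   unfolding dg[OF xi] dg[OF yi] by (simp add: sum_subtractf[symmetric] scaleR_diff_right)
  hence "norm (dgmat d x h - dgmat d y h) \<le> n * norm (D x - D y) * norm h" by (simp only: sum_bound)
  also have "\<dots> \<le> (L * norm (x - y)) * norm h"
  proof (rule mult_right_mono)
   have "n * norm (D x - D y) \<le> n * (C1 * norm (x - y))"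
    using r1(5)[OF subsetD[OF sub(1) x] subsetD[OF sub(1) y]] unfolding n_def by (intro mult_left_mono) auto
   also have "\<dots> \<le> L * norm (x - y)" unfolding L_def mult.assoc[symmetric] using r2(2) by (intro mult_right_mono) auto
   finally show "n * norm (D x - D y) \<le> L * norm (x - y)" .
  qed simp
  finally show "norm (dgmat d x h - dgmat d y h) \<le> L * norm (x - y) * norm h" .
 qed
 thus thesis by (rule that[OF _ sub(3)])
qed
end

context riemannian_manifold
begin

abbreviation trans_map :: "('m, 'n) chart => ('m, 'n) chart => real^'n => real^'n" where
 "trans_map c d \<equiv> snd d \<circ> chart_inv c"

abbreviation trans_deriv :: "('m, 'n) chart => ('m, 'n) chart => real^'n => real^'n => real^'n" where
 "trans_deriv c d y \<equiv> frechet_derivative (trans_map c d) (at y)"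

context
 fixes c d :: "('m, 'n) chart" and S assumes c: "c \<in> \<A>" and d: "d \<in> \<A>"
 defines "S \<equiv> snd c ` (fst c \<inter> fst d)"
begin

lemma overlap: "open S" "S \<subseteq> chart_image c" "y \<in> S ==> chart_inv c y \<in> fst d"
 "y \<in> S ==> trans_map c d y \<in> chart_image d" "y \<in> S ==> chart_inv d (trans_map c d y) = chart_inv c y"
 using chart_open[OF atlas_chart[OF c]] chart_continuous(3)[OF atlas_chart[OF d]]
  chart_preimage[OF atlas_chart[OF c]] chart_inv_left[OF atlas_chart[OF d]] unfolding S_def by auto

lemma trans_deriv: "y \<in> S ==> (trans_map c d has_derivative trans_deriv c d y) (at y)"
 and trans_deriv_C1: "b \<in> Basis ==> y \<in> S ==> (\<lambda>y. trans_deriv c d y b) differentiable (at y)"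
 using transition_C21[OF c d] unfolding S_def numeral_2_eq_2 by (auto simp: frechet_derivative_works[symmetric])

definition hess :: "real^'n => real^'n => real^'n => real^'n" where
 "hess y h w = (\<Sum>b\<in>Basis. (w \<bullet> b) *\<^sub>R frechet_derivative (\<lambda>y. trans_deriv c d y b) (at y) h)"

lemma trans_deriv_linear: "y \<in> S ==> linear (trans_deriv c d y)" using trans_deriv has_derivative_linear by blast

lemma trans_deriv_expand: assumes "y \<in> S" shows "trans_deriv c d y w = (\<Sum>b\<in>Basis. (w \<bullet> b) *\<^sub>R trans_deriv c d y b)"
proof -
 have "trans_deriv c d y w = trans_deriv c d y (\<Sum>b\<in>Basis. (w \<bullet> b) *\<^sub>R b)" by (simp add: euclidean_representation)
 thus ?thesis using trans_deriv_linear[OF assms] by (simp only: linear_sum linear_scale)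
qed

lemma hess: assumes y: "y \<in> S" shows "((\<lambda>y. trans_deriv c d y w) has_derivative (\<lambda>h. hess y h w)) (at y)"
proof -
 have "((\<lambda>y. \<Sum>b\<in>Basis. (w \<bullet> b) *\<^sub>R trans_deriv c d y b) has_derivative (\<lambda>h. hess y h w)) (at y)"
  unfolding hess_def
  by (intro has_derivative_sum has_derivative_scaleR_right) (use trans_deriv_C1 y in \<open>simp add: frechet_derivative_works\<close>)
 thus ?thesis by (rule has_derivative_transform_within_open[OF _ overlap(1) y]) (rule trans_deriv_expand[symmetric])
qed

lemma hess_sym: "y \<in> S ==> hess y h w = hess y w h" using second_derivative_symmetric[OF overlap(1) _ trans_deriv hess hess] by blast

lemma metric_pullback: assumes y: "y \<in> S"
 shows "a \<bullet> (gmat c y *v b) = trans_deriv c d y a \<bullet> (gmat d (trans_map c d y) *v trans_deriv c d y b)"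
proof -
 let ?q = "chart_inv c y" and ?J = "matrix (trans_deriv c d y)"
 have q: "?q \<in> fst c \<inter> fst d" "snd c ?q = y"
  using overlap(2,3) y chart_inv_right[OF atlas_chart[OF c]] chart_inv_in[OF atlas_chart[OF c]] by auto
 have J: "?J *v a = trans_deriv c d y a" for a by (rule matrix_works) (simp add: linear_matrix_vector_mul_eq trans_deriv_linear[OF y])
 have "g c ?q = transpose ?J ** g d ?q ** ?J"
 proof -
  have "let J = matrix (frechet_derivative (snd d \<circ> chart_inv c) (at (snd c ?q)))
    in g c ?q = transpose J ** g d ?q ** J"
   by (rule bspec[OF bspec[OF bspec[OF conjunct2[OF metric[unfolded C11_riemannian_metric_def]] c] d], OF q(1)])
  thus ?thesis unfolding Let_def q(2) .
 qed
 moreover have "gmat d (trans_map c d y) = g d ?q" unfolding gmat_def using overlap(5)[OF y] by simp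
 ultimately have "gmat c y = transpose ?J ** gmat d (trans_map c d y) ** ?J" unfolding gmat_def by (simp only: comp_apply)
 hence "gmat c y *v b = transpose ?J *v (gmat d (trans_map c d y) *v (?J *v b))" by (simp only: matrix_vector_mul_assoc matrix_mul_assoc)
 hence "a \<bullet> (gmat c y *v b) = (?J *v a) \<bullet> (gmat d (trans_map c d y) *v (?J *v b))"
  by (metis dot_lmul_matrix vector_transpose_matrix)
 thus ?thesis by (simp add: J)
qed

lemma metric_pullback_deriv: assumes y: "y \<in> S"
 shows "a \<bullet> (dgmat c y h *v b) = hess y h a \<bullet> (gmat d (trans_map c d y) *v trans_deriv c d y b)
  + trans_deriv c d y a \<bullet> (dgmat d (trans_map c d y) (trans_deriv c d y h) *v trans_deriv c d y b)
  + trans_deriv c d y a \<bullet> (gmat d (trans_map c d y) *v hess y h b)"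
proof -
 have bl: "bounded_linear (\<lambda>A :: real^'n^'n. a \<bullet> (A *v b))" by (rule bounded_linear_compose[OF bounded_linear_inner_right
    bounded_bilinear.bounded_linear_left[OF bounded_bilinear_matrix_vector_mult]])
 have "((\<lambda>z. a \<bullet> (gmat c z *v b)) has_derivative (\<lambda>h. a \<bullet> (dgmat c y h *v b))) (at y)"
  using overlap(2) y by (intro bounded_linear.has_derivative[OF bl gmat_deriv[OF c]]) auto
 hence 1: "((\<lambda>z. trans_deriv c d z a \<bullet> (gmat d (trans_map c d z) *v trans_deriv c d z b))
   has_derivative (\<lambda>h. a \<bullet> (dgmat c y h *v b))) (at y)"
  by (rule has_derivative_transform_within_open[OF _ overlap(1) y]) (rule metric_pullback)
 have G: "((\<lambda>z. gmat d (trans_map c d z)) has_derivative (\<lambda>h. dgmat d (trans_map c d y) (trans_deriv c d y h))) (at y)"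
  by (rule has_derivative_compose[OF trans_deriv[OF y] gmat_deriv[OF d overlap(4)[OF y]]])
 have 2: "((\<lambda>z. gmat d (trans_map c d z) *v trans_deriv c d z b) has_derivative
  (\<lambda>h. gmat d (trans_map c d y) *v hess y h b + dgmat d (trans_map c d y) (trans_deriv c d y h) *v trans_deriv c d y b)) (at y)"
  by (rule bounded_bilinear.FDERIV[OF bounded_bilinear_matrix_vector_mult G hess[OF y]])
 have 3: "((\<lambda>z. trans_deriv c d z a \<bullet> (gmat d (trans_map c d z) *v trans_deriv c d z b)) has_derivative
  (\<lambda>h. trans_deriv c d y a \<bullet> (gmat d (trans_map c d y) *v hess y h b + dgmat d (trans_map c d y) (trans_deriv c d y h) *v trans_deriv c d y b)
    + hess y h a \<bullet> (gmat d (trans_map c d y) *v trans_deriv c d y b))) (at y)"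
  by (rule bounded_bilinear.FDERIV[OF bounded_bilinear_inner hess[OF y] 2])
 from fun_cong[OF has_derivative_unique[OF 1 3], of h] show ?thesis by (simp add: inner_add_right)
qed

lemma trans_deriv_surj: assumes y: "y \<in> S"
 obtains w where "trans_deriv c d y w = v"
proof -
 have "inj (trans_deriv c d y)" unfolding linear_injective_0[OF trans_deriv_linear[OF y]]
 proof (intro allI impI)
  fix w assume "trans_deriv c d y w = 0"
  hence "w \<bullet> (gmat c y *v w) = 0" using metric_pullback[OF y, of w w] by simp
  thus "w = 0" using gmat_pos[OF c, of y w] overlap(2) y by fastforce
 qed
 hence "surj (trans_deriv c d y)" by (rule linear_inj_imp_surj[OF trans_deriv_linear[OF y]])
 thus thesis using that by (metis surjD)
qed

text \<open>The transformation law of the Christoffel symbols. In the Euler--Lagrange form it reduces to the derivative of the pull-back of the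
metric; the two Hessian terms that are left over cancel by symmetry.\<close>

lemma geo_rhs_transform: assumes y: "y \<in> S" shows "trans_deriv c d y (geo_rhs c y u u) + hess y u u
  = geo_rhs d (trans_map c d y) (trans_deriv c d y u) (trans_deriv c d y u)"
proof (rule geo_rhsI[OF d overlap(4)[OF y]])
 fix v
 obtain w where w: "v = trans_deriv c d y w" using trans_deriv_surj[OF y] by metis
 have yc: "y \<in> chart_image c" using overlap(2) y by blast
 let ?J = "trans_deriv c d y" and ?G = "gmat d (trans_map c d y)" and ?D = "dgmat d (trans_map c d y)"
 have "?J (geo_rhs c y u u) \<bullet> (?G *v ?J w) = - (u \<bullet> (dgmat c y u *v w)) + (u \<bullet> (dgmat c y w *v u)) / 2"
  using metric_pullback[OF y, of "geo_rhs c y u u" w] geo_rhs_inner[OF c yc] by simp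
 moreover have "u \<bullet> (dgmat c y u *v w) = hess y u u \<bullet> (?G *v ?J w) + ?J u \<bullet> (?D (?J u) *v ?J w) + ?J u \<bullet> (?G *v hess y w u)"
  unfolding hess_sym[OF y, of w u] by (rule metric_pullback_deriv[OF y])
 moreover have "u \<bullet> (dgmat c y w *v u) = hess y w u \<bullet> (?G *v ?J u) + ?J u \<bullet> (?D (?J w) *v ?J u) + ?J u \<bullet> (?G *v hess y w u)"
  by (rule metric_pullback_deriv[OF y])
 moreover have "hess y w u \<bullet> (?G *v ?J u) = ?J u \<bullet> (?G *v hess y w u)" by (rule gmat_sym[OF d overlap(4)[OF y]])
 ultimately show "(?J (geo_rhs c y u u) + hess y u u) \<bullet> (?G *v v)
   = - (?J u \<bullet> (?D (?J u) *v v)) + (?J u \<bullet> (?D v *v ?J u)) / 2" unfolding w inner_add_left by argo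
qed

lemma geodesic_equation_transforms: assumes I: "open I" "t \<in> I" and x: "\<And>s. s \<in> I ==> (x has_vector_derivative u s) (at s)"
  and u: "(u has_vector_derivative geo_rhs c (x t) (u t) (u t)) (at t)" and xt: "x t \<in> S"
 shows "(trans_map c d \<circ> x has_vector_derivative trans_deriv c d (x t) (u t)) (at t)"
  and "((\<lambda>s. trans_deriv c d (x s) (u s)) has_vector_derivative
   geo_rhs d (trans_map c d (x t)) (trans_deriv c d (x t) (u t)) (trans_deriv c d (x t) (u t))) (at t)"
proof -
 have comp: "((\<lambda>s. f (x s)) has_vector_derivative f' (u t)) (at t)"
  if f: "(f has_derivative f') (at (x t))" for f f' :: "real^'n => real^'n"
 proof -
  have "((\<lambda>s. f (x s)) has_derivative (\<lambda>h. f' (h *\<^sub>R u t))) (at t)"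
   using x[OF I(2)] f unfolding has_vector_derivative_def by (rule has_derivative_compose)
  thus ?thesis unfolding has_vector_derivative_def using has_derivative_linear[OF f] by (simp add: linear_scale)
 qed
 show "(trans_map c d \<circ> x has_vector_derivative trans_deriv c d (x t) (u t)) (at t)" using comp[OF trans_deriv[OF xt]] unfolding comp_def .
 have cont: "continuous_on I x" using x has_vector_derivative_continuous continuous_at_imp_continuous_on by blast
 define T where "T = I \<inter> x -` S"
 have T: "open T" "t \<in> T" unfolding T_def using continuous_on_open_vimage[OF I(1), of x] cont overlap(1) I(2) xt by (auto simp: Int_commute)
 have ub: "((\<lambda>s. u s \<bullet> b) has_vector_derivative geo_rhs c (x t) (u t) (u t) \<bullet> b) (at t)" for b
  by (rule bounded_linear.has_vector_derivative[OF bounded_linear_inner_left u])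
 have "((\<lambda>s. \<Sum>b\<in>Basis. (u s \<bullet> b) *\<^sub>R trans_deriv c d (x s) b) has_vector_derivative
  (\<Sum>b\<in>Basis. (u t \<bullet> b) *\<^sub>R hess (x t) (u t) b + (geo_rhs c (x t) (u t) (u t) \<bullet> b) *\<^sub>R trans_deriv c d (x t) b)) (at t)"
  by (intro has_vector_derivative_sum bounded_bilinear.has_vector_derivative[OF bounded_bilinear_scaleR ub comp[OF hess[OF xt]]])
 hence "((\<lambda>s. trans_deriv c d (x s) (u s)) has_vector_derivative
  (\<Sum>b\<in>Basis. (u t \<bullet> b) *\<^sub>R hess (x t) (u t) b + (geo_rhs c (x t) (u t) (u t) \<bullet> b) *\<^sub>R trans_deriv c d (x t) b)) (at t)"
  by (rule has_vector_derivative_transform_within_open[OF _ T])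
   (use trans_deriv_expand in \<open>simp add: T_def\<close>)
 moreover have "(\<Sum>b\<in>Basis. (u t \<bullet> b) *\<^sub>R hess (x t) (u t) b + (geo_rhs c (x t) (u t) (u t) \<bullet> b) *\<^sub>R trans_deriv c d (x t) b)
   = hess (x t) (u t) (u t) + trans_deriv c d (x t) (geo_rhs c (x t) (u t) (u t))"
 proof -
  have "hess (x t) (u t) b = frechet_derivative (\<lambda>y. trans_deriv c d y b) (at (x t)) (u t)" if "b \<in> Basis" for b
   unfolding hess_def using that by (simp add: inner_Basis if_distrib[of "\<lambda>r. r *\<^sub>R _"] sum.delta cong: if_cong)
  thus ?thesis unfolding hess_def[of "x t" "u t" "u t"] sum.distrib trans_deriv_expand[OF xt, of "geo_rhs c (x t) (u t) (u t)"] by simp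
 qed
 ultimately show "((\<lambda>s. trans_deriv c d (x s) (u s)) has_vector_derivative
   geo_rhs d (trans_map c d (x t)) (trans_deriv c d (x t) (u t)) (trans_deriv c d (x t) (u t))) (at t)"
  using geo_rhs_transform[OF xt, of "u t"] by (simp add: add.commute)
qed
end

lemma chart_curve_geodesic_solution: assumes c: "c \<in> \<A>" and I: "open I" "is_interval I"
  and x: "\<And>s. s \<in> I ==> (x has_vector_derivative u s) (at s)"
  and u: "\<And>s. s \<in> I ==> (u has_vector_derivative geo_rhs c (x s) (u s) (u s)) (at s)"
  and xc: "\<And>s. s \<in> I ==> x s \<in> chart_image c" shows "geodesic_solution \<A> g I (chart_inv c \<circ> x)"
 unfolding geodesic_solution_def
proof (intro conjI I ballI)
 have "continuous_on I x" using x has_vector_derivative_continuous continuous_at_imp_continuous_on by blast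
 thus "continuous_on I (chart_inv c \<circ> x)"
  using xc by (intro continuous_on_compose continuous_on_subset[OF chart_continuous(2)[OF atlas_chart[OF c]]]) auto
 fix d assume d: "d \<in> \<A>"
 show "\<exists>u. \<forall>t\<in>I. (chart_inv c \<circ> x) t \<in> fst d \<longrightarrow>
    (snd d \<circ> (chart_inv c \<circ> x) has_vector_derivative u t) (at t) \<and>
    (u has_vector_derivative
    - (\<chi> \<mu>. \<Sum>\<alpha>\<in>UNIV. \<Sum>\<beta>\<in>UNIV. christoffel g d ((chart_inv c \<circ> x) t) \<mu> \<alpha> \<beta> * u t $ \<alpha> * u t $ \<beta>)) (at t)"
 proof (rule exI[of _ "\<lambda>s. trans_deriv c d (x s) (u s)"], intro ballI impI)
  fix t assume t: "t \<in> I" and td: "(chart_inv c \<circ> x) t \<in> fst d"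
  have xt: "x t \<in> snd c ` (fst c \<inter> fst d)" using td xc[OF t] chart_preimage[OF atlas_chart[OF c]] by auto
  note tr = geodesic_equation_transforms[OF c d I(1) t x u[OF t] xt]
  have "chart_inv d (trans_map c d (x t)) = (chart_inv c \<circ> x) t" using overlap(5)[OF c d xt] by simp
  thus "(snd d \<circ> (chart_inv c \<circ> x) has_vector_derivative trans_deriv c d (x t) (u t)) (at t) \<and>
    ((\<lambda>s. trans_deriv c d (x s) (u s)) has_vector_derivative
    - (\<chi> \<mu>. \<Sum>\<alpha>\<in>UNIV. \<Sum>\<beta>\<in>UNIV. christoffel g d ((chart_inv c \<circ> x) t) \<mu> \<alpha> \<beta> *
    trans_deriv c d (x t) (u t) $ \<alpha> * trans_deriv c d (x t) (u t) $ \<beta>)) (at t)"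
   using tr unfolding geo_rhs_def by (simp only: comp_assoc)
 qed
qed

lemma geodesic_solutionE: assumes "geodesic_solution \<A> g I \<gamma>" "d \<in> \<A>"
 obtains u where "\<And>t. t \<in> I ==> \<gamma> t \<in> fst d ==> (snd d \<circ> \<gamma> has_vector_derivative u t) (at t)"
  "\<And>t. t \<in> I ==> \<gamma> t \<in> fst d ==> (u has_vector_derivative geo_rhs d (snd d (\<gamma> t)) (u t) (u t)) (at t)"
proof -
 obtain u where u: "\<forall>t\<in>I. \<gamma> t \<in> fst d \<longrightarrow>
    ((snd d \<circ> \<gamma>) has_vector_derivative u t) (at t) \<and>
    (u has_vector_derivative
    - (\<chi> \<mu>. \<Sum>\<alpha>\<in>UNIV. \<Sum>\<beta>\<in>UNIV. christoffel g d (\<gamma> t) \<mu> \<alpha> \<beta> * u t $ \<alpha> * u t $ \<beta>)) (at t)"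
  using assms unfolding geodesic_solution_def by blast
 have "chart_inv d (snd d (\<gamma> t)) = \<gamma> t" if "\<gamma> t \<in> fst d" for t using chart_inv_left[OF atlas_chart[OF assms(2)] that] .
 thus thesis using that[of u] u unfolding geo_rhs_def by simp
qed

lemma geodesic_local_unique: assumes d: "d \<in> \<A>"
  and g1: "geodesic_solution \<A> g I \<gamma>" and g2: "geodesic_solution \<A> g J \<xi>" and t: "t \<in> I \<inter> J"
  and eq: "\<gamma> t = \<xi> t" "\<gamma> t \<in> fst d"
  and vel: "(snd d \<circ> \<gamma> has_vector_derivative v) (at t)" "(snd d \<circ> \<xi> has_vector_derivative v) (at t)"
 shows "\<exists>\<epsilon>>0. \<forall>s. \<bar>s - t\<bar> < \<epsilon> \<longrightarrow> s \<in> I \<inter> J \<and> \<gamma> s = \<xi> s"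
proof -
 obtain u where u: "\<And>s. s \<in> I ==> \<gamma> s \<in> fst d ==> (snd d \<circ> \<gamma> has_vector_derivative u s) (at s)"
  "\<And>s. s \<in> I ==> \<gamma> s \<in> fst d ==> (u has_vector_derivative geo_rhs d (snd d (\<gamma> s)) (u s) (u s)) (at s)"
  using geodesic_solutionE[OF g1 d] by blast
 obtain w where w: "\<And>s. s \<in> J ==> \<xi> s \<in> fst d ==> (snd d \<circ> \<xi> has_vector_derivative w s) (at s)"
  "\<And>s. s \<in> J ==> \<xi> s \<in> fst d ==> (w has_vector_derivative geo_rhs d (snd d (\<xi> s)) (w s) (w s)) (at s)"
  using geodesic_solutionE[OF g2 d] by blast
 define y0 where "y0 = snd d (\<gamma> t)"
 have y0: "y0 \<in> chart_image d" unfolding y0_def using eq by blast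
 obtain K r where r: "r > 0" "cball y0 r \<subseteq> chart_image d" "spray (geo_rhs d) y0 r K" using local_spray[OF d y0] by (metis order_refl)
 interpret spray "geo_rhs d" y0 r K by fact
 define V where "V = fst d \<inter> snd d -` ball y0 r"
 have V: "open V" unfolding V_def using continuous_on_open_vimage[OF chart_continuous(3)[OF atlas_chart[OF d]], of "snd d"]
   chart_continuous(1)[OF atlas_chart[OF d]] by (auto simp: Int_commute)
 have IJ: "open I" "open J" "continuous_on I \<gamma>" "continuous_on J \<xi>" using g1 g2 unfolding geodesic_solution_def by auto
 have "open (I \<inter> \<gamma> -` V)" "open (J \<inter> \<xi> -` V)"
  using continuous_on_open_vimage[OF IJ(1), of \<gamma>] continuous_on_open_vimage[OF IJ(2), of \<xi>] IJ V by (auto simp: Int_commute)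
 hence "open ((I \<inter> \<gamma> -` V) \<inter> (J \<inter> \<xi> -` V))" by (rule open_Int)
 moreover have "t \<in> (I \<inter> \<gamma> -` V) \<inter> (J \<inter> \<xi> -` V)" using t eq r(1) unfolding V_def y0_def by auto
 ultimately obtain \<epsilon> where \<epsilon>: "\<epsilon> > 0" "ball t \<epsilon> \<subseteq> (I \<inter> \<gamma> -` V) \<inter> (J \<inter> \<xi> -` V)" by (metis openE)
 have 1: "spray_curve (ball t \<epsilon>) (snd d \<circ> \<gamma>) u" unfolding spray_curve_def using u \<epsilon>(2) unfolding V_def by force
 have 2: "spray_curve (ball t \<epsilon>) (snd d \<circ> \<xi>) w" unfolding spray_curve_def using w \<epsilon>(2) unfolding V_def by force
 have "u t = v" "w t = v" using vector_derivative_unique_at u(1) w(1) vel t eq by (metis IntE)+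
 hence "(snd d \<circ> \<gamma>) s = (snd d \<circ> \<xi>) s" if "s \<in> ball t \<epsilon>" for s
  using spray_curve_unique[OF 1 2 _ _ _ _ that, of t] \<epsilon>(1) eq by (auto simp: is_interval_convex_1)
 moreover have "\<gamma> s \<in> fst d \<and> \<xi> s \<in> fst d" if "s \<in> ball t \<epsilon>" for s using \<epsilon>(2) that unfolding V_def by auto
 ultimately have "\<gamma> s = \<xi> s" if "s \<in> ball t \<epsilon>" for s
  using that chart_inv_left[OF atlas_chart[OF d]] by (metis comp_apply)
 moreover have "s \<in> ball t \<epsilon>" if "\<bar>s - t\<bar> < \<epsilon>" for s using that by (simp add: dist_real_def abs_minus_commute)
 ultimately show ?thesis using \<epsilon> by (intro exI[of _ \<epsilon>]) blast
qed

text \<open>The set of times near which the two geodesics agree is open. It is also closed: at a limit time the positions agree in the Hausdorff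
space \<open>M\<close>, the velocities agree by continuity, and local uniqueness applies. The interval of common times is connected.\<close>

theorem geodesic_unique: assumes c: "c \<in> \<A>" and q: "q \<in> fst c"
  and g1: "geodesic_with_velocity \<A> g c q v I \<gamma>" and g2: "geodesic_with_velocity \<A> g c q v J \<xi>" and t: "t \<in> I \<inter> J"
 shows "\<gamma> t = \<xi> t"
proof -
 have s1: "geodesic_solution \<A> g I \<gamma>" and s2: "geodesic_solution \<A> g J \<xi>"
  using g1 g2 unfolding geodesic_with_velocity_def by auto
 have IJ: "open I" "open J" "continuous_on I \<gamma>" "continuous_on J \<xi>" "is_interval I" "is_interval J"
  using s1 s2 unfolding geodesic_solution_def by auto
 define E where "E = {t \<in> I \<inter> J. \<exists>\<epsilon>>0. \<forall>s. \<bar>s - t\<bar> < \<epsilon> \<longrightarrow> s \<in> I \<inter> J \<and> \<gamma> s = \<xi> s}"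
 have conn: "connected (I \<inter> J)" using IJ by (simp add: is_interval_Int is_interval_connected)
 have "open E" unfolding open_dist
 proof
  fix t assume "t \<in> E"
  then obtain \<epsilon> where \<epsilon>: "\<epsilon> > 0" "\<And>s. \<bar>s - t\<bar> < \<epsilon> ==> s \<in> I \<inter> J \<and> \<gamma> s = \<xi> s" unfolding E_def by blast
  have "r \<in> E" if r: "dist r t < \<epsilon>" for r
  proof -
   have "\<forall>s. \<bar>s - r\<bar> < \<epsilon> - dist r t \<longrightarrow> s \<in> I \<inter> J \<and> \<gamma> s = \<xi> s"
    by (intro allI impI \<epsilon>(2)) (auto simp: dist_real_def)
   moreover have "r \<in> I \<inter> J" using \<epsilon>(2)[of r] r by (simp add: dist_real_def)
   ultimately show ?thesis unfolding E_def using r by (intro CollectI conjI exI[of _ "\<epsilon> - dist r t"]) auto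
  qed
  thus "\<exists>e>0. \<forall>y. dist y t < e \<longrightarrow> y \<in> E" using \<epsilon>(1) by blast
 qed
 moreover have "open (I \<inter> J - E)" unfolding open_subopen[of "I \<inter> J - E"]
 proof
  fix t assume t: "t \<in> I \<inter> J - E"
  have ct: "isCont \<gamma> t" "isCont \<xi> t" using IJ t continuous_on_eq_continuous_at by blast+
  show "\<exists>T. open T \<and> t \<in> T \<and> T \<subseteq> I \<inter> J - E"
  proof (cases "\<gamma> t = \<xi> t")
   case False
   obtain U V where UV: "open U" "open V" "\<gamma> t \<in> U" "\<xi> t \<in> V" "U \<inter> V = {}" using hausdorff[OF False] by blast
   have "open (I \<inter> \<gamma> -` U)" "open (J \<inter> \<xi> -` V)"
    using continuous_on_open_vimage[OF IJ(1), of \<gamma>] continuous_on_open_vimage[OF IJ(2), of \<xi>] IJ UV by (auto simp: Int_commute)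
   moreover have "(I \<inter> \<gamma> -` U) \<inter> (J \<inter> \<xi> -` V) \<subseteq> I \<inter> J - E"
   proof
    fix s assume s: "s \<in> (I \<inter> \<gamma> -` U) \<inter> (J \<inter> \<xi> -` V)"
    hence ne: "\<gamma> s \<noteq> \<xi> s" using UV(5) by auto
    have "s \<notin> E"
    proof
    assume "s \<in> E"
    then obtain \<epsilon> where "\<epsilon> > 0" "\<forall>r. \<bar>r - s\<bar> < \<epsilon> \<longrightarrow> r \<in> I \<inter> J \<and> \<gamma> r = \<xi> r" unfolding E_def by blast
    thus False using ne by (auto dest: spec[of _ s])
    qed
    thus "s \<in> I \<inter> J - E" using s by blast
   qed
   ultimately show ?thesis using t UV by (intro exI[of _ "(I \<inter> \<gamma> -` U) \<inter> (J \<inter> \<xi> -` V)"]) auto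
  next
   case True
   obtain d where d: "d \<in> \<A>" "\<gamma> t \<in> fst d" using atlas_covers by blast
   obtain u where u: "\<And>s. s \<in> I ==> \<gamma> s \<in> fst d ==> (snd d \<circ> \<gamma> has_vector_derivative u s) (at s)"
    "\<And>s. s \<in> I ==> \<gamma> s \<in> fst d ==> (u has_vector_derivative geo_rhs d (snd d (\<gamma> s)) (u s) (u s)) (at s)"
    using geodesic_solutionE[OF s1 d(1)] by blast
   obtain w where w: "\<And>s. s \<in> J ==> \<xi> s \<in> fst d ==> (snd d \<circ> \<xi> has_vector_derivative w s) (at s)"
    "\<And>s. s \<in> J ==> \<xi> s \<in> fst d ==> (w has_vector_derivative geo_rhs d (snd d (\<xi> s)) (w s) (w s)) (at s)"
    using geodesic_solutionE[OF s2 d(1)] by blast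
   have ne: "u t \<noteq> w t"
   proof
    assume "u t = w t"
    hence "(snd d \<circ> \<xi> has_vector_derivative u t) (at t)" using w(1)[of t] t True d(2) by simp
    hence "\<exists>\<epsilon>>0. \<forall>s. \<bar>s - t\<bar> < \<epsilon> \<longrightarrow> s \<in> I \<inter> J \<and> \<gamma> s = \<xi> s"
    using geodesic_local_unique[OF d(1) s1 s2 _ True d(2) u(1)[OF _ d(2)]] t by blast
    thus False using t unfolding E_def by blast
   qed
   have od: "open (fst d)" using chart_continuous(3)[OF atlas_chart[OF d(1)]] .
   define T where "T = (I \<inter> \<gamma> -` fst d) \<inter> (J \<inter> \<xi> -` fst d)"
   have T: "open T" "t \<in> T" unfolding T_def
    using continuous_on_open_vimage[OF IJ(1), of \<gamma>] continuous_on_open_vimage[OF IJ(2), of \<xi>] IJ od t True d(2)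
    by (auto simp: Int_commute)
   have "continuous_on T (\<lambda>s. u s - w s)"
   proof (rule continuous_at_imp_continuous_on, rule ballI)
    fix s assume "s \<in> T"
    hence "isCont u s" "isCont w s" using u(2)[of s] w(2)[of s] has_vector_derivative_continuous unfolding T_def by blast+
    thus "isCont (\<lambda>s. u s - w s) s" by (rule continuous_diff)
   qed
   hence "open (T \<inter> (\<lambda>s. u s - w s) -` (- {0}))"
    using continuous_on_open_vimage[OF T(1), of "\<lambda>s. u s - w s"] by (auto simp: Int_commute)
   moreover have "T \<inter> (\<lambda>s. u s - w s) -` (- {0}) \<subseteq> I \<inter> J - E"
   proof
    fix s assume s: "s \<in> T \<inter> (\<lambda>s. u s - w s) -` (- {0})"
    have "s \<notin> E"
    proof
    assume "s \<in> E"
    then obtain \<epsilon> where \<epsilon>: "\<epsilon> > 0" "\<And>r. \<bar>r - s\<bar> < \<epsilon> ==> \<gamma> r = \<xi> r" unfolding E_def by blast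
    have "(snd d \<circ> \<gamma> has_vector_derivative u s) (at s)" using u(1)[of s] s unfolding T_def by blast
    hence "(snd d \<circ> \<xi> has_vector_derivative u s) (at s)"
    by (rule has_vector_derivative_transform_within_open[of _ _ _ "ball s \<epsilon>"])
    (use \<epsilon> in \<open>auto simp: dist_real_def abs_minus_commute\<close>)
    moreover have "(snd d \<circ> \<xi> has_vector_derivative w s) (at s)" using w(1)[of s] s unfolding T_def by blast
    ultimately have "u s = w s" by (rule vector_derivative_unique_at)
    thus False using s by simp
    qed
    thus "s \<in> I \<inter> J - E" using s unfolding T_def by blast
   qed
   ultimately show ?thesis using T(2) ne by (intro exI[of _ "T \<inter> (\<lambda>s. u s - w s) -` (- {0})"]) auto
  qed
 qed
 moreover have "0 \<in> E"
 proof -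
  have 0: "0 \<in> I \<inter> J" "\<gamma> 0 = \<xi> 0" "\<gamma> 0 \<in> fst c" using g1 g2 q unfolding geodesic_with_velocity_def by auto
  moreover have "\<exists>\<epsilon>>0. \<forall>s. \<bar>s - 0\<bar> < \<epsilon> \<longrightarrow> s \<in> I \<inter> J \<and> \<gamma> s = \<xi> s"
   using g1 g2 unfolding geodesic_with_velocity_def by (intro geodesic_local_unique[OF c s1 s2 0]) auto
  ultimately show ?thesis unfolding E_def by blast
 qed
 moreover have "E \<subseteq> I \<inter> J" unfolding E_def by blast
 ultimately have "I \<inter> J - E = {}" using connectedD[OF conn, of E "I \<inter> J - E"] by blast
 hence "t \<in> E" using t by blast
 thus ?thesis unfolding E_def by auto
qed

lemma exp_map_eqI: assumes c: "c \<in> \<A>" and q: "q \<in> fst c"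
  and \<gamma>: "geodesic_with_velocity \<A> g c q v I \<gamma>" "{0..1} \<subseteq> I"
 shows "v \<in> exp_domain \<A> g c q" "exp_map \<A> g c q v = \<gamma> 1"
proof -
 show "v \<in> exp_domain \<A> g c q" unfolding exp_domain_def using \<gamma> by blast
 show "exp_map \<A> g c q v = \<gamma> 1" unfolding exp_map_def
 proof (rule the_equality)
  fix z assume "\<exists>J \<xi>. {0..1} \<subseteq> J \<and> geodesic_with_velocity \<A> g c q v J \<xi> \<and> \<xi> 1 = z"
  then obtain J \<xi> where J: "{0..1} \<subseteq> J" "geodesic_with_velocity \<A> g c q v J \<xi>" "\<xi> 1 = z" by blast
  have "1 \<in> J \<inter> I" using J(1) \<gamma>(2) by auto
  thus "z = \<gamma> 1" using geodesic_unique[OF c q J(2) \<gamma>(1)] J(3) by blast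
 qed (use \<gamma> in blast)
qed
end

section \<open>Normal balls\<close>

text \<open>For \<open>v\<close> in \<open>N\<close>, the times \<open>s\<close> with \<open>s v\<close> in \<open>N'\<close> form an open and closed subset of \<open>[0, 1]\<close>: openness is clear, and closedness holds because
the inverse of \<open>exp\<close> on \<open>N'\<close> is continuous. So the choice of a domain in \<open>exp_inverse\<close> is harmless.\<close>

lemma normal_domain_subset: assumes N: "normal_domain \<A> g c C p N" and N': "normal_domain \<A> g c C p N'"
  and p: "p \<in> C" and e0: "exp_map \<A> g c p 0 = p" shows "N \<subseteq> N'"
proof
 fix v assume v: "v \<in> N"
 let ?E = "exp_map \<A> g c p"
 have star: "t *\<^sub>R v \<in> N" if "t \<in> {0..1}" for t using N v that unfolding normal_domain_def by blast
 have hom: "homeomorphism N C ?E (inv_into N ?E)" and hom': "homeomorphism N' C ?E (inv_into N' ?E)" and op': "open N'"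
  using N N' unfolding normal_domain_def by auto
 have "N' \<noteq> {}" using hom' p unfolding homeomorphism_def by auto
 then obtain v0 where "v0 \<in> N'" by blast
 moreover have "(0::real) \<in> {0..1}" by simp
 ultimately have "0 *\<^sub>R v0 \<in> N'" using N' unfolding normal_domain_def by blast
 hence zN': "0 \<in> N'" by simp
 define A where "A = {t \<in> {0..1}. t *\<^sub>R v \<in> N'}"
 define w where "w t = inv_into N' ?E (?E (t *\<^sub>R v))" for t
 have EC: "?E (t *\<^sub>R v) \<in> C" if "t \<in> {0..1}" for t using hom star[OF that] unfolding homeomorphism_def by blast
 have wA: "w t = t *\<^sub>R v \<longleftrightarrow> t \<in> A" if t: "t \<in> {0..1}" for t
 proof
  assume "w t = t *\<^sub>R v"
  moreover have "w t \<in> N'" unfolding w_def using hom' EC[OF t] unfolding homeomorphism_def by blast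
  ultimately show "t \<in> A" unfolding A_def using t by simp
 next
  assume "t \<in> A"
  thus "w t = t *\<^sub>R v" unfolding w_def A_def using hom' unfolding homeomorphism_def by blast
 qed
 have line: "continuous_on {0..1} (\<lambda>t. t *\<^sub>R v)" by (intro continuous_intros)
 have "continuous_on N ?E" "continuous_on C (inv_into N' ?E)" using hom hom' unfolding homeomorphism_def by auto
 hence "continuous_on {0..1} (\<lambda>t. ?E (t *\<^sub>R v))" using continuous_on_compose2[OF _ line] star by blast
 hence "continuous_on {0..1} w" unfolding w_def using continuous_on_compose2[OF \<open>continuous_on C (inv_into N' ?E)\<close>] EC by blast
 hence "continuous_on {0..1} (\<lambda>t. w t - t *\<^sub>R v)" by (intro continuous_on_diff line)
 hence "closedin (top_of_set {0..1}) ({0..1} \<inter> (\<lambda>t. w t - t *\<^sub>R v) -` {0})" by (rule continuous_closedin_preimage) simp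
 moreover have "{0..1} \<inter> (\<lambda>t. w t - t *\<^sub>R v) -` {0} = A" using wA unfolding A_def by auto
 ultimately have "closedin (top_of_set {0..1}) A" by simp
 moreover have "openin (top_of_set {0..1}) A"
 proof -
  have "A = {0..1} \<inter> (\<lambda>t. t *\<^sub>R v) -` N'" unfolding A_def by auto
  thus ?thesis using continuous_openin_preimage_gen[OF line op'] by simp
 qed
 moreover have "0 \<in> A" unfolding A_def using zN' by simp
 moreover have "connected {0..1::real}" by (rule connected_Icc)
 ultimately have "A = {0..1}" using connected_clopen[of "{0..1::real}"] by (metis empty_iff)
 hence "1 \<in> A" by simp
 thus "v \<in> N'" unfolding A_def by simp
qed

context riemannian_manifold
begin

context
 fixes c p a K L assumes c: "c \<in> \<A>" and p: "p \<in> fst c" and ms: "metric_spray (geo_rhs c) (snd c p) a K (gmat c) (dgmat c) L"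
  and sub: "cball (snd c p) a \<subseteq> chart_image c"
begin

interpretation metric_spray "geo_rhs c" "snd c p" a K "gmat c" "dgmat c" L by (rule ms)

lemma exp_map_coordinates: assumes q: "q \<in> fst c" "snd c q \<in> cball (snd c p) (a / 2)" and v: "norm v \<le> speed / 2"
 shows "v \<in> exp_domain \<A> g c q" "exp_map \<A> g c q v = chart_inv c (expo (snd c q) v)"
  "expo (snd c q) v \<in> chart_image c"
proof -
 let ?I = "{-2<..<2} :: real set" and ?x = "pos (snd c q) v" and ?u = "vel (snd c q) v"
 note ge = geod(1-3)[OF q(2) v]
 have xc: "?x s \<in> chart_image c" if "s \<in> ?I" for s using spray_curveD(3)[OF ge(3) that] sub by blast
 have "geodesic_solution \<A> g ?I (chart_inv c \<circ> ?x)"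
  by (rule chart_curve_geodesic_solution[OF c _ _ spray_curveD(1)[OF ge(3)] spray_curveD(2)[OF ge(3)] xc])
   (auto simp: is_interval_oo)
 moreover have "(snd c \<circ> (chart_inv c \<circ> ?x) has_vector_derivative v) (at 0)"
 proof (rule has_vector_derivative_transform_within_open[of ?x _ _ ?I])
  show "(?x has_vector_derivative v) (at 0)" using spray_curveD(1)[OF ge(3), of 0] ge(2) by simp
  show "?x s = (snd c \<circ> (chart_inv c \<circ> ?x)) s" if "s \<in> ?I" for s using chart_inv_right[OF atlas_chart[OF c] xc[OF that]] by simp
 qed auto
 ultimately have "geodesic_with_velocity \<A> g c q v ?I (chart_inv c \<circ> ?x)"
  unfolding geodesic_with_velocity_def using ge(1) chart_inv_left[OF atlas_chart[OF c] q(1)] by simp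
 from exp_map_eqI[OF c q(1) this] show "v \<in> exp_domain \<A> g c q" "exp_map \<A> g c q v = chart_inv c (expo (snd c q) v)"
  unfolding expo_def by (auto simp: subset_iff)
 show "expo (snd c q) v \<in> chart_image c" unfolding expo_def using xc[of 1] by simp
qed

context
 fixes \<delta> :: real assumes \<delta>: "0 < \<delta>" "16 * \<delta> \<le> speed"
begin

lemma ball_in_chart: "ball (snd c p) \<delta> \<subseteq> chart_image c" "ball (snd c p) \<delta> \<subseteq> cball (snd c p) (a / 2)"
proof -
 have "2 * \<delta> \<le> a" using \<delta> speed by linarith
 thus "ball (snd c p) \<delta> \<subseteq> chart_image c" "ball (snd c p) \<delta> \<subseteq> cball (snd c p) (a / 2)"
  using sub \<delta>(1) by (auto simp: subset_iff)
qed

lemma coordinate_ball_image: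
 "snd c ` coordinate_ball c p \<delta> = ball (snd c p) \<delta>"
 "chart_inv c ` ball (snd c p) \<delta> = coordinate_ball c p \<delta>"
 "homeomorphism (ball (snd c p) \<delta>) (coordinate_ball c p \<delta>) (chart_inv c) (snd c)"
proof -
 note inv = chart_inv_left[OF atlas_chart[OF c]] chart_inv_right[OF atlas_chart[OF c]] chart_inv_in[OF atlas_chart[OF c]]
 have *: "chart_inv c y \<in> coordinate_ball c p \<delta>" if "y \<in> ball (snd c p) \<delta>" for y
  using that ball_in_chart(1) inv(2,3)[of y] unfolding coordinate_ball_def by auto
 have **: "snd c q \<in> ball (snd c p) \<delta>" "q \<in> fst c" if "q \<in> coordinate_ball c p \<delta>" for q
  using that unfolding coordinate_ball_def by auto
 have id1: "chart_inv c (snd c q) = q" if "q \<in> coordinate_ball c p \<delta>" for q using inv(1)[OF **(2)[OF that]] .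
 have id2: "snd c (chart_inv c y) = y" if "y \<in> ball (snd c p) \<delta>" for y using inv(2)[OF subsetD[OF ball_in_chart(1) that]] .
 show "snd c ` coordinate_ball c p \<delta> = ball (snd c p) \<delta>"
 proof (intro equalityI subsetI)
  fix y assume "y \<in> ball (snd c p) \<delta>"
  thus "y \<in> snd c ` coordinate_ball c p \<delta>" using * id2 by (intro image_eqI[of _ _ "chart_inv c y"]) simp_all
 qed (use **(1) in blast)
 show "chart_inv c ` ball (snd c p) \<delta> = coordinate_ball c p \<delta>"
 proof (intro equalityI subsetI)
  fix q assume "q \<in> coordinate_ball c p \<delta>"
  thus "q \<in> chart_inv c ` ball (snd c p) \<delta>" using **(1) id1 by (intro image_eqI[of _ _ "snd c q"]) simp_all
 qed (use * in blast)
 show "homeomorphism (ball (snd c p) \<delta>) (coordinate_ball c p \<delta>) (chart_inv c) (snd c)"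
 proof (rule homeomorphismI)
  show "continuous_on (ball (snd c p) \<delta>) (chart_inv c)"
   by (rule continuous_on_subset[OF chart_continuous(2)[OF atlas_chart[OF c]] ball_in_chart(1)])
  show "continuous_on (coordinate_ball c p \<delta>) (snd c)"
   by (rule continuous_on_subset[OF chart_continuous(1)[OF atlas_chart[OF c]]]) (use **(2) in blast)
  show "chart_inv c ` ball (snd c p) \<delta> \<subseteq> coordinate_ball c p \<delta>" using * by blast
  show "snd c ` coordinate_ball c p \<delta> \<subseteq> ball (snd c p) \<delta>" using **(1) by blast
 qed (simp_all add: id1 id2)
qed

lemma normal_domain_coordinate_ball: assumes q: "q \<in> coordinate_ball c p \<delta>"
 shows "normal_domain \<A> g c (coordinate_ball c p \<delta>) q (expo_dom \<delta> (snd c q))" and "x \<in> ball (snd c p) \<delta> ==>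
   inv_into (expo_dom \<delta> (snd c q)) (exp_map \<A> g c q) (chart_inv c x) = expo_inv \<delta> (snd c q) x"
proof -
 let ?C = "coordinate_ball c p \<delta>" and ?y = "snd c q" and ?N = "expo_dom \<delta> (snd c q)" and ?E = "exp_map \<A> g c q"
 have qc: "q \<in> fst c" and y: "?y \<in> ball (snd c p) \<delta>" using q unfolding coordinate_ball_def by auto
 have y2: "?y \<in> cball (snd c p) (a / 2)" using y ball_in_chart(2) by blast
 have E: "v \<in> exp_domain \<A> g c q" "?E v = chart_inv c (expo ?y v)" "snd c (?E v) = expo ?y v" if "v \<in> ?N" for v
  using exp_map_coordinates[OF qc y2 expo_domD(1)[OF \<delta>(2) y that]] chart_inv_right[OF atlas_chart[OF c]] by auto
 have hom: "homeomorphism ?N ?C (chart_inv c \<circ> expo ?y) (expo_inv \<delta> ?y \<circ> snd c)"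
  by (rule homeomorphism_compose[OF expo_homeomorphism[OF \<delta>(2) y] coordinate_ball_image(3)])
 have inj: "inj_on ?E ?N"
 proof (rule inj_onI)
  fix v w assume "v \<in> ?N" "w \<in> ?N" "?E v = ?E w"
  hence "(chart_inv c \<circ> expo ?y) v = (chart_inv c \<circ> expo ?y) w" using E(2) by simp
  thus "v = w" using homeomorphism_apply1[OF hom \<open>v \<in> ?N\<close>] homeomorphism_apply1[OF hom \<open>w \<in> ?N\<close>] by metis
 qed
 have inv: "inv_into ?N ?E z = (expo_inv \<delta> ?y \<circ> snd c) z" if "z \<in> ?C" for z
 proof -
  let ?v = "(expo_inv \<delta> ?y \<circ> snd c) z"
  have v: "?v \<in> ?N" "(chart_inv c \<circ> expo ?y) ?v = z"
   using homeomorphism_image2[OF hom] homeomorphism_apply2[OF hom that] that by blast+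
  hence "?E ?v = z" using E(2)[OF v(1)] by simp
  thus ?thesis using inv_into_f_f[OF inj v(1)] by simp
 qed
 show inv': "inv_into ?N ?E (chart_inv c x) = expo_inv \<delta> ?y x" if "x \<in> ball (snd c p) \<delta>" for x
 proof -
  have "chart_inv c x \<in> ?C" using coordinate_ball_image(2) that by blast
  from inv[OF this] show ?thesis using chart_inv_right[OF atlas_chart[OF c] subsetD[OF ball_in_chart(1) that]] by simp
 qed
 show "normal_domain \<A> g c ?C q ?N" unfolding normal_domain_def
 proof (intro conjI ballI)
  show "open ?N" by (rule expo_dom_open[OF \<delta>(2) y])
  show "s *\<^sub>R v \<in> ?N" if "v \<in> ?N" "s \<in> {0..1}" for v s by (rule expo_dom_star[OF \<delta>(2) y that])
  show "?N \<subseteq> exp_domain \<A> g c q" using E(1) by blast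
  show "homeomorphism ?N ?C ?E (inv_into ?N ?E)" by (rule homeomorphism_cong[OF hom refl refl]) (simp_all add: E(2) inv)
  show "locally_lipschitz_on ?N (snd c \<circ> ?E)"
   by (rule iffD2[OF loclip_cong lipschitz_on_imp_locally[OF expo_lipschitz[OF \<delta>(2) y]]])
    (simp only: comp_apply E(3))
  show "locally_lipschitz_on (snd c ` ?C) (inv_into ?N ?E \<circ> chart_inv c)" unfolding coordinate_ball_image(1)
   by (rule iffD2[OF loclip_cong lipschitz_on_imp_locally[OF expo_inv_lipschitz[OF \<delta>(2) y]]])
    (simp only: comp_apply inv')
 qed
qed

lemma convex_normal_coordinate_ball: "convex_normal \<A> g c (coordinate_ball c p \<delta>)" unfolding convex_normal_def
proof (intro conjI ballI)
 have "coordinate_ball c p \<delta> = fst c \<inter> snd c -` ball (snd c p) \<delta>" unfolding coordinate_ball_def by auto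
 thus "open (coordinate_ball c p \<delta>)" using continuous_on_open_vimage[OF chart_continuous(3)[OF atlas_chart[OF c]], of "snd c"]
   chart_continuous(1)[OF atlas_chart[OF c]] by (auto simp: Int_commute)
 show "coordinate_ball c p \<delta> \<subseteq> fst c" unfolding coordinate_ball_def by blast
 show "\<exists>N. normal_domain \<A> g c (coordinate_ball c p \<delta>) q N" if "q \<in> coordinate_ball c p \<delta>" for q
  using normal_domain_coordinate_ball(1)[OF that] by blast
qed

lemma exp_inverse_coordinate_ball: assumes q: "q \<in> coordinate_ball c p \<delta>"
 shows "exp_inverse \<A> g c (coordinate_ball c p \<delta>) p q = expo_inv \<delta> (snd c p) (snd c q)"
proof -
 let ?C = "coordinate_ball c p \<delta>" and ?N = "expo_dom \<delta> (snd c p)"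
 have pC: "p \<in> ?C" unfolding coordinate_ball_def using p \<delta>(1) by simp
 have x0: "snd c p \<in> cball (snd c p) (a / 2)" using a by simp
 have n: "normal_domain \<A> g c ?C p ?N" by (rule normal_domain_coordinate_ball(1)[OF pC])
 have e0: "exp_map \<A> g c p 0 = p"
  using exp_map_coordinates(2)[OF p x0, of 0] expo_zero[OF x0] chart_inv_left[OF atlas_chart[OF c] p] speed(1) by simp
 have "(SOME N. normal_domain \<A> g c ?C p N) = ?N"
 proof (rule some_equality)
  show "normal_domain \<A> g c ?C p ?N" by (rule n)
  fix N assume N: "normal_domain \<A> g c ?C p N"
  show "N = ?N" using normal_domain_subset[OF N n pC e0] normal_domain_subset[OF n N pC e0] by blast
 qed
 moreover have "snd c q \<in> ball (snd c p) \<delta>" "chart_inv c (snd c q) = q"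
  using q chart_inv_left[OF atlas_chart[OF c], of q] by (simp_all add: coordinate_ball_def)
 ultimately show ?thesis unfolding exp_inverse_def using normal_domain_coordinate_ball(2)[OF pC, of "snd c q"] by simp
qed
end
end

text \<open>Bi-Lipschitz estimates and convexity hold uniformly for base points in the ball, so one small ball is normal for all of its
points; the radial data belong to its centre.\<close>

theorem normal_balls: assumes c: "c \<in> \<A>" and p: "p \<in> fst c" and gp: "g c p = mat 1"
 obtains \<delta>\<^sub>0 where "0 < \<delta>\<^sub>0" "\<And>\<delta>. 0 < \<delta> ==> \<delta> < \<delta>\<^sub>0 ==>
  ball (snd c p) \<delta> \<subseteq> chart_image c \<and> convex_normal \<A> g c (coordinate_ball c p \<delta>) \<and>
  (\<exists>N ex lg Z L. radial_ball (snd c p) \<delta> N ex lg Z (gmat c) L \<and>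
   (\<forall>q\<in>coordinate_ball c p \<delta>. exp_inverse \<A> g c (coordinate_ball c p \<delta>) p q = lg (snd c q)))"
proof -
 have "gmat c (snd c p) = mat 1" unfolding gmat_def using chart_inv_left[OF atlas_chart[OF c] p] gp by simp
 then obtain a K L where ms: "metric_spray (geo_rhs c) (snd c p) a K (gmat c) (dgmat c) L" and sub: "cball (snd c p) a \<subseteq> chart_image c"
  using local_metric_spray[OF c, of "snd c p"] p by blast
 interpret metric_spray "geo_rhs c" "snd c p" a K "gmat c" "dgmat c" L by (rule ms)
 show thesis
 proof (rule that[of "speed / 16"])
  show "0 < speed / 16" using speed(1) by simp
  fix \<delta> assume "0 < \<delta>" "\<delta> < speed / 16"
  hence \<delta>: "0 < \<delta>" "16 * \<delta> \<le> speed" by auto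
  show "ball (snd c p) \<delta> \<subseteq> chart_image c \<and> convex_normal \<A> g c (coordinate_ball c p \<delta>) \<and>
   (\<exists>N ex lg Z L. radial_ball (snd c p) \<delta> N ex lg Z (gmat c) L \<and>
    (\<forall>q\<in>coordinate_ball c p \<delta>. exp_inverse \<A> g c (coordinate_ball c p \<delta>) p q = lg (snd c q)))"
  proof (rule conjI[OF ball_in_chart(1)[OF c p ms sub \<delta>] conjI[OF convex_normal_coordinate_ball[OF c p ms sub \<delta>]]])
   have "\<forall>q\<in>coordinate_ball c p \<delta>. exp_inverse \<A> g c (coordinate_ball c p \<delta>) p q = expo_inv \<delta> (snd c p) (snd c q)"
    by (rule ballI) (rule exp_inverse_coordinate_ball[OF c p ms sub \<delta>])
   from conjI[OF radial_ballI[OF \<delta>] this]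
   show "\<exists>N ex lg Z L. radial_ball (snd c p) \<delta> N ex lg Z (gmat c) L \<and>
    (\<forall>q\<in>coordinate_ball c p \<delta>. exp_inverse \<A> g c (coordinate_ball c p \<delta>) p q = lg (snd c q))"
    by - (rule exI, rule exI, rule exI, rule exI, rule exI)
  qed
 qed
qed
end

section \<open>Charts obtained from a chart of the atlas\<close>

lemma Ck1_on_compose01:
 fixes f :: "'a::euclidean_space => 'b::euclidean_space" assumes "k \<le> 1" "open S" "Ck1_on k S f" "Ck1_on k T h" "f ` S \<subseteq> T"
 shows "Ck1_on k S (\<lambda>x. h (f x))"
proof (cases "k = 0")
 case True
 thus ?thesis using assms by (simp add: loclip_compose)
next
 case False
 hence "k = 1" using assms(1) by simp
 thus ?thesis using assms Ck1_on_1_compose by blast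
qed

lemma Ck1_on_2_imp01: assumes "open S" "Ck1_on 2 S f" "k \<le> 1" shows "Ck1_on k S f"
proof -
 have 1: "Ck1_on 1 S f" using Ck1_on_Suc_imp[OF assms(1), of 1 f] assms(2) by (simp add: numeral_2_eq_2)
 hence "Ck1_on 0 S f" using Ck1_on_1_imp_0[OF assms(1)] by simp
 thus ?thesis using 1 assms(3) by (cases "k = 0") (auto simp: le_Suc_eq)
qed

lemma Ck1_on_1_imp01: "open S ==> Ck1_on 1 S f ==> k \<le> 1 ==> Ck1_on k S f" using Ck1_on_1_imp_0 by (cases "k = 0") (auto simp: le_Suc_eq)

lemma drop_coord_bounded_linear: "bounded_linear (drop_coord k)" unfolding linear_conv_bounded_linear[symmetric]
 by (auto intro!: linearI simp: drop_coord_def vec_eq_iff)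

text \<open>A function on the hyperplane is as regular as any regular function on an open set that extends it.\<close>

lemma Ck1_on_sliceI:
 fixes F :: "real^'n => 'b::real_normed_vector" assumes j: "j \<le> 1" and S: "open S" and G: "Ck1_on j S G"
  and A: "\<And>y. y $ k = 0 ==> y \<in> A \<longleftrightarrow> y \<in> S" and eq: "\<And>y. y $ k = 0 ==> y \<in> A ==> F y = G y"
 shows "Ck1_on_slice j k A F"
proof -
 let ?B = "{y. drop_coord k y \<in> A}"
 have dk: "drop_coord k y $ k = 0" for y unfolding drop_coord_def by simp
 have B: "?B = drop_coord k -` S" using A[OF dk] by auto
 have lin: "Ck1_on j ?B (drop_coord k)" by (rule Ck1_on_subset[OF Ck1_on_1_imp01[OF open_UNIV _ j]])
   (use Ck1_on_bounded_linear[OF drop_coord_bounded_linear, of 0 UNIV k] in auto)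
 have op: "open ?B" unfolding B using S linear_continuous_on[OF drop_coord_bounded_linear[of k]] open_vimage by blast
 have "Ck1_on j ?B (\<lambda>y. G (drop_coord k y))" by (rule Ck1_on_compose01[OF j op lin G]) (use B in blast)
 hence "Ck1_on j ?B (F \<circ> drop_coord k)" by (rule Ck1_on_cong[OF op, rotated]) (simp add: eq[OF dk])
 thus ?thesis unfolding Ck1_on_slice_def .
qed

lemma Ck1_on_1_injective_inverse:
 fixes f :: "real^'n => real^'n" assumes S: "open S" and f: "Ck1_on 1 S f" and inj: "inj_on f S"
  and d: "\<And>x w. x \<in> S ==> frechet_derivative f (at x) w = 0 ==> w = 0"
 shows "open (f ` S)" "homeomorphism S (f ` S) f (inv_into S f)" "Ck1_on 1 (f ` S) (inv_into S f)"
proof -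
 have cont: "continuous_on S f" using loclip_continuous[OF Ck1_on_1_imp_0[OF S f]] .
 show op: "open (f ` S)" using invariance_of_domain[OF cont S inj] .
 obtain h where h: "homeomorphism S (f ` S) f h" using invariance_of_domain_homeomorphism[OF S cont _ inj] by auto
 show hom: "homeomorphism S (f ` S) f (inv_into S f)" by (rule homeomorphism_cong[OF h refl refl refl])
   (use h inj in \<open>auto simp: homeomorphism_def inv_into_f_f\<close>)
 show "Ck1_on 1 (f ` S) (inv_into S f)" by (rule Ck1_on_1_inverse[OF S op hom f d])
qed

context riemannian_manifold
begin

text \<open>Composing a chart of the atlas with a change of coordinates of class \<open>C\<^sup>0\<^sup>,\<^sup>1\<close> or \<open>C\<^sup>1\<^sup>,\<^sup>1\<close> preserves compatibility, since
transition maps are more regular than that.\<close>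

lemma chart_from_coordinates: assumes c: "c \<in> \<A>" and k: "k \<le> 1" and U: "open U" "U \<subseteq> chart_image c" and V: "open V"
  and hom: "homeomorphism U V f h" and f: "Ck1_on k U f" and h: "Ck1_on k V h"
  and dom: "fst \<psi> = chart_inv c ` U" and val: "\<And>q. q \<in> fst \<psi> ==> snd \<psi> q = f (snd c q)"
 shows "Ck1_chart k \<A> \<psi>" "chart_image \<psi> = V" "\<And>y. y \<in> V ==> chart_inv \<psi> y = chart_inv c (h y)"
proof -
 note ic = atlas_chart[OF c]
 have Uc: "snd c (chart_inv c x) = x" "chart_inv c x \<in> fst c" if "x \<in> U" for x
  using chart_inv_right[OF ic] chart_inv_in[OF ic] U(2) that by auto
 have hU: "h y \<in> U" "f (h y) = y" if "y \<in> V" for y using hom that unfolding homeomorphism_def by auto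
 have fV: "f x \<in> V" "h (f x) = x" if "x \<in> U" for x using hom that unfolding homeomorphism_def by auto
 have homc: "homeomorphism (chart_inv c ` U) U (snd c) (chart_inv c)"
 proof (rule homeomorphismI)
  show "continuous_on (chart_inv c ` U) (snd c)" by (rule continuous_on_subset[OF chart_continuous(1)[OF ic]]) (use Uc in auto)
  show "continuous_on U (chart_inv c)" by (rule continuous_on_subset[OF chart_continuous(2)[OF ic] U(2)])
 qed (use Uc in auto)
 have hom1: "homeomorphism (fst \<psi>) V (snd \<psi>) (chart_inv c \<circ> h)" unfolding dom
  by (rule homeomorphism_cong[OF homeomorphism_compose[OF homc hom] refl refl])
   (simp_all add: val dom)
 show img: "chart_image \<psi> = V" using homeomorphism_image1[OF hom1] .
 have inj: "inj_on (snd \<psi>) (fst \<psi>)" using homeomorphism_apply1[OF hom1] by (metis inj_onI)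
 show inv: "chart_inv \<psi> y = chart_inv c (h y)" if "y \<in> V" for y
 proof -
  have "chart_inv c (h y) \<in> fst \<psi>" using hU(1)[OF that] dom by blast
  moreover have "snd \<psi> (chart_inv c (h y)) = y" using homeomorphism_apply2[OF hom1 that] by simp
  ultimately show ?thesis using inv_into_f_f[OF inj] by metis
 qed
 have dom': "fst \<psi> = fst c \<inter> snd c -` U" unfolding dom using Uc chart_inv_left[OF ic] by (force simp: image_iff)
 have opd: "open (fst \<psi>)" unfolding dom' using continuous_on_open_vimage[OF chart_continuous(3)[OF ic], of "snd c"]
   chart_continuous(1)[OF ic] U(1) by (auto simp: Int_commute)
 have isc: "is_chart \<psi>" unfolding is_chart_def img
 proof (intro conjI opd V)
  show "homeomorphism (fst \<psi>) V (snd \<psi>) (chart_inv \<psi>)" by (rule homeomorphism_cong[OF hom1 refl refl refl]) (simp add: inv)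
 qed
 have "Ck1_compatible k \<psi> d" if d: "d \<in> \<A>" for d unfolding Ck1_compatible_def
 proof
  let ?S = "snd \<psi> ` (fst \<psi> \<inter> fst d)" and ?O = "snd c ` (fst c \<inter> fst d)" and ?T = "snd d ` (fst \<psi> \<inter> fst d)"
  note oo = chart_continuous(3)[OF atlas_chart[OF d]]
  have S: "open ?S" by (rule chart_open[OF isc oo])
  have SV: "?S \<subseteq> V" using img by blast
  have S': "h y \<in> ?O" if "y \<in> ?S" for y
  proof -
   have "chart_inv \<psi> y \<in> fst \<psi> \<inter> fst d" using that chart_preimage[OF isc] chart_inv_in[OF isc] by blast
   moreover have "chart_inv \<psi> y = chart_inv c (h y)" by (rule inv[OF subsetD[OF SV that]])
   ultimately have "chart_inv c (h y) \<in> fst c \<inter> fst d" unfolding dom' by simp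
   thus ?thesis using Uc(1)[OF hU(1)[OF subsetD[OF SV that]]] by (metis image_eqI)
  qed
  have "Ck1_on k ?S (\<lambda>y. trans_map c d (h y))"
   by (rule Ck1_on_compose01[OF k S Ck1_on_subset[OF h SV] Ck1_on_2_imp01[OF overlap(1)[OF c d] transition_C21[OF c d] k]])
    (use S' in blast)
  thus "Ck1_on k ?S (snd d \<circ> chart_inv \<psi>)" by (rule Ck1_on_cong[OF S, rotated]) (use inv SV in auto)
  have T: "open ?T" using chart_open[OF atlas_chart[OF d] opd] by (simp add: Int_commute)
  have Tin: "y \<in> chart_image d \<and> chart_inv d y \<in> fst \<psi>" if "y \<in> ?T" for y
   using that chart_inv_left[OF atlas_chart[OF d]] by auto
  have TO: "?T \<subseteq> snd d ` (fst d \<inter> fst c)" using dom' by blast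
  have "Ck1_on k ?T (\<lambda>y. f (trans_map d c y))"
  proof (rule Ck1_on_compose01[OF k T Ck1_on_subset[OF Ck1_on_2_imp01[OF overlap(1)[OF d c] transition_C21[OF d c] k] TO] f])
   show "(snd c \<circ> chart_inv d) ` ?T \<subseteq> U" using Tin dom' by auto
  qed
  thus "Ck1_on k ?T (snd \<psi> \<circ> chart_inv d)" by (rule Ck1_on_cong[OF T, rotated]) (use val Tin in simp)
 qed
 thus "Ck1_chart k \<A> \<psi>" unfolding Ck1_chart_def using isc by blast
qed

lemma C11_chartD: assumes \<psi>: "Ck1_chart 1 \<A> \<psi>" and d: "d \<in> \<A>"
 shows "is_chart \<psi>" "open (snd \<psi> ` (fst \<psi> \<inter> fst d))"
  "Ck1_on 1 (snd \<psi> ` (fst \<psi> \<inter> fst d)) (snd d \<circ> chart_inv \<psi>)"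
  "open (snd d ` (fst d \<inter> fst \<psi>))"
  "Ck1_on 1 (snd d ` (fst d \<inter> fst \<psi>)) (snd \<psi> \<circ> chart_inv d)"
proof -
 show ic: "is_chart \<psi>" using \<psi> unfolding Ck1_chart_def by blast
 show "open (snd \<psi> ` (fst \<psi> \<inter> fst d))" by (rule chart_open[OF ic chart_continuous(3)[OF atlas_chart[OF d]]])
 show "open (snd d ` (fst d \<inter> fst \<psi>))" by (rule chart_open[OF atlas_chart[OF d] chart_continuous(3)[OF ic]])
 show "Ck1_on 1 (snd \<psi> ` (fst \<psi> \<inter> fst d)) (snd d \<circ> chart_inv \<psi>)"
  "Ck1_on 1 (snd d ` (fst d \<inter> fst \<psi>)) (snd \<psi> \<circ> chart_inv d)"
  using \<psi> d unfolding Ck1_chart_def Ck1_compatible_def by (auto simp: Int_commute)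
qed

lemma metric_component_locally_lipschitz: assumes \<psi>: "Ck1_chart 1 \<A> \<psi>" and d: "d \<in> \<A>"
 shows "locally_lipschitz_on (snd \<psi> ` (fst \<psi> \<inter> fst d)) (metric_component g d \<psi> i j)"
proof -
 let ?O = "snd \<psi> ` (fst \<psi> \<inter> fst d)"
 note D = C11_chartD[OF \<psi> d]
 have in_d: "chart_inv \<psi> y \<in> fst d" if "y \<in> ?O" for y using that chart_preimage[OF D(1)] by blast
 have L: "locally_lipschitz_on ?O (\<lambda>y. frechet_derivative (snd d \<circ> chart_inv \<psi>) (at y) w)" for w
  by (rule Ck1_on_1_derivative_lipschitz[OF D(3) loclip_const])
 have "locally_lipschitz_on ?O (\<lambda>y. gmat d ((snd d \<circ> chart_inv \<psi>) y))" by (rule loclip_compose[OF Ck1_on_1_imp_0[OF D(2,3)]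
    Ck1_on_1_imp_0[OF chart_continuous(4)[OF atlas_chart[OF d]] gmat_C11[OF d]]])
   (use in_d in auto)
 hence "locally_lipschitz_on ?O (\<lambda>y. frechet_derivative (snd d \<circ> chart_inv \<psi>) (at y) (axis i 1) \<bullet>
  (gmat d ((snd d \<circ> chart_inv \<psi>) y) *v frechet_derivative (snd d \<circ> chart_inv \<psi>) (at y) (axis j 1)))"
  by (intro loclip_inner loclip_bilinear[OF bounded_bilinear_matrix_vector_mult] L)
 moreover have "gmat d ((snd d \<circ> chart_inv \<psi>) y) = g d (chart_inv \<psi> y)" if "y \<in> ?O" for y
  unfolding gmat_def using chart_inv_left[OF atlas_chart[OF d] in_d[OF that]] by simp
 ultimately show ?thesis using loclip_cong[of ?O "metric_component g d \<psi> i j"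
   "\<lambda>y. frechet_derivative (snd d \<circ> chart_inv \<psi>) (at y) (axis i 1) \<bullet>
  (gmat d ((snd d \<circ> chart_inv \<psi>) y) *v frechet_derivative (snd d \<circ> chart_inv \<psi>) (at y) (axis j 1))"]
  unfolding metric_component_def metric_in_def Let_def by presburger
qed

end

text \<open>Splitting \<open>u = u\<^sub>k a + (u - u\<^sub>k a)\<close>: the image of \<open>a\<close> is the unit normal, and it is orthogonal to the image of the hyperplane \<open>u\<^sub>k = 0\<close>.
The components \<open>a\<^sub>i\<close> are the coefficients \<open>A\<^sub>i\<close> of the metric.\<close>

lemma orthogonal_decomposition:
 fixes M :: "real^'n^'n" and L :: "real^'n => real^'n" assumes L: "linear L" and sym: "\<And>u w. u \<bullet> (M *v w) = w \<bullet> (M *v u)"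
  and rad: "\<And>u. L a \<bullet> (M *v L u) = u $ k" and unit: "L a \<bullet> (M *v L a) = 1"
 shows "L u \<bullet> (M *v L w) = u $ k * w $ k + (\<Sum>i\<in>-{k}. \<Sum>j\<in>-{k}. (L (axis i 1) \<bullet> (M *v L (axis j 1))) *
  (u $ i - a $ i * u $ k) * (w $ j - a $ j * w $ k))"
proof -
 have ak: "a $ k = 1" using rad[of a] unit by simp
 define v where "v u = u - u $ k *\<^sub>R a" for u
 have vk: "v u $ k = 0" for u unfolding v_def using ak by simp
 have vi: "v u $ i = u $ i - a $ i * u $ k" for u i unfolding v_def by simp
 have Lu: "L u = u $ k *\<^sub>R L a + L (v u)" for u unfolding v_def by (simp add: linear_diff[OF L] linear_scale[OF L])
 have Lv: "L (v u) = (\<Sum>i\<in>-{k}. v u $ i *\<^sub>R L (axis i 1))" for u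
 proof -
  have "L (v u) = L (\<Sum>i\<in>UNIV. v u $ i *\<^sub>R axis i 1)" using basis_expansion[of "v u"] by (simp add: scalar_mult_eq_scaleR)
  also have "\<dots> = (\<Sum>i\<in>UNIV. v u $ i *\<^sub>R L (axis i 1))" by (simp only: linear_sum[OF L] linear_scale[OF L])
  also have "\<dots> = (\<Sum>i\<in>-{k}. v u $ i *\<^sub>R L (axis i 1))" by (rule sum.mono_neutral_right) (auto simp: vk)
  finally show ?thesis .
 qed
 have cross: "L a \<bullet> (M *v L (v u)) = 0" "L (v u) \<bullet> (M *v L a) = 0" for u
  using rad[of "v u"] vk sym[of "L (v u)" "L a"] by simp_all
 have "L u \<bullet> (M *v L w) = u $ k * w $ k + L (v u) \<bullet> (M *v L (v w))" unfolding Lu[of u] Lu[of w]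
  by (simp add: matrix_vector_right_distrib matrix_vector_mult_scaleR inner_add_left inner_add_right cross unit)
 also have "L (v u) \<bullet> (M *v L (v w)) = (\<Sum>i\<in>-{k}. \<Sum>j\<in>-{k}. (L (axis i 1) \<bullet> (M *v L (axis j 1))) * v u $ i * v w $ j)"
 proof -
  have "M *v L (v w) = (\<Sum>j\<in>-{k}. v w $ j *\<^sub>R (M *v L (axis j 1)))" unfolding Lv[of w]
   by (simp only: linear_sum[OF matrix_vector_mul_linear] matrix_vector_mult_scaleR)
  thus ?thesis unfolding Lv[of u] by (simp add: inner_sum_left inner_sum_right sum_distrib_left mult_ac) (rule sum.swap)
 qed
 finally show ?thesis unfolding vi .
qed

section \<open>Coordinate geometry of the radial function\<close>

context radial_ball
begin

definition rad :: "real^'n => real" where "rad x = norm (lg x)"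
text \<open>The unit normal of the spheres \<open>r = const\<close>, which is the gradient of \<open>r\<close>.\<close>

definition nrm :: "real^'n => real^'n" where "nrm x = (1 / rad x) *\<^sub>R Z x"
definition P :: "(real^'n) set" where "P = ball x0 \<delta> - {x0}"

lemma P_open: "open P" unfolding P_def by (simp add: open_delete)

lemma lg: "x \<in> ball x0 \<delta> ==> lg x \<in> N" "x \<in> ball x0 \<delta> ==> ex (lg x) = x"
 "v \<in> N ==> ex v \<in> ball x0 \<delta>" "v \<in> N ==> lg (ex v) = v" using hom unfolding homeomorphism_def by auto

lemma zero_in_N: "0 \<in> N" using N_star[OF lg(1)[of x0], of 0] \<delta> by simp

lemma lg_center: "lg x0 = 0" using lg(4)[OF zero_in_N] ex_0 by simp

lemma rad_pos: "x \<in> P ==> 0 < rad x" unfolding rad_def P_def using lg(2)[of x] ex_0 by auto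

lemma rad_zero_iff: "x \<in> ball x0 \<delta> ==> rad x = 0 \<longleftrightarrow> x = x0"
 unfolding rad_def using lg(2)[of x] ex_0 lg_center by auto

lemma rad_ex: "v \<in> N ==> rad (ex v) = norm v" unfolding rad_def by (simp add: lg)

lemma ex_in_P: "v \<in> N ==> v \<noteq> 0 ==> ex v \<in> P" unfolding P_def using lg(3,4)[of v] lg_center by auto

lemma rad_lipschitz: "locally_lipschitz_on (ball x0 \<delta>) rad"
proof -
 have "1-lipschitz_on UNIV (norm :: real^'n => real)" by (rule lipschitz_onI) (simp_all add: dist_norm norm_triangle_ineq3)
 thus ?thesis unfolding rad_def by (intro loclip_compose[OF lg_lip lipschitz_on_imp_locally]) auto
qed

lemma nrm_lipschitz: "locally_lipschitz_on P nrm"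
proof -
 have sub: "P \<subseteq> ball x0 \<delta>" unfolding P_def by blast
 have ne: "rad x \<noteq> 0" if "x \<in> P" for x using rad_pos[OF that] by simp
 show ?thesis unfolding nrm_def by (intro loclip_scaleR loclip_divide loclip_const
    loclip_subset[OF rad_lipschitz sub] loclip_subset[OF Z_lip sub] ne)
qed

lemma rad_deriv: assumes x: "x \<in> P" shows "(rad has_derivative (\<lambda>w. nrm x \<bullet> (M x *v w))) (at x)"
proof -
 have xb: "x \<in> ball x0 \<delta>" using x unfolding P_def by blast
 define e where "e y = (lg y \<bullet> lg y) / 2" for y
 have rs: "rad y = sqrt (2 * e y)" for y unfolding rad_def e_def by (simp add: norm_eq_sqrt_inner)
 have p: "0 < 2 * e x" using rad_pos[OF x] unfolding rad_def e_def by simp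
 have d: "((\<lambda>y. 2 * e y) has_derivative (\<lambda>w. 2 * (Z x \<bullet> (M x *v w)))) (at x)"
  unfolding e_def by (rule has_derivative_mult_right[OF energy_deriv[OF xb]])
 have "((\<lambda>y. sqrt (2 * e y)) has_derivative (\<lambda>w. inverse (sqrt (2 * e x)) / 2 * (2 * (Z x \<bullet> (M x *v w))))) (at x)"
  using d DERIV_real_sqrt[OF p, unfolded has_field_derivative_def]
  by (rule has_derivative_compose[of "\<lambda>y. 2 * e y" "\<lambda>w. 2 * (Z x \<bullet> (M x *v w))" x UNIV sqrt "(*) (inverse (sqrt (2 * e x)) / 2)"])
 moreover have "inverse (sqrt (2 * e x)) / 2 * (2 * (Z x \<bullet> (M x *v w))) = nrm x \<bullet> (M x *v w)" for w
  unfolding nrm_def rs[symmetric] inner_scaleR_left by (simp only: divide_inverse) simp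
 moreover have "rad = (\<lambda>y. sqrt (2 * e y))" by (rule ext) (rule rs)
 ultimately show ?thesis by simp
qed

lemma nrm_unit: "x \<in> P ==> nrm x \<bullet> (M x *v nrm x) = 1"
proof -
 assume x: "x \<in> P"
 hence "Z x \<bullet> (M x *v Z x) = lg x \<bullet> lg x" by (intro Z_norm) (simp add: P_def)
 also have "\<dots> = rad x * rad x" unfolding rad_def by (simp add: power2_norm_eq_inner[symmetric] power2_eq_square)
 finally have "Z x \<bullet> (M x *v Z x) = rad x * rad x" .
 moreover have "nrm x \<bullet> (M x *v nrm x) = (1 / rad x) * ((1 / rad x) * (Z x \<bullet> (M x *v Z x)))"
  unfolding nrm_def matrix_vector_mult_scaleR inner_scaleR_left inner_scaleR_right ..
 ultimately show ?thesis using rad_pos[OF x] by simp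
qed

lemma rad_C11: "Ck1_on 1 P rad"
proof (rule Ck1_on_1I[OF rad_deriv])
 fix b :: "real^'n"
 have "locally_lipschitz_on P M" by (rule loclip_subset[OF M_lip]) (simp add: P_def)
 thus "locally_lipschitz_on P (\<lambda>x. nrm x \<bullet> (M x *v b))" by (intro loclip_inner nrm_lipschitz
    loclip_bilinear[OF bounded_bilinear_matrix_vector_mult] loclip_const)
qed

text \<open>The exponential map is Lipschitz. The estimate makes \<open>r\<close> large near the boundary of the ball, so that all small values of \<open>r\<close> are attained on every ray.\<close>

lemma rad_lower: assumes x: "x \<in> ball x0 \<delta>" shows "norm (x - x0) \<le> Le * rad x"
proof -
 have "dist (ex (lg x)) (ex 0) \<le> Le * dist (lg x) 0" by (rule lipschitz_onD[OF ex_lip lg(1)[OF x] zero_in_N])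
 thus ?thesis unfolding rad_def lg(2)[OF x] ex_0 by (simp add: dist_norm)
qed

lemma radial_curve: assumes w: "s *\<^sub>R w \<in> N" and s: "s > 0" and w1: "norm w = 1"
 shows "((\<lambda>t. ex (t *\<^sub>R w)) has_vector_derivative nrm (ex (s *\<^sub>R w))) (at s)"
proof -
 have 1: "((\<lambda>t. t / s) has_vector_derivative 1 / s) (at s)" by (auto intro!: derivative_eq_intros)
 have "((\<lambda>t. ex (t *\<^sub>R (s *\<^sub>R w))) has_vector_derivative Z (ex (s *\<^sub>R w))) (at (s / s))"
  using ex_radial[OF w] s by simp
 from vector_diff_chain_at[OF 1 this]
 have "((\<lambda>t. ex ((t / s) *\<^sub>R (s *\<^sub>R w))) has_vector_derivative (1 / s) *\<^sub>R Z (ex (s *\<^sub>R w))) (at s)"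
  by (simp add: comp_def)
 moreover have "(\<lambda>t. ex ((t / s) *\<^sub>R (s *\<^sub>R w))) = (\<lambda>t. ex (t *\<^sub>R w))" using s by simp
 moreover have "rad (ex (s *\<^sub>R w)) = s" using rad_ex[OF w] w1 s by simp
 ultimately show ?thesis unfolding nrm_def by simp
qed

text \<open>The derivative of \<open>r\<close> along a straight ray from the centre is positive by \<open>Z_outward\<close>.\<close>

lemma rad_strict_on_rays: assumes w: "norm w = 1" and st: "0 < s" "s < t" "t < \<delta>"
 shows "rad (x0 + s *\<^sub>R w) < rad (x0 + t *\<^sub>R w)"
proof (rule DERIV_pos_imp_increasing[OF st(2)])
 fix r assume r: "s \<le> r" "r \<le> t"
 let ?x = "x0 + r *\<^sub>R w"
 have x: "?x \<in> P" unfolding P_def using r st w by (auto simp: dist_norm)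
 hence xb: "?x \<in> ball x0 \<delta>" "?x \<noteq> x0" unfolding P_def by auto
 have "((\<lambda>r. rad (x0 + r *\<^sub>R w)) has_derivative (\<lambda>h. nrm ?x \<bullet> (M ?x *v (h *\<^sub>R w)))) (at r)"
  by (rule has_derivative_compose[of "\<lambda>r. x0 + r *\<^sub>R w" "\<lambda>h. h *\<^sub>R w" r UNIV rad])
   (auto intro!: derivative_eq_intros rad_deriv[OF x])
 hence d: "((\<lambda>r. rad (x0 + r *\<^sub>R w)) has_real_derivative nrm ?x \<bullet> (M ?x *v w)) (at r)"
  unfolding has_field_derivative_def by (simp add: matrix_vector_mult_scaleR mult.commute[of _ "_ \<bullet> _"])
 have "0 < Z ?x \<bullet> (M ?x *v (r *\<^sub>R w))" using Z_outward[OF xb] by simp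
 hence "0 < r * (Z ?x \<bullet> (M ?x *v w))" by (simp add: matrix_vector_mult_scaleR)
 hence "0 < Z ?x \<bullet> (M ?x *v w)" using r st by (simp add: zero_less_mult_iff)
 hence "0 < nrm ?x \<bullet> (M ?x *v w)" unfolding nrm_def using rad_pos[OF x] by simp
 thus "\<exists>y. ((\<lambda>r. rad (x0 + r *\<^sub>R w)) has_real_derivative y) (at r) \<and> 0 < y" using d by blast
qed

end

lemma loclip_finite:
 fixes f :: "'i => 'a::metric_space => 'b::metric_space" assumes "finite I" "\<And>i. i \<in> I ==> locally_lipschitz_on S (f i)" "x \<in> S"
 shows "\<exists>e>0. \<forall>i\<in>I. \<exists>L. L-lipschitz_on (ball x e \<inter> S) (f i)" using assms(1,2)
proof (induction I rule: finite_induct)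
 case empty
 thus ?case using zero_less_one by blast
next
 case (insert i I)
 then obtain e where e: "e > 0" "\<forall>i\<in>I. \<exists>L. L-lipschitz_on (ball x e \<inter> S) (f i)" by auto
 have "locally_lipschitz_on S (f i)" using insert.prems by simp
 then obtain d L where d: "d > 0" "L-lipschitz_on (ball x d \<inter> S) (f i)" using assms(3) unfolding locally_lipschitz_on_def by blast
 have sub: "ball x (min e d) \<inter> S \<subseteq> ball x e \<inter> S" "ball x (min e d) \<inter> S \<subseteq> ball x d \<inter> S" by auto
 have "\<exists>L. L-lipschitz_on (ball x (min e d) \<inter> S) (f j)" if "j \<in> insert i I" for j
  using that e(2) d(2) lipschitz_on_subset[OF _ sub(1)] lipschitz_on_subset[OF _ sub(2)] by blast
 thus ?case using e(1) d(1) by (intro exI[of _ "min e d"]) simp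
qed

context radial_ball
begin

text \<open>The coordinates in which \<open>x\<^sub>j\<close> is replaced by \<open>r - \<kappa>\<close>. The new coordinate is moved to the slot \<open>k\<close>; if \<open>j \<noteq> k\<close>, then \<open>x\<^sub>k\<close>
takes the free slot \<open>j\<close>.\<close>

definition rcoord :: "'n => 'n => real => real^'n => real^'n" where
 "rcoord k j \<kappa> x = (\<chi> i. if i = k then rad x - \<kappa> else x $ (if i = j then k else i))"

definition rest :: "'n => 'n => real^'n => real^'n" where
 "rest k j x = (\<chi> i. if i = k then 0 else x $ (if i = j then k else i))"

lemma rest_bounded_linear: "bounded_linear (rest k j)" unfolding linear_conv_bounded_linear[symmetric]
 by (auto intro!: linearI simp: rest_def vec_eq_iff)

lemma rcoord_eq: "rcoord k j \<kappa> x = (rad x - \<kappa>) *\<^sub>R axis k 1 + rest k j x"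
 by (simp add: rcoord_def rest_def vec_eq_iff axis_def)

lemma rcoord_C11: "Ck1_on 1 P (rcoord k j \<kappa>)"
proof -
 have "Ck1_on 1 P (\<lambda>x. rad x + (- \<kappa>))" by (intro Ck1_on_1_add rad_C11 Ck1_on_const)
 hence "Ck1_on 1 P (\<lambda>x. (rad x + (- \<kappa>)) *\<^sub>R axis k (1::real))"
  by (rule Ck1_on_bounded_linear_compose[OF P_open bounded_linear_scaleR_left])
 moreover have "Ck1_on 1 P (rest k j)" using Ck1_on_bounded_linear[OF rest_bounded_linear, of 0 P k j] by simp
 ultimately have "Ck1_on 1 P (\<lambda>x. (rad x + (- \<kappa>)) *\<^sub>R axis k 1 + rest k j x)" by (rule Ck1_on_1_add)
 thus ?thesis unfolding rcoord_eq[abs_def] by simp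
qed

lemma rcoord_deriv: assumes x: "x \<in> P"
 shows "(rcoord k j \<kappa> has_derivative (\<lambda>w. (nrm x \<bullet> (M x *v w)) *\<^sub>R axis k 1 + rest k j w)) (at x)"
 unfolding rcoord_eq[abs_def] using bounded_linear_imp_has_derivative[OF rest_bounded_linear, of k j]
 by (intro has_derivative_add) (auto intro!: derivative_eq_intros rad_deriv[OF x])

text \<open>The gradient of \<open>r\<close> does not vanish, so for some \<open>j\<close> the coordinate \<open>x\<^sub>j\<close> can be replaced by \<open>r\<close>.\<close>

lemma rcoord_chart: assumes x: "x \<in> P"
 obtains j U V h where "open U" "x \<in> U" "U \<subseteq> P" "open V" "homeomorphism U V (rcoord k j \<kappa>) h"
  "Ck1_on 1 U (rcoord k j \<kappa>)" "Ck1_on 1 V h"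
proof -
 have "\<exists>j. nrm x \<bullet> (M x *v axis j 1) \<noteq> 0"
 proof (rule ccontr)
  assume "\<nexists>j. nrm x \<bullet> (M x *v axis j 1) \<noteq> 0"
  hence *: "(M x *v axis j 1) \<bullet> nrm x = 0" for j by (simp add: inner_commute)
  have "M x *v nrm x = M x *v (\<Sum>j\<in>UNIV. nrm x $ j *\<^sub>R axis j 1)"
   using basis_expansion[of "nrm x"] by (simp add: scalar_mult_eq_scaleR)
  also have "\<dots> = (\<Sum>j\<in>UNIV. nrm x $ j *\<^sub>R (M x *v axis j 1))"
   by (simp only: linear_sum[OF matrix_vector_mul_linear] matrix_vector_mult_scaleR)
  finally have "(M x *v nrm x) \<bullet> nrm x = 0" using * by (simp add: inner_sum_left)
  thus False using nrm_unit[OF x] by (simp add: inner_commute)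
 qed
 then obtain j where j: "nrm x \<bullet> (M x *v axis j 1) \<noteq> 0" by blast
 have "w = 0" if "frechet_derivative (rcoord k j \<kappa>) (at x) w = 0" for w
 proof -
  have "(nrm x \<bullet> (M x *v w)) *\<^sub>R axis k 1 + rest k j w = 0"
   using that unfolding frechet_derivative_at[OF rcoord_deriv[OF x], symmetric] .
  hence e: "((nrm x \<bullet> (M x *v w)) *\<^sub>R axis k 1 + rest k j w) $ i = 0" for i by simp
  have "w $ l = 0" if "l \<noteq> j" for l
  proof (cases "l = k")
   case True
   hence "j \<noteq> k" using that by blast
   thus ?thesis using e[of j] True by (simp add: rest_def axis_def)
  next
   case False
   thus ?thesis using e[of l] that by (simp add: rest_def axis_def)
  qed
  hence w: "w = w $ j *\<^sub>R axis j 1" by (simp add: vec_eq_iff axis_def)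
  have "nrm x \<bullet> (M x *v w) = 0" using e[of k] by (simp add: rest_def)
  hence "w $ j * (nrm x \<bullet> (M x *v axis j 1)) = 0" by (subst (asm) w) (simp add: matrix_vector_mult_scaleR)
  thus "w = 0" using j w by simp
 qed
 from Ck1_on_1_local_inverse[OF P_open rcoord_C11 x this] obtain U V h where
  UV: "open U" "U \<subseteq> P" "x \<in> U" "open V" "homeomorphism U V (rcoord k j \<kappa>) h" "Ck1_on 1 V h" by blast
 show thesis by (rule that[OF UV(1,3,2,4,5) Ck1_on_subset[OF rcoord_C11 UV(2)] UV(6)])
qed

text \<open>The chain rule for \<open>r \<circ> h\<close>: pairing with the gradient of \<open>r\<close> is the differential of the coordinate \<open>k\<close>.\<close>

lemma radial_inverse_deriv: assumes V: "open V" "y \<in> V" and h: "(h has_derivative L) (at y)" and hP: "\<And>z. z \<in> V ==> h z \<in> P"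
  and rk: "\<And>z. z \<in> V ==> rad (h z) = z $ k + \<kappa>" shows "nrm (h y) \<bullet> (M (h y) *v L u) = u $ k"
proof -
 have "((\<lambda>z. rad (h z)) has_derivative (\<lambda>u. nrm (h y) \<bullet> (M (h y) *v L u))) (at y)"
  by (rule has_derivative_compose[of h L y UNIV rad "\<lambda>w. nrm (h y) \<bullet> (M (h y) *v w)"])
   (auto intro: h rad_deriv[OF hP[OF V(2)]])
 moreover have "((\<lambda>z. rad (h z)) has_derivative (\<lambda>u. u $ k)) (at y)"
 proof (rule has_derivative_transform_within_open[OF _ V])
  show "((\<lambda>z. z $ k + \<kappa>) has_derivative (\<lambda>u. u $ k)) (at y)"
   by (auto intro!: derivative_eq_intros bounded_linear_imp_has_derivative bounded_linear_vec_nth)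
 qed (simp add: rk)
 ultimately show ?thesis using has_derivative_unique by metis
qed

end

text \<open>A coordinate ball of the manifold together with its radial data.\<close>

locale geodesic_ball = riemannian_manifold \<A> g + radial_ball "snd c p" \<delta> N ex lg Z "g c \<circ> chart_inv c" Le
 for \<A> :: "('m::t2_space, 'n::finite) chart set" and g c p \<delta> N ex lg Z Le +
 assumes c: "c \<in> \<A>" and p: "p \<in> fst c" and center: "g c p = mat 1" and ball_sub: "ball (snd c p) \<delta> \<subseteq> chart_image c"
  and exp_inverse: "\<And>q. q \<in> coordinate_ball c p \<delta> ==>
   exp_inverse \<A> g c (coordinate_ball c p \<delta>) p q = lg (snd c q)"
begin

abbreviation "C \<equiv> coordinate_ball c p \<delta>"
abbreviation "r \<equiv> geodesic_distance \<A> g c C p"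
definition level :: "real => 'm set" where "level \<rho> = {q \<in> C. r q = \<rho>}"

lemma C_iff: "q \<in> C \<longleftrightarrow> q \<in> fst c \<and> snd c q \<in> ball (snd c p) \<delta>" unfolding coordinate_ball_def by auto

lemma r_eq: "q \<in> C ==> r q = rad (snd c q)" unfolding geodesic_distance_def rad_def by (simp add: exp_inverse center norm_eq_sqrt_inner)

lemma coords: "q \<in> C ==> chart_inv c (snd c q) = q"
 "x \<in> ball (snd c p) \<delta> ==> snd c (chart_inv c x) = x" "x \<in> ball (snd c p) \<delta> ==> chart_inv c x \<in> C"
 using chart_invs[OF atlas_chart[OF c]] ball_sub unfolding C_iff by auto

lemma punctured: "q \<in> C - {p} \<longleftrightarrow> q \<in> fst c \<and> snd c q \<in> P"
proof -
 note inv = chart_inv_left[OF atlas_chart[OF c]]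
 have "snd c q = snd c p \<longleftrightarrow> q = p" if "q \<in> fst c"
  using trans[OF inv[OF that, symmetric] trans[OF arg_cong[of "snd c q" "snd c p" "chart_inv c"] inv[OF p]]] by blast
 thus ?thesis unfolding P_def by (auto simp: C_iff)
qed

lemma P_sub: "P \<subseteq> ball (snd c p) \<delta>" "P \<subseteq> chart_image c" using ball_sub unfolding P_def by auto

lemma level_iff: "q \<in> level \<rho> \<longleftrightarrow> q \<in> C \<and> rad (snd c q) = \<rho>" unfolding level_def using r_eq by auto

lemma level_punctured: "0 < \<rho> ==> q \<in> level \<rho> ==> snd c q \<in> P"
 unfolding level_iff P_def C_iff using rad_zero_iff[of "snd c p"] \<delta> by auto

lemma level_hypersurface: assumes \<rho>: "0 < \<rho>" shows "C11_hypersurface \<A> k (level \<rho>)" unfolding C11_hypersurface_def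
proof
 fix q assume q: "q \<in> level \<rho>"
 have x: "snd c q \<in> P" by (rule level_punctured[OF \<rho> q])
 obtain j U V h where U: "open U" "snd c q \<in> U" "U \<subseteq> P" "open V" "homeomorphism U V (rcoord k j \<rho>) h"
  "Ck1_on 1 U (rcoord k j \<rho>)" "Ck1_on 1 V h" using rcoord_chart[OF x, where k = k and \<kappa> = \<rho>] .
 define \<psi> where "\<psi> = (chart_inv c ` U, rcoord k j \<rho> \<circ> snd c)"
 have Uc: "U \<subseteq> chart_image c" using U(3) P_sub by blast
 have ch: "Ck1_chart 1 \<A> \<psi>" by (rule chart_from_coordinates[OF c order_refl U(1) Uc U(4-7)]) (simp_all add: \<psi>_def)
 have "z \<in> level \<rho> \<longleftrightarrow> snd \<psi> z $ k = 0" if "z \<in> fst \<psi>" for z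
 proof -
  obtain u where u: "u \<in> U" "z = chart_inv c u" using \<open>z \<in> fst \<psi>\<close> unfolding \<psi>_def by auto
  hence "u \<in> ball (snd c p) \<delta>" using U(3) P_sub by blast
  hence "z \<in> C" "snd c z = u" using coords u by auto
  thus ?thesis unfolding level_iff \<psi>_def by (simp add: rcoord_def)
 qed
 moreover have "q \<in> fst \<psi>"
  unfolding \<psi>_def using U(2) coords(1)[of q] q unfolding level_iff by (auto intro!: image_eqI[of _ _ "snd c q"])
 ultimately show "\<exists>\<psi>. slice_chart \<A> k (level \<rho>) \<psi> \<and> q \<in> fst \<psi>"
  unfolding slice_chart_def using ch by blast
qed

lemma level_metric: "induces_lipschitz_metric \<A> g k (level \<rho>)" unfolding induces_lipschitz_metric_def
proof (intro ballI allI impI)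
 fix d \<psi> i j assume d: "d \<in> \<A>" and \<psi>: "slice_chart \<A> k (level \<rho>) \<psi>"
 have ch: "Ck1_chart 1 \<A> \<psi>" and lev: "\<And>q. q \<in> fst \<psi> ==> q \<in> level \<rho> \<longleftrightarrow> snd \<psi> q $ k = 0"
  using \<psi> unfolding slice_chart_def by auto
 show "Ck1_on_slice 0 k (snd \<psi> ` (level \<rho> \<inter> fst \<psi> \<inter> fst d)) (metric_component g d \<psi> i j)"
 proof (rule Ck1_on_sliceI)
  show "open (snd \<psi> ` (fst \<psi> \<inter> fst d))" by (rule C11_chartD(2)[OF ch d])
  show "Ck1_on 0 (snd \<psi> ` (fst \<psi> \<inter> fst d)) (metric_component g d \<psi> i j)"
   using metric_component_locally_lipschitz[OF ch d] by simp
  show "y \<in> snd \<psi> ` (level \<rho> \<inter> fst \<psi> \<inter> fst d) \<longleftrightarrow> y \<in> snd \<psi> ` (fst \<psi> \<inter> fst d)" if "y $ k = 0" for y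
   using lev that by auto
 qed simp_all
qed

text \<open>The columns of the inverse chart satisfy \<open>orthogonal_decomposition\<close> with \<open>a\<close> the coordinates of the normal. The functions \<open>\<theta>\<^sub>i\<close> are
coordinates of the original chart, whence their higher regularity. The chart is shrunk at the end because Lipschitz
conditions of local nature are wanted in their uniform form.\<close>

theorem radial_charts: assumes q: "q \<in> C - {p}" shows "\<exists>V \<theta>. open V \<and> q \<in> V \<and> V \<subseteq> C - {p} \<and>
  (\<forall>i. i \<noteq> k \<longrightarrow> Ck1_fun_on 2 \<A> V (\<lambda>z. \<theta> z $ i)) \<and>
  (let \<psi> = radial_chart k V r \<theta>; h = metric_component g c \<psi>
  in Ck1_chart 1 \<A> \<psi> \<and>
    (\<exists>A :: 'n => real^'n => real.
    (\<forall>i j. i \<noteq> k \<and> j \<noteq> k \<longrightarrow> (\<exists>L. L-lipschitz_on (chart_image \<psi>) (h i j))) \<and>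
    (\<forall>i. i \<noteq> k \<longrightarrow> (\<exists>L. L-lipschitz_on (chart_image \<psi>) (A i))) \<and>
    (\<forall>y\<in>chart_image \<psi>. \<forall>u w.
    metric_in g c \<psi> y u w =
    u $ k * w $ k +
    (\<Sum>i\<in>-{k}. \<Sum>j\<in>-{k}. h i j y *
    (u $ i - A i y * u $ k) * (w $ j - A j y * w $ k)))))"
proof -
 have x: "snd c q \<in> P" using q punctured by blast
 obtain j U V h where U: "open U" "snd c q \<in> U" "U \<subseteq> P" "open V" "homeomorphism U V (rcoord k j 0) h"
  "Ck1_on 1 U (rcoord k j 0)" "Ck1_on 1 V h" using rcoord_chart[OF x, where k = k and \<kappa> = 0] .
 define \<theta> where "\<theta> z = (\<chi> i. snd c z $ (if i = j then k else i))" for z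
 define chart where "chart U' = radial_chart k (chart_inv c ` U') r \<theta>" for U'
 have val: "snd (chart U') z = rcoord k j 0 (snd c z)" if "z \<in> C" for z U'
  unfolding chart_def radial_chart_def \<theta>_def rcoord_def by (simp add: r_eq[OF that] vec_eq_iff)
 have main: "Ck1_chart 1 \<A> (chart U')" "chart_image (chart U') = V'"
   "\<And>y. y \<in> V' ==> chart_inv (chart U') y = chart_inv c (h y)"
  if U': "open U'" "U' \<subseteq> U" and V': "open V'" "V' \<subseteq> V" and hom: "homeomorphism U' V' (rcoord k j 0) h" for U' V'
 proof -
  have "z \<in> C" if "z \<in> fst (chart U')" for z
  proof -
   have "fst (chart U') = chart_inv c ` U'" unfolding chart_def radial_chart_def by (rule fst_conv)
   hence "z \<in> chart_inv c ` U'" using that by (simp only:)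
   then obtain u where u: "z = chart_inv c u" "u \<in> U'" by (rule imageE)
   hence "u \<in> ball (snd c p) \<delta>" using U'(2) U(3) P_sub by blast
   thus ?thesis unfolding u(1) by (rule coords(3))
  qed
  hence v: "snd (chart U') z = rcoord k j 0 (snd c z)" if "z \<in> fst (chart U')" for z using val that by blast
  have Uc: "U' \<subseteq> chart_image c" using U' U(3) P_sub by blast
  note cc = chart_from_coordinates[OF c order_refl U'(1) Uc V'(1) hom Ck1_on_subset[OF U(6) U'(2)] Ck1_on_subset[OF U(7) V'(2)] _ v]
  show "Ck1_chart 1 \<A> (chart U')" "chart_image (chart U') = V'"
   "\<And>y. y \<in> V' ==> chart_inv (chart U') y = chart_inv c (h y)" using cc by (simp_all add: chart_def radial_chart_def)
 qed
 note big = main[OF U(1) order_refl U(4) order_refl U(5)]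
 have hU: "h y \<in> U" "rcoord k j 0 (h y) = y" if "y \<in> V" for y using U(5) that unfolding homeomorphism_def by auto
 have hP: "h y \<in> P" if "y \<in> V" for y using hU(1)[OF that] U(3) by blast
 have hball: "h y \<in> ball (snd c p) \<delta>" if "y \<in> V" for y using hP[OF that] P_sub by blast
 have inc: "snd c (chart_inv (chart U) y) = h y" if "y \<in> V" for y using big(3)[OF that] coords(2)[OF hball[OF that]] by simp
 have rk: "rad (h y) = y $ k + 0" if "y \<in> V" for y using arg_cong[OF hU(2)[OF that], of "\<lambda>v. v $ k"] by (simp add: rcoord_def)
 define A where "A i y = nrm (h y) $ (if i = j then k else i)" for i y
 have A_lip: "locally_lipschitz_on V (A i)" for i unfolding A_def
  by (intro loclip_nth loclip_compose[OF Ck1_on_1_imp_0[OF U(4,7)] nrm_lipschitz])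
   (use hP in blast)
 have "chart_inv (chart U) y \<in> fst c" if "y \<in> V" for y using big(3)[OF that] coords(3)[OF hball[OF that]] C_iff by simp
 hence "snd (chart U) ` (fst (chart U) \<inter> fst c) = V" using chart_preimage[of "chart U" "fst c"] big(1,2) unfolding Ck1_chart_def by auto
 hence h_lip: "locally_lipschitz_on V (metric_component g c (chart U) i l)" for i l
  using metric_component_locally_lipschitz[OF big(1) c, of i l] by simp
 define y0 where "y0 = rcoord k j 0 (snd c q)"
 have y0: "y0 \<in> V" "h y0 = snd c q" using U(2,5) unfolding y0_def homeomorphism_def by auto
 obtain e1 where e1: "e1 > 0" "\<forall>i\<in>UNIV. \<exists>L. L-lipschitz_on (ball y0 e1 \<inter> V) (A i)"
  using loclip_finite[of "UNIV :: 'n set" V A y0] A_lip y0 by auto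
 obtain e2 where e2: "e2 > 0" "\<forall>i\<in>UNIV. \<exists>L. L-lipschitz_on (ball y0 e2 \<inter> V) (case i of (i, l) => metric_component g c (chart U) i l)"
  using loclip_finite[of "UNIV :: ('n \<times> 'n) set" V "\<lambda>i. case i of (i, l) => metric_component g c (chart U) i l" y0] h_lip y0
  by auto
 obtain e3 where e3: "e3 > 0" "ball y0 e3 \<subseteq> V" using U(4) y0 openE by blast
 define V' where "V' = ball y0 (min e1 (min e2 e3))"
 have V': "open V'" "V' \<subseteq> V" "y0 \<in> V'" "V' \<subseteq> ball y0 e1 \<inter> V" "V' \<subseteq> ball y0 e2 \<inter> V"
  unfolding V'_def using e1 e2 e3 by auto
 define U' where "U' = h ` V'"
 have U'U: "U' \<subseteq> U" unfolding U'_def using hU(1) V'(2) by blast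
 have hom': "homeomorphism U' V' (rcoord k j 0) h"
 proof (rule homeomorphismI)
  show "continuous_on U' (rcoord k j 0)" by (rule continuous_on_subset[OF homeomorphism_cont1[OF U(5)] U'U])
  show "continuous_on V' h" by (rule continuous_on_subset[OF homeomorphism_cont2[OF U(5)] V'(2)])
 qed (use hU(2) V'(2) in \<open>auto simp: U'_def\<close>)
 have opU': "open U'"
 proof -
  have "U' = U \<inter> rcoord k j 0 -` V'"
  proof
   show "U' \<subseteq> U \<inter> rcoord k j 0 -` V'" using U'U V'(2) hU(2) unfolding U'_def by auto
   show "U \<inter> rcoord k j 0 -` V' \<subseteq> U'"
   proof
    fix x assume "x \<in> U \<inter> rcoord k j 0 -` V'"
    hence "rcoord k j 0 x \<in> V'" "x = h (rcoord k j 0 x)" using homeomorphism_apply1[OF U(5)] by auto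
    thus "x \<in> U'" unfolding U'_def by (rule rev_image_eqI)
   qed
  qed
  thus ?thesis using continuous_open_preimage[OF homeomorphism_cont1[OF U(5)] U(1) V'(1)] by simp
 qed
 note small = main[OF opU' U'U V'(1,2) hom']
 let ?\<psi> = "chart U'"
 have inc': "(snd c \<circ> chart_inv ?\<psi>) y = h y" if "y \<in> V'" for y using small(3)[OF that] coords(2)[OF hball] V'(2) that by auto
 have dh: "(h has_derivative frechet_derivative h (at y)) (at y)" if "y \<in> V'" for y
  using Ck1_on_1_has_derivative[OF U(7)] that V'(2) by blast
 have frech: "frechet_derivative (snd c \<circ> chart_inv ?\<psi>) (at y) = frechet_derivative h (at y)" if "y \<in> V'" for y
 proof -
  have "((snd c \<circ> chart_inv ?\<psi>) has_derivative frechet_derivative h (at y)) (at y)"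
   by (rule has_derivative_transform_within_open[OF dh[OF that] V'(1) that]) (simp only: inc')
  thus ?thesis by (rule frechet_derivative_at[symmetric])
 qed
 have frech_big: "frechet_derivative (snd c \<circ> chart_inv (chart U)) (at y) = frechet_derivative h (at y)" if "y \<in> V'" for y
 proof -
  have "((snd c \<circ> chart_inv (chart U)) has_derivative frechet_derivative h (at y)) (at y)"
   by (rule has_derivative_transform_within_open[OF dh[OF that] V'(1) that]) (use inc V'(2) in auto)
  thus ?thesis by (rule frechet_derivative_at[symmetric])
 qed
 have gM: "g c (chart_inv ?\<psi> y) = (g c \<circ> chart_inv c) (h y)" if "y \<in> V'" for y using small(3)[OF that] by simp
 have gM_big: "g c (chart_inv (chart U) y) = (g c \<circ> chart_inv c) (h y)" if "y \<in> V'" for y using big(3) V'(2) that by auto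
 have comp_eq: "metric_component g c ?\<psi> i l y = metric_component g c (chart U) i l y" if "y \<in> V'" for i l y
  unfolding metric_component_def metric_in_def Let_def frech[OF that] frech_big[OF that] gM[OF that] gM_big[OF that] ..
 have C1: "\<exists>L. L-lipschitz_on V' (metric_component g c ?\<psi> i l)" for i l
 proof -
  obtain L where "L-lipschitz_on (ball y0 e2 \<inter> V) (metric_component g c (chart U) i l)" using e2(2) by force
  hence "L-lipschitz_on V' (metric_component g c (chart U) i l)" by (rule lipschitz_on_subset[OF _ V'(5)])
  hence "L-lipschitz_on V' (metric_component g c ?\<psi> i l)" by (rule lipschitz_on_transform) (simp add: comp_eq)
  thus ?thesis ..
 qed
 have C2: "\<exists>L. L-lipschitz_on V' (A i)" for i using e1(2) lipschitz_on_subset[OF _ V'(4)] by blast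
 have C3: "metric_in g c ?\<psi> y u w = u $ k * w $ k + (\<Sum>i\<in>-{k}. \<Sum>l\<in>-{k}. metric_component g c ?\<psi> i l y *
   (u $ i - A i y * u $ k) * (w $ l - A l y * w $ k))" if y: "y \<in> V'" for y u w
 proof -
  have yV: "y \<in> V" using y V'(2) by blast
  let ?L = "frechet_derivative h (at y)" and ?M = "(g c \<circ> chart_inv c) (h y)"
  have lin: "linear ?L" using dh[OF y] has_derivative_linear by blast
  define a where "a = (1::real) *\<^sub>R axis k 1 + rest k j (nrm (h y))"
  have ai: "a $ i = A i y" if "i \<noteq> k" for i using that unfolding a_def A_def rest_def by (simp add: axis_def)
  have "?L a = nrm (h y)"
  proof -
   let ?D = "\<lambda>w. (nrm (h y) \<bullet> (?M *v w)) *\<^sub>R axis k 1 + rest k j w"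
   have "((\<lambda>x. h (rcoord k j 0 x)) has_derivative (\<lambda>w. ?L (?D w))) (at (h y))" using rcoord_deriv[OF hP[OF yV]] dh[OF y]
    by (rule has_derivative_compose[of "rcoord k j 0" ?D "h y" UNIV h ?L, unfolded hU(2)[OF yV]])
   moreover have "((\<lambda>x. h (rcoord k j 0 x)) has_derivative (\<lambda>w. w)) (at (h y))"
    by (rule has_derivative_transform_within_open[OF has_derivative_ident U(1) hU(1)[OF yV]])
    (use U(5) in \<open>simp add: homeomorphism_def\<close>)
   ultimately have "(\<lambda>w. ?L (?D w)) = (\<lambda>w. w)" by (rule has_derivative_unique)
   from fun_cong[OF this, of "nrm (h y)"] show ?thesis using nrm_unit[OF hP[OF yV]] unfolding a_def by simp
  qed
  hence rad': "?L a \<bullet> (?M *v ?L u) = u $ k" for u using radial_inverse_deriv[OF U(4) yV dh[OF y] hP rk] by simp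
  have unit: "?L a \<bullet> (?M *v ?L a) = 1" using nrm_unit[OF hP[OF yV]] \<open>?L a = nrm (h y)\<close> by simp
  have "?L u \<bullet> (?M *v ?L w) = u $ k * w $ k + (\<Sum>i\<in>-{k}. \<Sum>l\<in>-{k}. (?L (axis i 1) \<bullet> (?M *v ?L (axis l 1))) *
  (u $ i - a $ i * u $ k) * (w $ l - a $ l * w $ k))" by (rule orthogonal_decomposition[OF lin M_sym[OF hball[OF yV]] rad' unit])
  also have "\<dots> = u $ k * w $ k + (\<Sum>i\<in>-{k}. \<Sum>l\<in>-{k}. (?L (axis i 1) \<bullet> (?M *v ?L (axis l 1))) *
  (u $ i - A i y * u $ k) * (w $ l - A l y * w $ k))" by (intro arg_cong2[where f = "(+)"] refl sum.cong) (simp add: ai)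
  finally show ?thesis unfolding metric_component_def metric_in_def Let_def frech[OF y] gM[OF y] .
 qed
 have sub: "chart_inv c ` U' \<subseteq> C - {p}"
 proof
  fix z assume "z \<in> chart_inv c ` U'"
  then obtain u where u: "u \<in> P" "z = chart_inv c u" using U'U U(3) by blast
  hence "u \<in> ball (snd c p) \<delta>" using P_sub by blast
  hence "z \<in> fst c" "snd c z = u" using coords u C_iff by auto
  thus "z \<in> C - {p}" using punctured u by blast
 qed
 have "q \<in> chart_inv c ` U'" unfolding U'_def using y0 V'(3) coords(1)[of q] q by (metis DiffD1 image_eqI)
 moreover have "open (chart_inv c ` U')" using small(1) unfolding Ck1_chart_def is_chart_def chart_def radial_chart_def by simp
 moreover have "Ck1_fun_on 2 \<A> (chart_inv c ` U') (\<lambda>z. \<theta> z $ i)" for i unfolding Ck1_fun_on_def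
 proof
  fix d assume d: "d \<in> \<A>"
  have "Ck1_on 2 (snd d ` (fst d \<inter> fst c)) (\<lambda>y. trans_map d c y $ (if i = j then k else i))"
   by (rule Ck1_on_bounded_linear_compose[OF overlap(1)[OF d c], of "\<lambda>x. x $ (if i = j then k else i)", OF bounded_linear_vec_nth transition_C21[OF d c]])
  hence "Ck1_on 2 (snd d ` (fst d \<inter> chart_inv c ` U')) (\<lambda>y. trans_map d c y $ (if i = j then k else i))"
   by (rule Ck1_on_subset) (use sub C_iff in blast)
  thus "Ck1_on 2 (snd d ` (fst d \<inter> chart_inv c ` U')) ((\<lambda>z. \<theta> z $ i) \<circ> chart_inv d)"
   unfolding \<theta>_def comp_def by simp
 qed
 ultimately have top: "open (chart_inv c ` U') \<and> q \<in> chart_inv c ` U' \<and> chart_inv c ` U' \<subseteq> C - {p} \<and>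
  (\<forall>i. i \<noteq> k \<longrightarrow> Ck1_fun_on 2 \<A> (chart_inv c ` U') (\<lambda>z. \<theta> z $ i))"
  using sub by (intro conjI allI impI)
 have bot: "Ck1_chart 1 \<A> ?\<psi> \<and>
    (\<exists>A :: 'n => real^'n => real.
    (\<forall>i j. i \<noteq> k \<and> j \<noteq> k \<longrightarrow> (\<exists>L. L-lipschitz_on (chart_image ?\<psi>) (metric_component g c ?\<psi> i j))) \<and>
    (\<forall>i. i \<noteq> k \<longrightarrow> (\<exists>L. L-lipschitz_on (chart_image ?\<psi>) (A i))) \<and>
    (\<forall>y\<in>chart_image ?\<psi>. \<forall>u w.
    metric_in g c ?\<psi> y u w =
    u $ k * w $ k +
    (\<Sum>i\<in>-{k}. \<Sum>j\<in>-{k}. metric_component g c ?\<psi> i j y *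
    (u $ i - A i y * u $ k) * (w $ j - A j y * w $ k))))" unfolding small(2)
  by (rule conjI[OF small(1) exI[of _ A]], intro conjI allI impI ballI) (rule C1, rule C2, rule C3, assumption)
 note t = conjunct1[OF top] conjunct1[OF conjunct2[OF top]] conjunct1[OF conjunct2[OF conjunct2[OF top]]]
  conjunct2[OF conjunct2[OF conjunct2[OF top]]]
 show ?thesis
  apply (rule exI[of _ "chart_inv c ` U'"])
  apply (rule exI[of _ \<theta>])
  apply (rule conjI[OF t(1)])
  apply (rule conjI[OF t(2)])
  apply (rule conjI[OF t(3)])
  apply (rule conjI[OF t(4)])
  apply (unfold Let_def)
  apply (rule bot[unfolded chart_def])
  done
qed

end

section \<open>Level sets of the radial function as spheres\<close>

lemma Ck1_on_1_preimage_open: assumes "open S" "Ck1_on 1 S f" "open T" shows "open (S \<inter> f -` T)"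
 by (rule continuous_open_preimage[OF loclip_continuous[OF Ck1_on_1_imp_0[OF assms(1,2)]] assms(1,3)])

context radial_ball
begin

text \<open>The point on the straight ray through \<open>x\<close> whose Euclidean distance from the origin is \<open>r x\<close>; it maps level sets of \<open>r\<close> to round spheres.\<close>

definition polar :: "real^'n => real^'n" where
 "polar x = (rad x * inverse (norm (x - x0))) *\<^sub>R (x - x0)"

lemma P_D: "x \<in> P ==> 0 < norm (x - x0)" "x \<in> P ==> x \<in> ball x0 \<delta>" unfolding P_def by auto

lemma norm_polar: "x \<in> P ==> norm (polar x) = rad x" unfolding polar_def using rad_pos[of x] P_D(1)[of x] by simp

lemma polar_C11: "Ck1_on 1 P polar"
proof -
 have d: "Ck1_on 1 P (\<lambda>x. x - x0)"
  using Ck1_on_1_add[OF Ck1_on_bounded_linear[OF bounded_linear_ident, of 0 P, folded One_nat_def] Ck1_on_const[of 1 P "- x0"]] by simp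
 have sq: "Ck1_on 1 P (\<lambda>x. (x - x0) \<bullet> (x - x0))" by (rule Ck1_on_1_bilinear[OF P_open bounded_bilinear_inner d d])
 have n: "Ck1_on 1 P (\<lambda>x. sqrt ((x - x0) \<bullet> (x - x0)))" by (rule Ck1_on_1_compose[OF P_open sq Ck1_on_1_sqrt]) (auto simp: P_def)
 have "Ck1_on 1 P (\<lambda>x. inverse (sqrt ((x - x0) \<bullet> (x - x0))))"
  by (rule Ck1_on_1_compose[OF P_open n Ck1_on_1_inverse_real]) (auto simp: P_def)
 hence i: "Ck1_on 1 P (\<lambda>x. inverse (norm (x - x0)))" unfolding norm_eq_sqrt_inner .
 have "Ck1_on 1 P (\<lambda>x. rad x * inverse (norm (x - x0)))" by (rule Ck1_on_1_bilinear[OF P_open bounded_bilinear_mult rad_C11 i])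
 from Ck1_on_1_bilinear[OF P_open bounded_bilinear_scaleR this d] show ?thesis unfolding polar_def[abs_def] .
qed

lemma polar_inj: "inj_on polar P"
proof (rule inj_onI)
 fix x y assume x: "x \<in> P" and y: "y \<in> P" and e: "polar x = polar y"
 define w where "w = inverse (norm (x - x0)) *\<^sub>R (x - x0)"
 have r: "rad x = rad y" using e norm_polar x y by metis
 have px: "polar x = rad x *\<^sub>R w" unfolding polar_def w_def by simp
 have py: "polar y = rad x *\<^sub>R (inverse (norm (y - x0)) *\<^sub>R (y - x0))" unfolding polar_def r by simp
 have wy: "w = inverse (norm (y - x0)) *\<^sub>R (y - x0)" using e rad_pos[OF x] unfolding px py by (simp del: scaleR_scaleR)
 have w1: "norm w = 1" unfolding w_def using P_D(1)[OF x] by simp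
 have xe: "x = x0 + norm (x - x0) *\<^sub>R w" unfolding w_def using P_D(1)[OF x] by simp
 have ye: "y = x0 + norm (y - x0) *\<^sub>R w" unfolding wy using P_D(1)[OF y] by simp
 have b: "norm (x - x0) < \<delta>" "norm (y - x0) < \<delta>" using P_D(2)[OF x] P_D(2)[OF y] by (auto simp: dist_norm norm_minus_commute)
 show "x = y"
 proof (cases "norm (x - x0)" "norm (y - x0)" rule: linorder_cases)
  case less
  from rad_strict_on_rays[OF w1 P_D(1)[OF x] less b(2)] show ?thesis using r xe ye by simp
 next
  case equal
  thus ?thesis using xe ye by metis
 next
  case greater
  from rad_strict_on_rays[OF w1 P_D(1)[OF y] greater b(1)] show ?thesis using r xe ye by simp
 qed
qed

text \<open>A vector annihilated by the derivative is tangent to the level sets, because \<open>|polar x| = r x\<close>, and tangent to the ray, because the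
direction of \<open>x - x0\<close> is that of \<open>polar x\<close>. The two are transversal by \<open>Z_outward\<close>.\<close>

lemma polar_deriv_injective: assumes x: "x \<in> P" and w: "frechet_derivative polar (at x) w = 0" shows "w = 0"
proof -
 let ?D = "frechet_derivative polar (at x)" and ?dr = "\<lambda>w. nrm x \<bullet> (M x *v w)"
 let ?dn = "\<lambda>w. w \<bullet> sgn (x - x0)"
 have D: "(polar has_derivative ?D) (at x)" by (rule Ck1_on_1_has_derivative[OF polar_C11 x])
 have n: "((\<lambda>x. norm (x - x0)) has_derivative ?dn) (at x)" using P_D(1)[OF x] has_derivative_norm[of "x - x0"]
  by (intro has_derivative_compose[of "\<lambda>x. x - x0" "\<lambda>w. w" x UNIV norm ?dn]) (auto intro!: derivative_eq_intros)
 have "((\<lambda>x. polar x \<bullet> polar x) has_derivative (\<lambda>w. polar x \<bullet> ?D w + ?D w \<bullet> polar x)) (at x)"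
  by (rule has_derivative_inner[OF D D])
 moreover have "((\<lambda>x. polar x \<bullet> polar x) has_derivative (\<lambda>w. rad x * ?dr w + ?dr w * rad x)) (at x)"
 proof (rule has_derivative_transform_within_open[OF has_derivative_mult[OF rad_deriv[OF x] rad_deriv[OF x]] P_open x])
  show "rad y * rad y = polar y \<bullet> polar y" if "y \<in> P" for y
   using norm_polar[OF that] by (simp add: power2_norm_eq_inner[symmetric] power2_eq_square)
 qed
 ultimately have "(\<lambda>w. polar x \<bullet> ?D w + ?D w \<bullet> polar x) = (\<lambda>w. rad x * ?dr w + ?dr w * rad x)"
  by (rule has_derivative_unique)
 from fun_cong[OF this, of w] have dr0: "?dr w = 0" using w rad_pos[OF x] by simp
 have "((\<lambda>x. rad x *\<^sub>R (x - x0)) has_derivative (\<lambda>w. rad x *\<^sub>R (w - 0) + ?dr w *\<^sub>R (x - x0))) (at x)"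
  by (intro has_derivative_scaleR rad_deriv[OF x] has_derivative_diff has_derivative_ident has_derivative_const)
 moreover have "((\<lambda>x. rad x *\<^sub>R (x - x0)) has_derivative (\<lambda>w. norm (x - x0) *\<^sub>R ?D w + ?dn w *\<^sub>R polar x)) (at x)"
 proof (rule has_derivative_transform_within_open[OF has_derivative_scaleR[OF n D] P_open x])
  show "norm (y - x0) *\<^sub>R polar y = rad y *\<^sub>R (y - x0)" if "y \<in> P" for y using P_D(1)[OF that] unfolding polar_def by simp
 qed
 ultimately have "(\<lambda>w. rad x *\<^sub>R (w - 0) + ?dr w *\<^sub>R (x - x0)) = (\<lambda>w. norm (x - x0) *\<^sub>R ?D w + ?dn w *\<^sub>R polar x)"
  by (rule has_derivative_unique)
 from fun_cong[OF this, of w] have e: "rad x *\<^sub>R w = ?dn w *\<^sub>R polar x" using w dr0 by simp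
 define l where "l = ?dn w * inverse (norm (x - x0))"
 have "rad x *\<^sub>R w = rad x *\<^sub>R (l *\<^sub>R (x - x0))" unfolding e polar_def l_def by (simp add: mult_ac)
 hence wl: "w = l *\<^sub>R (x - x0)" using rad_pos[OF x] by (simp del: scaleR_scaleR)
 have "0 = l * (nrm x \<bullet> (M x *v (x - x0)))" using dr0 unfolding wl by (simp add: matrix_vector_mult_scaleR)
 moreover have "nrm x \<bullet> (M x *v (x - x0)) = (1 / rad x) * (Z x \<bullet> (M x *v (x - x0)))" unfolding nrm_def by simp
 moreover have "0 < Z x \<bullet> (M x *v (x - x0))" using x by (intro Z_outward) (auto simp: P_def)
 ultimately have "l = 0" using rad_pos[OF x] by simp
 thus ?thesis using wl by simp
qed

lemma polar_inverse:
 "open (polar ` P)" "homeomorphism P (polar ` P) polar (inv_into P polar)" "Ck1_on 1 (polar ` P) (inv_into P polar)"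
 by (rule Ck1_on_1_injective_inverse[OF P_open polar_C11 polar_inj polar_deriv_injective], assumption+)+

lemma Le_nonneg: "0 \<le> Le" using ex_lip by (rule lipschitz_on_nonneg)

lemma sphere_in_polar_image: assumes \<rho>: "0 < \<rho>" "\<rho> * (Le + 1) < \<delta> / 2" and z: "norm z = \<rho>" shows "z \<in> polar ` P"
proof -
 define w where "w = (1 / \<rho>) *\<^sub>R z"
 have w1: "norm w = 1" unfolding w_def using \<rho> z by simp
 have b: "x0 + t *\<^sub>R w \<in> ball x0 \<delta>" if "0 \<le> t" "t \<le> \<delta> / 2" for t using that w1 \<delta> by (simp add: dist_norm)
 have cont: "continuous_on {0..\<delta> / 2} (\<lambda>t. rad (x0 + t *\<^sub>R w))"
  by (rule continuous_on_compose2[OF loclip_continuous[OF rad_lipschitz]])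
   (use b in \<open>auto intro!: continuous_intros\<close>)
 have "norm (x0 + (\<delta> / 2) *\<^sub>R w - x0) \<le> Le * rad (x0 + (\<delta> / 2) *\<^sub>R w)" using \<delta> by (intro rad_lower b) auto
 hence low: "\<delta> / 2 \<le> Le * rad (x0 + (\<delta> / 2) *\<^sub>R w)" using w1 \<delta> by simp
 have "\<rho> \<le> rad (x0 + (\<delta> / 2) *\<^sub>R w)"
 proof (rule ccontr)
  assume "\<not> \<rho> \<le> rad (x0 + (\<delta> / 2) *\<^sub>R w)"
  hence "Le * rad (x0 + (\<delta> / 2) *\<^sub>R w) \<le> Le * \<rho>" using Le_nonneg by (intro mult_left_mono) auto
  moreover have "Le * \<rho> \<le> \<rho> * (Le + 1)" using \<rho>(1) by (simp add: algebra_simps)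
  ultimately show False using low \<rho>(2) by linarith
 qed
 moreover have "rad (x0 + 0 *\<^sub>R w) \<le> \<rho>" using rad_zero_iff[of x0] \<delta> \<rho>(1) by simp
 ultimately obtain t where t: "0 \<le> t" "t \<le> \<delta> / 2" "rad (x0 + t *\<^sub>R w) = \<rho>"
  using IVT'[of "\<lambda>t. rad (x0 + t *\<^sub>R w)" 0 \<rho> "\<delta> / 2"] cont \<delta> by auto
 have "t \<noteq> 0" using t(3) rad_zero_iff[of x0] \<delta> \<rho>(1) by auto
 hence t0: "0 < t" using t(1) by simp
 have "w \<noteq> 0" using w1 by auto
 hence "x0 + t *\<^sub>R w \<in> P" unfolding P_def using b[OF t(1,2)] t0 by simp
 moreover have "polar (x0 + t *\<^sub>R w) = z" unfolding polar_def t(3) using w1 t0 \<rho>(1) by (simp add: w_def)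
 ultimately show ?thesis by (rule rev_image_eqI[OF _ sym])
qed

end

lemma euclidean_slice_chartD: assumes "slice_chart euclidean_atlas k T \<xi>"
 shows "is_chart \<xi>" "Ck1_on 1 (chart_image \<xi>) (chart_inv \<xi>)" "Ck1_on 1 (fst \<xi>) (snd \<xi>)"
  "\<And>z. z \<in> fst \<xi> ==> z \<in> T \<longleftrightarrow> snd \<xi> z $ k = 0"
 using assms unfolding slice_chart_def euclidean_atlas_def Ck1_chart_def Ck1_compatible_def
 by (auto simp: comp_def inv_id[unfolded id_def] id_def)

context geodesic_ball
begin

text \<open>The map \<open>polar\<close>, rescaled by \<open>1 / \<rho>\<close>, is a \<open>C\<^sup>1\<^sup>,\<^sup>1\<close> diffeomorphism of open sets that takes the level set to the unit sphere.\<close>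

theorem level_diffeomorphic_sphere: assumes \<rho>: "0 < \<rho>" "\<rho> * (Le + 1) < \<delta> / 2"
 shows "C11_hypersurface_diffeomorphic k \<A> (level \<rho>) euclidean_atlas (sphere 0 1 :: (real^'n) set)"
proof -
 note ic = atlas_chart[OF c]
 let ?Q = "polar ` P"
 define \<Psi> where "\<Psi> = inv_into P polar"
 note \<Psi> = polar_inverse[folded \<Psi>_def]
 define F where "F q = (1 / \<rho>) *\<^sub>R polar (snd c q)" for q
 define H where "H z = chart_inv c (\<Psi> (\<rho> *\<^sub>R z))" for z
 have PP: "polar x \<in> ?Q" "\<Psi> (polar x) = x" if "x \<in> P" for x using \<Psi>(2) that unfolding homeomorphism_def by auto
 have QQ: "\<Psi> y \<in> P" "polar (\<Psi> y) = y" if "y \<in> ?Q" for y using \<Psi>(2) that unfolding homeomorphism_def by auto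
 have sQ: "\<rho> *\<^sub>R z \<in> ?Q" if "z \<in> sphere 0 1" for z using that \<rho>(1) by (intro sphere_in_polar_image[OF \<rho>]) simp
 have levP: "snd c q \<in> P" if "q \<in> level \<rho>" for q by (rule level_punctured[OF \<rho>(1) that])
 have levD: "rad (snd c q) = \<rho>" "q \<in> fst c" "chart_inv c (snd c q) = q" if "q \<in> level \<rho>" for q
  using that coords(1)[of q] C_iff unfolding level_iff by auto
 have inP: "snd c (chart_inv c x) = x" "chart_inv c x \<in> C" "chart_inv c x \<in> fst c" if "x \<in> P" for x
  using coords(2,3)[of x] P_sub that C_iff by auto
 have FH: "F (H z) = z" "H z \<in> level \<rho>" if "z \<in> sphere 0 1" for z
 proof -
  have a: "\<Psi> (\<rho> *\<^sub>R z) \<in> P" "polar (\<Psi> (\<rho> *\<^sub>R z)) = \<rho> *\<^sub>R z" using QQ[OF sQ[OF that]] by auto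
  show "F (H z) = z" unfolding F_def H_def inP(1)[OF a(1)] a(2) using \<rho>(1) by simp
  have "rad (\<Psi> (\<rho> *\<^sub>R z)) = \<rho>" using norm_polar[OF a(1)] a(2) that \<rho>(1) by simp
  thus "H z \<in> level \<rho>" unfolding level_iff H_def inP(1)[OF a(1)] using inP(2)[OF a(1)] by simp
 qed
 have HF: "H (F q) = q" "F q \<in> sphere 0 1" if "q \<in> level \<rho>" for q
 proof -
  show "H (F q) = q" unfolding F_def H_def using \<rho>(1) PP(2)[OF levP[OF that]] levD(3)[OF that] by simp
  show "F q \<in> sphere 0 1" unfolding F_def using \<rho>(1) norm_polar[OF levP[OF that]] levD(1)[OF that] by simp
 qed
 have contpolar: "continuous_on P polar" and contPsi: "continuous_on ?Q \<Psi>"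
  using homeomorphism_cont1[OF \<Psi>(2)] homeomorphism_cont2[OF \<Psi>(2)] by auto
 have hom: "homeomorphism (level \<rho>) (sphere 0 1) F H"
 proof (rule homeomorphismI)
  have "continuous_on (level \<rho>) (\<lambda>q. polar (snd c q))"
   by (rule continuous_on_compose2[OF contpolar continuous_on_subset[OF chart_continuous(1)[OF ic]]])
    (use levD levP in blast)+
  thus "continuous_on (level \<rho>) F" unfolding F_def by (intro continuous_intros)
  have "continuous_on (sphere 0 1) (\<lambda>z. \<Psi> (\<rho> *\<^sub>R z))"
   by (rule continuous_on_compose2[OF contPsi]) (use sQ in \<open>auto intro!: continuous_intros\<close>)
  thus "continuous_on (sphere 0 1) H" unfolding H_def
   by (rule continuous_on_compose2[OF chart_continuous(2)[OF ic]]) (use QQ(1)[OF sQ] P_sub in blast)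
 qed (use FH HF in auto)
 have PsiC: "Ck1_on 1 ?Q \<Psi>" by (rule \<Psi>(3))
 have FC: "Ck1_on 1 P (\<lambda>x. (1 / \<rho>) *\<^sub>R polar x)"
  by (rule Ck1_on_bounded_linear_compose[OF P_open bounded_linear_scaleR_right polar_C11])
 have smooth: "Ck1_on_slice 1 k (snd \<psi> ` {q \<in> level \<rho> \<inter> fst \<psi>. F q \<in> fst \<xi>}) (snd \<xi> \<circ> F \<circ> chart_inv \<psi>) \<and>
   Ck1_on_slice 1 k (snd \<xi> ` {z \<in> sphere 0 1 \<inter> fst \<xi>. H z \<in> fst \<psi>}) (snd \<psi> \<circ> H \<circ> chart_inv \<xi>)"
  if \<psi>: "slice_chart \<A> k (level \<rho>) \<psi>" and \<xi>: "slice_chart euclidean_atlas k (sphere 0 1) \<xi>" for \<psi> \<xi>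
 proof
  have ch: "Ck1_chart 1 \<A> \<psi>" and lev: "\<And>q. q \<in> fst \<psi> ==> q \<in> level \<rho> \<longleftrightarrow> snd \<psi> q $ k = 0"
   using \<psi> unfolding slice_chart_def by auto
  note D = C11_chartD[OF ch c]
  note E = euclidean_slice_chartD[OF \<xi>]
  note i\<psi> = chart_inv_left[OF D(1)] chart_inv_right[OF D(1)] chart_inv_in[OF D(1)]
  note i\<xi> = chart_inv_left[OF E(1)] chart_inv_right[OF E(1)] chart_inv_in[OF E(1)]
  let ?O = "snd \<psi> ` (fst \<psi> \<inter> fst c)" and ?c = "snd c \<circ> chart_inv \<psi>"
  define T where "T = P \<inter> (\<lambda>x. (1 / \<rho>) *\<^sub>R polar x) -` fst \<xi>"
  have T: "open T" unfolding T_def by (rule Ck1_on_1_preimage_open[OF P_open FC chart_continuous(3)[OF E(1)]])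
  define S where "S = ?O \<inter> ?c -` T"
  have S: "open S" unfolding S_def by (rule Ck1_on_1_preimage_open[OF D(2,3) T])
  have "Ck1_on 1 S (\<lambda>y. (1 / \<rho>) *\<^sub>R polar (?c y))"
   by (rule Ck1_on_1_compose[OF S Ck1_on_subset[OF D(3)] FC]) (auto simp: S_def T_def)
  hence "Ck1_on 1 S (\<lambda>y. snd \<xi> ((1 / \<rho>) *\<^sub>R polar (?c y)))"
   by (rule Ck1_on_1_compose[OF S _ E(3)]) (auto simp: S_def T_def)
  thus "Ck1_on_slice 1 k (snd \<psi> ` {q \<in> level \<rho> \<inter> fst \<psi>. F q \<in> fst \<xi>}) (snd \<xi> \<circ> F \<circ> chart_inv \<psi>)"
  proof (rule Ck1_on_sliceI[OF order_refl S])
   fix y :: "real^'n" assume y: "y $ k = 0"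
   show "y \<in> snd \<psi> ` {q \<in> level \<rho> \<inter> fst \<psi>. F q \<in> fst \<xi>} \<longleftrightarrow> y \<in> S"
   proof
    assume "y \<in> snd \<psi> ` {q \<in> level \<rho> \<inter> fst \<psi>. F q \<in> fst \<xi>}"
    then obtain q where q: "y = snd \<psi> q" "q \<in> level \<rho>" "q \<in> fst \<psi>" "F q \<in> fst \<xi>" by blast
    hence "chart_inv \<psi> y = q" using i\<psi>(1) by simp
    thus "y \<in> S" unfolding S_def T_def using q levP[OF q(2)] levD(2)[OF q(2)] unfolding F_def by simp
   next
    assume yS: "y \<in> S"
    define q where "q = chart_inv \<psi> y"
    have "y \<in> chart_image \<psi>" using yS unfolding S_def by blast
    hence "q \<in> fst \<psi>" "snd \<psi> q = y" unfolding q_def using i\<psi>(2,3) by auto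
    moreover have "F q \<in> fst \<xi>" using yS unfolding S_def T_def F_def q_def by simp
    moreover have "q \<in> level \<rho>" using lev[OF calculation(1)] calculation(2) y by simp
    ultimately show "y \<in> snd \<psi> ` {q \<in> level \<rho> \<inter> fst \<psi>. F q \<in> fst \<xi>}" by blast
   qed
  qed (simp add: F_def)
  define T' where "T' = ?Q \<inter> \<Psi> -` (snd c ` (fst c \<inter> fst \<psi>))"
  have T': "open T'" unfolding T'_def by (rule Ck1_on_1_preimage_open[OF \<Psi>(1) PsiC D(4)])
  have zC: "Ck1_on 1 (chart_image \<xi>) (\<lambda>y. \<rho> *\<^sub>R chart_inv \<xi> y)"
   by (rule Ck1_on_bounded_linear_compose[OF chart_continuous(4)[OF E(1)] bounded_linear_scaleR_right E(2)])
  define S' where "S' = chart_image \<xi> \<inter> (\<lambda>y. \<rho> *\<^sub>R chart_inv \<xi> y) -` T'"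
  have S': "open S'" unfolding S'_def by (rule Ck1_on_1_preimage_open[OF chart_continuous(4)[OF E(1)] zC T'])
  have "Ck1_on 1 S' (\<lambda>y. \<Psi> (\<rho> *\<^sub>R chart_inv \<xi> y))"
   by (rule Ck1_on_1_compose[OF S' Ck1_on_subset[OF zC] PsiC]) (auto simp: S'_def T'_def)
  hence "Ck1_on 1 S' (\<lambda>y. (snd \<psi> \<circ> chart_inv c) (\<Psi> (\<rho> *\<^sub>R chart_inv \<xi> y)))"
   by (rule Ck1_on_1_compose[OF S' _ D(5)]) (auto simp: S'_def T'_def)
  thus "Ck1_on_slice 1 k (snd \<xi> ` {z \<in> sphere 0 1 \<inter> fst \<xi>. H z \<in> fst \<psi>}) (snd \<psi> \<circ> H \<circ> chart_inv \<xi>)"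
  proof (rule Ck1_on_sliceI[OF order_refl S'])
   fix y :: "real^'n" assume y: "y $ k = 0"
   show "y \<in> snd \<xi> ` {z \<in> sphere 0 1 \<inter> fst \<xi>. H z \<in> fst \<psi>} \<longleftrightarrow> y \<in> S'"
   proof
    assume "y \<in> snd \<xi> ` {z \<in> sphere 0 1 \<inter> fst \<xi>. H z \<in> fst \<psi>}"
    then obtain z where z: "y = snd \<xi> z" "z \<in> sphere 0 1" "z \<in> fst \<xi>" "H z \<in> fst \<psi>" by blast
    have zy: "chart_inv \<xi> y = z" using z i\<xi>(1) by simp
    have a: "\<Psi> (\<rho> *\<^sub>R z) \<in> P" by (rule QQ(1)[OF sQ[OF z(2)]])
    have "\<Psi> (\<rho> *\<^sub>R z) \<in> snd c ` (fst c \<inter> fst \<psi>)"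
    using inP(1,3)[OF a] z(4) unfolding H_def by (intro image_eqI[of _ _ "chart_inv c (\<Psi> (\<rho> *\<^sub>R z))"]) auto
    thus "y \<in> S'" unfolding S'_def T'_def using zy z(1,3) sQ[OF z(2)] by simp
   next
    assume yS: "y \<in> S'"
    define z where "z = chart_inv \<xi> y"
    have "y \<in> chart_image \<xi>" using yS unfolding S'_def by blast
    hence z: "z \<in> fst \<xi>" "snd \<xi> z = y" unfolding z_def using i\<xi>(2,3) by auto
    have "z \<in> sphere 0 1" using E(4)[OF z(1)] z(2) y by simp
    moreover have "\<Psi> (\<rho> *\<^sub>R z) \<in> snd c ` (fst c \<inter> fst \<psi>)" using yS unfolding S'_def T'_def z_def by simp
    then obtain a where a: "a \<in> fst c" "a \<in> fst \<psi>" "\<Psi> (\<rho> *\<^sub>R z) = snd c a" by blast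
    hence "H z \<in> fst \<psi>" unfolding H_def a(3) using chart_inv_left[OF ic a(1)] by simp
    ultimately show "y \<in> snd \<xi> ` {z \<in> sphere 0 1 \<inter> fst \<xi>. H z \<in> fst \<psi>}" using z by blast
   qed
  qed (simp add: H_def)
 qed
 show ?thesis unfolding C11_hypersurface_diffeomorphic_def by (intro exI[of _ F] exI[of _ H] conjI hom allI impI) (use smooth in blast)+
qed

end

section \<open>Lipschitz coordinates carried along the radial geodesics\<close>

lemma lipschitz_on_derivative_bound:
 fixes f :: "'a::real_normed_vector => 'b::real_normed_vector"
 assumes S: "open S" "x \<in> S" and f: "K-lipschitz_on S f" and L: "(f has_derivative L) (at x)" shows "norm (L v) \<le> K * norm v"
proof (cases "v = 0")
 case True
 thus ?thesis using linear_0[OF has_derivative_linear[OF L]] by simp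
next
 case False
 show ?thesis
 proof (rule field_le_epsilon)
  fix e :: real assume e: "0 < e"
  define e' where "e' = e / norm v"
  have e': "0 < e'" "e' * norm v = e" unfolding e'_def using e False by auto
  obtain d where d: "0 < d" "\<And>y. norm (y - x) < d ==> norm (f y - f x - L (y - x)) \<le> e' * norm (y - x)"
   using L e'(1) unfolding has_derivative_at_alt by blast
  obtain r where r: "0 < r" "ball x r \<subseteq> S" using S openE by blast
  define t where "t = min d r / (2 * norm v)"
  have t: "0 < t" "t * norm v < d" "t * norm v < r" unfolding t_def using d(1) r(1) False by (auto simp: min_def)
  define y where "y = x + t *\<^sub>R v"
  have yS: "y \<in> S" using r(2) t(1,3) unfolding y_def by (auto simp: dist_norm)
  have "norm (f y - f x - L (t *\<^sub>R v)) \<le> e' * (t * norm v)" using d(2)[of y] t(1,2) unfolding y_def by simp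
  moreover have "norm (f y - f x) \<le> K * (t * norm v)" using lipschitz_onD[OF f yS S(2)] t(1) unfolding y_def by (simp add: dist_norm)
  ultimately have "norm (L (t *\<^sub>R v)) \<le> K * (t * norm v) + e' * (t * norm v)"
   using norm_triangle_ineq4[of "f y - f x" "f y - f x - L (t *\<^sub>R v)"] by simp
  also have "\<dots> = t * (K * norm v + e)" using e'(2) by (simp add: algebra_simps)
  finally have "t * norm (L v) \<le> t * (K * norm v + e)" using linear_scale[OF has_derivative_linear[OF L], of t v] t(1) by simp
  thus "norm (L v) \<le> K * norm v + e" using t(1) by simp
 qed
qed

lemma has_derivative_imp_has_vector_derivative_line: assumes "(f has_derivative L) (at x)"
 shows "((\<lambda>t. f (x + t *\<^sub>R v)) has_vector_derivative L v) (at 0)"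
proof -
 have "((\<lambda>t. f (x + t *\<^sub>R v)) has_derivative (\<lambda>t. L (t *\<^sub>R v))) (at 0)"
  by (rule has_derivative_compose[of "\<lambda>t. x + t *\<^sub>R v" "\<lambda>t. t *\<^sub>R v" 0 UNIV f L])
   (use assms in \<open>auto intro!: derivative_eq_intros\<close>)
 thus ?thesis unfolding has_vector_derivative_def linear_scale[OF has_derivative_linear[OF assms]] .
qed

context geodesic_ball
begin

text \<open>The common property of all coordinates that are constant along the radial geodesics: where the inverse \<open>Y\<close> of the chart is
differentiable, its \<open>k\<close>-th column is the unit normal, so \<open>orthogonal_decomposition\<close> applies with \<open>A\<^sub>i = 0\<close>.\<close>

lemma ae_direct_sum_formI: assumes B: "open B" and lip: "K-lipschitz_on B Y" and YP: "\<And>y. y \<in> B ==> Y y \<in> P"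
  and rk: "\<And>y. y \<in> B ==> rad (Y y) = y $ k"
  and radial: "\<And>y. y \<in> B ==> ((\<lambda>t. Y (y + t *\<^sub>R axis k 1)) has_vector_derivative nrm (Y y)) (at 0)"
  and img: "chart_image \<psi> = B" and inv: "\<And>y. y \<in> B ==> chart_inv \<psi> y = chart_inv c (Y y)"
 shows "\<And>y. y \<in> B ==> components_defined_at c \<psi> y \<longleftrightarrow> Y differentiable (at y)"
  and "\<And>y L i l. y \<in> B ==> (Y has_derivative L) (at y) ==>
   metric_component g c \<psi> i l y = L (axis i 1) \<bullet> ((g c \<circ> chart_inv c) (Y y) *v L (axis l 1))"
  and "ae_direct_sum_form g c k \<psi>"
proof -
 have eq: "(snd c \<circ> chart_inv \<psi>) y = Y y" if "y \<in> B" for y using inv[OF that] coords(2)[of "Y y"] YP[OF that] P_sub by auto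
 show cd: "components_defined_at c \<psi> y \<longleftrightarrow> Y differentiable (at y)" if "y \<in> B" for y
  unfolding components_defined_at_def using differentiable_transform_open[OF B that, of "snd c \<circ> chart_inv \<psi>" Y]
   differentiable_transform_open[OF B that, of Y "snd c \<circ> chart_inv \<psi>"] eq by metis
 have metric: "metric_in g c \<psi> y u w = L u \<bullet> ((g c \<circ> chart_inv c) (Y y) *v L w)"
  if y: "y \<in> B" and L: "(Y has_derivative L) (at y)" for y L u w
 proof -
  have "((snd c \<circ> chart_inv \<psi>) has_derivative L) (at y)" by (rule has_derivative_transform_within_open[OF L B y]) (simp only: eq)
  hence "frechet_derivative (snd c \<circ> chart_inv \<psi>) (at y) = L" by (rule frechet_derivative_at[symmetric])
  thus ?thesis unfolding metric_in_def Let_def inv[OF y] by simp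
 qed
 show comp: "metric_component g c \<psi> i l y = L (axis i 1) \<bullet> ((g c \<circ> chart_inv c) (Y y) *v L (axis l 1))"
  if "y \<in> B" "(Y has_derivative L) (at y)" for y L i l unfolding metric_component_def by (rule metric[OF that])
 have "negligible {y \<in> B. \<not> Y differentiable (at y)}"
  by (rule locally_lipschitz_differentiable_ae[OF B lipschitz_on_imp_locally[OF lip]])
 moreover have "{y \<in> B. \<not> Y differentiable (at y)} = {y \<in> B. \<not> components_defined_at c \<psi> y}" using cd by blast
 ultimately have neg: "negligible {y \<in> B. \<not> components_defined_at c \<psi> y}" by simp
 have form: "metric_in g c \<psi> y u w = u $ k * w $ k +
    (\<Sum>i\<in>-{k}. \<Sum>j\<in>-{k}. metric_component g c \<psi> i j y * u $ i * w $ j)"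
  and bound: "\<bar>metric_component g c \<psi> i j y\<bar> \<le> 2 * K * K"
  if y: "y \<in> B" and d: "components_defined_at c \<psi> y" for y u w i j
 proof -
  let ?M = "(g c \<circ> chart_inv c) (Y y)"
  obtain L where L: "(Y has_derivative L) (at y)" using d cd[OF y] unfolding differentiable_def by blast
  have lin: "linear L" by (rule has_derivative_linear[OF L])
  have a: "L (axis k 1) = nrm (Y y)" by (rule vector_derivative_unique_at[OF has_derivative_imp_has_vector_derivative_line[OF L] radial[OF y]])
  have YB: "Y y \<in> ball (snd c p) \<delta>" using YP[OF y] P_sub by blast
  have r1: "L (axis k 1) \<bullet> (?M *v L u) = u $ k" for u unfolding a by (rule radial_inverse_deriv[OF B y L YP]) (simp_all add: rk)
  have "L u \<bullet> (?M *v L w) = u $ k * w $ k + (\<Sum>i\<in>-{k}. \<Sum>j\<in>-{k}. (L (axis i 1) \<bullet> (?M *v L (axis j 1))) *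
  (u $ i - axis k 1 $ i * u $ k) * (w $ j - axis k 1 $ j * w $ k))"
   by (rule orthogonal_decomposition[OF lin M_sym[OF YB] r1]) (unfold a, rule nrm_unit[OF YP[OF y]])
  also have "\<dots> = u $ k * w $ k + (\<Sum>i\<in>-{k}. \<Sum>j\<in>-{k}. (L (axis i 1) \<bullet> (?M *v L (axis j 1))) * u $ i * w $ j)"
   by (intro arg_cong2[where f = "(+)"] refl sum.cong) (simp add: axis_def)
  finally show "metric_in g c \<psi> y u w = u $ k * w $ k +
    (\<Sum>i\<in>-{k}. \<Sum>j\<in>-{k}. metric_component g c \<psi> i j y * u $ i * w $ j)" unfolding metric[OF y L] comp[OF y L] .
  have K: "norm (L (axis i 1)) \<le> K" for i using lipschitz_on_derivative_bound[OF B y lip L, of "axis i 1"] by simp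
  have "\<bar>L (axis i 1) \<bullet> (?M *v L (axis j 1))\<bar> \<le> 2 * norm (L (axis i 1)) * norm (L (axis j 1))" by (rule M_bdd[OF YB])
  also have "\<dots> \<le> 2 * K * K" using K lipschitz_on_nonneg[OF lip] by (intro mult_mono) auto
  finally show "\<bar>metric_component g c \<psi> i j y\<bar> \<le> 2 * K * K" unfolding comp[OF y L] .
 qed
 show "ae_direct_sum_form g c k \<psi>" unfolding ae_direct_sum_form_def img
  by (intro conjI neg ballI impI allI form exI[of _ "2 * K * K"] bound)
qed

end

text \<open>A tube of radial geodesics through the patch \<open>h1 ` ball y1 \<epsilon>\<close> of the level set \<open>r = \<rho>\<close>, long enough to reach from the centre to
the distance \<open>s\<close>. The conditions \<open>dir_lip\<close> and \<open>dir_N\<close> concern the initial directions of these geodesics.\<close>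

locale radial_tube = radial_ball x0 \<delta> N ex lg Z M Le
 for x0 :: "real^'n" and \<delta> N ex lg Z M Le +
 fixes k j :: 'n and \<rho> s \<epsilon> L1 :: real and y1 :: "real^'n" and U1 V1 :: "(real^'n) set" and h1 :: "real^'n => real^'n"
 assumes \<rho>: "0 < \<rho>" "\<rho> < s" and y1: "y1 $ k = \<rho>" and \<epsilon>: "0 < \<epsilon>" "ball y1 \<epsilon> \<subseteq> V1"
  and chart: "open U1" "U1 \<subseteq> P" "open V1" "homeomorphism U1 V1 (rcoord k j 0) h1" "Ck1_on 1 V1 h1"
  and dir_lip: "L1-lipschitz_on (ball y1 \<epsilon>) (\<lambda>z. (1 / \<rho>) *\<^sub>R lg (h1 z))"
  and dir_N: "\<And>z. z \<in> ball y1 \<epsilon> ==> s *\<^sub>R ((1 / \<rho>) *\<^sub>R lg (h1 z)) \<in> N"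
begin

text \<open>Projection of the coordinates to the level \<open>r = \<rho>\<close>.\<close>

definition setk :: "real^'n => real^'n" where "setk y = drop_coord k y + \<rho> *\<^sub>R axis k 1"
definition dir :: "real^'n => real^'n" where "dir z = (1 / \<rho>) *\<^sub>R lg (h1 z)"
definition B :: "(real^'n) set" where "B = {y. 0 < y $ k \<and> y $ k < s \<and> setk y \<in> ball y1 \<epsilon>}"
text \<open>Follow, up to the distance \<open>y\<^sub>k\<close>, the radial geodesic through the point of the level set \<open>r = \<rho>\<close> with the remaining coordinates of \<open>y\<close>.\<close>

definition Y :: "real^'n => real^'n" where "Y y = ex (y $ k *\<^sub>R dir (setk y))"
definition T :: "real^'n => real^'n" where
 "T x = (\<chi> i. if i = k then rad x else ex ((\<rho> / rad x) *\<^sub>R lg x) $ (if i = j then k else i))"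

lemma setk_nth: "setk y $ i = (if i = k then \<rho> else y $ i)" unfolding setk_def drop_coord_def by (simp add: axis_def)

lemma setk_fixed: "y $ k = \<rho> ==> setk y = y" by (simp add: vec_eq_iff setk_nth)

lemma setk_line: "setk (y + t *\<^sub>R axis k 1) = setk y" by (simp add: vec_eq_iff setk_nth axis_def)

lemma setk_drop: "setk (drop_coord k y) = setk y" by (simp add: vec_eq_iff setk_nth drop_coord_def)

lemma setk_contraction: "norm (setk y - setk z) \<le> norm (y - z)" by (rule norm_le_componentwise_cart) (simp add: setk_nth)

lemma setk_continuous: "continuous_on S setk" unfolding setk_def by (intro continuous_intros linear_continuous_on drop_coord_bounded_linear)

lemma setk_derivative: "(setk has_derivative drop_coord k) (at y)"
proof -
 have "((\<lambda>y. drop_coord k y + \<rho> *\<^sub>R axis k 1) has_derivative (\<lambda>u. drop_coord k u + 0)) (at y)"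
  by (intro has_derivative_add has_derivative_const bounded_linear_imp_has_derivative drop_coord_bounded_linear)
 thus ?thesis unfolding setk_def[abs_def] by simp
qed

lemma h1: "z \<in> V1 ==> h1 z \<in> U1" "z \<in> V1 ==> h1 z \<in> P" "z \<in> V1 ==> rcoord k j 0 (h1 z) = z" "z \<in> V1 ==> rad (h1 z) = z $ k"
proof -
 assume z: "z \<in> V1"
 show "h1 z \<in> U1" "rcoord k j 0 (h1 z) = z" using chart(4) z unfolding homeomorphism_def by auto
 thus "h1 z \<in> P" using chart(2) by blast
 show "rad (h1 z) = z $ k" using arg_cong[OF \<open>rcoord k j 0 (h1 z) = z\<close>, of "\<lambda>v. v $ k"] by (simp add: rcoord_def)
qed

lemma dir_unit: "z \<in> V1 ==> z $ k = \<rho> ==> norm (dir z) = 1" using h1(4)[of z] \<rho>(1) unfolding dir_def rad_def by simp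

lemma B_D: assumes "y \<in> B" shows "0 < y $ k" "y $ k < s" "setk y \<in> ball y1 \<epsilon>" "setk y \<in> V1" "norm (dir (setk y)) = 1"
proof -
 show *: "0 < y $ k" "y $ k < s" "setk y \<in> ball y1 \<epsilon>" using assms unfolding B_def by auto
 thus "setk y \<in> V1" using \<epsilon> by blast
 thus "norm (dir (setk y)) = 1" by (rule dir_unit) (simp add: setk_nth)
qed

lemma dir_in_N: assumes "z \<in> ball y1 \<epsilon>" "0 \<le> t" "t \<le> s" shows "t *\<^sub>R dir z \<in> N"
proof -
 have "s *\<^sub>R dir z \<in> N" unfolding dir_def by (rule dir_N[OF assms(1)])
 hence "(t / s) *\<^sub>R (s *\<^sub>R dir z) \<in> N" by (rule N_star) (use assms \<rho> in \<open>auto simp: divide_simps\<close>)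
 thus ?thesis using \<rho> by simp
qed

lemma Y_in_P: "y \<in> B ==> Y y \<in> P" unfolding Y_def using B_D[of y] by (intro ex_in_P dir_in_N) auto

lemma rad_Y: "y \<in> B ==> rad (Y y) = y $ k" unfolding Y_def using B_D[of y] by (subst rad_ex) (auto intro!: dir_in_N)

lemma lg_Y: "y \<in> B ==> lg (Y y) = y $ k *\<^sub>R dir (setk y)" unfolding Y_def using B_D[of y] by (intro lg dir_in_N) auto

lemma ex_dir: "z \<in> V1 ==> ex (\<rho> *\<^sub>R dir z) = h1 z" unfolding dir_def using \<rho>(1) h1(2)[of z] P_D(2) lg(2) by simp

lemma retract_Y: assumes y: "y \<in> B"
 shows "(\<rho> / rad (Y y)) *\<^sub>R lg (Y y) = \<rho> *\<^sub>R dir (setk y)" "ex ((\<rho> / rad (Y y)) *\<^sub>R lg (Y y)) = h1 (setk y)"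
proof -
 show "(\<rho> / rad (Y y)) *\<^sub>R lg (Y y) = \<rho> *\<^sub>R dir (setk y)" unfolding rad_Y[OF y] lg_Y[OF y] using B_D(1)[OF y] by simp
 thus "ex ((\<rho> / rad (Y y)) *\<^sub>R lg (Y y)) = h1 (setk y)" using ex_dir[OF B_D(4)[OF y]] by simp
qed

lemma T_Y: "y \<in> B ==> T (Y y) = y"
proof -
 assume y: "y \<in> B"
 have "h1 (setk y) $ (if i = j then k else i) = y $ i" if "i \<noteq> k" for i
  using arg_cong[OF h1(3)[OF B_D(4)[OF y]], of "\<lambda>v. v $ i"] that by (simp add: rcoord_def setk_nth)
 thus "T (Y y) = y" unfolding T_def retract_Y(2)[OF y] by (simp add: vec_eq_iff rad_Y[OF y])
qed

lemma Y_level: "y \<in> B ==> y $ k = \<rho> ==> Y y = h1 y" unfolding Y_def using ex_dir[OF B_D(4)[of y]] setk_fixed[of y] by simp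

lemma setk_in_B: "setk y \<in> ball y1 \<epsilon> ==> setk y \<in> B" unfolding B_def using \<rho> setk_fixed[of "setk y"] by (simp add: setk_nth)

lemma B_open: "open B"
proof -
 have "B = {y. 0 < y $ k} \<inter> {y. y $ k < s} \<inter> setk -` ball y1 \<epsilon>" unfolding B_def by auto
 thus ?thesis using setk_continuous[of UNIV] by (auto intro!: open_Int open_Collect_less continuous_intros open_vimage)
qed

lemma B_convex: "convex B"
proof -
 have "setk ((1 - u) *\<^sub>R x + u *\<^sub>R y) = (1 - u) *\<^sub>R setk x + u *\<^sub>R setk y" for u x y
  by (simp add: vec_eq_iff setk_nth algebra_simps)
 hence "convex (setk -` ball y1 \<epsilon>)" using convex_ball[of y1 \<epsilon>] unfolding convex_alt by auto
 moreover have "convex {y :: real^'n. 0 < y $ k}" "convex {y :: real^'n. y $ k < s}"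
  using convex_halfspace_gt[of 0 "axis k 1 :: real^'n"] convex_halfspace_lt[of "axis k 1 :: real^'n" s] by (simp_all add: inner_axis' )
 moreover have "B = {y. 0 < y $ k} \<inter> {y. y $ k < s} \<inter> setk -` ball y1 \<epsilon>" unfolding B_def by auto
 ultimately show ?thesis by (simp add: convex_Int)
qed

lemma Y_lipschitz: "(Le * (s * L1 + 1))-lipschitz_on B Y"
proof (rule lipschitz_onI)
 have L1: "0 \<le> L1" using dir_lip by (rule lipschitz_on_nonneg)
 show "0 \<le> Le * (s * L1 + 1)" using L1 Le_nonneg \<rho> by simp
 fix y z assume y: "y \<in> B" and z: "z \<in> B"
 have 1: "norm (dir (setk y) - dir (setk z)) \<le> L1 * norm (y - z)"
 proof -
  have "norm (dir (setk y) - dir (setk z)) \<le> L1 * norm (setk y - setk z)"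
   using lipschitz_onD[OF dir_lip B_D(3)[OF y] B_D(3)[OF z]] unfolding dir_def by (simp add: dist_norm)
  also have "\<dots> \<le> L1 * norm (y - z)" by (rule mult_left_mono[OF setk_contraction L1])
  finally show ?thesis .
 qed
 have "y $ k *\<^sub>R dir (setk y) - z $ k *\<^sub>R dir (setk z) = y $ k *\<^sub>R (dir (setk y) - dir (setk z)) + (y - z) $ k *\<^sub>R dir (setk z)"
  by (simp add: algebra_simps)
 hence "norm (y $ k *\<^sub>R dir (setk y) - z $ k *\<^sub>R dir (setk z))
   \<le> norm (y $ k *\<^sub>R (dir (setk y) - dir (setk z))) + norm ((y - z) $ k *\<^sub>R dir (setk z))" by (metis norm_triangle_ineq)
 also have "\<dots> = y $ k * norm (dir (setk y) - dir (setk z)) + \<bar>(y - z) $ k\<bar>" using B_D(1,5)[OF y] B_D(5)[OF z] by simp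
 also have "\<dots> \<le> s * (L1 * norm (y - z)) + norm (y - z)"
  using B_D(1,2)[OF y] 1 component_le_norm_cart[of "y - z" k] by (intro add_mono mult_mono) auto
 also have "\<dots> = (s * L1 + 1) * norm (y - z)" by (simp add: algebra_simps)
 finally have 2: "norm (y $ k *\<^sub>R dir (setk y) - z $ k *\<^sub>R dir (setk z)) \<le> (s * L1 + 1) * norm (y - z)" .
 have "norm (Y y - Y z) \<le> Le * norm (y $ k *\<^sub>R dir (setk y) - z $ k *\<^sub>R dir (setk z))"
  using lipschitz_onD[OF ex_lip, of "y $ k *\<^sub>R dir (setk y)" "z $ k *\<^sub>R dir (setk z)"] B_D[OF y] B_D[OF z]
  unfolding Y_def by (simp add: dist_norm dir_in_N)
 also have "\<dots> \<le> Le * ((s * L1 + 1) * norm (y - z))" by (rule mult_left_mono[OF 2 Le_nonneg])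
 finally show "dist (Y y) (Y z) \<le> Le * (s * L1 + 1) * dist y z" by (simp add: dist_norm mult.assoc)
qed

lemma Y_homeomorphism: "open (Y ` B)" "homeomorphism (Y ` B) B T Y"
proof -
 have cont: "continuous_on B Y" using lipschitz_on_continuous_on[OF Y_lipschitz] .
 have inj: "inj_on Y B" using T_Y by (rule inj_on_inverseI)
 show "open (Y ` B)" by (rule invariance_of_domain[OF cont B_open inj])
 obtain t where t: "homeomorphism B (Y ` B) Y t" using invariance_of_domain_homeomorphism[OF B_open cont _ inj] by auto
 have "t x = T x" if "x \<in> Y ` B" for x using that T_Y homeomorphism_apply1[OF t] by auto
 thus "homeomorphism (Y ` B) B T Y" using homeomorphism_cong[OF homeomorphism_symD[OF t] refl refl] by simp
qed

lemma T_lipschitz: "locally_lipschitz_on (Y ` B) T"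
proof (rule loclip_vec)
 fix i
 have sub: "Y ` B \<subseteq> ball x0 \<delta>" "Y ` B \<subseteq> P" using Y_in_P P_D by auto
 have r: "locally_lipschitz_on (Y ` B) rad" by (rule loclip_subset[OF rad_lipschitz sub(1)])
 have nz: "rad x \<noteq> 0" if "x \<in> Y ` B" for x using rad_pos[of x] sub that by auto
 have "locally_lipschitz_on (Y ` B) (\<lambda>x. (\<rho> / rad x) *\<^sub>R lg x)" by (intro loclip_scaleR loclip_divide loclip_const r nz
    loclip_subset[OF lg_lip sub(1)])
 hence "locally_lipschitz_on (Y ` B) (\<lambda>x. ex ((\<rho> / rad x) *\<^sub>R lg x))"
 proof (rule loclip_compose[OF _ lipschitz_on_imp_locally[OF ex_lip]])
  show "(\<lambda>x. (\<rho> / rad x) *\<^sub>R lg x) ` Y ` B \<subseteq> N" using dir_in_N[OF B_D(3)] \<rho> retract_Y(1) by auto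
 qed
 hence "locally_lipschitz_on (Y ` B) (\<lambda>x. ex ((\<rho> / rad x) *\<^sub>R lg x) $ l)" for l by (rule loclip_nth)
 thus "locally_lipschitz_on (Y ` B) (\<lambda>x. T x $ i)" unfolding T_def using r by (cases "i = k") auto
qed

lemma Y_radial: assumes y: "y \<in> B" shows "((\<lambda>t. Y (y + t *\<^sub>R axis k 1)) has_vector_derivative nrm (Y y)) (at 0)"
proof -
 have w: "y $ k *\<^sub>R dir (setk y) \<in> N" using B_D[OF y] by (intro dir_in_N) auto
 have "((\<lambda>t. y $ k + t) has_vector_derivative 1) (at 0)" by (auto intro!: derivative_eq_intros)
 moreover have "((\<lambda>t. ex (t *\<^sub>R dir (setk y))) has_vector_derivative nrm (Y y)) (at (y $ k + 0))"
  using radial_curve[OF w B_D(1,5)[OF y]] unfolding Y_def by simp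
 ultimately have "((\<lambda>t. ex ((y $ k + t) *\<^sub>R dir (setk y))) has_vector_derivative 1 *\<^sub>R nrm (Y y)) (at 0)"
  using vector_diff_chain_at[of "\<lambda>t. y $ k + t" 1 0 "\<lambda>t. ex (t *\<^sub>R dir (setk y))"] by (simp add: comp_def)
 thus ?thesis unfolding Y_def setk_line by (simp add: axis_def)
qed

text \<open>On the level set itself the coordinates come from the \<open>C\<^sup>1\<^sup>,\<^sup>1\<close> map \<open>h1\<close>. Leaving it along the normal \<open>nrm\<close>, which is
Lipschitz along the radial geodesics, causes an error that is quadratic in the distance from \<open>y0\<close>.\<close>

lemma Y_differentiable_on_level: assumes y0: "y0 \<in> B" "y0 $ k = \<rho>"
 shows "(Y has_derivative (\<lambda>u. frechet_derivative h1 (at y0) (drop_coord k u) + u $ k *\<^sub>R nrm (h1 y0))) (at y0)"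
proof -
 have sy0: "setk y0 = y0" by (rule setk_fixed[OF y0(2)])
 have y0V: "y0 \<in> V1" using B_D(4)[OF y0(1)] sy0 by simp
 have Yy0: "Y y0 = h1 y0" by (rule Y_level[OF y0])
 obtain e Cn where e: "0 < e" "Cn-lipschitz_on (ball (h1 y0) e \<inter> P) nrm"
  using nrm_lipschitz h1(2)[OF y0V] unfolding locally_lipschitz_on_def by blast
 have Cn: "0 \<le> Cn" using e(2) by (rule lipschitz_on_nonneg)
 define K where "K = Le * (s * L1 + 1)"
 note KY = Y_lipschitz[folded K_def]
 have K: "0 \<le> K" using KY by (rule lipschitz_on_nonneg)
 obtain b where b: "0 < b" "ball y0 b \<subseteq> B" using openE[OF B_open y0(1)] by blast
 define d where "d = min b (e / (2 * K + 1)) / 2"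
 have "0 < 2 * K + 1" using K by simp
 hence d: "0 < d" "2 * d \<le> b" "2 * d \<le> e / (2 * K + 1)" unfolding d_def using b(1) e(1) by auto
 define E where "E y = Y y - h1 (setk y) - (y $ k - \<rho>) *\<^sub>R nrm (h1 y0)" for y
 have est: "norm (E y - E y0 - 0) \<le> Cn * (2 * K) * (norm (y - y0))\<^sup>2" if y: "y \<in> ball y0 d" for y
 proof -
  define n where "n = norm (y - y0)"
  have n: "n < d" "0 \<le> n" using y unfolding n_def by (auto simp: dist_norm norm_minus_commute)
  define c where "c t = y + (t - y $ k) *\<^sub>R axis k 1" for t
  have ck: "c t $ k = t" for t unfolding c_def by (simp add: axis_def)
  have dk: "\<bar>y $ k - \<rho>\<bar> \<le> n" using component_le_norm_cart[of "y - y0" k] y0(2) unfolding n_def by simp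
  define I where "I = closed_segment \<rho> (y $ k)"
  have I: "convex I" "\<rho> \<in> I" "y $ k \<in> I" unfolding I_def by auto
  have tI: "\<bar>t - y $ k\<bar> \<le> n" if "t \<in> I" for t
   using that dk unfolding I_def closed_segment_eq_real_ivl by (auto split: if_splits)
  have cdist: "norm (c t - y0) \<le> 2 * n" if "t \<in> I" for t
  proof -
   have "norm (c t - y0) \<le> norm (y - y0) + norm ((t - y $ k) *\<^sub>R axis k (1::real))"
    unfolding c_def using norm_triangle_ineq[of "y - y0" "(t - y $ k) *\<^sub>R axis k 1"] by (simp add: algebra_simps)
   also have "\<dots> \<le> 2 * n" using tI[OF that] unfolding n_def by simp
   finally show ?thesis .
  qed
  have cB: "c t \<in> B" if "t \<in> I" for t using cdist[OF that] n d b(2) by (auto simp: subset_iff dist_norm norm_minus_commute)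
  have cY: "norm (Y (c t) - h1 y0) \<le> K * (2 * n)" if "t \<in> I" for t
  proof -
   have "norm (Y (c t) - Y y0) \<le> K * norm (c t - y0)" using lipschitz_onD[OF KY cB[OF that] y0(1)] by (simp add: dist_norm)
   also have "\<dots> \<le> K * (2 * n)" by (rule mult_left_mono[OF cdist[OF that] K])
   finally show ?thesis unfolding Yy0 .
  qed
  have dc: "((\<lambda>t. Y (c t)) has_vector_derivative nrm (Y (c t))) (at t)" if "t \<in> I" for t
  proof -
   have "((\<lambda>u. u - t) has_vector_derivative 1) (at t)" by (auto intro!: derivative_eq_intros)
   moreover have "((\<lambda>u. Y (c t + u *\<^sub>R axis k 1)) has_vector_derivative nrm (Y (c t))) (at (t - t))"
    using Y_radial[OF cB[OF that]] by simp
   ultimately have "((\<lambda>u. Y (c t + (u - t) *\<^sub>R axis k 1)) has_vector_derivative 1 *\<^sub>R nrm (Y (c t))) (at t)"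
    using vector_diff_chain_at[of "\<lambda>u. u - t" 1 t "\<lambda>u. Y (c t + u *\<^sub>R axis k 1)"] by (simp add: comp_def)
   moreover have "c t + (u - t) *\<^sub>R axis k 1 = c u" for u unfolding c_def by (simp add: algebra_simps)
   ultimately show ?thesis by simp
  qed
  have "norm ((Y (c (y $ k)) - (y $ k) *\<^sub>R nrm (h1 y0)) - (Y (c \<rho>) - \<rho> *\<^sub>R nrm (h1 y0))) \<le> Cn * (K * (2 * n)) * \<bar>y $ k - \<rho>\<bar>"
  proof (rule vector_derivative_bound[OF I(1) _ _ I(2,3)])
   fix t assume t: "t \<in> I"
   have "((\<lambda>t. Y (c t) - t *\<^sub>R nrm (h1 y0)) has_vector_derivative (nrm (Y (c t)) - 1 *\<^sub>R nrm (h1 y0))) (at t)"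
    by (intro has_vector_derivative_diff dc[OF t]) (auto intro!: derivative_eq_intros)
   thus "((\<lambda>t. Y (c t) - t *\<^sub>R nrm (h1 y0)) has_vector_derivative (nrm (Y (c t)) - nrm (h1 y0))) (at t within I)"
    using has_vector_derivative_at_within by fastforce
   have "K * (2 * n) < e"
   proof -
    have "K * (2 * n) \<le> K * (2 * d)" using n K by (intro mult_left_mono) auto
    also have "\<dots> \<le> (2 * K + 1) * d" using d(1) by (simp add: algebra_simps)
    also have "\<dots> < (2 * K + 1) * (2 * d)" using d(1) K by (intro mult_strict_left_mono) auto
    also have "\<dots> \<le> e" using d(3) \<open>0 < 2 * K + 1\<close> by (simp add: pos_le_divide_eq mult.commute)
    finally show ?thesis .
   qed
   hence "Y (c t) \<in> ball (h1 y0) e \<inter> P" using cY[OF t] Y_in_P[OF cB[OF t]] by (simp add: dist_norm norm_minus_commute)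
   moreover have "h1 y0 \<in> ball (h1 y0) e \<inter> P" using e(1) h1(2)[OF y0V] by simp
   ultimately have "norm (nrm (Y (c t)) - nrm (h1 y0)) \<le> Cn * norm (Y (c t) - h1 y0)" using lipschitz_onD[OF e(2)] by (simp add: dist_norm)
   also have "\<dots> \<le> Cn * (K * (2 * n))" by (rule mult_left_mono[OF cY[OF t] Cn])
   finally show "norm (nrm (Y (c t)) - nrm (h1 y0)) \<le> Cn * (K * (2 * n))" .
  qed
  also have "\<dots> \<le> Cn * (K * (2 * n)) * n" using dk Cn K n by (intro mult_left_mono) auto
  finally have *: "norm ((Y (c (y $ k)) - (y $ k) *\<^sub>R nrm (h1 y0)) - (Y (c \<rho>) - \<rho> *\<^sub>R nrm (h1 y0))) \<le> Cn * (K * (2 * n)) * n" .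
  have c1: "c (y $ k) = y" unfolding c_def by simp
  have c2: "c \<rho> = setk y" unfolding c_def by (simp add: vec_eq_iff setk_nth axis_def)
  have "Y (c \<rho>) = h1 (setk y)" using Y_level[OF cB[OF I(2)] ck] c2 by simp
  hence "E y = (Y (c (y $ k)) - (y $ k) *\<^sub>R nrm (h1 y0)) - (Y (c \<rho>) - \<rho> *\<^sub>R nrm (h1 y0))"
   unfolding E_def c1 by (simp add: algebra_simps)
  moreover have "E y0 = 0" unfolding E_def Yy0 sy0 y0(2) by simp
  ultimately show ?thesis using * unfolding n_def[symmetric] by (simp add: power2_eq_square mult_ac)
 qed
 have dE: "(E has_derivative (\<lambda>u. 0)) (at y0)"
  by (rule quadratic_remainder_imp_has_derivative[OF bounded_linear_zero open_ball _ est]) (use d(1) in \<open>simp_all only: centre_in_ball\<close>)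
 have dh: "((\<lambda>y. h1 (setk y)) has_derivative (\<lambda>u. frechet_derivative h1 (at y0) (drop_coord k u))) (at y0)"
  using has_derivative_compose[of setk "drop_coord k" y0 UNIV h1 "frechet_derivative h1 (at y0)"]
   setk_derivative Ck1_on_1_has_derivative[OF chart(5) y0V] sy0 by simp
 have dn: "((\<lambda>y. (y $ k - \<rho>) *\<^sub>R nrm (h1 y0)) has_derivative (\<lambda>u. u $ k *\<^sub>R nrm (h1 y0))) (at y0)"
 proof -
  have "((\<lambda>y::real^'n. y $ k - \<rho>) has_derivative (\<lambda>u. u $ k - 0)) (at y0)"
   by (intro has_derivative_diff has_derivative_const bounded_linear_imp_has_derivative bounded_linear_vec_nth)
  thus ?thesis using has_derivative_scaleR_left[of "\<lambda>y. y $ k - \<rho>" "\<lambda>u. u $ k" "at y0" "nrm (h1 y0)"] by simp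
 qed
 have "((\<lambda>y. E y + (h1 (setk y) + (y $ k - \<rho>) *\<^sub>R nrm (h1 y0))) has_derivative
  (\<lambda>u. 0 + (frechet_derivative h1 (at y0) (drop_coord k u) + u $ k *\<^sub>R nrm (h1 y0)))) (at y0)"
  by (intro has_derivative_add dE dh dn)
 thus ?thesis unfolding E_def by simp
qed

end

context geodesic_ball
begin

text \<open>The radial geodesic through \<open>x\<close> meets the level set at \<open>ex (\<rho> w)\<close>. Coordinates of the level set near that point, small enough for
all estimates, carry the tube.\<close>

lemma tube_exists: assumes R: "ball 0 R \<subseteq> N" and \<rho>: "0 < \<rho>" "\<rho> < R" and x: "x \<in> P"
 obtains j s \<epsilon> L1 y1 U1 V1 h1 where
  "radial_tube (snd c p) \<delta> N ex lg Z (g c \<circ> chart_inv c) Le k j \<rho> s \<epsilon> L1 y1 U1 V1 h1"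
  "rad x < s" "rad x *\<^sub>R ((1 / \<rho>) *\<^sub>R lg (h1 y1)) = lg x"
  "\<forall>i l. \<exists>L. L-lipschitz_on (ball y1 \<epsilon>) (\<lambda>z. frechet_derivative h1 (at z) (axis i 1) \<bullet>
   ((g c \<circ> chart_inv c) (h1 z) *v frechet_derivative h1 (at z) (axis l 1)))"
proof -
 define w where "w = (1 / rad x) *\<^sub>R lg x"
 have rx: "0 < rad x" by (rule rad_pos[OF x])
 have w1: "norm w = 1" unfolding w_def using rx by (simp add: rad_def)
 have xw: "rad x *\<^sub>R w = lg x" unfolding w_def using rx by simp
 have \<rho>N: "\<rho> *\<^sub>R w \<in> N" using R \<rho> w1 by auto
 define x1 where "x1 = ex (\<rho> *\<^sub>R w)"
 have "\<rho> *\<^sub>R w \<noteq> 0" using \<rho> w1 by auto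
 hence x1P: "x1 \<in> P" unfolding x1_def by (rule ex_in_P[OF \<rho>N])
 obtain j U1 V1 h1 where U1: "open U1" "x1 \<in> U1" "U1 \<subseteq> P" "open V1" "homeomorphism U1 V1 (rcoord k j 0) h1"
  "Ck1_on 1 U1 (rcoord k j 0)" "Ck1_on 1 V1 h1" using rcoord_chart[OF x1P, where k = k and \<kappa> = 0] .
 define y1 where "y1 = rcoord k j 0 x1"
 have y1: "y1 \<in> V1" "h1 y1 = x1" using U1(2,5) unfolding y1_def homeomorphism_def by auto
 have y1k: "y1 $ k = \<rho>" unfolding y1_def x1_def using rad_ex[OF \<rho>N] w1 \<rho> by (simp add: rcoord_def)
 have lgx1: "lg (h1 y1) = \<rho> *\<^sub>R w" unfolding y1(2) x1_def by (rule lg(4)[OF \<rho>N])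
 have hP: "h1 z \<in> P" "h1 z \<in> ball (snd c p) \<delta>" if "z \<in> V1" for z
  using U1(3,5) P_sub that unfolding homeomorphism_def by blast+
 define m where "m = max \<rho> (rad x)"
 have mN: "m *\<^sub>R w \<in> N" unfolding m_def max_def using \<rho>N xw lg(1)[of x] x P_sub by auto
 obtain e where e: "0 < e" "ball (m *\<^sub>R w) e \<subseteq> N" using openE[OF N_open mN] by blast
 define s where "s = m + e / 2"
 have s: "\<rho> < s" "rad x < s" unfolding s_def m_def using e(1) by auto
 have sN: "s *\<^sub>R w \<in> N" by (rule subsetD[OF e(2)]) (use e(1) w1 in \<open>simp add: s_def dist_norm algebra_simps\<close>)
 have h_lip: "locally_lipschitz_on V1 h1" by (rule Ck1_on_1_imp_0[OF U1(4,7)])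
 have dl: "locally_lipschitz_on V1 (\<lambda>z. (1 / \<rho>) *\<^sub>R lg (h1 z))"
  by (intro loclip_scaleR loclip_const loclip_compose[OF h_lip lg_lip])
   (use hP in blast)
 then obtain e1 L1 where e1: "0 < e1" "L1-lipschitz_on (ball y1 e1 \<inter> V1) (\<lambda>z. (1 / \<rho>) *\<^sub>R lg (h1 z))"
  using y1(1) unfolding locally_lipschitz_on_def by blast
 have "continuous_on V1 (\<lambda>z. s *\<^sub>R ((1 / \<rho>) *\<^sub>R lg (h1 z)))"
  by (rule continuous_on_scaleR[OF continuous_on_const loclip_continuous[OF dl]])
 hence "open (V1 \<inter> (\<lambda>z. s *\<^sub>R ((1 / \<rho>) *\<^sub>R lg (h1 z))) -` N)" by (rule continuous_open_preimage[OF _ U1(4) N_open])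
 moreover have "y1 \<in> V1 \<inter> (\<lambda>z. s *\<^sub>R ((1 / \<rho>) *\<^sub>R lg (h1 z))) -` N" using y1(1) sN \<rho> lgx1 by simp
 ultimately obtain e2 where e2: "0 < e2" "ball y1 e2 \<subseteq> V1 \<inter> (\<lambda>z. s *\<^sub>R ((1 / \<rho>) *\<^sub>R lg (h1 z))) -` N"
  using openE by blast
 define H where "H i l z = frechet_derivative h1 (at z) (axis i 1) \<bullet>
   ((g c \<circ> chart_inv c) (h1 z) *v frechet_derivative h1 (at z) (axis l 1))" for i l z
 have H: "locally_lipschitz_on V1 (H i l)" for i l unfolding H_def by (intro loclip_inner loclip_bilinear[OF bounded_bilinear_matrix_vector_mult]
    Ck1_on_1_derivative_lipschitz[OF U1(7)] loclip_const
    loclip_compose[OF h_lip M_lip]) (use hP in blast)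
 obtain e3 where e3: "0 < e3" "\<forall>i\<in>UNIV. \<exists>L. L-lipschitz_on (ball y1 e3 \<inter> V1) (case i of (i, l) => H i l)"
  using loclip_finite[of "UNIV :: ('n \<times> 'n) set" V1 "\<lambda>i. case i of (i, l) => H i l" y1] H y1(1) by auto
 define \<epsilon> where "\<epsilon> = min e1 (min e2 e3)"
 have \<epsilon>: "0 < \<epsilon>" unfolding \<epsilon>_def using e1 e2 e3 by simp
 have sub2: "ball y1 \<epsilon> \<subseteq> V1 \<inter> (\<lambda>z. s *\<^sub>R ((1 / \<rho>) *\<^sub>R lg (h1 z))) -` N"
  by (rule order_trans[OF _ e2(2)]) (simp add: \<epsilon>_def subset_ball)
 have sub: "ball y1 \<epsilon> \<subseteq> ball y1 e1 \<inter> V1" "ball y1 \<epsilon> \<subseteq> ball y1 e3 \<inter> V1"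
  using sub2 by (auto simp: \<epsilon>_def)
 show thesis
 proof (rule that)
  show "radial_tube (snd c p) \<delta> N ex lg Z (g c \<circ> chart_inv c) Le k j \<rho> s \<epsilon> L1 y1 U1 V1 h1"
   by (rule radial_tube.intro[OF radial_ball_axioms], rule radial_tube_axioms.intro)
    (use \<rho>(1) s(1) y1k \<epsilon> sub2 U1 lipschitz_on_subset[OF e1(2) sub(1)] in \<open>simp_all add: subset_iff\<close>)
  show "rad x < s" by (rule s(2))
  show "rad x *\<^sub>R ((1 / \<rho>) *\<^sub>R lg (h1 y1)) = lg x" unfolding lgx1 using \<rho>(1) xw by simp
  show "\<forall>i l. \<exists>L. L-lipschitz_on (ball y1 \<epsilon>) (\<lambda>z. frechet_derivative h1 (at z) (axis i 1) \<bullet>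
   ((g c \<circ> chart_inv c) (h1 z) *v frechet_derivative h1 (at z) (axis l 1)))" unfolding H_def[symmetric]
  proof (intro allI)
   fix i l
   obtain L where "L-lipschitz_on (ball y1 e3 \<inter> V1) (H i l)" using e3(2) by force
   hence "L-lipschitz_on (ball y1 \<epsilon>) (H i l)" by (rule lipschitz_on_subset[OF _ sub(2)])
   thus "\<exists>L. L-lipschitz_on (ball y1 \<epsilon>) (H i l)" ..
  qed
 qed
qed

text \<open>On the level set \<open>r = \<rho>\<close> the new coordinates are those of the original chart with one of them omitted, so they are \<open>C\<^sup>1\<^sup>,\<^sup>1\<close> there; the
differentiability of the inverse chart at its points is \<open>Y_differentiable_on_level\<close>.\<close>

theorem tube_charts: assumes R: "ball 0 R \<subseteq> N" and \<rho>: "0 < \<rho>" "\<rho> < R" and q: "q \<in> C - {p}"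
 shows "\<exists>W \<alpha>. open W \<and> connected W \<and> q \<in> W \<and> W \<subseteq> C - {p} \<and> W \<inter> level \<rho> \<noteq> {} \<and>
  (let \<psi> = radial_chart k W r \<alpha>
  in Ck1_chart 0 \<A> \<psi> \<and>
    C11_hypersurface_chart \<A> k (level \<rho>) (W \<inter> level \<rho>, \<lambda>z. drop_coord k (\<alpha> z)) \<and>
    ae_direct_sum_form g c k \<psi> \<and>
    (\<forall>y\<in>chart_image \<psi>. y $ k = \<rho> \<longrightarrow> components_defined_at c \<psi> y) \<and>
    (\<forall>i j. i \<noteq> k \<and> j \<noteq> k \<longrightarrow>
    (\<exists>L. L-lipschitz_on {y \<in> chart_image \<psi>. y $ k = \<rho>} (metric_component g c \<psi> i j))))"
proof -
 note ic = atlas_chart[OF c]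
 have xP: "snd c q \<in> P" using q punctured by blast
 obtain j s \<epsilon> L1 y1 U1 V1 h1 where
  tube: "radial_tube (snd c p) \<delta> N ex lg Z (g c \<circ> chart_inv c) Le k j \<rho> s \<epsilon> L1 y1 U1 V1 h1"
  and rs: "rad (snd c q) < s" and qdir: "rad (snd c q) *\<^sub>R ((1 / \<rho>) *\<^sub>R lg (h1 y1)) = lg (snd c q)"
  and H: "\<forall>i l. \<exists>L. L-lipschitz_on (ball y1 \<epsilon>) (\<lambda>z. frechet_derivative h1 (at z) (axis i 1) \<bullet>
   ((g c \<circ> chart_inv c) (h1 z) *v frechet_derivative h1 (at z) (axis l 1)))" using tube_exists[OF R \<rho> xP, where k = k] .
 interpret tube: radial_tube "snd c p" \<delta> N ex lg Z "g c \<circ> chart_inv c" Le k j \<rho> s \<epsilon> L1 y1 U1 V1 h1 by (rule tube)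
 let ?B = tube.B and ?Y = tube.Y and ?T = tube.T and ?setk = tube.setk
 let ?U = "?Y ` ?B"
 define W where "W = chart_inv c ` ?U"
 define \<alpha> where "\<alpha> z = ?T (snd c z)" for z
 define \<psi> where "\<psi> = radial_chart k W r \<alpha>"
 have UP: "?U \<subseteq> P" using tube.Y_in_P by blast
 have Uc: "?U \<subseteq> chart_image c" using UP P_sub by blast
 have inP: "snd c (chart_inv c x) = x" "chart_inv c x \<in> C - {p}" "chart_inv c x \<in> fst c" if "x \<in> P" for x
 proof -
  show a: "snd c (chart_inv c x) = x" "chart_inv c x \<in> fst c" using coords(2,3)[of x] P_sub that C_iff by auto
  show "chart_inv c x \<in> C - {p}" unfolding punctured a(1) using a(2) that by blast
 qed
 have W: "\<exists>y\<in>?B. z = chart_inv c (?Y y) \<and> snd c z = ?Y y" if "z \<in> W" for z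
 proof -
  obtain y where y: "y \<in> ?B" "z = chart_inv c (?Y y)" using \<open>z \<in> W\<close> unfolding W_def by blast
  thus ?thesis using inP(1)[OF tube.Y_in_P[OF y(1)]] by blast
 qed
 have WC: "W \<subseteq> C - {p}" unfolding W_def using inP(2) UP by blast
 have dom: "fst \<psi> = chart_inv c ` ?U" unfolding \<psi>_def radial_chart_def W_def by simp
 have val: "snd \<psi> z = ?T (snd c z)" if "z \<in> fst \<psi>" for z
 proof -
  have "z \<in> C" using that WC unfolding dom W_def by blast
  thus ?thesis unfolding \<psi>_def radial_chart_def \<alpha>_def tube.T_def by (simp add: r_eq vec_eq_iff)
 qed
 have Tl: "Ck1_on 0 ?U ?T" and Yl: "Ck1_on 0 ?B ?Y" using tube.T_lipschitz lipschitz_on_imp_locally[OF tube.Y_lipschitz] by simp_all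
 have ch: "Ck1_chart 0 \<A> \<psi>" "chart_image \<psi> = ?B" "\<And>y. y \<in> ?B ==> chart_inv \<psi> y = chart_inv c (?Y y)"
  by (rule chart_from_coordinates[OF c zero_le_one tube.Y_homeomorphism(1) Uc tube.B_open tube.Y_homeomorphism(2) Tl Yl dom val], assumption+)+
 have opW: "open W" using ch(1) dom unfolding Ck1_chart_def is_chart_def W_def by simp
 have "connected W"
 proof -
  have "continuous_on ?B ?Y" by (rule lipschitz_on_continuous_on[OF tube.Y_lipschitz])
  hence "connected ?U" by (rule connected_continuous_image[OF _ convex_connected[OF tube.B_convex]])
  thus ?thesis unfolding W_def by (rule connected_continuous_image[OF continuous_on_subset[OF chart_continuous(2)[OF ic] Uc]])
 qed
 have y1B: "y1 \<in> ?B" using tube.setk_in_B[of y1] tube.setk_fixed[OF tube.y1] tube.\<epsilon> by simp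
 have "q \<in> W"
 proof -
  define y where "y = y1 + (rad (snd c q) - \<rho>) *\<^sub>R axis k 1"
  have yk: "y $ k = rad (snd c q)" unfolding y_def using tube.y1 by (simp add: axis_def)
  have sy: "?setk y = y1" unfolding y_def tube.setk_line by (rule tube.setk_fixed[OF tube.y1])
  have "y \<in> ?B" using rad_pos[OF xP] rs tube.\<epsilon>(1) by (simp add: tube.B_def yk sy)
  moreover have "?Y y = snd c q"
  proof -
   have "?Y y = ex (lg (snd c q))" unfolding tube.Y_def yk sy tube.dir_def qdir ..
   also have "\<dots> = snd c q" using xP P_sub by (intro lg(2)) blast
   finally show ?thesis .
  qed
  moreover have "chart_inv c (snd c q) = q" using coords(1) q by blast
  ultimately show ?thesis unfolding W_def by (metis imageI)
 qed
 have lev: "chart_inv c (?Y y) \<in> level \<rho> \<longleftrightarrow> y $ k = \<rho>" if y: "y \<in> ?B" for y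
  unfolding level_iff using inP(1,2)[OF tube.Y_in_P[OF y]] tube.rad_Y[OF y] by simp
 have WL: "\<exists>y\<in>?B. y $ k = \<rho> \<and> z = chart_inv c (h1 y) \<and> snd c z = h1 y \<and> ?T (snd c z) = y" if z: "z \<in> W \<inter> level \<rho>" for z
 proof -
  obtain y where y: "y \<in> ?B" "z = chart_inv c (?Y y)" "snd c z = ?Y y" using W z by blast
  hence "y $ k = \<rho>" using lev[OF y(1)] z by simp
  thus ?thesis using y tube.Y_level[OF y(1)] tube.T_Y[OF y(1)] by metis
 qed
 have h1W: "chart_inv c (h1 z) \<in> W \<inter> level \<rho>" "snd c (chart_inv c (h1 z)) = h1 z" "?T (h1 z) = z"
  if "z \<in> ball y1 \<epsilon>" "z $ k = \<rho>" for z
 proof -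
  have z: "z \<in> ?B" using tube.setk_in_B[of z] tube.setk_fixed[OF that(2)] that(1) by simp
  have Yz: "?Y z = h1 z" by (rule tube.Y_level[OF z that(2)])
  show "chart_inv c (h1 z) \<in> W \<inter> level \<rho>" using lev[OF z] that(2) z unfolding Yz[symmetric] W_def by blast
  show "snd c (chart_inv c (h1 z)) = h1 z" using inP(1)[OF tube.Y_in_P[OF z]] unfolding Yz .
  show "?T (h1 z) = z" using tube.T_Y[OF z] unfolding Yz .
 qed
 have Wlev: "W \<inter> level \<rho> \<noteq> {}" using h1W(1)[of y1] tube.\<epsilon>(1) tube.y1 by auto
 define a where "a = (W \<inter> level \<rho>, \<lambda>z. drop_coord k (\<alpha> z))"
 define A where "A = {y :: real^'n. y $ k = 0 \<and> ?setk y \<in> ball y1 \<epsilon>}"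
 define b where "b y = chart_inv c (h1 (?setk y))" for y
 have sk: "?setk y $ k = \<rho>" for y by (simp add: tube.setk_nth)
 have drop_setk: "drop_coord k (?setk y) = y" if "y $ k = 0" for y using that by (simp add: vec_eq_iff drop_coord_def tube.setk_nth)
 have dk: "drop_coord k y $ k = 0" for y :: "real^'n" by (simp add: drop_coord_def)
 have ab: "snd a (b y) = y" "b y \<in> fst a" if "y \<in> A" for y
  using h1W[of "?setk y"] sk drop_setk[of y] that unfolding a_def b_def \<alpha>_def A_def by auto
 have ba: "b (snd a z) = z" "snd a z \<in> A" if z: "z \<in> fst a" for z
 proof -
  obtain y where y: "y \<in> ?B" "y $ k = \<rho>" "z = chart_inv c (h1 y)" "?T (snd c z) = y" using WL[of z] z unfolding a_def fst_conv by blast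
  have s: "?setk (drop_coord k y) = y" unfolding tube.setk_drop by (rule tube.setk_fixed[OF y(2)])
  show "b (snd a z) = z" unfolding a_def \<alpha>_def b_def using y(3) s unfolding y(4)[symmetric] by simp
  show "snd a z \<in> A" unfolding a_def \<alpha>_def A_def using s dk tube.B_D(3)[OF y(1)] tube.setk_fixed[OF y(2)] y(4) by simp
 qed
 have imga: "chart_image a = A" using ab ba by (force simp: image_iff)
 have inva: "chart_inv a y = b y" if "y \<in> A" for y
 proof -
  have "inj_on (snd a) (fst a)" using ba(1) by (rule inj_on_inverseI)
  from inv_into_f_f[OF this ab(2)[OF that]] show ?thesis unfolding ab(1)[OF that] .
 qed
 have hA: "h1 (?setk y) \<in> chart_image c" if "y \<in> A" for y
  using tube.h1(2)[of "?setk y"] tube.\<epsilon>(2) P_sub(2) that unfolding A_def by blast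
 have contW: "continuous_on W (snd c)" by (rule continuous_on_subset[OF chart_continuous(1)[OF ic]]) (use WC C_iff in blast)
 have hom_a: "homeomorphism (fst a) (chart_image a) (snd a) (chart_inv a)" unfolding imga
 proof (rule homeomorphism_cong[of "fst a" A "snd a" b])
  show "homeomorphism (fst a) A (snd a) b"
  proof (rule homeomorphismI)
   have "continuous_on ?U ?T" using homeomorphism_cont1[OF tube.Y_homeomorphism(2)] .
   hence "continuous_on (W \<inter> level \<rho>) (\<lambda>z. ?T (snd c z))"
    by (rule continuous_on_compose2[OF _ continuous_on_subset[OF contW]]) (use W in auto)
   hence "continuous_on (W \<inter> level \<rho>) (\<lambda>z. drop_coord k (?T (snd c z)))"
    by (rule bounded_linear.continuous_on[OF drop_coord_bounded_linear])
   thus "continuous_on (fst a) (snd a)" unfolding a_def \<alpha>_def by simp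
   have "continuous_on A (\<lambda>y. h1 (?setk y))"
    by (rule continuous_on_compose2[OF homeomorphism_cont2[OF tube.chart(4)] tube.setk_continuous])
    (use tube.\<epsilon>(2) in \<open>auto simp: A_def\<close>)
   thus "continuous_on A b" unfolding b_def by (rule continuous_on_compose2[OF chart_continuous(2)[OF ic]])
    (use hA in blast)
  qed (use ab ba in auto)
 qed (use inva in auto)
 have hyp: "C11_hypersurface_chart \<A> k (level \<rho>) a" unfolding C11_hypersurface_chart_def
 proof (intro conjI hom_a allI impI)
  show "openin (top_of_set (level \<rho>)) (fst a)" unfolding a_def using openin_open_Int[OF opW, of "level \<rho>"] by (simp add: Int_commute)
  have "open (?setk -` ball y1 \<epsilon>)" using tube.setk_continuous[of UNIV] by (intro open_vimage) auto
  from openin_open_Int[OF this] have "openin (top_of_set {y. y $ k = 0}) ({y. y $ k = 0} \<inter> ?setk -` ball y1 \<epsilon>)" .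
  moreover have "A = {y. y $ k = 0} \<inter> ?setk -` ball y1 \<epsilon>" unfolding A_def by blast
  ultimately show "openin (top_of_set {y. y $ k = 0}) (chart_image a)" unfolding imga by simp
 next
  fix \<chi>' assume \<chi>': "slice_chart \<A> k (level \<rho>) \<chi>'"
  have ch': "Ck1_chart 1 \<A> \<chi>'" and lev': "\<And>q. q \<in> fst \<chi>' ==> q \<in> level \<rho> \<longleftrightarrow> snd \<chi>' q $ k = 0"
   using \<chi>' unfolding slice_chart_def by auto
  note D = C11_chartD[OF ch' c]
  note i' = chart_inv_left[OF D(1)] chart_inv_right[OF D(1)] chart_inv_in[OF D(1)]
  let ?O = "snd \<chi>' ` (fst \<chi>' \<inter> fst c)" and ?c = "snd c \<circ> chart_inv \<chi>'"
  define S where "S = ?O \<inter> ?c -` ?U"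
  have S: "open S" unfolding S_def by (rule Ck1_on_1_preimage_open[OF D(2,3) tube.Y_homeomorphism(1)])
  have "Ck1_on 1 S ?c" by (rule Ck1_on_subset[OF D(3)]) (simp add: S_def)
  hence "Ck1_on 1 S (\<lambda>y. rest k j (?c y))" by (rule Ck1_on_bounded_linear_compose[OF S rest_bounded_linear])
  thus "Ck1_on_slice 1 k (snd \<chi>' ` (fst a \<inter> fst \<chi>')) (snd a \<circ> chart_inv \<chi>')"
  proof (rule Ck1_on_sliceI[OF order_refl S])
   fix y :: "real^'n" assume y: "y $ k = 0"
   show "y \<in> snd \<chi>' ` (fst a \<inter> fst \<chi>') \<longleftrightarrow> y \<in> S"
   proof
    assume "y \<in> snd \<chi>' ` (fst a \<inter> fst \<chi>')"
    then obtain z where z: "y = snd \<chi>' z" "z \<in> W" "z \<in> fst \<chi>'" unfolding a_def by auto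
    have zc: "z \<in> fst c" using z(2) WC C_iff by blast
    moreover have "snd c z \<in> ?U" using W[OF z(2)] by auto
    ultimately show "y \<in> S" unfolding S_def using z i'(1)[OF z(3)] by auto
   next
    assume yS: "y \<in> S"
    define z where "z = chart_inv \<chi>' y"
    have "y \<in> chart_image \<chi>'" using yS unfolding S_def by blast
    hence z: "z \<in> fst \<chi>'" "snd \<chi>' z = y" unfolding z_def using i'(2,3) by auto
    have zU: "snd c z \<in> ?U" using yS unfolding S_def z_def by simp
    have "z \<in> fst c" using yS z_def i'(1) unfolding S_def by auto
    hence "chart_inv c (snd c z) = z" by (rule chart_inv_left[OF ic])
    hence "z \<in> W" unfolding W_def using zU by (metis imageI)
    moreover have "z \<in> level \<rho>" using lev'[OF z(1)] z(2) y by simp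
    ultimately show "y \<in> snd \<chi>' ` (fst a \<inter> fst \<chi>')" unfolding a_def using z by auto
   qed
  next
   fix y :: "real^'n" assume "y \<in> snd \<chi>' ` (fst a \<inter> fst \<chi>')"
   then obtain z where z: "y = snd \<chi>' z" "z \<in> W \<inter> level \<rho>" "z \<in> fst \<chi>'" unfolding a_def by auto
   have iz: "chart_inv \<chi>' y = z" using z i'(1) by simp
   obtain u where u: "u \<in> ?B" "u $ k = \<rho>" "snd c z = h1 u" "?T (snd c z) = u" using WL[OF z(2)] by blast
   have uV: "u \<in> V1" using tube.B_D(4)[OF u(1)] tube.setk_fixed[OF u(2)] by simp
   have "rest k j (h1 u) $ i = drop_coord k u $ i" for i using arg_cong[OF tube.h1(3)[OF uV], of "\<lambda>v. v $ i"]
    by (cases "i = k") (simp_all add: rest_def drop_coord_def rcoord_def)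
   hence "rest k j (h1 u) = drop_coord k u" unfolding vec_eq_iff by blast
   thus "(snd a \<circ> chart_inv \<chi>') y = rest k j (?c y)" unfolding comp_apply iz a_def snd_conv \<alpha>_def using u(3,4) by simp
  qed
  have sC: "Ck1_on 1 UNIV ?setk" unfolding tube.setk_def[abs_def]
   using Ck1_on_1_add[OF Ck1_on_bounded_linear[OF drop_coord_bounded_linear, of 0 UNIV k, folded One_nat_def] Ck1_on_const] .
  define S1 where "S1 = UNIV \<inter> ?setk -` ball y1 \<epsilon>"
  have S1: "open S1" unfolding S1_def by (rule Ck1_on_1_preimage_open[OF open_UNIV sC open_ball])
  have hC: "Ck1_on 1 S1 (\<lambda>y. h1 (?setk y))"
   by (rule Ck1_on_1_compose[OF S1 Ck1_on_subset[OF sC] tube.chart(5)]) (use tube.\<epsilon>(2) in \<open>auto simp: S1_def\<close>)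
  define S' where "S' = S1 \<inter> (\<lambda>y. h1 (?setk y)) -` (snd c ` (fst c \<inter> fst \<chi>'))"
  have S': "open S'" unfolding S'_def by (rule Ck1_on_1_preimage_open[OF S1 hC D(4)])
  have "Ck1_on 1 S' (\<lambda>y. (snd \<chi>' \<circ> chart_inv c) (h1 (?setk y)))"
   by (rule Ck1_on_1_compose[OF S' Ck1_on_subset[OF hC] D(5)]) (auto simp: S'_def)
  thus "Ck1_on_slice 1 k (snd a ` (fst a \<inter> fst \<chi>')) (snd \<chi>' \<circ> chart_inv a)"
  proof (rule Ck1_on_sliceI[OF order_refl S'])
   fix y :: "real^'n" assume y: "y $ k = 0"
   show "y \<in> snd a ` (fst a \<inter> fst \<chi>') \<longleftrightarrow> y \<in> S'"
   proof
    assume "y \<in> snd a ` (fst a \<inter> fst \<chi>')"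
    then obtain z where z: "y = snd a z" "z \<in> fst a" "z \<in> fst \<chi>'" by blast
    have yA: "y \<in> A" and bz: "b y = z" using ba[OF z(2)] z(1) by auto
    have "h1 (?setk y) = snd c z" using h1W(2)[of "?setk y"] sk bz yA unfolding A_def b_def by auto
    moreover have "z \<in> fst c" using z(2) WC C_iff unfolding a_def by auto
    ultimately show "y \<in> S'" unfolding S'_def S1_def using yA z(3) unfolding A_def by auto
   next
    assume yS: "y \<in> S'"
    hence yA: "y \<in> A" unfolding S'_def S1_def A_def using y by simp
    obtain z where z: "z \<in> fst c" "z \<in> fst \<chi>'" "h1 (?setk y) = snd c z" using yS unfolding S'_def by auto
    have "b y = z" unfolding b_def z(3) by (rule chart_inv_left[OF ic z(1)])
    thus "y \<in> snd a ` (fst a \<inter> fst \<chi>')" using ab[OF yA] z(2) by (metis IntI imageI)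
   qed
  next
   fix y :: "real^'n" assume "y \<in> snd a ` (fst a \<inter> fst \<chi>')"
   hence "y \<in> A" using imga by blast
   thus "(snd \<chi>' \<circ> chart_inv a) y = (snd \<chi>' \<circ> chart_inv c) (h1 (?setk y))" using inva unfolding b_def by simp
  qed
 qed
 have ae: "\<And>y. y \<in> ?B ==> components_defined_at c \<psi> y \<longleftrightarrow> ?Y differentiable (at y)"
  "\<And>y L i l. y \<in> ?B ==> (?Y has_derivative L) (at y) ==>
   metric_component g c \<psi> i l y = L (axis i 1) \<bullet> ((g c \<circ> chart_inv c) (?Y y) *v L (axis l 1))"
  "ae_direct_sum_form g c k \<psi>"
  by (rule ae_direct_sum_formI[OF tube.B_open tube.Y_lipschitz tube.Y_in_P tube.rad_Y tube.Y_radial ch(2,3)], assumption+)+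
 have diff: "components_defined_at c \<psi> y" if "y \<in> ?B" "y $ k = \<rho>" for y
  unfolding ae(1)[OF that(1)] using tube.Y_differentiable_on_level[OF that] differentiableI by blast
 have comp: "metric_component g c \<psi> i l y = frechet_derivative h1 (at y) (axis i 1) \<bullet>
   ((g c \<circ> chart_inv c) (h1 y) *v frechet_derivative h1 (at y) (axis l 1))"
  if "y \<in> ?B" "y $ k = \<rho>" "i \<noteq> k" "l \<noteq> k" for y i l
 proof -
  have "drop_coord k (axis i 1) = axis i (1::real)" if "i \<noteq> k" for i using that by (simp add: drop_coord_def axis_def vec_eq_iff)
  thus ?thesis using ae(2)[OF that(1) tube.Y_differentiable_on_level[OF that(1,2)], of i l] tube.Y_level[OF that(1,2)] that(3,4)
   by (simp add: axis_def)
 qed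
 have lipc: "\<exists>L. L-lipschitz_on {y \<in> ?B. y $ k = \<rho>} (metric_component g c \<psi> i l)" if "i \<noteq> k" "l \<noteq> k" for i l
 proof -
  obtain L where L: "L-lipschitz_on (ball y1 \<epsilon>) (\<lambda>z. frechet_derivative h1 (at z) (axis i 1) \<bullet>
   ((g c \<circ> chart_inv c) (h1 z) *v frechet_derivative h1 (at z) (axis l 1)))" using H by blast
  have "{y \<in> ?B. y $ k = \<rho>} \<subseteq> ball y1 \<epsilon>" using tube.B_D(3) tube.setk_fixed by fastforce
  from lipschitz_on_subset[OF L this] have "L-lipschitz_on {y \<in> ?B. y $ k = \<rho>} (metric_component g c \<psi> i l)"
   by (rule lipschitz_on_transform) (use comp that in auto)
  thus ?thesis ..
 qed
 have fin: "Ck1_chart 0 \<A> \<psi> \<and> C11_hypersurface_chart \<A> k (level \<rho>) a \<and> ae_direct_sum_form g c k \<psi> \<and>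
    (\<forall>y\<in>chart_image \<psi>. y $ k = \<rho> \<longrightarrow> components_defined_at c \<psi> y) \<and>
    (\<forall>i j. i \<noteq> k \<and> j \<noteq> k \<longrightarrow>
    (\<exists>L. L-lipschitz_on {y \<in> chart_image \<psi>. y $ k = \<rho>} (metric_component g c \<psi> i j)))"
  unfolding ch(2) using ch(1) hyp ae(3) diff lipc by blast
 show ?thesis by (rule exI[of _ W], rule exI[of _ \<alpha>],
    rule conjI[OF opW conjI[OF \<open>connected W\<close> conjI[OF \<open>q \<in> W\<close> conjI[OF WC conjI[OF Wlev]]]]],
    unfold Let_def, rule fin[unfolded a_def \<psi>_def])
qed

end

section \<open>Spherical coordinates\<close>

lemma loclip_arccos: "locally_lipschitz_on {-1<..<1} arccos"
proof (rule real_C1_imp_locally_lipschitz_on)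
 show "(arccos has_real_derivative inverse (- sqrt (1 - x\<^sup>2))) (at x)" if "x \<in> {-1<..<1}" for x using that by (intro DERIV_arccos) auto
 have "x\<^sup>2 \<noteq> 1" if "x \<in> {-1<..<1}" for x :: real using that by (simp add: power2_eq_1_iff)
 thus "continuous_on {-1<..<1} (\<lambda>x::real. inverse (- sqrt (1 - x\<^sup>2)))" by (intro continuous_intros) auto
qed simp

lemma angle_from_half_angle: assumes \<phi>: "0 < \<phi>" "\<phi> < 2 * pi" and Q: "0 < Q"
 shows "pi - 2 * arctan (Q * sin \<phi> / (Q - Q * cos \<phi>)) = \<phi>" and "cos \<phi> < 1"
proof -
 define a where "a = \<phi> / 2"
 have a: "0 < a" "a < pi" "\<phi> = 2 * a" unfolding a_def using \<phi> by auto
 have s: "0 < sin a" by (rule sin_gt_zero[OF a(1,2)])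
 have c: "1 - cos \<phi> = 2 * (sin a)\<^sup>2" unfolding a(3) by (simp add: cos_double_sin)
 thus "cos \<phi> < 1" using s by (smt (verit) zero_less_power)
 have "Q - Q * cos \<phi> = Q * (1 - cos \<phi>)" by (simp add: right_diff_distrib)
 hence "Q * sin \<phi> / (Q - Q * cos \<phi>) = sin \<phi> / (1 - cos \<phi>)" using Q by simp
 also have "\<dots> = cos a / sin a" unfolding c unfolding a(3) sin_double using s by (simp add: power2_eq_square)
 also have "\<dots> = tan (pi / 2 - a)" unfolding tan_cot' cot_def ..
 finally have "arctan (Q * sin \<phi> / (Q - Q * cos \<phi>)) = pi / 2 - a" using a(1,2) by (simp add: arctan_tan)
 thus "pi - 2 * arctan (Q * sin \<phi> / (Q - Q * cos \<phi>)) = \<phi>" using a(3) by simp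
qed

text \<open>Closed under products; this gives the Lipschitz property of products of sines and cosines.\<close>

definition unit_lipschitz_on :: "'a::metric_space set => ('a => real) => bool" where
 "unit_lipschitz_on S f \<longleftrightarrow> (\<forall>x\<in>S. \<bar>f x\<bar> \<le> 1) \<and> (\<exists>L. L-lipschitz_on S f)"

lemma unit_lipschitz_on_mult: assumes "unit_lipschitz_on S f" "unit_lipschitz_on S g" shows "unit_lipschitz_on S (\<lambda>x. f x * g x)"
proof -
 have f: "\<And>x. x \<in> S ==> \<bar>f x\<bar> \<le> 1" and g: "\<And>x. x \<in> S ==> \<bar>g x\<bar> \<le> 1"
  using assms unfolding unit_lipschitz_on_def by auto
 obtain K L where K: "K-lipschitz_on S f" and L: "L-lipschitz_on S g" using assms unfolding unit_lipschitz_on_def by auto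
 have "(L + K)-lipschitz_on S (\<lambda>x. f x * g x)"
 proof (rule lipschitz_onI)
  fix x y assume x: "x \<in> S" and y: "y \<in> S"
  have 1: "\<bar>g x - g y\<bar> \<le> L * dist x y" "\<bar>f x - f y\<bar> \<le> K * dist x y"
   using lipschitz_onD[OF L x y] lipschitz_onD[OF K x y] by (simp_all add: dist_real_def)
  have "f x * g x - f y * g y = f x * (g x - g y) + (f x - f y) * g y" by (simp add: algebra_simps)
  hence "\<bar>f x * g x - f y * g y\<bar> \<le> \<bar>f x\<bar> * \<bar>g x - g y\<bar> + \<bar>f x - f y\<bar> * \<bar>g y\<bar>"
   by (metis abs_triangle_ineq abs_mult)
  also have "\<dots> \<le> 1 * \<bar>g x - g y\<bar> + \<bar>f x - f y\<bar> * 1"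
   using f[OF x] g[OF y] by (intro add_mono mult_right_mono mult_left_mono) auto
  finally show "dist (f x * g x) (f y * g y) \<le> (L + K) * dist x y" using 1 by (simp add: dist_real_def algebra_simps)
 qed (use lipschitz_on_nonneg[OF K] lipschitz_on_nonneg[OF L] in auto)
 moreover have "\<bar>f x * g x\<bar> \<le> 1" if "x \<in> S" for x unfolding abs_mult using f[OF that] g[OF that] by (intro mult_le_one) auto
 ultimately show ?thesis unfolding unit_lipschitz_on_def by blast
qed

lemma unit_lipschitz_on_one: "unit_lipschitz_on S (\<lambda>x. 1)" unfolding unit_lipschitz_on_def using lipschitz_on_constant by auto

lemma unit_lipschitz_on_prod:
 "(\<And>i. i \<in> I ==> unit_lipschitz_on S (f i)) ==> unit_lipschitz_on S (\<lambda>x. \<Prod>i\<in>I. f i x)"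
 by (induction I rule: infinite_finite_induct) (simp_all add: unit_lipschitz_on_one unit_lipschitz_on_mult)

lemma unit_lipschitz_on_trig:
 fixes S :: "(real^'n) set" shows "unit_lipschitz_on S (\<lambda>y. sin (y $ i))" "unit_lipschitz_on S (\<lambda>y. cos (y $ i))"
proof -
 have d: "\<bar>sin a - sin b\<bar> \<le> \<bar>a - b\<bar>" "\<bar>cos a - cos b\<bar> \<le> \<bar>a - b\<bar>" for a b :: real
  using vector_derivative_bound[of UNIV sin cos 1 b a] vector_derivative_bound[of UNIV cos "\<lambda>x. - sin x" 1 b a]
  by (auto simp: has_real_derivative_iff_has_vector_derivative[symmetric] intro!: derivative_eq_intros)
 have n: "\<bar>x $ i - y $ i\<bar> \<le> dist x y" for x y :: "real^'n" using component_le_norm_cart[of "x - y" i] by (simp add: dist_norm)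
 have "1-lipschitz_on S (\<lambda>y. sin (y $ i))" "1-lipschitz_on S (\<lambda>y. cos (y $ i))"
  by (rule lipschitz_onI; use d n order_trans in \<open>fastforce simp: dist_real_def\<close>)+
 thus "unit_lipschitz_on S (\<lambda>y. sin (y $ i))" "unit_lipschitz_on S (\<lambda>y. cos (y $ i))" unfolding unit_lipschitz_on_def by auto
qed

locale index_enumeration =
 fixes e :: "nat => 'n::finite" assumes e: "bij_betw e {..<CARD('n)} UNIV"
begin

lemma e_inj: "i < CARD('n) ==> j < CARD('n) ==> e i = e j \<longleftrightarrow> i = j" using e unfolding bij_betw_def inj_on_def by auto

lemma e_surj: obtains j where "j < CARD('n)" "i = e j" using e unfolding bij_betw_def by (metis UNIV_I imageE lessThan_iff)

lemma spherical_nth: assumes "j < CARD('n)" shows "spherical_point e y $ e j =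
  y $ e 0 * (\<Prod>l\<in>{1..j}. sin (y $ e l)) * (if Suc j < CARD('n) then cos (y $ e (Suc j)) else 1)"
proof -
 have "spherical_point e y $ e j = (\<Sum>i<CARD('n). if i = j then
  y $ e 0 * (\<Prod>l\<in>{1..i}. sin (y $ e l)) * (if Suc i < CARD('n) then cos (y $ e (Suc i)) else 1) else 0)"
  unfolding spherical_point_def sum_component by (rule sum.cong) (use e_inj assms in \<open>auto simp: axis_def\<close>)
 thus ?thesis using assms by simp
qed

definition tail :: "nat => real^'n => real" where
 "tail j v = sqrt (\<Sum>l\<in>{j..<CARD('n)}. (v $ e l)\<^sup>2)"

text \<open>The inverse of spherical coordinates: \<open>tail j v\<close> is \<open>\<rho> sin \<phi>\<^sub>1 \<dots> sin \<phi>\<^sub>j\<close>, so \<open>cos \<phi>\<^sub>j\<close> is a quotient. The last angle ranges over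
\<open>(0, 2 \<pi>)\<close>, and the half-angle formula \<open>cot (\<phi> / 2) = sin \<phi> / (1 - cos \<phi>)\<close> gives it without a case distinction.\<close>

definition angle :: "nat => real^'n => real" where
 "angle j v = (if j = 0 then tail 0 v
  else if Suc j < CARD('n) then arccos (v $ e (j - 1) / tail (j - 1) v)
  else pi - 2 * arctan (v $ e j / (tail (j - 1) v - v $ e (j - 1))))"

definition spherical_coords :: "real^'n => real^'n" where
 "spherical_coords v = (\<chi> i. angle (inv_into {..<CARD('n)} e i) v)"

lemma norm_eq_tail: "norm v = tail 0 v"
proof -
 have "(\<Sum>i\<in>UNIV. (v $ i)\<^sup>2) = (\<Sum>l<CARD('n). (v $ e l)\<^sup>2)"
  using sum.reindex_bij_betw[OF e, of "\<lambda>i. (v $ i)\<^sup>2"] by simp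
 thus ?thesis unfolding tail_def norm_vec_def L2_set_def by (simp add: atLeast0LessThan)
qed

text \<open>Descending induction on \<open>j\<close>, with \<open>cos\<^sup>2 + sin\<^sup>2 = 1\<close> at each step.\<close>

lemma spherical_tail_squared: assumes "j < CARD('n)"
 shows "(\<Sum>l\<in>{j..<CARD('n)}. (spherical_point e y $ e l)\<^sup>2) = (y $ e 0 * (\<Prod>l\<in>{1..j}. sin (y $ e l)))\<^sup>2" using assms
proof (induction "CARD('n) - Suc j" arbitrary: j)
 case 0
 hence "Suc j = CARD('n)" by simp
 hence "{j..<CARD('n)} = {j}" by auto
 thus ?case using spherical_nth[OF 0(2), of y] \<open>Suc j = CARD('n)\<close> by simp
next
 case (Suc d)
 hence j: "Suc j < CARD('n)" by simp
 let ?p = "y $ e 0 * (\<Prod>l\<in>{1..j}. sin (y $ e l))"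
 have "(\<Sum>l\<in>{j..<CARD('n)}. (spherical_point e y $ e l)\<^sup>2) =
   (spherical_point e y $ e j)\<^sup>2 + (\<Sum>l\<in>{Suc j..<CARD('n)}. (spherical_point e y $ e l)\<^sup>2)"
  by (rule sum.atLeast_Suc_lessThan[OF Suc(3)])
 also have "\<dots> = (?p * cos (y $ e (Suc j)))\<^sup>2 + (?p * sin (y $ e (Suc j)))\<^sup>2"
  using Suc(1)[of "Suc j"] Suc(2) j spherical_nth[OF Suc(3), of y] by (simp add: prod.nat_ivl_Suc' mult_ac)
 also have "\<dots> = ?p\<^sup>2 * ((cos (y $ e (Suc j)))\<^sup>2 + (sin (y $ e (Suc j)))\<^sup>2)"
  by (simp only: power_mult_distrib distrib_left)
 finally show ?case by simp
qed

lemma range_D: assumes "y \<in> spherical_range e"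
 shows "0 < y $ e 0" "\<And>j. 1 \<le> j ==> Suc j < CARD('n) ==> 0 < y $ e j \<and> y $ e j < pi"
  "\<And>j. 1 \<le> j ==> Suc j = CARD('n) ==> 0 < y $ e j \<and> y $ e j < 2 * pi"
proof -
 show "0 < y $ e 0" "\<And>j. 1 \<le> j ==> Suc j < CARD('n) ==> 0 < y $ e j \<and> y $ e j < pi"
  using assms unfolding spherical_range_def by auto
 fix j assume "1 \<le> j" "Suc j = CARD('n)"
 hence "2 \<le> CARD('n)" "CARD('n) - 1 = j" by auto
 thus "0 < y $ e j \<and> y $ e j < 2 * pi" using assms unfolding spherical_range_def by simp
qed

lemma spherical_tail: assumes y: "y \<in> spherical_range e" and j: "j = 0 \<or> Suc j < CARD('n)"
 shows "tail j (spherical_point e y) = y $ e 0 * (\<Prod>l\<in>{1..j}. sin (y $ e l))" and "0 < tail j (spherical_point e y)"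
proof -
 have jn: "j < CARD('n)" using j zero_less_card_finite by auto
 have "0 < sin (y $ e l)" if "l \<in> {1..j}" for l using range_D(2)[OF y, of l] that j by (intro sin_gt_zero) auto
 hence "0 < y $ e 0 * (\<Prod>l\<in>{1..j}. sin (y $ e l))" by (intro mult_pos_pos range_D(1)[OF y] prod_pos)
 moreover have "tail j (spherical_point e y) = \<bar>y $ e 0 * (\<Prod>l\<in>{1..j}. sin (y $ e l))\<bar>"
  unfolding tail_def spherical_tail_squared[OF jn] by simp
 ultimately show "tail j (spherical_point e y) = y $ e 0 * (\<Prod>l\<in>{1..j}. sin (y $ e l))"
  "0 < tail j (spherical_point e y)" by simp_all
qed

lemma spherical_step: assumes y: "y \<in> spherical_range e" and j: "0 < j" "j < CARD('n)"
 shows "spherical_point e y $ e (j - 1) = tail (j - 1) (spherical_point e y) * cos (y $ e j)" and "0 < tail (j - 1) (spherical_point e y)"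
  and "Suc j = CARD('n) ==> spherical_point e y $ e j = tail (j - 1) (spherical_point e y) * sin (y $ e j)"
proof -
 obtain i where i: "j = Suc i" using j(1) by (cases j) auto
 have i': "i = 0 \<or> Suc i < CARD('n)" "i < CARD('n)" using j(2) i by auto
 note t = spherical_tail[OF y i'(1)]
 show "spherical_point e y $ e (j - 1) = tail (j - 1) (spherical_point e y) * cos (y $ e j)"
  unfolding i using spherical_nth[OF i'(2), of y] t(1) j(2) i by simp
 show "0 < tail (j - 1) (spherical_point e y)" unfolding i using t(2) by simp
 show "spherical_point e y $ e j = tail (j - 1) (spherical_point e y) * sin (y $ e j)" if "Suc j = CARD('n)"
  unfolding i using spherical_nth[OF j(2), of y] t(1) that i by (simp add: prod.nat_ivl_Suc' mult_ac)
qed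

lemma angle_spherical: assumes y: "y \<in> spherical_range e" and j: "j < CARD('n)" shows "angle j (spherical_point e y) = y $ e j"
proof (cases "j = 0")
 case True
 thus ?thesis unfolding angle_def using spherical_tail(1)[OF y, of 0] by simp
next
 case False
 hence j0: "0 < j" by simp
 note s = spherical_step[OF y j0 j]
 show ?thesis
 proof (cases "Suc j < CARD('n)")
  case True
  thus ?thesis unfolding angle_def unfolding s(1) using False s(2) range_D(2)[OF y, of j] by (simp add: arccos_cos)
 next
  case 2: False
  hence jn: "Suc j = CARD('n)" using j by simp
  hence "0 < y $ e j" "y $ e j < 2 * pi" using range_D(3)[OF y, of j] j0 by auto
  from angle_from_half_angle(1)[OF this s(2)] show ?thesis unfolding angle_def unfolding s(1) s(3)[OF jn] using False 2 by simp
 qed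
qed

lemma spherical_coords_spherical: "y \<in> spherical_range e ==> spherical_coords (spherical_point e y) = y"
proof -
 assume y: "y \<in> spherical_range e"
 have "spherical_coords (spherical_point e y) $ i = y $ i" for i
 proof -
  obtain j where j: "j < CARD('n)" "i = e j" by (rule e_surj)
  have "inv_into {..<CARD('n)} e i = j" unfolding j(2) using e j(1) by (intro inv_into_f_f) (auto simp: bij_betw_def)
  thus ?thesis unfolding spherical_coords_def using angle_spherical[OF y j(1)] j(2) by simp
 qed
 thus ?thesis by (simp add: vec_eq_iff)
qed

lemma spherical_coords_lipschitz: "locally_lipschitz_on (spherical_point e ` spherical_range e) spherical_coords"
proof (rule loclip_vec)
 fix i
 let ?S = "spherical_point e ` spherical_range e"
 define j where "j = inv_into {..<CARD('n)} e i"
 have j: "j < CARD('n)" unfolding j_def using inv_into_into[of i e "{..<CARD('n)}"] e unfolding bij_betw_def by auto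
 have nth: "locally_lipschitz_on ?S (\<lambda>v. v $ l)" for l by (rule loclip_nth[OF loclip_id])
 have tl: "locally_lipschitz_on ?S (tail m)" if m: "m = 0 \<or> Suc m < CARD('n)" for m unfolding tail_def[abs_def] power2_eq_square
 proof (rule loclip_compose[OF _ loclip_sqrt])
  show "locally_lipschitz_on ?S (\<lambda>v. \<Sum>l\<in>{m..<CARD('n)}. v $ e l * v $ e l)" by (intro loclip_sum loclip_mult nth)
  show "(\<lambda>v. \<Sum>l\<in>{m..<CARD('n)}. v $ e l * v $ e l) ` ?S \<subseteq> {0<..}"
   using spherical_tail(2)[OF _ m] unfolding tail_def power2_eq_square by (auto simp: real_sqrt_gt_0_iff)
 qed
 have "locally_lipschitz_on ?S (angle j)"
 proof (cases "j = 0")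
  case True
  thus ?thesis unfolding angle_def[abs_def] using tl[of 0] by simp
 next
  case False
  hence j0: "0 < j" by simp
  have m: "j - 1 = 0 \<or> Suc (j - 1) < CARD('n)" using j j0 by auto
  show ?thesis
  proof (cases "Suc j < CARD('n)")
   case True
   have "locally_lipschitz_on ?S (\<lambda>v. v $ e (j - 1) / tail (j - 1) v)"
    by (intro loclip_divide nth tl m) (use spherical_step(2)[OF _ j0 j] in force)
   hence "locally_lipschitz_on ?S (\<lambda>v. arccos (v $ e (j - 1) / tail (j - 1) v))"
   proof (rule loclip_compose[OF _ loclip_arccos])
    show "(\<lambda>v. v $ e (j - 1) / tail (j - 1) v) ` ?S \<subseteq> {-1<..<1}"
    proof (rule image_subsetI)
    fix v assume "v \<in> ?S"
    then obtain y where y: "y \<in> spherical_range e" "v = spherical_point e y" by blast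
    have b: "0 < y $ e j" "y $ e j < pi" using range_D(2)[OF y(1), of j] j0 True by auto
    have "v $ e (j - 1) / tail (j - 1) v = cos (y $ e j)" unfolding y(2) using spherical_step(1,2)[OF y(1) j0 j] by simp
    moreover have "cos (y $ e j) < cos 0" "cos pi < cos (y $ e j)" using b by (intro cos_monotone_0_pi; simp)+
    ultimately show "v $ e (j - 1) / tail (j - 1) v \<in> {-1<..<1}" by simp
    qed
   qed
   thus ?thesis unfolding angle_def[abs_def] using False True by simp
  next
   case 2: False
   hence jn: "Suc j = CARD('n)" using j by simp
   have "tail (j - 1) v - v $ e (j - 1) \<noteq> 0" if "v \<in> ?S" for v
   proof -
    obtain y where y: "y \<in> spherical_range e" "v = spherical_point e y" using \<open>v \<in> ?S\<close> by blast
    have "cos (y $ e j) < 1" using angle_from_half_angle(2)[of "y $ e j" 1] range_D(3)[OF y(1), of j] j0 jn by simp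
    thus ?thesis unfolding y(2) spherical_step(1)[OF y(1) j0 j] using spherical_step(2)[OF y(1) j0 j] by simp
   qed
   hence "locally_lipschitz_on ?S (\<lambda>v. v $ e j / (tail (j - 1) v - v $ e (j - 1)))" by (intro loclip_divide loclip_diff nth tl m) auto
   hence "locally_lipschitz_on ?S (\<lambda>v. arctan (v $ e j / (tail (j - 1) v - v $ e (j - 1))))"
    by (rule loclip_compose[OF _ loclip_arctan]) simp
   hence "locally_lipschitz_on ?S (\<lambda>v. pi - 2 * arctan (v $ e j / (tail (j - 1) v - v $ e (j - 1))))"
    by (intro loclip_diff loclip_mult loclip_const)
   thus ?thesis unfolding angle_def[abs_def] using False 2 by simp
  qed
 qed
 thus "locally_lipschitz_on ?S (\<lambda>v. spherical_coords v $ i)" unfolding spherical_coords_def j_def by simp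
qed

lemma spherical_range_open: "open (spherical_range e)"
proof -
 have "spherical_range e = {y. 0 < y $ e 0} \<inter>
  (\<Inter>j\<in>{j. 1 \<le> j \<and> Suc j < CARD('n)}. {y. 0 < y $ e j} \<inter> {y. y $ e j < pi}) \<inter>
  (if 2 \<le> CARD('n) then {y. 0 < y $ e (CARD('n) - 1)} \<inter> {y. y $ e (CARD('n) - 1) < 2 * pi} else UNIV)"
  unfolding spherical_range_def by auto
 moreover have "finite {j. 1 \<le> j \<and> Suc j < CARD('n)}" by (rule finite_subset[of _ "{..<CARD('n)}"]) auto
 ultimately show ?thesis by (auto intro!: open_Int open_INT open_Collect_less continuous_intros)
qed

lemma spherical_point_lipschitz: "\<exists>L. L-lipschitz_on {y. \<bar>y $ e 0\<bar> \<le> 1} (spherical_point e)"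
proof -
 let ?S = "{y :: real^'n. \<bar>y $ e 0\<bar> \<le> 1}"
 have "\<exists>L. L-lipschitz_on ?S (\<lambda>y. spherical_point e y $ i)" for i
 proof -
  obtain j where j: "j < CARD('n)" "i = e j" by (rule e_surj)
  have "1-lipschitz_on ?S (\<lambda>y. y $ e 0)" by (rule lipschitz_onI) (auto simp: dist_norm component_le_norm_cart[of "_ - _", simplified])
  hence "unit_lipschitz_on ?S (\<lambda>y. y $ e 0)" unfolding unit_lipschitz_on_def by auto
  hence "unit_lipschitz_on ?S (\<lambda>y. y $ e 0 * (\<Prod>l\<in>{1..j}. sin (y $ e l)) *
    (if Suc j < CARD('n) then cos (y $ e (Suc j)) else 1))" by (cases "Suc j < CARD('n)")
    (auto intro!: unit_lipschitz_on_mult unit_lipschitz_on_prod unit_lipschitz_on_trig)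
  thus ?thesis unfolding j(2) spherical_nth[OF j(1)] unit_lipschitz_on_def by blast
 qed
 then obtain L where L: "\<And>i. (L i)-lipschitz_on ?S (\<lambda>y. spherical_point e y $ i)" by metis
 have "(\<Sum>i\<in>UNIV. L i)-lipschitz_on ?S (spherical_point e)"
 proof (rule lipschitz_onI)
  fix x y assume xy: "x \<in> ?S" "y \<in> ?S"
  have "dist (spherical_point e x) (spherical_point e y) \<le> (\<Sum>i\<in>UNIV. \<bar>(spherical_point e x - spherical_point e y) $ i\<bar>)"
   unfolding dist_norm by (rule norm_le_l1_cart)
  also have "\<dots> \<le> (\<Sum>i\<in>UNIV. L i * dist x y)" using lipschitz_onD[OF L xy] by (intro sum_mono) (simp add: dist_real_def)
  finally show "dist (spherical_point e x) (spherical_point e y) \<le> (\<Sum>i\<in>UNIV. L i) * dist x y" by (simp add: sum_distrib_right)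
 qed (use lipschitz_on_nonneg[OF L] in \<open>auto intro: sum_nonneg\<close>)
 thus ?thesis ..
qed

lemma spherical_point_radial: assumes y: "y $ e 0 \<noteq> 0"
 shows "spherical_point e (y + t *\<^sub>R axis (e 0) 1) = (y $ e 0 + t) *\<^sub>R ((1 / y $ e 0) *\<^sub>R spherical_point e y)"
proof -
 have nth: "(y + t *\<^sub>R axis (e 0) 1) $ e l = y $ e l" if "0 < l" "l < CARD('n)" for l using that e_inj[of l 0] by (simp add: axis_def)
 have "spherical_point e (y + t *\<^sub>R axis (e 0) 1) $ i = ((y $ e 0 + t) *\<^sub>R ((1 / y $ e 0) *\<^sub>R spherical_point e y)) $ i" for i
 proof -
  obtain j where j: "j < CARD('n)" "i = e j" by (rule e_surj)
  have "(\<Prod>l\<in>{1..j}. sin ((y + t *\<^sub>R axis (e 0) 1) $ e l)) = (\<Prod>l\<in>{1..j}. sin (y $ e l))"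
   using j(1) by (intro prod.cong refl arg_cong[of _ _ sin] nth) auto
  moreover have "(if Suc j < CARD('n) then cos ((y + t *\<^sub>R axis (e 0) 1) $ e (Suc j)) else 1) = (if Suc j < CARD('n) then cos (y $ e (Suc j)) else 1)"
   by (intro if_cong refl arg_cong[of _ _ cos] nth) auto
  moreover have "(y + t *\<^sub>R axis (e 0) 1) $ e 0 = y $ e 0 + t" by (simp add: axis_def)
  ultimately show ?thesis unfolding j(2) spherical_nth[OF j(1)] vector_scaleR_component using y by simp
 qed
 thus ?thesis by (simp add: vec_eq_iff)
qed

end

context geodesic_ball
begin

text \<open>The coordinates \<open>ex \<circ> f\<close>, with \<open>f\<close> the spherical coordinates in the frame \<open>E\<close>, are constant along radial geodesics except for \<open>r\<close>.\<close>

theorem spherical_chart: assumes e: "bij_betw e {..<CARD('n)} (UNIV :: 'n set)" and e0: "e 0 = k" and E: "transpose E ** g c p ** E = mat 1"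
 shows "let \<psi> = spherical_normal_chart \<A> g c C p e E
  in Ck1_chart 0 \<A> \<psi> \<and> (\<forall>z\<in>fst \<psi>. snd \<psi> z $ k = r z) \<and> ae_direct_sum_form g c k \<psi>"
proof -
 interpret idx: index_enumeration e by (rule index_enumeration.intro[OF e])
 have EE: "transpose E ** E = mat 1" using E unfolding center matrix_mul_rid .
 let ?S = "spherical_range e"
 define f where "f y = E *v spherical_point e y" for y
 have undo_E: "transpose E *v (E *v u) = u" for u unfolding matrix_vector_mul_assoc EE by (rule matrix_vector_mul_lid)
 have iso: "norm (E *v u) = norm u" for u
 proof -
  have "(E *v u) \<bullet> (E *v u) = (transpose E *v (E *v u)) \<bullet> u" unfolding transpose_matrix_vector dot_lmul_matrix ..
  thus ?thesis unfolding undo_E norm_eq_sqrt_inner by simp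
 qed
 have norm_f: "norm (f y) = y $ k" if "y \<in> ?S" for y
  unfolding f_def iso unfolding idx.norm_eq_tail using idx.spherical_tail(1)[OF that, of 0] e0 by simp
 have pos: "0 < y $ k" if "y \<in> ?S" for y using idx.range_D(1)[OF that] e0 by simp
 define G where "G v = idx.spherical_coords (transpose E *v v)" for v
 have Gf: "G (f y) = y" if "y \<in> ?S" for y unfolding G_def f_def undo_E by (rule idx.spherical_coords_spherical[OF that])
 have inj: "inj_on f ?S" using Gf by (rule inj_on_inverseI)
 define S1 where "S1 = ?S \<inter> {y. y $ k < 1}"
 have S1: "open S1" unfolding S1_def by (intro open_Int idx.spherical_range_open open_Collect_less continuous_intros)
 obtain L where L: "L-lipschitz_on {y. \<bar>y $ e 0\<bar> \<le> 1} (spherical_point e)" using idx.spherical_point_lipschitz by blast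
 have f_lip: "L-lipschitz_on S1 f"
 proof (rule lipschitz_onI)
  fix x y assume "x \<in> S1" "y \<in> S1"
  hence "x \<in> {y. \<bar>y $ e 0\<bar> \<le> 1}" "y \<in> {y. \<bar>y $ e 0\<bar> \<le> 1}" using pos e0 unfolding S1_def by fastforce+
  hence "dist (spherical_point e x) (spherical_point e y) \<le> L * dist x y" by (rule lipschitz_onD[OF L])
  thus "dist (f x) (f y) \<le> L * dist x y" unfolding f_def dist_norm matrix_vector_mult_diff_distrib[symmetric] iso .
 qed (rule lipschitz_on_nonneg[OF L])
 define B where "B = S1 \<inter> f -` N"
 have B: "open B" unfolding B_def by (rule continuous_open_preimage[OF lipschitz_on_continuous_on[OF f_lip] S1 N_open])
 have BD: "y \<in> ?S" "f y \<in> N" "f y \<noteq> 0" "0 < y $ k" if "y \<in> B" for y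
  using that pos[of y] norm_f[of y] unfolding B_def S1_def by auto
 have BI: "y \<in> B" if "y \<in> ?S" "f y \<in> N" for y using that N_bounded norm_f[OF that(1)] unfolding B_def S1_def by auto
 define Y where "Y y = ex (f y)" for y
 have YP: "Y y \<in> P" if "y \<in> B" for y unfolding Y_def by (rule ex_in_P[OF BD(2,3)[OF that]])
 have radY: "rad (Y y) = y $ k" if "y \<in> B" for y unfolding Y_def rad_ex[OF BD(2)[OF that]] by (rule norm_f[OF BD(1)[OF that]])
 have lgY: "lg (Y y) = f y" if "y \<in> B" for y unfolding Y_def by (rule lg(4)[OF BD(2)[OF that]])
 have Y_lip: "(Le * L)-lipschitz_on B Y"
 proof (rule lipschitz_onI)
  show "0 \<le> Le * L" using Le_nonneg lipschitz_on_nonneg[OF L] by simp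
  fix x y assume x: "x \<in> B" and y: "y \<in> B"
  have "dist (Y x) (Y y) \<le> Le * dist (f x) (f y)" unfolding Y_def by (rule lipschitz_onD[OF ex_lip BD(2)[OF x] BD(2)[OF y]])
  also have "\<dots> \<le> Le * (L * dist x y)" using x y by (intro mult_left_mono[OF _ Le_nonneg] lipschitz_onD[OF f_lip]) (auto simp: B_def)
  finally show "dist (Y x) (Y y) \<le> Le * L * dist x y" by (simp add: mult.assoc)
 qed
 have radial: "((\<lambda>t. Y (y + t *\<^sub>R axis k 1)) has_vector_derivative nrm (Y y)) (at 0)" if y: "y \<in> B" for y
 proof -
  define w where "w = (1 / y $ k) *\<^sub>R f y"
  have yk: "0 < y $ k" by (rule BD(4)[OF y])
  have yw: "y $ k *\<^sub>R w = f y" unfolding w_def using yk by simp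
  have w1: "norm w = 1" unfolding w_def using norm_f[OF BD(1)[OF y]] yk by simp
  have "y $ k *\<^sub>R w \<in> N" unfolding yw by (rule BD(2)[OF y])
  from radial_curve[OF this yk w1]
  have "((\<lambda>t. ex (t *\<^sub>R w)) has_vector_derivative nrm (Y y)) (at (y $ k + 0))" unfolding yw Y_def by simp
  moreover have "((\<lambda>t. y $ k + t) has_vector_derivative 1) (at 0)" by (auto intro!: derivative_eq_intros)
  ultimately have "((\<lambda>t. ex ((y $ k + t) *\<^sub>R w)) has_vector_derivative 1 *\<^sub>R nrm (Y y)) (at 0)"
   using vector_diff_chain_at[of "\<lambda>t. y $ k + t" 1 0 "\<lambda>t. ex (t *\<^sub>R w)"] by (simp add: comp_def)
  moreover have "f (y + t *\<^sub>R axis k 1) = (y $ k + t) *\<^sub>R w" for t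
   using idx.spherical_point_radial[of y t] yk unfolding f_def w_def e0 by (simp add: matrix_vector_mult_scaleR)
  ultimately show ?thesis unfolding Y_def by simp
 qed
 define T where "T x = inv_into ?S f (lg x)" for x
 have TY: "T (Y y) = y" if "y \<in> B" for y unfolding T_def lgY[OF that] by (rule inv_into_f_f[OF inj BD(1)[OF that]])
 have contY: "continuous_on B Y" by (rule lipschitz_on_continuous_on[OF Y_lip])
 have injY: "inj_on Y B" using TY by (rule inj_on_inverseI)
 let ?U = "Y ` B"
 have U: "open ?U" by (rule invariance_of_domain[OF contY B injY])
 have hom: "homeomorphism ?U B T Y"
 proof -
  obtain t where t: "homeomorphism B ?U Y t" using invariance_of_domain_homeomorphism[OF B contY _ injY] by auto
  have "t x = T x" if "x \<in> ?U" for x using that TY homeomorphism_apply1[OF t] by auto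
  thus ?thesis using homeomorphism_cong[OF homeomorphism_symD[OF t] refl refl] by simp
 qed
 have UP: "?U \<subseteq> P" using YP by blast
 have T_lip: "locally_lipschitz_on ?U T"
 proof -
  have "locally_lipschitz_on ?U lg" by (rule loclip_subset[OF lg_lip]) (use UP P_sub in blast)
  hence "locally_lipschitz_on ?U (\<lambda>x. transpose E *v lg x)" by (rule loclip_bounded_linear[OF matrix_vector_mul_bounded_linear])
  hence "locally_lipschitz_on ?U (\<lambda>x. G (lg x))" unfolding G_def
  proof (rule loclip_compose[OF _ idx.spherical_coords_lipschitz])
   have "transpose E *v lg (Y y) = spherical_point e y" if "y \<in> B" for y unfolding lgY[OF that] f_def by (rule undo_E)
   thus "(\<lambda>x. transpose E *v lg x) ` ?U \<subseteq> spherical_point e ` ?S" using BD(1) by auto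
  qed
  moreover have "T x = G (lg x)" if "x \<in> ?U" for x using that TY lgY Gf[OF BD(1)] by auto
  ultimately show ?thesis using loclip_cong[of ?U T "\<lambda>x. G (lg x)"] by blast
 qed
 define \<psi> where "\<psi> = spherical_normal_chart \<A> g c C p e E"
 have \<psi>: "fst \<psi> = {q \<in> C. exp_inverse \<A> g c C p q \<in> f ` ?S}" "snd \<psi> q = inv_into ?S f (exp_inverse \<A> g c C p q)" for q
  unfolding \<psi>_def spherical_normal_chart_def Let_def f_def[abs_def] by simp_all
 have inP: "snd c (chart_inv c x) = x" "chart_inv c x \<in> C" if "x \<in> P" for x using coords(2,3)[of x] P_sub that by auto
 have dom: "fst \<psi> = chart_inv c ` ?U"
 proof
  show "fst \<psi> \<subseteq> chart_inv c ` ?U"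
  proof
   fix q assume "q \<in> fst \<psi>"
   then obtain y where q: "q \<in> C" and y: "y \<in> ?S" "lg (snd c q) = f y" unfolding \<psi>(1) using exp_inverse by auto
   have qb: "snd c q \<in> ball (snd c p) \<delta>" using q C_iff by blast
   have "y \<in> B" by (rule BI[OF y(1)]) (use lg(1)[OF qb] y(2) in simp)
   moreover have "Y y = snd c q" unfolding Y_def y(2)[symmetric] by (rule lg(2)[OF qb])
   ultimately have "snd c q \<in> ?U" by (rule rev_image_eqI[OF _ sym])
   hence "chart_inv c (snd c q) \<in> chart_inv c ` ?U" by (rule imageI)
   thus "q \<in> chart_inv c ` ?U" unfolding coords(1)[OF q] .
  qed
  show "chart_inv c ` ?U \<subseteq> fst \<psi>"
  proof (rule image_subsetI)
   fix x assume "x \<in> ?U"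
   then obtain y where y: "y \<in> B" "x = Y y" by blast
   note i = inP[OF YP[OF y(1)], folded y(2)]
   have "exp_inverse \<A> g c C p (chart_inv c x) = f y" using exp_inverse[OF i(2)] i(1) lgY[OF y(1)] y(2) by simp
   thus "chart_inv c x \<in> fst \<psi>" unfolding \<psi>(1) using i(2) BD(1)[OF y(1)] by blast
  qed
 qed
 have val: "snd \<psi> q = T (snd c q)" if "q \<in> fst \<psi>" for q using that exp_inverse unfolding \<psi>(2) T_def \<psi>(1) by simp
 have Tl: "Ck1_on 0 ?U T" and Yl: "Ck1_on 0 B Y" using T_lip lipschitz_on_imp_locally[OF Y_lip] by simp_all
 have Uc: "?U \<subseteq> chart_image c" using UP P_sub by blast
 have ch: "Ck1_chart 0 \<A> \<psi>" "chart_image \<psi> = B" "\<And>y. y \<in> B ==> chart_inv \<psi> y = chart_inv c (Y y)"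
  by (rule chart_from_coordinates[OF c zero_le_one U Uc B hom Tl Yl dom val], assumption+)+
 have "ae_direct_sum_form g c k \<psi>" by (rule ae_direct_sum_formI(3)[OF B Y_lip YP radY radial ch(2,3)], assumption+)
 moreover have "snd \<psi> z $ k = r z" if "z \<in> fst \<psi>" for z
 proof -
  obtain y where y: "y \<in> B" "z = chart_inv c (Y y)" using \<open>z \<in> fst \<psi>\<close> unfolding dom by blast
  note i = inP[OF YP[OF y(1)], folded y(2)]
  show ?thesis unfolding val[OF \<open>z \<in> fst \<psi>\<close>] r_eq[OF i(2)] i(1) TY[OF y(1)] radY[OF y(1)] ..
 qed
 ultimately show ?thesis unfolding Let_def \<psi>_def[symmetric] using ch(1) by blast
qed

end

section \<open>The metric in a normal ball\<close>

theorem theorem9: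
 fixes \<A> :: "('m::t2_space, 'n::finite) chart set" and g :: "('m, 'n) metric" and c :: "('m, 'n) chart" and p :: 'm and k :: 'n
 assumes "Ck1_manifold 2 \<A>" and "C11_riemannian_metric \<A> g" and "c \<in> \<A>" and "p \<in> fst c" and "g c p = mat 1"
  and "\<And>\<mu> \<alpha> \<beta>. christoffel g c p \<mu> \<alpha> \<beta> = 0"
 shows "\<exists>\<delta>\<^sub>0>0. \<forall>\<delta>. 0 < \<delta> \<and> \<delta> < \<delta>\<^sub>0 \<longrightarrow>
  (let C = coordinate_ball c p \<delta>;
    r = geodesic_distance \<A> g c C p;
    level = (\<lambda>\<rho>. {q \<in> C. r q = \<rho>})
  in ball (snd c p) \<delta> \<subseteq> chart_image c \<and> convex_normal \<A> g c C \<and>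
    (\<exists>R>0. \<forall>\<rho>. 0 < \<rho> \<and> \<rho> < R \<longrightarrow>
    C11_hypersurface \<A> k (level \<rho>) \<and>
    C11_hypersurface_diffeomorphic k \<A> (level \<rho>) euclidean_atlas (sphere 0 1 :: (real^'n) set) \<and>
    induces_lipschitz_metric \<A> g k (level \<rho>)) \<and>
    (\<forall>q\<in>C - {p}. \<exists>V \<theta>.
    open V \<and> q \<in> V \<and> V \<subseteq> C - {p} \<and>
    (\<forall>i. i \<noteq> k \<longrightarrow> Ck1_fun_on 2 \<A> V (\<lambda>z. \<theta> z $ i)) \<and>
    (let \<psi> = radial_chart k V r \<theta>; h = metric_component g c \<psi>
    in Ck1_chart 1 \<A> \<psi> \<and>
    (\<exists>A :: 'n \<Rightarrow> real^'n \<Rightarrow> real.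
    (\<forall>i j. i \<noteq> k \<and> j \<noteq> k \<longrightarrow> (\<exists>L. L-lipschitz_on (chart_image \<psi>) (h i j))) \<and>
    (\<forall>i. i \<noteq> k \<longrightarrow> (\<exists>L. L-lipschitz_on (chart_image \<psi>) (A i))) \<and>
    (\<forall>y\<in>chart_image \<psi>. \<forall>u w.
    metric_in g c \<psi> y u w =
    u $ k * w $ k +
    (\<Sum>i\<in>-{k}. \<Sum>j\<in>-{k}. h i j y *
    (u $ i - A i y * u $ k) * (w $ j - A j y * w $ k)))))) \<and>
    (\<exists>R>0. \<forall>\<rho>. 0 < \<rho> \<and> \<rho> < R \<longrightarrow>
    (\<forall>q\<in>C - {p}. \<exists>W \<alpha>.
    open W \<and> connected W \<and> q \<in> W \<and> W \<subseteq> C - {p} \<and> W \<inter> level \<rho> \<noteq> {} \<and>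
    (let \<psi> = radial_chart k W r \<alpha>
    in Ck1_chart 0 \<A> \<psi> \<and>
    C11_hypersurface_chart \<A> k (level \<rho>)
    (W \<inter> level \<rho>, \<lambda>z. drop_coord k (\<alpha> z)) \<and>
    ae_direct_sum_form g c k \<psi> \<and>
    (\<forall>y\<in>chart_image \<psi>. y $ k = \<rho> \<longrightarrow> components_defined_at c \<psi> y) \<and>
    (\<forall>i j. i \<noteq> k \<and> j \<noteq> k \<longrightarrow>
    (\<exists>L. L-lipschitz_on {y \<in> chart_image \<psi>. y $ k = \<rho>}
    (metric_component g c \<psi> i j)))))) \<and>
    (\<forall>e E. bij_betw e {..<CARD('n)} UNIV \<and> e 0 = k \<and> transpose E ** g c p ** E = mat 1 \<longrightarrow>
    (let \<psi> = spherical_normal_chart \<A> g c C p e E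
    in Ck1_chart 0 \<A> \<psi> \<and> (\<forall>z\<in>fst \<psi>. snd \<psi> z $ k = r z) \<and>
    ae_direct_sum_form g c k \<psi>)))"
proof -
 interpret riemannian_manifold \<A> g by (rule riemannian_manifold.intro[OF assms(1,2)])
 have "\<exists>\<delta>\<^sub>0>0. \<forall>\<delta>. 0 < \<delta> \<and> \<delta> < \<delta>\<^sub>0 \<longrightarrow>
  ball (snd c p) \<delta> \<subseteq> chart_image c \<and> convex_normal \<A> g c (coordinate_ball c p \<delta>) \<and>
  (\<exists>N ex lg Z L. radial_ball (snd c p) \<delta> N ex lg Z (gmat c) L \<and>
   (\<forall>q\<in>coordinate_ball c p \<delta>. exp_inverse \<A> g c (coordinate_ball c p \<delta>) p q = lg (snd c q)))"
  (is "\<exists>\<delta>\<^sub>0>0. \<forall>\<delta>. _ \<longrightarrow> ?ball \<delta>")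
 proof (rule normal_balls[OF assms(3-5)], goal_cases)
  case (1 \<delta>\<^sub>0)
  have "\<forall>\<delta>. 0 < \<delta> \<and> \<delta> < \<delta>\<^sub>0 \<longrightarrow> ?ball \<delta>" using 1(2) by (intro allI impI) (elim conjE)
  then show ?case using 1(1) by (intro exI[of _ \<delta>\<^sub>0] conjI)
 qed
 then obtain \<delta>\<^sub>0 where \<delta>\<^sub>0: "0 < \<delta>\<^sub>0" and balls: "\<forall>\<delta>. 0 < \<delta> \<and> \<delta> < \<delta>\<^sub>0 \<longrightarrow> ?ball \<delta>"
  by (elim exE conjE)
 show ?thesis
 proof (intro exI[of _ \<delta>\<^sub>0] conjI \<delta>\<^sub>0 allI impI, goal_cases)
  case \<delta>: (1 \<delta>)
  note b = mp[OF spec[OF balls] \<delta>]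
  obtain N ex lg Z Le where rb: "radial_ball (snd c p) \<delta> N ex lg Z (gmat c) Le"
   and einv: "\<forall>q\<in>coordinate_ball c p \<delta>. exp_inverse \<A> g c (coordinate_ball c p \<delta>) p q = lg (snd c q)"
   using b by blast
  interpret geodesic_ball \<A> g c p \<delta> N ex lg Z Le
   by (intro geodesic_ball.intro geodesic_ball_axioms.intro riemannian_manifold_axioms rb[unfolded gmat_def])
    (use assms(3-5) b einv in blast)+
  have R1: "0 < \<delta> / 2 / (Le + 1)" using \<delta> Le_nonneg by simp
  have lev: "C11_hypersurface \<A> k (level \<rho>) \<and>
    C11_hypersurface_diffeomorphic k \<A> (level \<rho>) euclidean_atlas (sphere 0 1 :: (real^'n) set) \<and>
    induces_lipschitz_metric \<A> g k (level \<rho>)" if "0 < \<rho> \<and> \<rho> < \<delta> / 2 / (Le + 1)" for \<rho>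
  proof -
   have "\<rho> * (Le + 1) < \<delta> / 2"
    using conjunct2[OF that] unfolding pos_less_divide_eq[OF add_nonneg_pos[OF Le_nonneg zero_less_one]] .
   then show ?thesis using level_hypersurface level_diffeomorphic_sphere level_metric that by blast
  qed
  obtain R where R: "0 < R" "ball 0 R \<subseteq> N" using openE[OF N_open zero_in_N] by blast
  have fin1: "\<exists>R>0. \<forall>\<rho>. 0 < \<rho> \<and> \<rho> < R \<longrightarrow> C11_hypersurface \<A> k (level \<rho>) \<and>
    C11_hypersurface_diffeomorphic k \<A> (level \<rho>) euclidean_atlas (sphere 0 1 :: (real^'n) set) \<and>
    induces_lipschitz_metric \<A> g k (level \<rho>)" using R1 lev by blast
  note fin2 = radial_charts[where k = k]
  note fin3 = tube_charts[OF R(2), where k = k]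
  note fin4 = spherical_chart[where k = k]
  show ?case
   unfolding Let_def[of "coordinate_ball c p \<delta>"] Let_def[of "geodesic_distance \<A> g c C p"] Let_def[of "\<lambda>\<rho>. {q \<in> C. r q = \<rho>}"]
    level_def[symmetric] unfolding Let_def[of level]
  proof (intro conjI)
   show "ball (snd c p) \<delta> \<subseteq> chart_image c" "convex_normal \<A> g c C" using b by blast+
  next
   show "\<exists>R>0. \<forall>\<rho>. 0 < \<rho> \<and> \<rho> < R \<longrightarrow> C11_hypersurface \<A> k (level \<rho>) \<and>
    C11_hypersurface_diffeomorphic k \<A> (level \<rho>) euclidean_atlas (sphere 0 1 :: (real^'n) set) \<and>
    induces_lipschitz_metric \<A> g k (level \<rho>)" by (rule fin1)
  qed ((rule ballI, erule fin2), (rule exI[of _ R], intro conjI R(1) allI impI ballI, erule conjE, erule (2) fin3),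
    (intro allI impI, elim conjE, erule (2) fin4))
 qed
qed

end
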